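(* Let $s\in\Xi$ and $\mu=\mu_s$. For every $4\le q<\infty$ we have the continuous embedding $\mathcal H^2_\mu(T_\Omega)\hookrightarrow A^{4,q}_{\frac q4(2s+\frac nr)}(T_\Omega)$; i.e. there is $C$ with $\|F\|_{A^{4,q}_{\frac q4(2s+\frac nr)}}\le C\|F\|_{\mathcal H^2_\mu}$ for all $F\in\mathcal H^2_\mu(T_\Omega)$.
   Context: Let $V$ be an $n$-dimensional Euclidean Jordan algebra (identified with $\mathbb R^n$) with inner product $(x|y)=\mathrm{tr}(xy)$ and identity $\mathbf e$, and let $\Omega\subset V$ be an irreducible symmetric cone of rank $r\ge2$ with determinant $\Delta$. Define $d$ by $(r-1)\frac d2=\frac nr-1$ and $g_0=((j-1)\frac d2)_{1\le j\le r}$. $T_\Omega=V+i\Omega$. Fix a Jordan frame $\{c_1,\dots,c_r\}$ with principal minors $\Delta_1,\dots,\Delta_r$ and set $\Delta_s(x)=\Delta_1^{s_1-s_2}(x)\cdots\Delta_{r-1}^{s_{r-1}-s_r}(x)\Delta_r^{s_r}(x)$ for $s\in\mathbb C^r$, $x\in\Omega$. Inequalities between multi-indices are componentwise; a scalar added to a multi-index means adding the constant vector. $\Gamma_\Omega(s)=\int_\Omega e^{-(\mathbf e|\xi)}\Delta_s(\xi)\Delta^{-n/r}(\xi)d\xi$. For $\nu\in\mathbb R^r$, $\nu>g_0$, $1\le p,q<\infty$, $A^{p,q}_\nu(T_\Omega)$ is the space of holomorphic $F$ on $T_\Omega$ with $\|F\|_{A^{p,q}_\nu}=\big(\int_\Omega(\int_V|F(x+iy)|^pdx)^{q/p}\Delta_\nu(y)\Delta^{-n/r}(y)dy\big)^{1/q}<\infty$.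 For $s\in\mathbb R^r$, $s>g_0$, let $d\mu_s(t)=\chi_\Omega(t)\frac{\Delta_s(t)}{\Gamma_\Omega(s)}\frac{dt}{\Delta^{n/r}(t)}$; this family of tempered distributions extends analytically to all $s\in\mathbb C^r$, and $\mu_s$ is a positive measure (supported on $\overline\Omega$) exactly for $s$ in the Wallach set $\Xi=\{(u_1,\,u_2+\frac d2\,\mathrm{sgn}\,u_1,\,\dots,\,u_r+\frac d2(\mathrm{sgn}\,u_1+\cdots+\mathrm{sgn}\,u_{r-1})):u_1,\dots,u_r\ge0\}$. For such $\mu$, $\mathcal H^2_\mu(T_\Omega)$ is the space of holomorphic $F$ on $T_\Omega$ with $\|F\|_{\mathcal H^2_\mu}^2=\sup_{t\in\Omega}\int_{\overline\Omega}\int_V|F(x+i(y+t))|^2dx\,d\mu(y)<\infty$. *)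

theory Defs
  imports "HOL-Analysis.Analysis"
begin

text \<open>The Jordan product is m, the identity is e.  V is the type 'a (a Euclidean
  space, identified with R^n, n = DIM('a)); its inner product is the given one,
  and dx is Lebesgue measure lborel.\<close>

definition prim_idem :: "('a::real_vector \<Rightarrow> 'a \<Rightarrow> 'a) \<Rightarrow> 'a \<Rightarrow> bool" where
  "prim_idem m p \<longleftrightarrow> p \<noteq> 0 \<and> m p p = p \<and>
     \<not> (\<exists>a b. a \<noteq> 0 \<and> b \<noteq> 0 \<and> m a a = a \<and> m b b = b \<and> m a b = 0 \<and> p = a + b)"

definition jspec :: "('a::real_vector \<Rightarrow> 'a \<Rightarrow> 'a) \<Rightarrow> 'a \<Rightarrow> 'a \<Rightarrow> nat \<Rightarrow> (nat \<Rightarrow> real) \<Rightarrow> (nat \<Rightarrow> 'a) \<Rightarrow> bool" where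
  "jspec m u x k l d \<longleftrightarrow> (\<forall>i<k. prim_idem m (d i)) \<and>
     (\<forall>i<k. \<forall>j<k. i \<noteq> j \<longrightarrow> m (d i) (d j) = 0) \<and>
     (\<Sum>i<k. d i) = u \<and> x = (\<Sum>i<k. l i *\<^sub>R d i)"

text \<open>Trace (sum of eigenvalues) and determinant (product of eigenvalues);
  jdet_in m u x is the determinant of x in the subalgebra V(u,1) with identity u.\<close>
definition jtr :: "('a::real_vector \<Rightarrow> 'a \<Rightarrow> 'a) \<Rightarrow> 'a \<Rightarrow> 'a \<Rightarrow> real" where
  "jtr m e x = (SOME t. \<exists>k l d. jspec m e x k l d \<and> t = (\<Sum>i<k. l i))"

definition jdet_in :: "('a::real_vector \<Rightarrow> 'a \<Rightarrow> 'a) \<Rightarrow> 'a \<Rightarrow> 'a \<Rightarrow> real" where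
  "jdet_in m u x = (SOME t. \<exists>k l d. jspec m u x k l d \<and> t = (\<Prod>i<k. l i))"

definition eja :: "('a::euclidean_space \<Rightarrow> 'a \<Rightarrow> 'a) \<Rightarrow> 'a \<Rightarrow> bool" where
  "eja m e \<longleftrightarrow> bounded_bilinear m \<and> (\<forall>x y. m x y = m y x) \<and>
     (\<forall>x y. m x (m (m x x) y) = m (m x x) (m x y)) \<and> (\<forall>x. m e x = x) \<and>
     (\<forall>x y z. inner (m x y) z = inner y (m x z)) \<and>
     (\<forall>x y. inner x y = jtr m e (m x y))"

text \<open>Simple Jordan algebra (equivalently: the symmetric cone is irreducible).\<close>
definition simple_ja :: "('a::real_vector \<Rightarrow> 'a \<Rightarrow> 'a) \<Rightarrow> bool" where
  "simple_ja m \<longleftrightarrow> (\<forall>I. subspace I \<and> (\<forall>x\<in>I. \<forall>y. m x y \<in> I) \<longrightarrow> I = {0} \<or> I = UNIV)"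

definition jordan_frame :: "('a::real_vector \<Rightarrow> 'a \<Rightarrow> 'a) \<Rightarrow> 'a \<Rightarrow> (nat \<Rightarrow> 'a) \<Rightarrow> nat \<Rightarrow> bool" where
  "jordan_frame m e c r \<longleftrightarrow> (\<forall>i\<in>{1..r}. prim_idem m (c i)) \<and>
     (\<forall>i\<in>{1..r}. \<forall>j\<in>{1..r}. i \<noteq> j \<longrightarrow> m (c i) (c j) = 0) \<and> (\<Sum>i=1..r. c i) = e"

definition sym_cone :: "('a::real_normed_vector \<Rightarrow> 'a \<Rightarrow> 'a) \<Rightarrow> 'a set" where
  "sym_cone m = interior (range (\<lambda>x. m x x))"

definition orth_proj :: "'a::real_inner set \<Rightarrow> 'a \<Rightarrow> 'a" where
  "orth_proj W x = (THE y. y \<in> W \<and> (\<forall>w\<in>W. inner (x - y) w = 0))"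

definition minor :: "('a::euclidean_space \<Rightarrow> 'a \<Rightarrow> 'a) \<Rightarrow> (nat \<Rightarrow> 'a) \<Rightarrow> nat \<Rightarrow> 'a \<Rightarrow> real" where
  "minor m c k x = jdet_in m (\<Sum>i=1..k. c i)
      (orth_proj {y. m (\<Sum>i=1..k. c i) y = y} x)"

definition jd :: "nat \<Rightarrow> nat \<Rightarrow> real" where
  "jd n r = 2 * (real n / real r - 1) / (real r - 1)"

definition g0 :: "nat \<Rightarrow> nat \<Rightarrow> nat \<Rightarrow> real" where
  "g0 n r j = (real j - 1) * jd n r / 2"

text \<open>Exponent differences s_j - s_(j+1), with s_(r+1) = 0.\<close>
definition sdiff :: "nat \<Rightarrow> (nat \<Rightarrow> 'b::ab_group_add) \<Rightarrow> nat \<Rightarrow> 'b" where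
  "sdiff r s j = (if j = r then s j else s j - s (j + 1))"

definition gpow :: "('a::euclidean_space \<Rightarrow> 'a \<Rightarrow> 'a) \<Rightarrow> (nat \<Rightarrow> 'a) \<Rightarrow> nat \<Rightarrow> (nat \<Rightarrow> real) \<Rightarrow> 'a \<Rightarrow> real" where
  "gpow m c r s x = (\<Prod>j=1..r. minor m c j x powr sdiff r s j)"

definition gpowc :: "('a::euclidean_space \<Rightarrow> 'a \<Rightarrow> 'a) \<Rightarrow> (nat \<Rightarrow> 'a) \<Rightarrow> nat \<Rightarrow> (nat \<Rightarrow> complex) \<Rightarrow> 'a \<Rightarrow> complex" where
  "gpowc m c r s x = (\<Prod>j=1..r. exp (sdiff r s j * complex_of_real (ln (minor m c j x))))"

definition gammaO :: "('a::euclidean_space \<Rightarrow> 'a \<Rightarrow> 'a) \<Rightarrow> 'a \<Rightarrow> (nat \<Rightarrow> 'a) \<Rightarrow> nat \<Rightarrow> (nat \<Rightarrow> complex) \<Rightarrow> complex" where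
  "gammaO m e c r s = (\<integral>\<xi>\<in>sym_cone m.
      complex_of_real (exp (- inner e \<xi>)) * gpowc m c r s \<xi> *
      complex_of_real (jdet_in m e \<xi> powr (- real DIM('a) / real r)) \<partial>lborel)"

text \<open>Pairing of the distribution mu_s (Re s > g0) with a test function phi.\<close>
definition mu_pair :: "('a::euclidean_space \<Rightarrow> 'a \<Rightarrow> 'a) \<Rightarrow> 'a \<Rightarrow> (nat \<Rightarrow> 'a) \<Rightarrow> nat \<Rightarrow> (nat \<Rightarrow> complex) \<Rightarrow> ('a \<Rightarrow> real) \<Rightarrow> complex" where
  "mu_pair m e c r s \<phi> = (\<integral>t\<in>sym_cone m.
      complex_of_real (\<phi> t) * gpowc m c r s t / gammaO m e c r s *
      complex_of_real (jdet_in m e t powr (- real DIM('a) / real r)) \<partial>lborel)"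

coinductive smooth_fun :: "('a::euclidean_space \<Rightarrow> real) \<Rightarrow> bool" where
  "(\<forall>x. f differentiable (at x)) \<Longrightarrow>
   (\<forall>v. smooth_fun (\<lambda>x. frechet_derivative f (at x) v)) \<Longrightarrow> smooth_fun f"

definition test_fun :: "('a::euclidean_space \<Rightarrow> real) \<Rightarrow> bool" where
  "test_fun \<phi> \<longleftrightarrow> smooth_fun \<phi> \<and> bounded {x. \<phi> x \<noteq> 0}"

text \<open>M is the positive measure mu_s: a locally finite Borel measure whose pairing
  with every test function is the value at s of the entire (holomorphic in each
  variable s_1..s_r) continuation of z \<mapsto> <mu_z, phi> from Re z > g0.\<close>
definition is_mu :: "('a::euclidean_space \<Rightarrow> 'a \<Rightarrow> 'a) \<Rightarrow> 'a \<Rightarrow> (nat \<Rightarrow> 'a) \<Rightarrow> nat \<Rightarrow> (nat \<Rightarrow> real) \<Rightarrow> 'a measure \<Rightarrow> bool" where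
  "is_mu m e c r s M \<longleftrightarrow> sets M = sets borel \<and>
     (\<forall>K. compact K \<longrightarrow> emeasure M K < \<infinity>) \<and>
     (\<forall>\<phi>. test_fun \<phi> \<longrightarrow> integrable M \<phi> \<and>
        (\<exists>G :: (nat \<Rightarrow> complex) \<Rightarrow> complex.
           (\<forall>z j. j \<in> {1..r} \<longrightarrow> (\<lambda>w. G (z(j := w))) holomorphic_on UNIV) \<and>
           (\<forall>z. (\<forall>j\<in>{1..r}. Re (z j) > g0 DIM('a) r j) \<longrightarrow> G z = mu_pair m e c r z \<phi>) \<and>
           G (\<lambda>j. complex_of_real (s j)) = complex_of_real (\<integral>x. \<phi> x \<partial>M)))"

definition wallach :: "real \<Rightarrow> nat \<Rightarrow> (nat \<Rightarrow> real) \<Rightarrow> bool" where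
  "wallach d r s \<longleftrightarrow> (\<exists>u::nat \<Rightarrow> real. (\<forall>j\<in>{1..r}. u j \<ge> 0) \<and>
     (\<forall>j\<in>{1..r}. s j = u j + d / 2 * (\<Sum>i=1..<j. sgn (u i))))"

text \<open>Holomorphy on the tube domain: the point (x,y) stands for x + i y in V_C;
  F is real-differentiable with complex-linear derivative (multiplication by i
  maps (u,v) to (-v,u)).\<close>
definition tube_holo :: "('a::euclidean_space \<Rightarrow> 'a \<Rightarrow> 'a) \<Rightarrow> ('a \<times> 'a \<Rightarrow> complex) \<Rightarrow> bool" where
  "tube_holo m F \<longleftrightarrow> (\<forall>x y. y \<in> sym_cone m \<longrightarrow>
     (\<exists>D. (F has_derivative D) (at (x, y)) \<and> (\<forall>u v. D (- v, u) = \<i> * D (u, v))))"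

definition enn_powr :: "ennreal \<Rightarrow> real \<Rightarrow> ennreal" where
  "enn_powr a p = (if a = \<infinity> then \<infinity> else ennreal (enn2real a powr p))"

definition h2norm :: "('a::euclidean_space \<Rightarrow> 'a \<Rightarrow> 'a) \<Rightarrow> 'a measure \<Rightarrow> ('a \<times> 'a \<Rightarrow> complex) \<Rightarrow> ennreal" where
  "h2norm m M F = enn_powr (SUP t\<in>sym_cone m.
      \<integral>\<^sup>+ y. indicator (closure (sym_cone m)) y *
        (\<integral>\<^sup>+ x. ennreal ((cmod (F (x, y + t)))\<^sup>2) \<partial>lborel) \<partial>M) (1/2)"

definition apq_norm :: "('a::euclidean_space \<Rightarrow> 'a \<Rightarrow> 'a) \<Rightarrow> 'a \<Rightarrow> (nat \<Rightarrow> 'a) \<Rightarrow> nat \<Rightarrow> real \<Rightarrow> real \<Rightarrow> (nat \<Rightarrow> real) \<Rightarrow> ('a \<times> 'a \<Rightarrow> complex) \<Rightarrow> ennreal" where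
  "apq_norm m e c r p q \<nu> F = enn_powr (\<integral>\<^sup>+ y. indicator (sym_cone m) y *
      enn_powr (\<integral>\<^sup>+ x. ennreal (cmod (F (x, y)) powr p) \<partial>lborel) (q / p) *
      ennreal (gpow m c r \<nu> y * jdet_in m e y powr (- real DIM('a) / real r)) \<partial>lborel) (1 / q)"

end

theory Submission
 imports Defs "HOL-Complex_Analysis.Complex_Analysis"
begin

text \<open>
Let F be in the Hardy space and let L be the Laplace transform of \<open>\<mu>\<^sub>s\<close>. By Paley-Wiener, the slice
\<open>F(\<cdot> + iy)\<close> has Fourier transform \<open>f(\<xi>) e\<^bsup>-(y|\<xi>)\<^esup>\<close> with f supported in the closed cone, and Plancherel turns
the Hardy norm into the norm of f in \<open>L\<^sup>2(L(2\<xi>)d\<xi>)\<close>. Since F\<open>\<^sup>2\<close> has transform f*f, the Cauchy-Schwarz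
inequality gives \<open>|f*f|\<^sup>2 \<le> J B\<close>, where J has mass \<open>||F||\<^sup>4\<close> and B does not depend on F. The measure \<open>\<mu>\<^sub>s\<close> is
relatively invariant under the triangular group, which acts simply transitively on the cone; comparing
covariance factors shows that B times the Laplace transform of \<open>\<Delta>\<^bsub>2s\<^esub>\<close> is bounded on the cone. This bounds
\<open>g(y) = \<integral>|F(x+iy)|\<^sup>4dx\<close> both pointwise, by a multiple of \<open>||F||\<^sup>4 / \<Delta>\<^bsub>2s+n/r\<^esub>(y)\<close>, and in \<open>L\<^sup>1(\<Delta>\<^bsub>2s\<^esub>dy)\<close>, and the
range \<open>q \<ge> 4\<close> follows by interpolating the two. The relative invariance and the nontriviality of \<open>\<mu>\<^sub>s\<close> near 0 are
identities between entire functions of s, hence need only be checked for large s. The Fourier argument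
is applied to F times a holomorphic damping factor, which is removed by Fatou's lemma.
\<close>

text \<open>Two features of the definitions shape the proof. Trace and determinant are
  \<open>SOME\<close>-choices over spectral decompositions, so no calculus of the determinant is at
  hand; its behaviour under triangular maps is obtained from concavity of ln det along linear flows.
  And the Hardy norm sees F only through averages over the support of \<open>M\<close>, which may be
  a thin boundary orbit or the point 0. Mass of \<open>M\<close> arbitrarily close to 0 compensates
  for this twice: it gives local bounds of F, which the slices require to have Fourier transforms at
  all, and a locally uniform lower bound of L, on which finiteness of B rests. The exponent comes
  from homogeneity: in B the two factors 1/L contribute s each and Lebesgue measure contributes n/r,
  while the Laplace transform of \<Delta>_{2s} scales inversely. Since \<Delta>_{2s+n/r}
  \<Delta>^{-n/r} = \<Delta>_{2s}, the sup bound and the integral bound concern the same weight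
  \<Delta>_{2s+n/r}, taken against the invariant measure.\<close>

abbreviation cplx :: "real => complex" where "cplx \<equiv> complex_of_real"

section \<open>Jordan algebra identities and their linearisations\<close>

locale euclidean_jordan =
 fixes m :: "'a::euclidean_space => 'a => 'a" (infixl \<open>\<odot>\<close> 70)
  and e :: 'a
 assumes eja: "eja m e"
begin

lemma bilin: "bounded_bilinear m" and comm: "x \<odot> y = y \<odot> x"
 and jordan_id: "x \<odot> ((x \<odot> x) \<odot> y) = (x \<odot> x) \<odot> (x \<odot> y)"
 and unit_left [simp]: "e \<odot> x = x"
 and assoc_inner: "inner (x \<odot> y) z = inner y (x \<odot> z)"
 and inner_jtr: "inner x y = jtr m e (x \<odot> y)"
 using eja unfolding eja_def by blast+

lemmas add_l = bounded_bilinear.add_left[OF bilin]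
 and add_r = bounded_bilinear.add_right[OF bilin]
 and diff_l = bounded_bilinear.diff_left[OF bilin]
 and diff_r = bounded_bilinear.diff_right[OF bilin]
 and scale_l = bounded_bilinear.scaleR_left[OF bilin]
 and scale_r = bounded_bilinear.scaleR_right[OF bilin]
 and minus_l = bounded_bilinear.minus_left[OF bilin]
 and minus_r = bounded_bilinear.minus_right[OF bilin]
 and zero_l [simp] = bounded_bilinear.zero_left[OF bilin]
 and zero_r [simp] = bounded_bilinear.zero_right[OF bilin]
 and sum_l = bounded_bilinear.sum_left[OF bilin]
 and sum_r = bounded_bilinear.sum_right[OF bilin]

lemma unit_right [simp]: "x \<odot> e = x"
 using comm[of x e] by simp

lemmas lin_simps = add_l add_r diff_l diff_r scale_l scale_r minus_l minus_r

lemma linear_mult: "linear (m x)"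
 by (intro linearI) (simp_all add: add_r scale_r)

lemma assoc_inner': "inner (x \<odot> y) z = inner x (y \<odot> z)"
 using assoc_inner[of y x z] comm[of x y] by simp

text \<open>The defect \<open>?J\<close> of the Jordan identity is cubic in \<open>x\<close>, so
  J(x+y) - J(x-y) - 2 J(y) isolates twice the part of degree two in \<open>x\<close> and one in
  \<open>y\<close>.\<close>

lemma jordan_polar1:
 "y \<odot> ((x \<odot> x) \<odot> w) + 2 *\<^sub>R (x \<odot> ((x \<odot> y) \<odot> w))
  = (x \<odot> x) \<odot> (y \<odot> w) + 2 *\<^sub>R ((x \<odot> y) \<odot> (x \<odot> w))"
proof -
 let ?J = "\<lambda>x. x \<odot> ((x \<odot> x) \<odot> w) - (x \<odot> x) \<odot> (x \<odot> w)"
 let ?B = "y \<odot> ((x \<odot> x) \<odot> w) + 2 *\<^sub>R (x \<odot> ((x \<odot> y) \<odot> w))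
  - (x \<odot> x) \<odot> (y \<odot> w) - 2 *\<^sub>R ((x \<odot> y) \<odot> (x \<odot> w))"
 have "?J (x + y) - ?J (x - y) - 2 *\<^sub>R ?J y = 2 *\<^sub>R ?B"
  by (simp add: lin_simps comm[of y x] scaleR_2 algebra_simps)
 moreover have "?J z = 0" for z
  by (simp add: jordan_id)
 ultimately have "?B = 0"
  by simp
 then show ?thesis
  by (simp add: algebra_simps)
qed

lemma jordan_polar:
 "x \<odot> ((y \<odot> z) \<odot> w) + y \<odot> ((z \<odot> x) \<odot> w) + z \<odot> ((x \<odot> y) \<odot> w)
 = (y \<odot> z) \<odot> (x \<odot> w) + (z \<odot> x) \<odot> (y \<odot> w) + (x \<odot> y) \<odot> (z \<odot> w)"
proof -
 let ?J = "\<lambda>x. y \<odot> ((x \<odot> x) \<odot> w) + 2 *\<^sub>R (x \<odot> ((x \<odot> y) \<odot> w))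
  - (x \<odot> x) \<odot> (y \<odot> w) - 2 *\<^sub>R ((x \<odot> y) \<odot> (x \<odot> w))"
 let ?B = "x \<odot> ((y \<odot> z) \<odot> w) + y \<odot> ((z \<odot> x) \<odot> w) + z \<odot> ((x \<odot> y) \<odot> w)
 - (y \<odot> z) \<odot> (x \<odot> w) - (z \<odot> x) \<odot> (y \<odot> w) - (x \<odot> y) \<odot> (z \<odot> w)"
 have "?J (x + z) - ?J x - ?J z = 2 *\<^sub>R ?B"
  by (simp add: lin_simps comm[of z x] comm[of y z] scaleR_2 algebra_simps)
 moreover have "?J z = 0" for z
  using jordan_polar1[of y z w] by (simp add: algebra_simps)
 ultimately have "?B = 0"
  by simp
 then show ?thesis
  by (simp add: algebra_simps)
qed

text \<open>The linearised identity solved for L((xy)w): multiplication by a triple product is a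
  polynomial in multiplications by products of at most two factors. All later operator identities
  are instances.\<close>

lemma mult_triple:
 "((x \<odot> y) \<odot> w) \<odot> z = (x \<odot> w) \<odot> (y \<odot> z) + (y \<odot> w) \<odot> (x \<odot> z) + (x \<odot> y) \<odot> (w \<odot> z)
  - x \<odot> (w \<odot> (y \<odot> z)) - y \<odot> (w \<odot> (x \<odot> z))"
 using jordan_polar[of x y z w]
 by (simp add: comm[of z] comm[of _ w] comm[of "y \<odot> z"] comm[of "x \<odot> z"] algebra_simps)

text \<open>In operator form: D = [L(w), L(y)] is a derivation, since the left side is x D(z) -
  D(xz) and the right side is -D(x) z.\<close>

lemma commutator_derivation:
 "x \<odot> (w \<odot> (y \<odot> z) - y \<odot> (w \<odot> z)) - (w \<odot> (y \<odot> (x \<odot> z)) - y \<odot> (w \<odot> (x \<odot> z)))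
  = ((x \<odot> w) \<odot> y) \<odot> z - ((x \<odot> y) \<odot> w) \<odot> z"
 using mult_triple[of x y w z] mult_triple[of x w y z]
 by (simp add: comm[of w y] lin_simps algebra_simps)

subsection \<open>Powers\<close>

primrec pw :: "'a => nat => 'a" where
 "pw x 0 = e"
| "pw x (Suc k) = x \<odot> pw x k"

lemma sq_pw: "(x \<odot> x) \<odot> pw x k = pw x (Suc (Suc k))"
 by (induction k) (simp_all flip: jordan_id)

text \<open>\<open>mult_triple\<close> gives a recursion for L of the next power in terms of L(x),
  L(xx) and the two preceding powers, all of which commute with L(x) by induction. Power
  associativity follows.\<close>

lemma pw_commute:
 "x \<odot> (pw x k \<odot> z) = pw x k \<odot> (x \<odot> z)"
proof (induction k arbitrary: z rule: less_induct)
 case (less k)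
 show ?case
 proof (cases "k < 2")
  case True
  then have "k = 0 \<or> k = 1" by auto
  then show ?thesis by auto
 next
  case False
  then obtain j where k: "k = Suc (Suc j)"
   by (metis One_nat_def Suc_1 add_2_eq_Suc le_Suc_ex not_less)
  have E: "pw x k \<odot> z = 2 *\<^sub>R (pw x (Suc j) \<odot> (x \<odot> z)) + (x \<odot> x) \<odot> (pw x j \<odot> z)
   - 2 *\<^sub>R (x \<odot> (pw x j \<odot> (x \<odot> z)))" for z
   using mult_triple[of x x "pw x j" z] sq_pw[of x j] k by (simp add: scaleR_2)
  show ?thesis
   unfolding E using less[of j] less[of "Suc j"] k
   by (simp add: lin_simps jordan_id del: pw.simps)
 qed
qed

lemma pw_add: "pw x i \<odot> pw x j = pw x (i + j)"
 by (induction j) (simp_all flip: pw_commute)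

end

text \<open>A maximiser of the Rayleigh quotient on the unit sphere of the invariant subspace is an
  eigenvector: the defect \<open>w\<close> would be a direction of first-order increase.\<close>

lemma symmetric_eigenvector:
 fixes f :: "'a::euclidean_space => 'a"
 assumes lf: "linear f" and sym: "\<And>x y. inner (f x) y = inner x (f y)"
  and U: "subspace U" and fU: "\<And>x. x \<in> U ==> f x \<in> U" and ne: "U \<noteq> {0}"
 obtains v l where "v \<in> U" "v \<noteq> 0" "f v = l *\<^sub>R v"
proof -
 have cont: "continuous_on S f" for S
  using lf linear_continuous_on linear_conv_bounded_linear by blast
 have "compact (sphere 0 1 \<inter> U)"
  using closed_subspace[OF U] by (simp add: compact_Int_closed)
 moreover obtain x0 where x0: "x0 \<in> U" "x0 \<noteq> 0"
  using ne subspace_0[OF U] by blast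
 then have "(1 / norm x0) *\<^sub>R x0 \<in> sphere 0 1 \<inter> U"
  using U by (simp add: subspace_scale)
 then have "sphere 0 1 \<inter> U \<noteq> {}"
  by blast
 moreover have "continuous_on (sphere 0 1 \<inter> U) (\<lambda>x. inner (f x) x)"
  by (intro continuous_intros cont)
 ultimately obtain v where v: "v \<in> sphere 0 1 \<inter> U"
  and vmax: "\<And>x. x \<in> sphere 0 1 \<inter> U ==> inner (f x) x \<le> inner (f v) v"
  using continuous_attains_sup[of "sphere 0 1 \<inter> U" "\<lambda>x. inner (f x) x"] by blast
 define l where "l = inner (f v) v"
 have bound: "inner (f x) x \<le> l * inner x x" if "x \<in> U" for x
 proof (cases "x = 0")
  case True
  then show ?thesis by simp
 next
  case False
  then have "inner (f ((1 / norm x) *\<^sub>R x)) ((1 / norm x) *\<^sub>R x) \<le> l"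
   using vmax[of "(1 / norm x) *\<^sub>R x"] that U unfolding l_def by (auto simp: subspace_scale)
  then show ?thesis
   using False by (simp add: linear_scale[OF lf] field_simps power2_eq_square flip: power2_norm_eq_inner)
 qed
 have vv: "inner v v = 1"
  using v by (simp add: norm_eq_1)
 define w where "w = f v - l *\<^sub>R v"
 have wU: "w \<in> U"
  unfolding w_def using v fU U by (auto intro!: subspace_diff subspace_scale)
 have fvw: "inner (f v) w - l * inner v w = inner w w"
  unfolding w_def by (simp add: inner_simps algebra_simps)
 \<comment> \<open>Minus the second-order coefficient of the Rayleigh inequality along v + t w; the
   first-order term is 2 |w|^2.\<close>
 define K where "K = l * inner w w - inner (f w) w"
 have K: "K \<ge> 0"
  using bound[OF wU] by (simp add: K_def)
 have ineq: "2 * t * inner w w \<le> t\<^sup>2 * K" for t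
 proof -
  have "v + t *\<^sub>R w \<in> U"
   using v wU U by (auto intro!: subspace_add subspace_scale)
  from bound[OF this] have "l + 2 * t * inner (f v) w + t\<^sup>2 * inner (f w) w
    \<le> l * (1 + 2 * t * inner v w + t\<^sup>2 * inner w w)"
   using sym[of w v] vv
   by (simp add: linear_add[OF lf] linear_scale[OF lf] inner_simps l_def inner_commute
     algebra_simps power2_eq_square)
  then have "2 * t * (inner (f v) w - l * inner v w) \<le> t\<^sup>2 * K"
   unfolding K_def by (simp add: algebra_simps)
  then show ?thesis
   unfolding fvw by simp
 qed
 have "w = 0"
 proof (rule ccontr)
  assume "w \<noteq> 0"
  define a where "a = inner w w"
  have a: "a > 0" using \<open>w \<noteq> 0\<close> by (simp add: a_def)
  \<comment> \<open>Chosen so that t K is at most a, which contradicts 2 a \<le> t K.\<close>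
  define t where "t = a / (K + 1)"
  have t: "t > 0" using a K by (simp add: t_def)
  have "t * (2 * a) \<le> t * (t * K)"
   using ineq[of t] by (simp add: a_def power2_eq_square algebra_simps)
  then have "2 * a \<le> t * K"
   using t by simp
  also have "t * K \<le> a"
   using a K by (simp add: t_def field_simps)
  finally show False using a by simp
 qed
 moreover have "v \<noteq> 0" using vv by auto
 ultimately show ?thesis
  using that[of v l] v by (simp add: w_def)
qed

section \<open>Peirce decomposition of an idempotent\<close>

context euclidean_jordan
begin

definition idem :: "'a => bool" where
 "idem c \<longleftrightarrow> c \<odot> c = c"

lemma idemD: "idem c ==> c \<odot> c = c"
 by (simp add: idem_def)

text \<open>\<open>mult_triple\<close> with equal arguments: L(c) is annihilated by X(2X - 1)(X -
  1), which fixes the eigenvalues 0, 1/2, 1.\<close>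

lemma peirce_cubic:
 assumes "idem c"
 shows "2 *\<^sub>R (c \<odot> (c \<odot> (c \<odot> x))) = 3 *\<^sub>R (c \<odot> (c \<odot> x)) - c \<odot> x"
proof -
 have "c \<odot> x = 3 *\<^sub>R (c \<odot> (c \<odot> x)) - 2 *\<^sub>R (c \<odot> (c \<odot> (c \<odot> x)))"
  using mult_triple[of c c c x] idemD[OF assms]
  using scaleR_add_left[of 2 1 "c \<odot> (c \<odot> x)"] by (simp add: algebra_simps scaleR_2)
 then show ?thesis by (simp add: algebra_simps)
qed

text \<open>The Lagrange interpolation polynomials of L(c) at the nodes 1, 1/2 and 0; on the
  eigenspaces of L(c) they act as the Peirce projections.\<close>

definition pE1 :: "'a => 'a => 'a" where
 "pE1 c x = 2 *\<^sub>R (c \<odot> (c \<odot> x)) - c \<odot> x"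
definition pEh :: "'a => 'a => 'a" where
 "pEh c x = 4 *\<^sub>R (c \<odot> x) - 4 *\<^sub>R (c \<odot> (c \<odot> x))"
definition pE0 :: "'a => 'a => 'a" where
 "pE0 c x = x - 3 *\<^sub>R (c \<odot> x) + 2 *\<^sub>R (c \<odot> (c \<odot> x))"

lemma peirce_sum: "pE1 c x + pEh c x + pE0 c x = x"
proof -
 have "(2 + - 4 + 2) *\<^sub>R (c \<odot> (c \<odot> x)) + (- 1 + 4 + - 3) *\<^sub>R (c \<odot> x) = 0"
  by simp
 then show ?thesis
  unfolding pE1_def pEh_def pE0_def scaleR_add_left by (simp add: algebra_simps)
qed

lemma scaleR_cancel2: "2 *\<^sub>R (x::'a) = 2 *\<^sub>R y ==> x = y"
 by simp

lemma peirce_eigen: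
 assumes "idem c"
 shows "c \<odot> pE1 c x = pE1 c x" "c \<odot> pEh c x = (1/2) *\<^sub>R pEh c x" "c \<odot> pE0 c x = 0"
proof -
 let ?a = "c \<odot> x" and ?b = "c \<odot> (c \<odot> x)" and ?d = "c \<odot> (c \<odot> (c \<odot> x))"
 have d: "?d = (3/2) *\<^sub>R ?b - (1/2) *\<^sub>R ?a"
  by (rule scaleR_cancel2) (simp add: scaleR_diff_right peirce_cubic[OF assms])
 show "c \<odot> pE1 c x = pE1 c x"
  unfolding pE1_def lin_simps d by (rule euclidean_eqI) (simp add: inner_simps algebra_simps)
 show "c \<odot> pEh c x = (1/2) *\<^sub>R pEh c x"
  unfolding pEh_def lin_simps d by (rule euclidean_eqI) (simp add: inner_simps algebra_simps)
 show "c \<odot> pE0 c x = 0"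
  unfolding pE0_def lin_simps d by (rule euclidean_eqI) (simp add: inner_simps algebra_simps)
qed

text \<open>Linearise once around \<open>c\<close>: when c y is y or 0, the terms of the polarised
  identity collapse to [L(c), L(y)] = 0.\<close>

lemma peirce_commute:
 assumes c: "idem c" and y: "c \<odot> y = y \<or> c \<odot> y = 0"
 shows "c \<odot> (y \<odot> w) = y \<odot> (c \<odot> w)"
 using jordan_polar1[of y c w] y idemD[OF c] by (auto simp: scaleR_2)

lemma peirce_11: "idem c ==> c \<odot> x = x ==> c \<odot> y = y ==> c \<odot> (x \<odot> y) = x \<odot> y"
 using peirce_commute[of c x y] by simp

text \<open>Commuting L(c) past either factor evaluates c (x y) both as 0 and as x y.\<close>

lemma peirce_10:
 assumes "idem c" "c \<odot> x = x" "c \<odot> y = 0"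
 shows "x \<odot> y = 0"
 using peirce_commute[of c x y] peirce_commute[of c y x] assms comm[of x y] by simp

lemma peirce_1h:
 "idem c ==> c \<odot> x = x ==> c \<odot> y = (1/2) *\<^sub>R y ==> c \<odot> (x \<odot> y) = (1/2) *\<^sub>R (x \<odot> y)"
 using peirce_commute[of c x y] by (simp add: scale_r)

lemma peirce_0h:
 "idem c ==> c \<odot> x = 0 ==> c \<odot> y = (1/2) *\<^sub>R y ==> c \<odot> (x \<odot> y) = (1/2) *\<^sub>R (x \<odot> y)"
 using peirce_commute[of c x y] by (simp add: scale_r)

text \<open>Products of half-space elements have no half component, because L(c) is idempotent on
  them. The linearised identity shows this for squares, and polarisation gives the rest.\<close>

lemma peirce_hh:
 assumes c: "idem c" and x: "c \<odot> x = (1/2) *\<^sub>R x" and y: "c \<odot> y = (1/2) *\<^sub>R y"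
 shows "c \<odot> (c \<odot> (x \<odot> y)) = c \<odot> (x \<odot> y)"
proof -
 have sq: "c \<odot> (c \<odot> (x \<odot> x)) = c \<odot> (x \<odot> x)" if "c \<odot> x = (1/2) *\<^sub>R x" for x
 proof -
  have "x \<odot> c = (1/2) *\<^sub>R x"
   using that comm[of x c] by simp
  with jordan_polar1[of c x c] idemD[OF c] that show ?thesis
   by (simp add: lin_simps comm[of "x \<odot> x" c])
 qed
 have "c \<odot> (x + y) = (1/2) *\<^sub>R (x + y)"
  using x y by (simp add: add_r scaleR_add_right)
 from sq[OF this] sq[OF x] sq[OF y]
 have "2 *\<^sub>R (c \<odot> (c \<odot> (x \<odot> y))) = 2 *\<^sub>R (c \<odot> (x \<odot> y))"
  by (simp add: lin_simps comm[of y x] scaleR_2 algebra_simps)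
 then show ?thesis by simp
qed

lemma eigen_orth:
 assumes "c \<odot> x = a *\<^sub>R x" "c \<odot> y = b *\<^sub>R y" "a \<noteq> b"
 shows "inner x y = 0"
 using assoc_inner[of c x y] assms by simp

text \<open>The Peirce spaces are orthogonal and carry the eigenvalues 1, 1/2, 0. The resulting
  positivity of L(c) is the source of all positivity statements about the cone.\<close>

lemma idem_psd_eq:
 assumes "idem c"
 shows "inner (c \<odot> x) x = (norm (pE1 c x))\<^sup>2 + (norm (pEh c x))\<^sup>2 / 2"
proof -
 note E = peirce_eigen[OF assms, of x]
 have o: "inner (pE1 c x) (pEh c x) = 0" "inner (pE1 c x) (pE0 c x) = 0" "inner (pEh c x) (pE0 c x) = 0"
  using E eigen_orth[of c "pE1 c x" 1 "pEh c x" "1/2"] eigen_orth[of c "pE1 c x" 1 "pE0 c x" 0]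
   eigen_orth[of c "pEh c x" "1/2" "pE0 c x" 0] by auto
 have "inner (c \<odot> x) x = inner (c \<odot> (pE1 c x + pEh c x + pE0 c x)) (pE1 c x + pEh c x + pE0 c x)"
  by (simp only: peirce_sum)
 also have "\<dots> = inner (pE1 c x) (pE1 c x) + inner (pEh c x) (pEh c x) / 2"
  by (simp add: add_r E inner_simps o inner_commute[of "pEh c x" "pE1 c x"])
 finally show ?thesis by (simp add: power2_norm_eq_inner)
qed

lemma idem_psd: "idem c ==> inner (c \<odot> x) x \<ge> 0"
 by (simp add: idem_psd_eq)

lemma idem_inner_nonneg: "idem a ==> idem b ==> inner a b \<ge> 0"
 using idem_psd[of a b] assoc_inner'[of a b b] by (simp add: idem_def)

lemma sq_eq_0: "x \<odot> x = 0 ==> x = 0"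
 using assoc_inner'[of x x e] by simp

lemma inner_e_idem: "idem p ==> inner e p = inner p p"
 using assoc_inner[of p p e] by (simp add: idem_def inner_commute)

section \<open>Primitive idempotents and the spectral theorem\<close>

definition V1 :: "'a => 'a set" where
 "V1 u = {y. u \<odot> y = y}"

lemma subspace_V1: "subspace (V1 u)"
 by (auto simp: subspace_def V1_def lin_simps)

lemma idem_diff: "idem u ==> idem a ==> u \<odot> a = a ==> idem (u - a)"
 by (simp add: idem_def lin_simps comm[of a u])

lemma V1_mono:
 assumes u: "idem u" and a: "idem a" and ua: "u \<odot> a = a"
 shows "V1 a \<subseteq> V1 u"
proof
 fix y assume "y \<in> V1 a"
 then have y: "a \<odot> y = y" by (simp add: V1_def)
 have "a \<odot> (u - a) = 0"
  using ua a by (simp add: diff_r comm[of a u] idem_def)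
 then have "y \<odot> (u - a) = 0"
  using peirce_10[OF a y] by simp
 then have "u \<odot> y = a \<odot> y"
  by (simp add: diff_r comm[of y u] comm[of y a])
 then show "y \<in> V1 u" using y by (simp add: V1_def)
qed

text \<open>The dimension of \<open>V1\<close> is the measure that makes the splitting off of
  idempotents terminate.\<close>

lemma dim_V1_less:
 assumes u: "idem u" and a: "idem a" and ua: "u \<odot> a = a" and ne: "a \<noteq> u"
 shows "dim (V1 a) < dim (V1 u)"
proof -
 have "u \<in> V1 u" "u \<notin> V1 a"
  using u ua ne by (auto simp: V1_def idem_def comm[of a u])
 then have "V1 a \<subset> V1 u" using V1_mono[OF u a ua] by blast
 then show ?thesis
  using subspace_V1 by (intro dim_psubset) (simp add: span_eq_iff[THEN iffD2])
qed

lemma prim_idem_idem: "prim_idem m p ==> idem p"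
 by (simp add: prim_idem_def idem_def)

lemma ex_prim_idem:
 assumes "idem p" "p \<noteq> 0"
 shows "\<exists>a. prim_idem m a \<and> p \<odot> a = a"
 using assms
proof (induction "dim (V1 p)" arbitrary: p rule: less_induct)
 case less
 show ?case
 proof (cases "prim_idem m p")
  case True
  then show ?thesis using less.prems by (auto simp: idem_def)
 next
  case False
  then obtain a b where ab: "a \<noteq> 0" "b \<noteq> 0" "idem a" "idem b" "a \<odot> b = 0" "p = a + b"
   using less.prems unfolding prim_idem_def idem_def by blast
  have pa: "p \<odot> a = a"
   using ab by (simp add: add_l idem_def comm[of b a])
  have "dim (V1 a) < dim (V1 p)"
   using dim_V1_less[OF less.prems(1) ab(3) pa] ab by auto
  from less.hyps[OF this ab(3) ab(1)] obtain q where "prim_idem m q" "a \<odot> q = q" by blast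
  then show ?thesis
   using V1_mono[OF less.prems(1) ab(3) pa] by (auto simp: V1_def)
 qed
qed

lemma pw_V1: "idem u ==> u \<odot> x = x ==> u \<odot> pw x (Suc k) = pw x (Suc k)"
 by (induction k) (simp_all add: peirce_11)

text \<open>The powers of \<open>x\<close> span an associative algebra that L(x) preserves. For an
  eigenvector \<open>v\<close> of L(x) inside it, every element of the algebra acts on
  \<open>v\<close> by a scalar, in particular \<open>v\<close> itself. So v v = c v, and c is
  nonzero because squares of nonzero elements do not vanish; v/c is the idempotent.\<close>

lemma ex_eigen_idem:
 assumes u: "idem u" "u \<noteq> 0" and ux: "u \<odot> x = x"
 shows "\<exists>p l. idem p \<and> p \<noteq> 0 \<and> u \<odot> p = p \<and> x \<odot> p = l *\<^sub>R p"
proof -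
 \<comment> \<open>The zeroth power is \<open>e\<close>, which may lie outside \<open>V1 u\<close>;
   the generated algebra is therefore spanned by \<open>u\<close> and the powers of positive
   degree.\<close>
 define S where "S = insert u (range (\<lambda>k. pw x (Suc k)))"
 have uS: "u \<odot> y = y" if "y \<in> S" for y
  using that pw_V1[OF u(1) ux] u(1) by (auto simp: S_def idem_def simp del: pw.simps)
 have uU: "u \<odot> y = y" if "y \<in> span S" for y
  using that by (induction rule: span_induct_alt) (simp_all add: lin_simps uS)
 have pwu: "pw x (Suc k) \<odot> u = pw x (Suc k)" for k
  using pw_V1[OF u(1) ux, of k] comm[of u "pw x (Suc k)"] by (simp del: pw.simps)
 have xS: "x \<odot> y \<in> S" if "y \<in> S" for y
 proof -
  have "x \<odot> u = pw x (Suc 0)" using ux comm[of x u] by simp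
  moreover have "x \<odot> pw x (Suc k) = pw x (Suc (Suc k))" for k by simp
  ultimately show ?thesis using that unfolding S_def by blast
 qed
 have xU: "x \<odot> y \<in> span S" if "y \<in> span S" for y
  using that
  by (induction rule: span_induct_alt)
   (auto simp: lin_simps intro: span_zero span_add span_scale span_base xS)
 have "span S \<noteq> {0}"
  using u span_base[of u S] by (auto simp: S_def)
 then obtain v l where v: "v \<in> span S" "v \<noteq> 0" "x \<odot> v = l *\<^sub>R v"
  using symmetric_eigenvector[OF linear_mult[of x] assoc_inner subspace_span xU] by metis
 have assoc: "pw x (Suc k) \<odot> y = x \<odot> (pw x k \<odot> y)" if "y \<in> span S" for k y
  using that
 proof (induction rule: span_induct_alt)
  case base
  then show ?case by simp
 next
  case (step a y z)
  have "pw x (Suc k) \<odot> y = x \<odot> (pw x k \<odot> y)"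
  proof (cases "y = u")
   case True
   then show ?thesis
    using pwu[of k] pwu[of "k - 1"] ux comm[of x u] by (cases k) simp_all
  next
   case False
   then obtain j where "y = pw x (Suc j)" using step by (auto simp: S_def)
   then show ?thesis by (simp add: pw_add del: pw.simps) simp
  qed
  then show ?case using step by (simp add: lin_simps del: pw.simps)
 qed
 have pwv: "pw x k \<odot> v = l ^ k *\<^sub>R v" for k
 proof (induction k)
  case (Suc k)
  then show ?case
   using assoc[OF v(1), of k] v(3) by (simp add: scale_r)
 qed simp
 have "\<exists>c. w \<odot> v = c *\<^sub>R v" if "w \<in> span S" for w
  using that
 proof (induction rule: span_induct_alt)
  case base
  show ?case by (intro exI[of _ 0]) simp
 next
  case (step a y z)
  then obtain d where d: "z \<odot> v = d *\<^sub>R v" by blast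
  have "\<exists>b. y \<odot> v = b *\<^sub>R v"
  proof (cases "y = u")
   case True
   then show ?thesis using uU[OF v(1)] by (intro exI[of _ 1]) simp
  next
   case False
   then obtain j where "y = pw x (Suc j)" using step by (auto simp: S_def)
   then show ?thesis using pwv[of "Suc j"] by blast
  qed
  then obtain b where "y \<odot> v = b *\<^sub>R v" by blast
  then have "(a *\<^sub>R y + z) \<odot> v = (a * b + d) *\<^sub>R v"
   using d by (simp add: lin_simps algebra_simps)
  then show ?case by blast
 qed
 then obtain c where c: "v \<odot> v = c *\<^sub>R v" using v(1) by blast
 have "c \<noteq> 0" using c sq_eq_0[of v] v(2) by auto
 then have "idem ((1/c) *\<^sub>R v)" "(1/c) *\<^sub>R v \<noteq> 0" "u \<odot> ((1/c) *\<^sub>R v) = (1/c) *\<^sub>R v"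
  "x \<odot> ((1/c) *\<^sub>R v) = l *\<^sub>R ((1/c) *\<^sub>R v)"
  using c v uU[OF v(1)] by (simp_all add: idem_def lin_simps)
 then show ?thesis by blast
qed

lemma jspec_V1:
 assumes "jspec m u x k l d" "i < k"
 shows "u \<odot> d i = d i"
proof -
 have "u \<odot> d i = (\<Sum>j<k. d j \<odot> d i)"
  using assms by (simp add: jspec_def sum_l flip: sum_l)
 also have "\<dots> = (\<Sum>j<k. if j = i then d i else 0)"
  using assms by (intro sum.cong) (auto simp: jspec_def prim_idem_def)
 finally show ?thesis using assms(2) by simp
qed

text \<open>Splits off a primitive idempotent \<open>a\<close> below an eigen-idempotent and
  continues in the smaller Peirce space of u - a.\<close>

theorem ex_jspec:
 assumes "idem u" "u \<odot> x = x"
 shows "\<exists>k l d. jspec m u x k l d"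
 using assms
proof (induction "dim (V1 u)" arbitrary: u x rule: less_induct)
 case less
 show ?case
 proof (cases "u = 0")
  case True
  then have "jspec m u x 0 (\<lambda>_. 0) (\<lambda>_. 0)"
   using less.prems by (simp add: jspec_def)
  then show ?thesis by blast
 next
  case False
  then obtain p l where p: "idem p" "p \<noteq> 0" "u \<odot> p = p" "x \<odot> p = l *\<^sub>R p"
   using ex_eigen_idem less.prems by blast
  obtain a where a: "prim_idem m a" "p \<odot> a = a"
   using ex_prim_idem p by blast
  have ia: "idem a" using a by (simp add: prim_idem_idem)
  have ua: "u \<odot> a = a"
   using V1_mono[OF less.prems(1) p(1,3)] a by (auto simp: V1_def)
  \<comment> \<open>The idempotent \<open>p\<close> need not be primitive. Since x - l p lies in the
    0-space of \<open>p\<close>, it annihilates everything in \<open>V1 p\<close>, so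
    \<open>a\<close> inherits the eigenvalue.\<close>
  have "p \<odot> (x - l *\<^sub>R p) = 0"
   using p by (simp add: lin_simps comm[of p x] idem_def)
  then have "a \<odot> (x - l *\<^sub>R p) = 0"
   using peirce_10[OF p(1) a(2)] by simp
  then have xa: "x \<odot> a = l *\<^sub>R a"
   using a by (simp add: lin_simps comm[of a x] comm[of a p])
  have iu: "idem (u - a)"
   using idem_diff less.prems ia ua by blast
  have ux: "(u - a) \<odot> (x - l *\<^sub>R a) = x - l *\<^sub>R a"
   using less.prems ua ia xa by (simp add: lin_simps comm[of a x] idem_def)
  have "a \<noteq> 0" using a by (simp add: prim_idem_def)
  moreover have "u \<odot> (u - a) = u - a"
   using less.prems ua by (simp add: diff_r idem_def)
  ultimately have "dim (V1 (u - a)) < dim (V1 u)"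
   using dim_V1_less[OF less.prems(1) iu] by auto
  from less.hyps[OF this iu ux] obtain k l' d where J: "jspec m (u - a) (x - l *\<^sub>R a) k l' d"
   by blast
  have "(u - a) \<odot> a = 0" using ua ia by (simp add: diff_l idem_def)
  then have o: "d i \<odot> a = 0" "a \<odot> d i = 0" if "i < k" for i
   using peirce_10[OF iu jspec_V1[OF J that]] comm[of a "d i"] by auto
  have "jspec m u x (Suc k) (l'(k := l)) (d(k := a))"
   using J a(1) o unfolding jspec_def by (auto simp: less_Suc_eq algebra_simps)
  then show ?thesis by blast
 qed
qed

text \<open>The inner product is the trace of the product, and the trace is that of some chosen
  decomposition. Whatever is chosen for a primitive \<open>p\<close>, its eigenvalues are 0 or 1
  because p p = p, and exactly one is 1 because \<open>p\<close> is indecomposable.\<close>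

lemma prim_idem_norm:
 assumes p: "prim_idem m p"
 shows "inner p p = 1"
proof -
 have ie: "idem e" by (simp add: idem_def)
 have pp: "p \<odot> p = p" using p by (simp add: prim_idem_def)
 have "\<exists>t k l d. jspec m e p k l d \<and> t = (\<Sum>i<k. l i)"
  using ex_jspec[OF ie, of p] by auto
 then have "\<exists>k l d. jspec m e p k l d \<and> jtr m e p = (\<Sum>i<k. l i)"
  unfolding jtr_def by (rule someI_ex)
 then obtain k l d where J: "jspec m e p k l d" and t: "jtr m e p = (\<Sum>i<k. l i)" by blast
 have dd: "d i \<odot> d j = (if i = j then d i else 0)" if "i < k" "j < k" for i j
  using J that by (auto simp: jspec_def prim_idem_def)
 have d0: "d i \<noteq> 0" if "i < k" for i
  using J that by (auto simp: jspec_def prim_idem_def)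
 have pd: "p \<odot> d i = l i *\<^sub>R d i" if "i < k" for i
 proof -
  have "p \<odot> d i = (\<Sum>j<k. l j *\<^sub>R (d j \<odot> d i))"
   using J by (simp add: jspec_def sum_l scale_l)
  also have "\<dots> = (\<Sum>j<k. if j = i then l i *\<^sub>R d i else 0)"
   using that by (intro sum.cong) (auto simp: dd)
  finally show ?thesis using that by simp
 qed
 have l01: "l i = 0 \<or> l i = 1" if "i < k" for i
 proof -
  have "p = (\<Sum>j<k. l j *\<^sub>R d j)" using J by (simp add: jspec_def)
  then have "p \<odot> p = (\<Sum>j<k. l j *\<^sub>R (p \<odot> d j))"
   by (subst (2) \<open>p = _\<close>) (simp add: sum_r scale_r)
  also have "\<dots> = (\<Sum>j<k. (l j * l j) *\<^sub>R d j)"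
   by (intro sum.cong) (auto simp: pd)
  finally have *: "(\<Sum>j<k. (l j * l j - l j) *\<^sub>R d j) = 0"
   using pp \<open>p = _\<close> by (simp add: scaleR_left_diff_distrib sum_subtractf)
  have "(\<Sum>j<k. (l j * l j - l j) *\<^sub>R d j) \<odot> d i = (\<Sum>j<k. if j = i then (l i * l i - l i) *\<^sub>R d i else 0)"
   unfolding sum_l using that by (intro sum.cong) (auto simp: dd scale_l)
  then have "(l i * l i - l i) *\<^sub>R d i = 0" using * that by simp
  then have "l i * (l i - 1) = 0" using d0[OF that] by (simp add: algebra_simps)
  then show ?thesis by simp
 qed
 define S where "S = {i. i < k \<and> l i = 1}"
 have fS: "finite S" by (simp add: S_def)
 have pS: "p = (\<Sum>i\<in>S. d i)"
 proof -
  have "p = (\<Sum>j<k. l j *\<^sub>R d j)" using J by (simp add: jspec_def)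
  also have "\<dots> = (\<Sum>j<k. if j \<in> S then d j else 0)"
   using l01 by (intro sum.cong) (auto simp: S_def)
  also have "\<dots> = (\<Sum>i\<in>S. d i)"
   by (subst sum.inter_restrict[symmetric]) (auto simp: S_def intro!: sum.cong)
  finally show ?thesis .
 qed
 have "S \<noteq> {}" using pS p by (auto simp: prim_idem_def)
 then obtain i where i: "i \<in> S" by blast
 have "S = {i}"
 proof (rule ccontr)
  assume "S \<noteq> {i}"
  define b where "b = (\<Sum>j\<in>S - {i}. d j)"
  have sum: "p = d i + b"
   unfolding pS b_def using i fS by (simp add: sum.remove)
  have "d j \<odot> b = (if j \<in> S - {i} then d j else 0)" if "j < k" for j
  proof -
   have "d j \<odot> b = (\<Sum>n\<in>S - {i}. if n = j then d j else 0)"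
    unfolding b_def sum_r using that by (intro sum.cong) (auto simp: dd S_def)
   then show ?thesis using fS by (simp add: sum.delta)
  qed
  note db = this
  have "b \<odot> b = (\<Sum>j\<in>S - {i}. d j \<odot> b)"
   by (subst (1) b_def) (simp add: sum_l)
  also have "\<dots> = b"
   unfolding b_def[symmetric] by (subst (2) b_def) (auto simp: db S_def intro!: sum.cong)
  finally have bb: "b \<odot> b = b" .
  obtain j where j: "j \<in> S - {i}" using \<open>S \<noteq> {i}\<close> i by blast
  then have "b \<noteq> 0" using db[of j] d0[of j] by (auto simp: S_def)
  moreover have "d i \<odot> b = 0" using db[of i] i by (auto simp: S_def)
  moreover have "d i \<noteq> 0" "d i \<odot> d i = d i" using i d0 dd by (auto simp: S_def)
  ultimately show False using p sum bb unfolding prim_idem_def by blast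
 qed
 then have "(\<Sum>i<k. l i) = (\<Sum>j<k. if j = i then 1 else 0)"
  using l01 i by (intro sum.cong) (auto simp: S_def)
 then have "jtr m e p = 1" using t i by (simp add: S_def)
 then show ?thesis using inner_jtr[of p p] pp by simp
qed

end

section \<open>Comparison of spectral decompositions and the determinant\<close>

context euclidean_jordan
begin

lemma idem_e: "idem e"
 by (simp add: idem_def)

lemma jspec_dd:
 "jspec m u x k l d ==> i < k ==> j < k ==> d i \<odot> d j = (if i = j then d i else 0)"
 by (auto simp: jspec_def prim_idem_def)

lemma jspec_inner_dd:
 assumes "jspec m u x k l d" "i < k" "j < k"
 shows "inner (d i) (d j) = (if i = j then 1 else 0)"
proof (cases "i = j")
 case True
 then show ?thesis using assms prim_idem_norm by (auto simp: jspec_def)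
next
 case False
 have "inner (d i) (d j) = inner (d i \<odot> d i) (d j)"
  using jspec_dd[OF assms(1) assms(2) assms(2)] by simp
 also have "\<dots> = 0"
  unfolding assoc_inner using jspec_dd[OF assms(1) assms(2) assms(3)] False by simp
 finally show ?thesis using False by simp
qed

lemma jspec_idem: "jspec m u x k l d ==> i < k ==> idem (d i)"
 using jspec_dd[of u x k l d i i] by (simp add: idem_def)

lemma jspec_sums: "jspec m u x k l d ==> (\<Sum>i<k. d i) = u" "jspec m u x k l d ==> x = (\<Sum>i<k. l i *\<^sub>R d i)"
 by (simp_all add: jspec_def)

lemma jspec_mult:
 assumes J: "jspec m u x k l d" and i: "i < k"
 shows "(\<Sum>j<k. a j *\<^sub>R d j) \<odot> d i = a i *\<^sub>R d i"
proof -
 have "(\<Sum>j<k. a j *\<^sub>R d j) \<odot> d i = (\<Sum>j<k. if j = i then a i *\<^sub>R d i else 0)"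
  unfolding sum_l using i by (intro sum.cong) (auto simp: scale_l jspec_dd[OF J])
 then show ?thesis using i by simp
qed

lemma jspec_mult_sum:
 assumes J: "jspec m u x k l d"
 shows "(\<Sum>j<k. a j *\<^sub>R d j) \<odot> (\<Sum>j<k. b j *\<^sub>R d j) = (\<Sum>j<k. (a j * b j) *\<^sub>R d j)"
 by (subst sum_r) (auto simp: scale_r jspec_mult[OF J] mult.commute intro!: sum.cong)

lemma jspec_inner_sum:
 assumes J: "jspec m u x k l d" and i: "i < k"
 shows "inner (\<Sum>j<k. a j *\<^sub>R d j) (d i) = a i"
proof -
 have "inner (\<Sum>j<k. a j *\<^sub>R d j) (d i) = (\<Sum>j<k. if j = i then a i else 0)"
  unfolding inner_sum_left using i by (intro sum.cong) (auto simp: jspec_inner_dd[OF J])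
 then show ?thesis using i by simp
qed

lemma jspec_inner_sum2:
 assumes J: "jspec m u x k l d"
 shows "inner (\<Sum>j<k. a j *\<^sub>R d j) (\<Sum>j<k. b j *\<^sub>R d j) = (\<Sum>j<k. a j * b j)"
 by (subst inner_sum_right) (auto simp: jspec_inner_sum[OF J] mult.commute intro!: sum.cong)

lemma jspec_eigen: "jspec m u x k l d ==> i < k ==> inner x (d i) = l i"
 using jspec_inner_sum[of u x k l d i l] jspec_sums(2)[of u x k l d] by simp

lemma jspec_unit_inner: "jspec m u x k l d ==> i < k ==> inner u (d i) = 1"
 using jspec_inner_sum[of u x k l d i "\<lambda>_. 1"] jspec_sums(1)[of u x k l d] by simp

lemma jspec_idem_u: "jspec m u x k l d ==> idem u"
 using jspec_mult_sum[of u x k l d "\<lambda>_. 1" "\<lambda>_. 1"] by (simp add: jspec_def idem_def)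

text \<open>Both families sum to \<open>u\<close>, and each member d satisfies (u|d) = 1; this gives
  the row and column sums. Nonnegativity is that of the pairing of two idempotents.\<close>

lemma jspec_weights:
 assumes J: "jspec m u x k l d" and J': "jspec m u y k' l' d'"
 shows "i < k ==> j < k' ==> inner (d i) (d' j) \<ge> 0"
  and "i < k ==> (\<Sum>j<k'. inner (d i) (d' j)) = 1"
  and "j < k' ==> (\<Sum>i<k. inner (d i) (d' j)) = 1"
  and "i < k ==> (\<Sum>j<k'. l' j * inner (d i) (d' j)) = inner y (d i)"
proof -
 show "i < k ==> j < k' ==> inner (d i) (d' j) \<ge> 0"
  using idem_inner_nonneg jspec_idem J J' by blast
 show "(\<Sum>j<k'. inner (d i) (d' j)) = 1" if "i < k"
  using jspec_unit_inner[OF J that] jspec_sums(1)[OF J']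
  by (simp add: inner_sum_right[symmetric] inner_commute)
 show "(\<Sum>i<k. inner (d i) (d' j)) = 1" if "j < k'"
  using jspec_unit_inner[OF J' that] jspec_sums(1)[OF J]
  by (simp add: inner_sum_left[symmetric])
 show "(\<Sum>j<k'. l' j * inner (d i) (d' j)) = inner y (d i)"
  by (subst jspec_sums(2)[OF J'], subst inner_commute) (simp add: inner_sum_right)
qed

lemma double_sum_left:
 fixes f :: "nat => real"
 assumes J: "jspec m u x k l d" and J': "jspec m u y k' l' d'"
 shows "(\<Sum>i<k. f i) = (\<Sum>i<k. \<Sum>j<k'. inner (d i) (d' j) * f i)"
 by (intro sum.cong) (auto simp: sum_distrib_right[symmetric] jspec_weights(2)[OF J J'])

lemma double_sum_right:
 fixes f :: "nat => real"
 assumes J: "jspec m u x k l d" and J': "jspec m u y k' l' d'"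
 shows "(\<Sum>j<k'. f j) = (\<Sum>i<k. \<Sum>j<k'. inner (d i) (d' j) * f j)"
 by (subst sum.swap, intro sum.cong) (auto simp: sum_distrib_right[symmetric] jspec_weights(3)[OF J J'])

text \<open>Eigenvectors of the symmetric operator L(x) for different eigenvalues are
  orthogonal.\<close>

lemma jspec_eigen_eq:
 assumes J: "jspec m u x k l d" and J': "jspec m u x k' l' d'" and "i < k" "j < k'"
  and ne: "inner (d i) (d' j) \<noteq> 0"
 shows "l i = l' j"
proof -
 have "x \<odot> d i = l i *\<^sub>R d i" "x \<odot> d' j = l' j *\<^sub>R d' j"
  using jspec_mult[OF J, of i l] jspec_mult[OF J', of j l'] jspec_sums(2)[OF J] jspec_sums(2)[OF J'] assms
  by auto
 then have "l i * inner (d i) (d' j) = l' j * inner (d i) (d' j)"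
  using assoc_inner[of x "d i" "d' j"] by simp
 then show ?thesis using ne by simp
qed

text \<open>Write either sum with the weights (d_i|d'_j); nonzero weights only connect equal
  eigenvalues. This makes spectral quantities independent of the \<open>SOME\<close>-choice.\<close>

lemma jspec_fun_sum:
 fixes f :: "real => real"
 assumes J: "jspec m u x k l d" and J': "jspec m u x k' l' d'"
 shows "(\<Sum>i<k. f (l i)) = (\<Sum>j<k'. f (l' j))"
 unfolding double_sum_left[OF J J', of "\<lambda>i. f (l i)"] double_sum_right[OF J J', of "\<lambda>i. f (l' i)"]
proof (intro sum.cong refl)
 fix i j assume "i \<in> {..<k}" "j \<in> {..<k'}"
 then show "inner (d i) (d' j) * f (l i) = inner (d i) (d' j) * f (l' j)"
  using jspec_eigen_eq[OF J J', of i j] by (cases "inner (d i) (d' j) = 0") auto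
qed

lemma jspec_pos:
 assumes J: "jspec m u x k l d" "\<forall>i<k. l i > 0" and J': "jspec m u x k' l' d'"
 shows "\<forall>j<k'. l' j > 0"
proof (intro allI impI)
 fix j assume j: "j < k'"
 have "\<exists>i<k. inner (d i) (d' j) \<noteq> 0"
 proof (rule ccontr)
  assume "\<not> ?thesis"
  then have "(\<Sum>i<k. inner (d i) (d' j)) = 0" by (intro sum.neutral) auto
  then show False using jspec_weights(3)[OF J(1) J' j] by simp
 qed
 then obtain i where i: "i < k" "inner (d i) (d' j) \<noteq> 0" by blast
 show "l' j > 0" using jspec_eigen_eq[OF J(1) J' i(1) j i(2)] J(2) i(1) by auto
qed

text \<open>Taking logarithms turns the product into a spectral sum, for which the choice of
  decomposition does not matter; this is why eigenvalues are assumed positive.\<close>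

lemma jdet_eq:
 assumes J: "jspec m u x k l d" and pos: "\<forall>i<k. l i > 0"
 shows "jdet_in m u x = (\<Prod>i<k. l i)"
proof -
 have "\<exists>k' l' d'. jspec m u x k' l' d' \<and> jdet_in m u x = (\<Prod>i<k'. l' i)"
  unfolding jdet_in_def by (rule someI_ex) (use J in blast)
 then obtain k' l' d' where J': "jspec m u x k' l' d'" and t: "jdet_in m u x = (\<Prod>i<k'. l' i)"
  by blast
 have pos': "\<forall>j<k'. l' j > 0" using jspec_pos[OF J pos J'] .
 have "ln (\<Prod>i<k. l i) = (\<Sum>i<k. ln (l i))"
  using pos by (intro ln_prod) auto
 also have "\<dots> = (\<Sum>i<k'. ln (l' i))" by (rule jspec_fun_sum[OF J J'])
 also have "\<dots> = ln (\<Prod>i<k'. l' i)"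
  using pos' by (intro ln_prod[symmetric]) auto
 finally show ?thesis
  unfolding t using pos pos' by (subst (asm) ln_inj_iff) (auto intro!: prod_pos)
qed

definition posspec :: "'a => 'a => bool" where
 "posspec u x \<longleftrightarrow> (\<exists>k l d. jspec m u x k l d \<and> (\<forall>i<k. l i > 0))"

lemma posspec_det_pos: "posspec u x ==> jdet_in m u x > 0"
 unfolding posspec_def using jdet_eq by (auto intro!: prod_pos)

lemma ln_jdet:
 "jspec m u x k l d ==> \<forall>i<k. l i > 0 ==> ln (jdet_in m u x) = (\<Sum>i<k. ln (l i))"
 unfolding jdet_eq by (intro ln_prod) auto

text \<open>Klein's inequality: the weights \<open>(d\<^sub>i|d'\<^sub>j)\<close> of two spectral decompositions are doubly
 stochastic, so concavity of \<open>ln\<close> passes to \<open>ln det\<close>.\<close>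

lemma ln_jdet_tangent:
 assumes J: "jspec m u x k l d" and pos: "\<forall>i<k. l i > 0" and z: "posspec u z"
 shows "ln (jdet_in m u z) - ln (jdet_in m u x) \<le> inner (\<Sum>i<k. (1 / l i) *\<^sub>R d i) (z - x)"
proof -
 obtain k' l' d' where J': "jspec m u z k' l' d'" and pos': "\<forall>i<k'. l' i > 0"
  using z by (auto simp: posspec_def)
 let ?p = "\<lambda>i j. inner (d i) (d' j)"
 have "ln (jdet_in m u z) - ln (jdet_in m u x) = (\<Sum>i<k. \<Sum>j<k'. ?p i j * (ln (l' j) - ln (l i)))"
  unfolding ln_jdet[OF J pos] ln_jdet[OF J' pos']
  by (subst double_sum_left[OF J J'], subst double_sum_right[OF J J'])
   (simp add: sum_subtractf[symmetric] right_diff_distrib)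
 also have "\<dots> \<le> (\<Sum>i<k. \<Sum>j<k'. ?p i j * ((l' j - l i) / l i))"
 proof (intro sum_mono mult_left_mono)
  fix i j assume "i \<in> {..<k}" "j \<in> {..<k'}"
  then show "ln (l' j) - ln (l i) \<le> (l' j - l i) / l i" and "?p i j \<ge> 0"
   using pos pos' jspec_weights(1)[OF J J'] ln_diff_le[of "l' j" "l i"] by auto
 qed
 also have "\<dots> = (\<Sum>i<k. inner z (d i) / l i - 1)"
 proof (intro sum.cong refl)
  fix i assume i: "i \<in> {..<k}"
  have "(\<Sum>j<k'. ?p i j * ((l' j - l i) / l i)) = (\<Sum>j<k'. l' j * ?p i j) / l i - (\<Sum>j<k'. ?p i j) * (l i / l i)"
   unfolding sum_divide_distrib sum_distrib_right sum_subtractf[symmetric]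
   by (intro sum.cong) (auto simp: diff_divide_distrib algebra_simps)
  also have "\<dots> = inner z (d i) / l i - 1"
   using pos i jspec_weights(2,4)[OF J J', of i] by auto
  finally show "(\<Sum>j<k'. ?p i j * ((l' j - l i) / l i)) = inner z (d i) / l i - 1" .
 qed
 also have "\<dots> = inner (\<Sum>i<k. (1 / l i) *\<^sub>R d i) z - (\<Sum>i<k. (1 / l i) * l i)"
  using pos unfolding sum_subtractf inner_sum_left
  by (intro arg_cong2[of _ _ _ _ "(-)"] sum.cong) (auto simp: inner_commute)
 also have "(\<Sum>i<k. (1 / l i) * l i) = inner (\<Sum>i<k. (1 / l i) *\<^sub>R d i) x"
  using jspec_inner_sum2[OF J, of "\<lambda>i. 1 / l i" l] jspec_sums(2)[OF J] by simp
 finally show ?thesis by (simp add: inner_diff_right)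
qed

text \<open>Hadamard's inequality: Jensen for ln with the weights (d_i|d'_j), whose averages of the
  eigenvalues of \<open>z\<close> are the diagonal entries (z|d_i). It bounds a determinant by data
  of an unrelated decomposition.\<close>

lemma jdet_hadamard:
 assumes J: "jspec m u x k l d" and z: "posspec u z"
 shows "jdet_in m u z \<le> (\<Prod>i<k. inner z (d i))" and "i < k ==> inner z (d i) > 0"
proof -
 obtain k' l' d' where J': "jspec m u z k' l' d'" and pos': "\<forall>i<k'. l' i > 0"
  using z by (auto simp: posspec_def)
 let ?p = "\<lambda>i j. inner (d i) (d' j)"
 have a: "inner z (d i) > 0" if i: "i < k" for i
 proof -
  have "inner z (d i) = (\<Sum>j<k'. l' j * ?p i j)" using jspec_weights(4)[OF J J' i] by simp
  also have "\<dots> > 0"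
  proof -
   have "\<exists>j<k'. ?p i j \<noteq> 0"
   proof (rule ccontr)
    assume "\<not> ?thesis"
    then have "(\<Sum>j<k'. ?p i j) = 0" by (intro sum.neutral) auto
    then show False using jspec_weights(2)[OF J J' i] by simp
   qed
   then obtain j where j: "j < k'" "?p i j \<noteq> 0" by blast
   show ?thesis
    using j pos' jspec_weights(1)[OF J J' i]
    by (intro sum_pos2[of _ j]) (auto intro!: mult_pos_pos mult_nonneg_nonneg simp: less_le)
  qed
  finally show ?thesis .
 qed
 show "i < k ==> inner z (d i) > 0" by (rule a)
 have "ln (jdet_in m u z) = (\<Sum>i<k. \<Sum>j<k'. ?p i j * ln (l' j))"
  unfolding ln_jdet[OF J' pos'] by (rule double_sum_right[OF J J'])
 also have "\<dots> \<le> (\<Sum>i<k. \<Sum>j<k'. ?p i j * (ln (inner z (d i)) + (l' j - inner z (d i)) / inner z (d i)))"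
 proof (intro sum_mono mult_left_mono)
  fix i j assume ij: "i \<in> {..<k}" "j \<in> {..<k'}"
  then show "?p i j \<ge> 0" using jspec_weights(1)[OF J J'] by auto
  show "ln (l' j) \<le> ln (inner z (d i)) + (l' j - inner z (d i)) / inner z (d i)"
   using ij pos' a ln_diff_le[of "l' j" "inner z (d i)"] by auto
 qed
 also have "\<dots> = (\<Sum>i<k. ln (inner z (d i)))"
 proof (intro sum.cong refl)
  fix i assume i: "i \<in> {..<k}"
  let ?a = "inner z (d i)"
  have "(\<Sum>j<k'. ?p i j * (ln ?a + (l' j - ?a) / ?a))
    = (\<Sum>j<k'. ?p i j) * ln ?a + (\<Sum>j<k'. l' j * ?p i j) / ?a - (\<Sum>j<k'. ?p i j) * (?a / ?a)"
   unfolding sum_divide_distrib sum_distrib_right sum_subtractf[symmetric] sum.distrib[symmetric]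
   by (intro sum.cong) (auto simp: diff_divide_distrib algebra_simps)
  also have "\<dots> = ln ?a"
   using a[of i] i jspec_weights(2,4)[OF J J', of i] by auto
  finally show "(\<Sum>j<k'. ?p i j * (ln ?a + (l' j - ?a) / ?a)) = ln ?a" .
 qed
 also have "\<dots> = ln (\<Prod>i<k. inner z (d i))"
  by (intro ln_prod[symmetric]) (auto dest: a)
 finally show "jdet_in m u z \<le> (\<Prod>i<k. inner z (d i))"
  using posspec_det_pos[OF z] a by (subst (asm) ln_le_cancel_iff) (auto intro!: prod_pos)
qed

subsection \<open>The symmetric cone\<close>

definition Q :: "'a set" where
 "Q = range (\<lambda>x. x \<odot> x)"

abbreviation \<Omega> :: "'a set" where
 "\<Omega> \<equiv> sym_cone m"

lemma idem_in_Q: "idem d ==> d \<in> Q"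
 unfolding Q_def idem_def by (rule image_eqI[of _ _ d]) auto

lemma Q_spec: "x \<in> Q ==> jspec m e x k l d ==> i < k ==> l i \<ge> 0"
proof -
 assume x: "x \<in> Q" and J: "jspec m e x k l d" and i: "i < k"
 obtain y where y: "x = y \<odot> y" using x by (auto simp: Q_def)
 have "l i = inner x (d i)" using jspec_eigen[OF J i] by simp
 also have "\<dots> = inner (d i \<odot> y) y"
  using assoc_inner'[of "d i" y y] assoc_inner'[of y y "d i"] unfolding y by (simp add: inner_commute comm[of y "d i"])
 also have "\<dots> \<ge> 0" using idem_psd[OF jspec_idem[OF J i]] .
 finally show ?thesis .
qed

lemma Q_I:
 assumes J: "jspec m e x k l d" and "\<forall>i<k. l i \<ge> 0"
 shows "x \<in> Q"
proof -
 have "(\<Sum>i<k. sqrt (l i) *\<^sub>R d i) \<odot> (\<Sum>i<k. sqrt (l i) *\<^sub>R d i) = x"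
  unfolding jspec_mult_sum[OF J] using assms(2)
  by (subst jspec_sums(2)[OF J]) (auto intro!: sum.cong)
 then show ?thesis unfolding Q_def
  by (intro image_eqI[of _ _ "\<Sum>i<k. sqrt (l i) *\<^sub>R d i"]) auto
qed

lemma ex_jspec_e: "\<exists>k l d. jspec m e x k l d"
 using ex_jspec[OF idem_e, of x] by simp

text \<open>Self-duality, reduced to idempotents: they are squares, so testing against them detects
  negative eigenvalues, and conversely (d|yy) = (dy|y) is nonnegative.\<close>

lemma Q_dual: "x \<in> Q \<longleftrightarrow> (\<forall>z\<in>Q. inner x z \<ge> 0)"
proof
 assume x: "x \<in> Q"
 obtain k l d where J: "jspec m e x k l d" using ex_jspec_e by blast
 show "\<forall>z\<in>Q. inner x z \<ge> 0"
 proof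
  fix z assume "z \<in> Q"
  then obtain y where y: "z = y \<odot> y" by (auto simp: Q_def)
  have "inner x z = (\<Sum>i<k. l i * inner (d i) z)"
   by (subst jspec_sums(2)[OF J]) (simp add: inner_sum_left)
  also have "\<dots> = (\<Sum>i<k. l i * inner (d i \<odot> y) y)"
   using assoc_inner' unfolding y by simp
  also have "\<dots> \<ge> 0"
   using Q_spec[OF x J] idem_psd jspec_idem[OF J] by (intro sum_nonneg mult_nonneg_nonneg) auto
  finally show "inner x z \<ge> 0" .
 qed
next
 assume *: "\<forall>z\<in>Q. inner x z \<ge> 0"
 obtain k l d where J: "jspec m e x k l d" using ex_jspec_e by blast
 show "x \<in> Q"
  using * jspec_eigen[OF J] idem_in_Q[OF jspec_idem[OF J]] by (intro Q_I[OF J]) force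
qed

lemma Q_add: "x \<in> Q ==> y \<in> Q ==> x + y \<in> Q"
 using Q_dual[of "x + y"] Q_dual[of x] Q_dual[of y] by (auto simp: inner_add_left)

lemma Q_scale: "x \<in> Q ==> a \<ge> 0 ==> a *\<^sub>R x \<in> Q"
 using Q_dual[of "a *\<^sub>R x"] Q_dual[of x] by auto

lemma closed_Q: "closed Q"
proof -
 have "Q = (\<Inter>z\<in>Q. {x. inner z x \<ge> 0})"
  by (rule set_eqI, subst Q_dual) (auto simp: inner_commute)
 also have "closed \<dots>"
  by (intro closed_INT ballI closed_halfspace_ge)
 finally show ?thesis .
qed

lemma e_in_Q: "e \<in> Q"
 using idem_in_Q[OF idem_e] .

text \<open>Triangle inequality in the spectral decomposition, whose idempotents have norm 1 and
  trace 1. It makes order intervals bounded and lets (e|x) serve as a norm on the cone.\<close>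

lemma Q_norm_le:
 assumes z: "z \<in> Q"
 shows "norm z \<le> inner e z"
proof -
 obtain k l d where J: "jspec m e z k l d" using ex_jspec_e by blast
 have l: "l i \<ge> 0" if "i < k" for i using Q_spec[OF z J that] .
 have "norm z = norm (\<Sum>i<k. l i *\<^sub>R d i)" using jspec_sums(2)[OF J] by simp
 also have "\<dots> \<le> (\<Sum>i<k. norm (l i *\<^sub>R d i))" by (rule norm_sum)
 also have "\<dots> = (\<Sum>i<k. l i * inner e (d i))"
  using l jspec_inner_dd[OF J] jspec_unit_inner[OF J] by (intro sum.cong) (auto simp: norm_eq_sqrt_inner)
 also have "\<dots> = inner e z"
  by (subst jspec_sums(2)[OF J]) (simp add: inner_sum_right)
 finally show ?thesis .
qed

text \<open>A quantitative form of interior: eps is a lower bound for the eigenvalues. A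
  perturbation of norm below eps is absorbed by duality, because |z| is at most (e|z) on the
  cone.\<close>

lemma in_\<Omega>_iff: "x \<in> \<Omega> \<longleftrightarrow> (\<exists>eps>0. x - eps *\<^sub>R e \<in> Q)"
proof
 assume "x \<in> \<Omega>"
 then obtain eps where eps: "eps > 0" "ball x eps \<subseteq> Q"
  by (auto simp: sym_cone_def Q_def mem_interior)
 define \<delta> where "\<delta> = eps / (2 * (norm e + 1))"
 have e1: "norm e + 1 > 0" by (simp add: add_nonneg_pos)
 have "\<delta> > 0" using eps e1 by (simp add: \<delta>_def)
 moreover have "\<delta> * (2 * (norm e + 1)) = eps" using e1 by (simp add: \<delta>_def)
 moreover have "\<delta> * norm e < \<delta> * (2 * (norm e + 1))"
  using \<open>\<delta> > 0\<close> e1 by (intro mult_strict_left_mono) (auto simp: algebra_simps)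
 ultimately have "\<delta> > 0" "\<delta> * norm e < eps" by auto
 then have "x - \<delta> *\<^sub>R e \<in> ball x eps" by (simp add: dist_norm)
 then show "\<exists>eps>0. x - eps *\<^sub>R e \<in> Q"
  using \<open>\<delta> > 0\<close> eps(2) by blast
next
 assume "\<exists>eps>0. x - eps *\<^sub>R e \<in> Q"
 then obtain eps where eps: "eps > 0" "x - eps *\<^sub>R e \<in> Q" by blast
 have "ball x eps \<subseteq> Q"
 proof
  fix y assume "y \<in> ball x eps"
  then have y: "norm (y - x) < eps" by (simp add: dist_norm norm_minus_commute)
  show "y \<in> Q"
  proof (subst Q_dual, intro ballI)
   fix z assume z: "z \<in> Q"
   have "inner y z = inner (x - eps *\<^sub>R e) z + eps * inner e z + inner (y - x) z"
    by (simp add: inner_simps)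
   moreover have "inner (x - eps *\<^sub>R e) z \<ge> 0" using eps z Q_dual by blast
   moreover have "eps * inner e z \<ge> eps * norm z" using eps Q_norm_le[OF z] by simp
   moreover have "\<bar>inner (y - x) z\<bar> \<le> eps * norm z"
    using Cauchy_Schwarz_ineq2[of "y - x" z] y by (meson less_imp_le mult_right_mono norm_ge_zero order_trans)
   ultimately show "inner y z \<ge> 0" by linarith
  qed
 qed
 then show "x \<in> \<Omega>" using eps by (auto simp: sym_cone_def Q_def mem_interior)
qed

lemma \<Omega>_sub_Q: "\<Omega> \<subseteq> Q"
 unfolding sym_cone_def Q_def by (rule interior_subset)

lemma open_\<Omega>: "open \<Omega>"
 by (simp add: sym_cone_def)

lemma \<Omega>_add_Q:
 assumes "x \<in> \<Omega>" "y \<in> Q"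
 shows "x + y \<in> \<Omega>"
proof -
 obtain eps where eps: "eps > 0" "x - eps *\<^sub>R e \<in> Q" using assms by (auto simp: in_\<Omega>_iff)
 then have "(x - eps *\<^sub>R e) + y \<in> Q" using Q_add assms by blast
 then show ?thesis using eps unfolding in_\<Omega>_iff by (auto simp: algebra_simps intro!: exI[of _ eps])
qed

lemma \<Omega>_scale:
 assumes "x \<in> \<Omega>" "a > 0"
 shows "a *\<^sub>R x \<in> \<Omega>"
proof -
 obtain eps where eps: "eps > 0" "x - eps *\<^sub>R e \<in> Q" using assms by (auto simp: in_\<Omega>_iff)
 then have "a *\<^sub>R (x - eps *\<^sub>R e) \<in> Q" using Q_scale[of "x - eps *\<^sub>R e" a] assms by simp
 then show ?thesis using eps assms unfolding in_\<Omega>_iff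
  by (auto simp: scaleR_diff_right intro!: exI[of _ "a * eps"])
qed

lemma e_in_\<Omega>: "e \<in> \<Omega>"
 unfolding in_\<Omega>_iff by (intro exI[of _ "1/2"]) (auto simp: Q_scale e_in_Q scaleR_left_diff_distrib[of 1 "1/2" e, simplified, symmetric])

lemma convex_\<Omega>: "convex \<Omega>"
proof (rule convexI)
 fix x y and a b :: real
 assume "x \<in> \<Omega>" "y \<in> \<Omega>" "0 \<le> a" "0 \<le> b" "a + b = 1"
 then show "a *\<^sub>R x + b *\<^sub>R y \<in> \<Omega>"
  using \<Omega>_scale \<Omega>_add_Q \<Omega>_sub_Q Q_scale
  by (cases "a = 0") (auto simp: less_le)
qed

lemma closure_\<Omega>: "closure \<Omega> = Q"
proof
 show "closure \<Omega> \<subseteq> Q" using \<Omega>_sub_Q closed_Q by (simp add: closure_minimal)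
 show "Q \<subseteq> closure \<Omega>"
 proof
  fix x assume x: "x \<in> Q"
  have "(\<lambda>n. x + inverse (real (Suc n)) *\<^sub>R e) \<longlonglongrightarrow> x + 0 *\<^sub>R e"
   by (intro tendsto_intros LIMSEQ_inverse_real_of_nat)
  moreover have "x + inverse (real (Suc n)) *\<^sub>R e \<in> \<Omega>" for n
   using \<Omega>_add_Q[OF \<Omega>_scale[OF e_in_\<Omega>] x] by (simp add: add.commute)
  ultimately show "x \<in> closure \<Omega>"
   unfolding closure_sequential by (intro exI[of _ "\<lambda>n. x + inverse (real (Suc n)) *\<^sub>R e"]) auto
 qed
qed

lemma \<Omega>_inner_pos:
 assumes "x \<in> \<Omega>" "z \<in> Q" "z \<noteq> 0"
 shows "inner x z > 0"
proof -
 obtain eps where eps: "eps > 0" "x - eps *\<^sub>R e \<in> Q" using assms by (auto simp: in_\<Omega>_iff)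
 then have "inner (x - eps *\<^sub>R e) z \<ge> 0" using Q_dual assms by blast
 moreover have "eps * inner e z > 0"
  using eps Q_norm_le[OF assms(2)] assms(3) zero_less_norm_iff[of z] by (intro mult_pos_pos) linarith+
 ultimately show ?thesis by (simp add: inner_simps)
qed

lemma Q_iff_\<Omega>_dual: "x \<in> Q \<longleftrightarrow> (\<forall>y\<in>\<Omega>. inner y x \<ge> 0)"
proof
 assume "x \<in> Q" then show "\<forall>y\<in>\<Omega>. inner y x \<ge> 0"
  using Q_dual \<Omega>_sub_Q by blast
next
 assume *: "\<forall>y\<in>\<Omega>. inner y x \<ge> 0"
 show "x \<in> Q"
 proof (subst Q_dual, intro ballI)
  fix z assume "z \<in> Q"
  then have "z \<in> closure \<Omega>" using closure_\<Omega> by simp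
  moreover have "closure \<Omega> \<subseteq> {y. inner x y \<ge> 0}"
   using * by (intro closure_minimal closed_halfspace_ge) (auto simp: inner_commute)
  ultimately show "inner x z \<ge> 0" by auto
 qed
qed

subsection \<open>Compression to Peirce spaces\<close>

lemma linear_pE1: "linear (pE1 u)"
 by (intro linearI) (simp_all add: pE1_def lin_simps algebra_simps)

lemma pE1_in: "idem u ==> u \<odot> pE1 u x = pE1 u x"
 by (rule peirce_eigen)

lemma inner_pE1:
 assumes u: "idem u" and w: "u \<odot> w = w"
 shows "inner w (pE1 u x) = inner w x"
proof -
 have "inner w (pEh u x) = 0" "inner w (pE0 u x) = 0"
  using eigen_orth[of u w 1 "pEh u x" "1/2"] eigen_orth[of u w 1 "pE0 u x" 0] w peirce_eigen[OF u] by auto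
 moreover have "inner w x = inner w (pE1 u x + pEh u x + pE0 u x)" by (simp only: peirce_sum)
 ultimately show ?thesis by (simp add: inner_add_right)
qed

text \<open>The Peirce spaces are eigenspaces of a symmetric operator, so the algebraic projection
  \<open>pE1\<close> is the orthogonal one by which \<open>minor\<close> is defined.\<close>

lemma orth_proj_eq:
 assumes u: "idem u"
 shows "orth_proj {y. u \<odot> y = y} x = pE1 u x"
 unfolding orth_proj_def
proof (rule the_equality)
 show "pE1 u x \<in> {y. u \<odot> y = y} \<and> (\<forall>w\<in>{y. u \<odot> y = y}. inner (x - pE1 u x) w = 0)"
  using pE1_in[OF u] inner_pE1[OF u, of _ x] by (auto simp: inner_diff_left inner_commute[of x] inner_commute[of "pE1 u x"])
 fix y assume y: "y \<in> {y. u \<odot> y = y} \<and> (\<forall>w\<in>{y. u \<odot> y = y}. inner (x - y) w = 0)"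
 have w: "u \<odot> (pE1 u x - y) = pE1 u x - y" using y pE1_in[OF u] by (simp add: diff_r)
 then have "inner (x - y) (pE1 u x - y) = 0" using y by blast
 moreover have "inner (pE1 u x - y) (pE1 u x) = inner (pE1 u x - y) x" using inner_pE1[OF u w] .
 ultimately have "inner (pE1 u x - y) (pE1 u x - y) = 0"
  by (simp add: inner_simps inner_commute)
 then show "y = pE1 u x" by simp
qed

text \<open>Eigenvalues of the compression are the pairings of \<open>x\<close> itself with
  idempotents of norm 1, hence inherit the lower bound from x - eps e.\<close>

lemma compress_spec:
 assumes x: "x - eps *\<^sub>R e \<in> Q" and J: "jspec m u (pE1 u x) k l d" and i: "i < k"
 shows "l i \<ge> eps"
proof -
 have u: "idem u" using jspec_idem_u[OF J] .
 have "l i = inner (d i) x"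
  using jspec_eigen[OF J i] inner_pE1[OF u jspec_V1[OF J i]] by (simp add: inner_commute)
 moreover have "inner (x - eps *\<^sub>R e) (d i) \<ge> 0"
  using x Q_dual idem_in_Q[OF jspec_idem[OF J i]] by blast
 moreover have "inner e (d i) = 1"
  using inner_e_idem[OF jspec_idem[OF J i]] jspec_inner_dd[OF J i i] by simp
 ultimately show ?thesis by (simp add: inner_simps inner_commute)
qed

lemma compress_ex_spec:
 assumes "idem u"
 shows "\<exists>k l d. jspec m u (pE1 u x) k l d"
 using ex_jspec[OF assms pE1_in[OF assms]] .

lemma compress_pos:
 assumes x: "x \<in> \<Omega>" and u: "idem u"
 shows "posspec u (pE1 u x)"
proof -
 obtain eps where eps: "eps > 0" "x - eps *\<^sub>R e \<in> Q" using x by (auto simp: in_\<Omega>_iff)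
 obtain k l d where J: "jspec m u (pE1 u x) k l d" using compress_ex_spec[OF u] by blast
 then show ?thesis unfolding posspec_def using compress_spec[OF eps(2) J] eps(1) by force
qed

lemma pE1_e: "pE1 e x = x"
 by (simp add: pE1_def scaleR_2)

lemma posspec_e_iff: "posspec e x \<longleftrightarrow> x \<in> \<Omega>"
proof
 assume "x \<in> \<Omega>" then show "posspec e x" using compress_pos[OF _ idem_e] by (simp add: pE1_e)
next
 assume "posspec e x"
 then obtain k l d where J: "jspec m e x k l d" and pos: "\<forall>i<k. l i > 0" by (auto simp: posspec_def)
 define eps where "eps = Min (insert 1 (l ` {..<k}))"
 have eps: "eps > 0" "\<And>i. i < k ==> eps \<le> l i" unfolding eps_def using pos by auto
 have "jspec m e (x - eps *\<^sub>R e) k (\<lambda>i. l i - eps) d"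
  using J by (auto simp: jspec_def scaleR_left_diff_distrib sum_subtractf scaleR_sum_right[symmetric])
 then have "x - eps *\<^sub>R e \<in> Q" using eps by (intro Q_I) auto
 then show "x \<in> \<Omega>" using eps(1) in_\<Omega>_iff by blast
qed

end

section \<open>Log-determinants along linear flows\<close>

context euclidean_jordan
begin

lemma Q_ball:
 assumes x: "x - eps *\<^sub>R e \<in> Q" and y: "norm (y - x) \<le> eps" and "eps \<ge> 0"
 shows "y \<in> Q"
proof (subst Q_dual, intro ballI)
 fix z assume z: "z \<in> Q"
 have "inner y z = inner (x - eps *\<^sub>R e) z + eps * inner e z + inner (y - x) z"
  by (simp add: inner_simps)
 moreover have "inner (x - eps *\<^sub>R e) z \<ge> 0" using x z Q_dual by blast
 moreover have "eps * inner e z \<ge> eps * norm z" using assms Q_norm_le[OF z] by (intro mult_left_mono) auto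
 moreover have "\<bar>inner (y - x) z\<bar> \<le> eps * norm z"
  using Cauchy_Schwarz_ineq2[of "y - x" z] y by (meson mult_right_mono norm_ge_zero order_trans)
 ultimately show "inner y z \<ge> 0" by linarith
qed

definition ldu :: "'a => 'a => real" where
 "ldu u x = ln (jdet_in m u (pE1 u x))"

text \<open>\<open>y\<close> is the inverse of the compressed element inside \<open>V1 u\<close>. It
  is also a supergradient of \<open>ldu u\<close> at \<open>x\<close>, which is its use
  here.\<close>

definition is_inv :: "'a => 'a => 'a => bool" where
 "is_inv u x y \<longleftrightarrow> (\<exists>k l d. jspec m u (pE1 u x) k l d \<and> (\<forall>i<k. l i > 0) \<and> y = (\<Sum>i<k. (1 / l i) *\<^sub>R d i))"

lemma ex_is_inv:
 assumes "x \<in> \<Omega>" "idem u"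
 obtains y where "is_inv u x y"
 using compress_pos[OF assms] unfolding posspec_def is_inv_def by blast

lemma is_inv_V1:
 assumes "is_inv u x y"
 shows "u \<odot> y = y"
proof -
 obtain k l d where J: "jspec m u (pE1 u x) k l d" and y: "y = (\<Sum>i<k. (1 / l i) *\<^sub>R d i)"
  using assms by (auto simp: is_inv_def)
 have "u \<odot> y = (\<Sum>i<k. (1 / l i) *\<^sub>R (u \<odot> d i))" by (simp add: y sum_r scale_r)
 also have "\<dots> = y" unfolding y using jspec_V1[OF J] by (intro sum.cong) auto
 finally show ?thesis .
qed

lemma is_inv_mult:
 assumes "is_inv u x y"
 shows "y \<odot> pE1 u x = u"
proof -
 obtain k l d where J: "jspec m u (pE1 u x) k l d" and l: "\<forall>i<k. l i > 0" and y: "y = (\<Sum>i<k. (1 / l i) *\<^sub>R d i)"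
  using assms by (auto simp: is_inv_def)
 have "y \<odot> pE1 u x = (\<Sum>i<k. (1 / l i) *\<^sub>R d i) \<odot> (\<Sum>i<k. l i *\<^sub>R d i)"
  using jspec_sums(2)[OF J] y by simp
 also have "\<dots> = (\<Sum>i<k. d i)"
  unfolding jspec_mult_sum[OF J] using l by (intro sum.cong) auto
 finally show ?thesis using jspec_sums(1)[OF J] by simp
qed

text \<open>Both elements are combinations of the same orthogonal idempotents, whose multiplication
  operators commute by \<open>peirce_commute\<close>.\<close>

lemma is_inv_commute:
 assumes "is_inv u x y"
 shows "y \<odot> (pE1 u x \<odot> v) = pE1 u x \<odot> (y \<odot> v)"
proof -
 obtain k l d where J: "jspec m u (pE1 u x) k l d" and y: "y = (\<Sum>i<k. (1 / l i) *\<^sub>R d i)"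
  using assms by (auto simp: is_inv_def)
 have dc: "d i \<odot> (d j \<odot> v) = d j \<odot> (d i \<odot> v)" if "i < k" "j < k" for i j
  using peirce_commute[OF jspec_idem[OF J that(1)], of "d j" v] jspec_dd[OF J that] by (cases "i = j") auto
 have "(\<Sum>i<k. a i *\<^sub>R d i) \<odot> ((\<Sum>j<k. b j *\<^sub>R d j) \<odot> v) = (\<Sum>j<k. b j *\<^sub>R d j) \<odot> ((\<Sum>i<k. a i *\<^sub>R d i) \<odot> v)" for a b
 proof -
  have "(\<Sum>i<k. a i *\<^sub>R d i) \<odot> ((\<Sum>j<k. b j *\<^sub>R d j) \<odot> v) = (\<Sum>i<k. \<Sum>j<k. (a i * b j) *\<^sub>R (d i \<odot> (d j \<odot> v)))"
   by (subst sum.swap) (simp add: sum_l sum_r scale_l scale_r scaleR_sum_right mult.commute)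
  also have "\<dots> = (\<Sum>i<k. \<Sum>j<k. (a i * b j) *\<^sub>R (d j \<odot> (d i \<odot> v)))"
   by (intro sum.cong refl) (auto simp: dc)
  also have "\<dots> = (\<Sum>j<k. b j *\<^sub>R d j) \<odot> ((\<Sum>i<k. a i *\<^sub>R d i) \<odot> v)"
   by (simp add: sum_l sum_r scale_l scale_r scaleR_sum_right mult.commute)
  finally show ?thesis .
 qed
 from this[of "\<lambda>i. 1 / l i" l] show ?thesis using y jspec_sums(2)[OF J] by simp
qed

lemma is_inv_norm:
 assumes x: "x - eps *\<^sub>R e \<in> Q" "eps > 0" and y: "is_inv u x y"
 shows "norm y \<le> inner u u / eps"
proof -
 obtain k l d where J: "jspec m u (pE1 u x) k l d" and y: "y = (\<Sum>i<k. (1 / l i) *\<^sub>R d i)"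
  using y by (auto simp: is_inv_def)
 have l: "l i \<ge> eps" if "i < k" for i using compress_spec[OF x(1) J that] .
 have "norm y \<le> (\<Sum>i<k. norm ((1 / l i) *\<^sub>R d i))" unfolding y by (rule norm_sum)
 also have "\<dots> \<le> (\<Sum>i<k. 1 / eps)"
 proof (rule sum_mono)
  fix i assume i: "i \<in> {..<k}"
  have "norm (d i) = 1" using i jspec_inner_dd[OF J, of i i] by (simp add: norm_eq_sqrt_inner)
  then show "norm ((1 / l i) *\<^sub>R d i) \<le> 1 / eps"
   using l[of i] i x(2) by (simp add: frac_le)
 qed
 also have "(\<Sum>i<k. 1 / eps) = inner u u / eps"
  using jspec_inner_sum2[OF J, of "\<lambda>_. 1" "\<lambda>_. 1"] jspec_sums(1)[OF J] by simp
 finally show ?thesis .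
qed

lemma ldu_tangent:
 assumes z: "z \<in> \<Omega>" and y: "is_inv u x y"
 shows "ldu u z - ldu u x \<le> inner y (z - x)"
proof -
 obtain k l d where J: "jspec m u (pE1 u x) k l d" and l: "\<forall>i<k. l i > 0" and yy: "y = (\<Sum>i<k. (1 / l i) *\<^sub>R d i)"
  using y by (auto simp: is_inv_def)
 have u: "idem u" using jspec_idem_u[OF J] .
 have "ldu u z - ldu u x \<le> inner y (pE1 u z - pE1 u x)"
  unfolding ldu_def yy by (rule ln_jdet_tangent[OF J l compress_pos[OF z u]])
 also have "\<dots> = inner y (z - x)"
  using inner_pE1[OF u is_inv_V1[OF y]] by (simp add: inner_diff_right)
 finally show ?thesis .
qed

text \<open>The derivative of \<open>ldu u\<close> along the vector field \<open>X\<close>,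
  expressed by the supergradient and required to be the same constant on the whole cone.\<close>

definition rate :: "('a => 'a) => 'a => real => bool" where
 "rate X u \<rho> \<longleftrightarrow> (\<forall>w\<in>\<Omega>. \<forall>y. is_inv u w y \<longrightarrow> inner y (X w) = \<rho>)"

text \<open>The supergradient inequality at the old point bounds the increment from above, at the
  new point from below. Supergradients are uniformly bounded nearby and pair with the velocity to
  the same constant, so the two bounds agree to first order; no differentiability of the determinant
  is presupposed.\<close>

lemma flow_deriv:
 assumes X: "linear X" and u: "idem u" and r: "rate X u \<rho>"
  and dx: "(x has_vector_derivative X (x t)) (at t)" and xt: "x t \<in> \<Omega>"
 shows "((\<lambda>t. ldu u (x t)) has_real_derivative \<rho>) (at t)"
proof -
 obtain eps where eps: "eps > 0" "x t - eps *\<^sub>R e \<in> Q" using xt by (auto simp: in_\<Omega>_iff)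
 obtain B where B: "B > 0" "\<And>v. norm (X v) \<le> B * norm v"
  using X linear_bounded_pos by blast
 define K where "K = inner u u / (eps/2)"
 define R where "R h = x (t + h) - x t - h *\<^sub>R X (x t)" for h
 have K0: "K \<ge> 0" using eps by (simp add: K_def)
 have cont: "((\<lambda>h. x (t + h)) \<longlongrightarrow> x t) (at 0)"
  using has_vector_derivative_continuous[OF dx] by (simp add: isCont_iff)
 have R0: "((\<lambda>h. norm (R h) / norm h) \<longlongrightarrow> 0) (at 0)"
  using dx unfolding has_vector_derivative_def has_derivative_at R_def by simp
 have near: "eventually (\<lambda>h. norm (x (t + h) - x t) < eps/2) (at 0)"
  using tendstoD[OF cont, of "eps/2"] eps by (simp add: dist_norm)
 have bnd: "\<bar>(ldu u (x (t + h)) - ldu u (x t)) / h - \<rho>\<bar> \<le> K * (norm (R h) / norm h + B * norm (x (t + h) - x t))"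
  if h: "norm (x (t + h) - x t) < eps/2" "h \<noteq> 0" for h
 proof -
  have "x t - (eps/2) *\<^sub>R e - (eps/2) *\<^sub>R e \<in> Q"
   using eps by (simp add: diff_diff_eq scaleR_add_left[symmetric])
  then have xh: "x (t + h) - (eps/2) *\<^sub>R e \<in> Q" "x t - (eps/2) *\<^sub>R e \<in> Q"
   using Q_ball[of "x t - (eps/2) *\<^sub>R e" "eps/2"] h eps by auto
  then have xh\<Omega>: "x (t + h) \<in> \<Omega>" using eps by (auto simp: in_\<Omega>_iff intro!: exI[of _ "eps/2"])
  obtain y0 where y0: "is_inv u (x t) y0" using ex_is_inv[OF xt u] .
  obtain yh where yh: "is_inv u (x (t + h)) yh" using ex_is_inv[OF xh\<Omega> u] .
  have n0: "norm y0 \<le> K" and nh: "norm yh \<le> K"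
   using is_inv_norm[OF xh(2) _ y0] is_inv_norm[OF xh(1) _ yh] eps by (auto simp: K_def)
  have r0: "inner y0 (X (x t)) = \<rho>" and rh: "inner yh (X (x (t + h))) = \<rho>"
   using r y0 yh xt xh\<Omega> by (auto simp: rate_def)
  let ?E = "K * (norm (R h) + \<bar>h\<bar> * (B * norm (x (t + h) - x t)))"
  have CS: "\<bar>inner a b\<bar> \<le> K * norm b" if "norm a \<le> K" for a b :: 'a
   using Cauchy_Schwarz_ineq2[of a b] that by (meson mult_right_mono norm_ge_zero order_trans)
  have "ldu u (x (t + h)) - ldu u (x t) \<le> inner y0 (x (t + h) - x t)"
   by (rule ldu_tangent[OF xh\<Omega> y0])
  also have "\<dots> = h * \<rho> + inner y0 (R h)" by (simp add: R_def inner_simps r0)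
  also have "\<dots> \<le> h * \<rho> + K * norm (R h)" using CS[OF n0, of "R h"] by simp
  also have "\<dots> \<le> h * \<rho> + ?E" using K0 B by (simp add: distrib_left)
  finally have up: "ldu u (x (t + h)) - ldu u (x t) - h * \<rho> \<le> ?E" by simp
  have "ldu u (x t) - ldu u (x (t + h)) \<le> inner yh (x t - x (t + h))"
   by (rule ldu_tangent[OF xt yh])
  also have "x t - x (t + h) = - (h *\<^sub>R X (x (t + h))) + (h *\<^sub>R X (x (t + h) - x t) - R h)"
   by (simp add: R_def linear_diff[OF X] algebra_simps)
  also have "inner yh \<dots> = - h * \<rho> + inner yh (h *\<^sub>R X (x (t + h) - x t) - R h)"
   by (simp only: inner_add_right inner_minus_right inner_scaleR_right rh mult_minus_left)
  also have "\<dots> \<le> - h * \<rho> + K * norm (h *\<^sub>R X (x (t + h) - x t) - R h)"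
   using CS[OF nh, of "h *\<^sub>R X (x (t + h) - x t) - R h"] by simp
  also have "\<dots> \<le> - h * \<rho> + ?E"
  proof -
   have "norm (h *\<^sub>R X (x (t + h) - x t) - R h) \<le> \<bar>h\<bar> * norm (X (x (t + h) - x t)) + norm (R h)"
    using norm_triangle_ineq4[of "h *\<^sub>R X (x (t + h) - x t)" "R h"] by simp
   also have "\<dots> \<le> \<bar>h\<bar> * (B * norm (x (t + h) - x t)) + norm (R h)"
    using B(2) by (intro add_mono mult_left_mono) auto
   finally show ?thesis using K0 by (simp add: mult_left_mono add.commute)
  qed
  finally have lo: "- (ldu u (x (t + h)) - ldu u (x t) - h * \<rho>) \<le> ?E" by simp
  have "\<bar>(ldu u (x (t + h)) - ldu u (x t)) / h - \<rho>\<bar> = \<bar>ldu u (x (t + h)) - ldu u (x t) - h * \<rho>\<bar> / \<bar>h\<bar>"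
   using h(2) by (simp add: field_simps flip: abs_divide)
  also have "\<dots> \<le> ?E / \<bar>h\<bar>" using up lo by (intro divide_right_mono) auto
  also have "\<dots> = K * (norm (R h) / norm h + B * norm (x (t + h) - x t))"
   using h(2) by (simp add: field_simps)
  finally show ?thesis .
 qed
 have lim0: "((\<lambda>h. K * (norm (R h) / norm h + B * norm (x (t + h) - x t))) \<longlongrightarrow> K * (0 + B * norm (x t - x t))) (at 0)"
  by (intro tendsto_intros R0 cont)
 have "((\<lambda>h. (ldu u (x (t + h)) - ldu u (x t)) / h - \<rho>) \<longlongrightarrow> 0) (at 0)"
 proof (rule Lim_null_comparison)
  show "eventually (\<lambda>h. norm ((ldu u (x (t + h)) - ldu u (x t)) / h - \<rho>) \<le> K * (norm (R h) / norm h + B * norm (x (t + h) - x t))) (at 0)"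
   using near eventually_neq_at_within[of 0 0 UNIV] by eventually_elim (unfold real_norm_def, rule bnd[unfolded real_norm_def])
  show "((\<lambda>h. K * (norm (R h) / norm h + B * norm (x (t + h) - x t))) \<longlongrightarrow> 0) (at 0)"
   using lim0 by simp
 qed
 then show ?thesis unfolding DERIV_def using Lim_null by blast
qed

text \<open>Up to the first exit time the log-determinant is affine in t, so the determinant stays
  away from 0. The exit point lies in the closed cone but has an eigenvalue 0, which is incompatible
  with this.\<close>

lemma flow_stays_pos:
 assumes X: "linear X" and r: "rate X e \<rho>"
  and dx: "\<And>t. (x has_vector_derivative X (x t)) (at t)" and x0: "x 0 \<in> \<Omega>" and T: "T \<ge> 0"
 shows "x T \<in> \<Omega>"
proof (rule ccontr)
 assume nT: "x T \<notin> \<Omega>"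
 have cx: "continuous_on S x" for S
  using dx by (meson continuous_at_imp_continuous_on has_vector_derivative_continuous)
 have icx: "isCont x t" for t
  using dx by (rule has_vector_derivative_continuous)
 define S where "S = {t\<in>{0..T}. x t \<notin> \<Omega>}"
 have "S = {0..T} \<inter> x -` (- \<Omega>)" by (auto simp: S_def)
 then have "compact S"
  using icx open_\<Omega> by (auto intro!: compact_Int_closed continuous_closed_vimage)
 moreover have "S \<noteq> {}" using nT T by (auto simp: S_def)
 ultimately have "\<exists>s\<in>S. \<forall>t\<in>S. s \<le> t"
  by (rule compact_attains_inf)
 then obtain s where s: "s \<in> S" "\<And>t. t \<in> S ==> s \<le> t"
  by blast
 have s0: "s > 0" using s x0 by (auto simp: S_def less_le)
 have in\<Omega>: "x t \<in> \<Omega>" if "0 \<le> t" "t < s" for t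
  using that s by (force simp: S_def)
 have F: "ldu e (x t) = ldu e (x 0) + \<rho> * t" if t: "0 \<le> t" "t < s" for t
 proof (cases "t = 0")
  case False
  then have t0: "t > 0" using t by simp
  have d: "((\<lambda>t. ldu e (x t) - \<rho> * t) has_real_derivative 0) (at v)" if "0 \<le> v" "v \<le> t" for v
   using flow_deriv[OF X idem_e r dx in\<Omega>[of v]] that t by (auto intro!: derivative_eq_intros)
  have "ldu e (x t) - \<rho> * t = ldu e (x 0) - \<rho> * 0"
   by (rule DERIV_isconst_end[OF t0]) (auto intro!: continuous_at_imp_continuous_on DERIV_isCont d)
  then show ?thesis by simp
 qed simp
 have lim: "(x \<longlongrightarrow> x s) (at_left s)"
  using icx[of s] unfolding isCont_def by (rule tendsto_within_subset) simp
 have ev: "eventually (\<lambda>t. 0 < t \<and> t < s) (at_left s)"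
  using eventually_at_left_real[OF s0] by eventually_elim auto
 have "x s \<in> Q"
  using ev in\<Omega> \<Omega>_sub_Q
  by (intro Lim_in_closed_set[OF closed_Q _ _ lim]) (auto elim!: eventually_mono)
 obtain k l d where J: "jspec m e (x s) k l d" using ex_jspec_e by blast
 have "\<not> posspec e (x s)" using s by (auto simp: posspec_e_iff S_def)
 then obtain i where i: "i < k" "l i \<le> 0" using J unfolding posspec_def by force
 then have li: "l i = 0" using Q_spec[OF \<open>x s \<in> Q\<close> J i(1)] by simp
 \<comment> \<open>Hadamard's inequality is used in the fixed decomposition of the exit point, not
   of \<open>x t\<close>, so that one factor on the right tends to 0.\<close>
 have le: "exp (ldu e (x 0) + \<rho> * t) \<le> (\<Prod>j<k. inner (x t) (d j))" if "0 < t" "t < s" for t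
 proof -
  have p: "posspec e (x t)" using in\<Omega>[of t] that by (simp add: posspec_e_iff)
  have "exp (ldu e (x 0) + \<rho> * t) = jdet_in m e (x t)"
   using F[of t, symmetric] that posspec_det_pos[OF p] by (simp add: ldu_def[of e "x t"] pE1_e)
  then show ?thesis using jdet_hadamard(1)[OF J p] by simp
 qed
 have "exp (ldu e (x 0) + \<rho> * s) \<le> (\<Prod>j<k. inner (x s) (d j))"
 proof (rule tendsto_le)
  show "((\<lambda>t. \<Prod>j<k. inner (x t) (d j)) \<longlongrightarrow> (\<Prod>j<k. inner (x s) (d j))) (at_left s)"
   by (intro tendsto_intros lim)
  show "((\<lambda>t. exp (ldu e (x 0) + \<rho> * t)) \<longlongrightarrow> exp (ldu e (x 0) + \<rho> * s)) (at_left s)"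
   by (intro tendsto_intros)
  show "eventually (\<lambda>t. exp (ldu e (x 0) + \<rho> * t) \<le> (\<Prod>j<k. inner (x t) (d j))) (at_left s)"
   using ev by eventually_elim (use le in auto)
 qed simp
 moreover have "(\<Prod>j<k. inner (x s) (d j)) = 0"
  using i li jspec_eigen[OF J] by (intro prod_zero) auto
 ultimately show False by simp
qed

lemma flow_stays:
 assumes X: "linear X" and r: "rate X e \<rho>"
  and dx: "\<And>t. (x has_vector_derivative X (x t)) (at t)" and x0: "x 0 \<in> \<Omega>"
 shows "x T \<in> \<Omega>"
proof (cases "T \<ge> 0")
 case False
 have "((\<lambda>t. x (- t)) has_vector_derivative - X (x (- t))) (at t)" for t
  using vector_diff_chain_at[OF has_vector_derivative_minus[OF has_vector_derivative_id] dx]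
  by (simp add: o_def)
 moreover have "linear (\<lambda>v. - X v)" by (rule linear_compose_neg[OF X])
 moreover have "rate (\<lambda>v. - X v) e (- \<rho>)" using r by (simp add: rate_def)
 ultimately show ?thesis
  using flow_stays_pos[of "\<lambda>v. - X v" "- \<rho>" "\<lambda>t. x (- t)" "- T"] x0 False by simp
qed (use assms flow_stays_pos in blast)

lemma flow_det:
 assumes X: "linear X" and r: "rate X e \<rho>" and u: "idem u" and ru: "rate X u \<rho>'"
  and dx: "\<And>t. (x has_vector_derivative X (x t)) (at t)" and x0: "x 0 \<in> \<Omega>"
 shows "jdet_in m u (pE1 u (x t)) = exp (\<rho>' * t) * jdet_in m u (pE1 u (x 0))"
proof -
 have in\<Omega>: "x t \<in> \<Omega>" for t using flow_stays[OF X r dx x0] .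
 have "((\<lambda>t. ldu u (x t) - \<rho>' * t) has_real_derivative 0) (at v)" for v
  using flow_deriv[OF X u ru dx in\<Omega>[of v]] by (auto intro!: derivative_eq_intros)
 then have "ldu u (x t) - \<rho>' * t = ldu u (x 0) - \<rho>' * 0"
  using DERIV_isconst_all[of "\<lambda>t. ldu u (x t) - \<rho>' * t"] by blast
 then have "ldu u (x t) = \<rho>' * t + ldu u (x 0)" by simp
 moreover have "jdet_in m u (pE1 u (x t)) = exp (ldu u (x t))" for t
  using posspec_det_pos[OF compress_pos[OF in\<Omega> u]] by (simp add: ldu_def)
 ultimately show ?thesis by (simp add: exp_add)
qed

subsection \<open>Diagonal and unipotent transformations\<close>

text \<open>The exponential of t L(c), written out on the eigenspaces of L(c).\<close>

definition Dg :: "'a => real => 'a => 'a" where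
 "Dg c t x = exp t *\<^sub>R pE1 c x + exp (t/2) *\<^sub>R pEh c x + pE0 c x"

text \<open>For \<open>z\<close> in the half space of \<open>c\<close> this is 2 (c box z), where x
  box y = L(xy) + [L(x), L(y)]. It moves the 0-space to the half space, the half space to the
  1-space, and kills the latter. \<open>Nlp'\<close> is its transpose 2 (z box c), which moves in
  the opposite direction.\<close>

definition Nlp :: "'a => 'a => 'a => 'a" where
 "Nlp c z x = z \<odot> x - 2 *\<^sub>R (z \<odot> (c \<odot> x)) + 2 *\<^sub>R (c \<odot> (z \<odot> x))"

definition Nlp' :: "'a => 'a => 'a => 'a" where
 "Nlp' c z x = z \<odot> x + 2 *\<^sub>R (z \<odot> (c \<odot> x)) - 2 *\<^sub>R (c \<odot> (z \<odot> x))"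

text \<open>The exponential of the nilpotent \<open>Nlp c z\<close>, whose series stops after the
  square (\<open>Nlp_cube\<close>): a Frobenius transformation, the unipotent counterpart of
  \<open>Dg\<close>.\<close>

definition Tu :: "'a => 'a => 'a => 'a" where
 "Tu c z x = x + Nlp c z x + (1/2) *\<^sub>R Nlp c z (Nlp c z x)"

definition Tu' :: "'a => 'a => 'a => 'a" where
 "Tu' c z x = x + Nlp' c z x + (1/2) *\<^sub>R Nlp' c z (Nlp' c z x)"

lemma peirce_proj:
 assumes "c \<odot> x = a *\<^sub>R x"
 shows "pE1 c x = (2*a\<^sup>2 - a) *\<^sub>R x" "pEh c x = (4*a - 4*a\<^sup>2) *\<^sub>R x" "pE0 c x = (1 - 3*a + 2*a\<^sup>2) *\<^sub>R x"
 by (simp_all add: pE1_def pEh_def pE0_def assms scale_r algebra_simps power2_eq_square)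

lemma linear_pEh: "linear (pEh u)" and linear_pE0: "linear (pE0 u)"
 by (intro linearI; simp add: pEh_def pE0_def lin_simps algebra_simps)+

lemma peirce_proj_sum:
 assumes c: "idem c" and "c \<odot> x1 = x1" "c \<odot> xh = (1/2) *\<^sub>R xh" "c \<odot> x0 = 0"
 shows "pE1 c (x1 + xh + x0) = x1" "pEh c (x1 + xh + x0) = xh" "pE0 c (x1 + xh + x0) = x0"
 using peirce_proj[of c x1 1] peirce_proj[of c xh "1/2"] peirce_proj[of c x0 0] assms
 by (simp_all add: linear_add[OF linear_pE1] linear_add[OF linear_pEh] linear_add[OF linear_pE0] power2_eq_square)

lemma Dg_parts:
 assumes c: "idem c"
 shows "pE1 c (Dg c t x) = exp t *\<^sub>R pE1 c x" "pEh c (Dg c t x) = exp (t/2) *\<^sub>R pEh c x" "pE0 c (Dg c t x) = pE0 c x"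
 unfolding Dg_def
 using peirce_proj_sum[OF c, of "exp t *\<^sub>R pE1 c x" "exp (t/2) *\<^sub>R pEh c x" "pE0 c x"] peirce_eigen[OF c, of x]
 by (simp_all add: scale_r)

lemma Dg_inv:
 assumes c: "idem c"
 shows "Dg c (- t) (Dg c t x) = x"
 unfolding Dg_def[of c "- t"] Dg_parts[OF c] by (simp add: peirce_sum flip: exp_add)

lemma linear_Dg: "linear (Dg c t)"
 unfolding Dg_def
 by (intro linear_compose_add linear_compose_scale_right linear_pE1 linear_pEh linear_pE0)

lemma Dg_flow:
 assumes c: "idem c"
 shows "((\<lambda>t. Dg c t x) has_vector_derivative c \<odot> Dg c t x) (at t)"
 unfolding Dg_def by (auto intro!: derivative_eq_intros simp: add_r scale_r peirce_eigen[OF c])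

lemma rate_mult_1:
 assumes u: "idem u" and uc: "u \<odot> c = c"
 shows "rate (m c) u (inner c u)"
 unfolding rate_def
proof (intro ballI allI impI)
 fix w y assume y: "is_inv u w y"
 have y1: "u \<odot> (c \<odot> y) = c \<odot> y" using peirce_11[OF u uc is_inv_V1[OF y]] .
 have "inner y (c \<odot> w) = inner (c \<odot> y) w" using assoc_inner[of c y w] by simp
 also have "\<dots> = inner (c \<odot> y) (pE1 u w)" using inner_pE1[OF u y1] by simp
 also have "\<dots> = inner c u" unfolding assoc_inner' is_inv_mult[OF y] ..
 finally show "inner y (c \<odot> w) = inner c u" .
qed

lemma rate_mult_0:
 assumes u: "idem u" and uc: "u \<odot> c = 0"
 shows "rate (m c) u 0"
 unfolding rate_def
proof (intro ballI allI impI)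
 fix w y assume y: "is_inv u w y"
 have "c \<odot> y = 0" using peirce_10[OF u is_inv_V1[OF y] uc] comm[of c y] by simp
 then show "inner y (c \<odot> w) = 0" using assoc_inner[of c y w] by simp
qed

lemma inner_Nlp: "inner (Nlp c z x) y = inner x (Nlp' c z y)"
 by (simp add: Nlp_def Nlp'_def inner_simps assoc_inner)

lemma linear_Nlp: "linear (Nlp c z)" and linear_Nlp': "linear (Nlp' c z)"
 by (intro linearI; simp add: Nlp_def Nlp'_def lin_simps algebra_simps)+

lemma inner_Tu: "inner (Tu c z x) y = inner x (Tu' c z y)"
 by (simp add: Tu_def Tu'_def inner_simps inner_Nlp)

lemma linear_Tu: "linear (Tu c z)" and linear_Tu': "linear (Tu' c z)"
 by (intro linearI; simp add: Tu_def Tu'_def linear_add[OF linear_Nlp] linear_scale[OF linear_Nlp]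
   linear_add[OF linear_Nlp'] linear_scale[OF linear_Nlp'] algebra_simps)+

lemma Nlp_parts:
 assumes c: "idem c" and z: "c \<odot> z = (1/2) *\<^sub>R z"
 shows "c \<odot> x = x ==> Nlp c z x = 0"
  and "c \<odot> x = (1/2) *\<^sub>R x ==> Nlp c z x = 2 *\<^sub>R (c \<odot> (z \<odot> x)) \<and> c \<odot> Nlp c z x = Nlp c z x"
  and "c \<odot> x = 0 ==> Nlp c z x = 2 *\<^sub>R (z \<odot> x) \<and> c \<odot> Nlp c z x = (1/2) *\<^sub>R Nlp c z x"
proof -
 show "Nlp c z x = 0" if "c \<odot> x = x"
  using peirce_1h[OF c that z] that by (simp add: Nlp_def comm[of z x] scaleR_2 scaleR_left_distrib[symmetric])
 show "Nlp c z x = 2 *\<^sub>R (c \<odot> (z \<odot> x)) \<and> c \<odot> Nlp c z x = Nlp c z x" if "c \<odot> x = (1/2) *\<^sub>R x"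
  using peirce_hh[OF c z that] that by (simp add: Nlp_def scale_r)
 show "Nlp c z x = 2 *\<^sub>R (z \<odot> x) \<and> c \<odot> Nlp c z x = (1/2) *\<^sub>R Nlp c z x" if "c \<odot> x = 0"
  using peirce_0h[OF c that z] that by (simp add: Nlp_def scale_r add_r comm[of z x] scaleR_2 scaleR_left_distrib[symmetric])
qed

lemma Nlp'_parts:
 assumes c: "idem c" and z: "c \<odot> z = (1/2) *\<^sub>R z"
 shows "c \<odot> x = 0 ==> Nlp' c z x = 0"
  and "c \<odot> x = (1/2) *\<^sub>R x ==> Nlp' c z x = 2 *\<^sub>R (z \<odot> x - c \<odot> (z \<odot> x)) \<and> c \<odot> Nlp' c z x = 0"
  and "c \<odot> x = x ==> Nlp' c z x = 2 *\<^sub>R (z \<odot> x) \<and> c \<odot> Nlp' c z x = (1/2) *\<^sub>R Nlp' c z x"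
proof -
 show "Nlp' c z x = 0" if "c \<odot> x = 0"
  using peirce_0h[OF c that z] that by (simp add: Nlp'_def comm[of z x])
 show "Nlp' c z x = 2 *\<^sub>R (z \<odot> x - c \<odot> (z \<odot> x)) \<and> c \<odot> Nlp' c z x = 0" if "c \<odot> x = (1/2) *\<^sub>R x"
  using peirce_hh[OF c z that] that by (simp add: Nlp'_def scale_r lin_simps scaleR_diff_right scaleR_2)
 show "Nlp' c z x = 2 *\<^sub>R (z \<odot> x) \<and> c \<odot> Nlp' c z x = (1/2) *\<^sub>R Nlp' c z x" if "c \<odot> x = x"
  using peirce_1h[OF c that z] that by (simp add: Nlp'_def lin_simps comm[of z x] scaleR_2 scaleR_left_distrib[symmetric])
qed

lemma Nlp_cube:
 assumes c: "idem c" and z: "c \<odot> z = (1/2) *\<^sub>R z"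
 shows "Nlp c z (Nlp c z (Nlp c z x)) = 0"
proof -
 note P = Nlp_parts[OF c z]
 note E = peirce_eigen[OF c, of x]
 have "Nlp c z (pE1 c x) = 0" using P(1)[OF E(1)] .
 moreover have "Nlp c z (Nlp c z (pEh c x)) = 0" using P(1) P(2)[OF E(2)] by blast
 moreover have "Nlp c z (Nlp c z (Nlp c z (pE0 c x))) = 0" using P(1) P(2) P(3)[OF E(3)] by blast
 ultimately have "Nlp c z (Nlp c z (Nlp c z (pE1 c x + pEh c x + pE0 c x))) = 0"
  by (simp only: linear_add[OF linear_Nlp] linear_0[OF linear_Nlp] add_0)
 then show ?thesis by (simp only: peirce_sum)
qed

lemma Nlp_scale: "Nlp c (a *\<^sub>R z) x = a *\<^sub>R Nlp c z x"
 by (simp add: Nlp_def lin_simps algebra_simps)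

lemma Tu_scale: "Tu c (t *\<^sub>R z) x = x + t *\<^sub>R Nlp c z x + (t\<^sup>2/2) *\<^sub>R Nlp c z (Nlp c z x)"
 by (simp add: Tu_def Nlp_scale linear_scale[OF linear_Nlp] power2_eq_square)

lemma Tu_add:
 assumes c: "idem c" and z: "c \<odot> z = (1/2) *\<^sub>R z"
 shows "Tu c (s *\<^sub>R z) (Tu c (t *\<^sub>R z) x) = Tu c ((s + t) *\<^sub>R z) x"
 unfolding Tu_scale
 by (rule euclidean_eqI) (simp add: Nlp_cube[OF c z, of x] linear_add[OF linear_Nlp] linear_scale[OF linear_Nlp] linear_0[OF linear_Nlp]
   inner_simps algebra_simps power2_eq_square)

lemma Tu_inv:
 assumes c: "idem c" and z: "c \<odot> z = (1/2) *\<^sub>R z"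
 shows "Tu c (- z) (Tu c z x) = x"
 using Tu_add[OF c z, of "-1" 1 x] by (simp add: Tu_scale[of c 0 z, simplified])

lemma Tu_flow:
 assumes c: "idem c" and z: "c \<odot> z = (1/2) *\<^sub>R z"
 shows "((\<lambda>t. Tu c (t *\<^sub>R z) x) has_vector_derivative Nlp c z (Tu c (t *\<^sub>R z) x)) (at t)"
 unfolding Tu_scale using Nlp_cube[OF c z, of x]
 by (auto intro!: derivative_eq_intros simp: linear_add[OF linear_Nlp] linear_scale[OF linear_Nlp])

lemma rate_Nlp_0:
 assumes c: "idem c" and z: "c \<odot> z = (1/2) *\<^sub>R z" and u: "idem u" and uc: "u \<odot> c = 0"
 shows "rate (Nlp c z) u 0"
 unfolding rate_def
proof (intro ballI allI impI)
 fix w y assume y: "is_inv u w y"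
 have "c \<odot> y = 0" using peirce_10[OF u is_inv_V1[OF y] uc] comm[of c y] by simp
 then have "Nlp' c z y = 0" by (rule Nlp'_parts(1)[OF c z])
 then show "inner y (Nlp c z w) = 0" using inner_Nlp[of c z w y] by (simp add: inner_commute)
qed

text \<open>Moving all operators onto \<open>z\<close>, the two double products cancel because an
  element and its inverse operator-commute, and (z|u) remains. It vanishes: z is in the half space
  of \<open>c\<close>, while c and u - c are in its 1- and 0-space.\<close>

lemma rate_Nlp_1:
 assumes c: "idem c" and z: "c \<odot> z = (1/2) *\<^sub>R z" and u: "idem u" and uc: "u \<odot> c = c" and uz: "u \<odot> z = z"
 shows "rate (Nlp c z) u 0"
 unfolding rate_def
proof (intro ballI allI impI)
 fix w y assume y: "is_inv u w y"
 let ?w = "pE1 u w"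
 note y1 = is_inv_V1[OF y]
 have "u \<odot> Nlp' c z y = Nlp' c z y"
  using peirce_11[OF u] y1 uc uz by (simp add: Nlp'_def lin_simps)
 then have "inner y (Nlp c z w) = inner y (Nlp c z ?w)"
  using inner_Nlp[of c z w y] inner_Nlp[of c z ?w y] inner_pE1[OF u, of "Nlp' c z y" w]
  by (metis inner_commute)
 also have "\<dots> = inner z (y \<odot> ?w) - 2 * inner z (y \<odot> (?w \<odot> c)) + 2 * inner z (?w \<odot> (y \<odot> c))"
 proof -
  have "inner y (z \<odot> v) = inner z (y \<odot> v)" for v
   using assoc_inner[of z y v] assoc_inner'[of z y v] by simp
  moreover have "inner y (c \<odot> (z \<odot> ?w)) = inner z (?w \<odot> (y \<odot> c))"
  proof -
   have "inner y (c \<odot> (z \<odot> ?w)) = inner (c \<odot> y) (z \<odot> ?w)" by (simp add: assoc_inner)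
   also have "\<dots> = inner (z \<odot> ?w) (y \<odot> c)" by (simp add: inner_commute comm[of c y])
   also have "\<dots> = inner z (?w \<odot> (y \<odot> c))" by (rule assoc_inner')
   finally show ?thesis .
  qed
  ultimately show ?thesis by (simp add: Nlp_def inner_simps comm[of c ?w])
 qed
 also have "\<dots> = inner z u" by (simp add: is_inv_commute[OF y] is_inv_mult[OF y])
 also have "\<dots> = inner z c + inner z (u - c)" by (simp add: inner_simps)
 also have "inner z c = 0" using eigen_orth[of c z "1/2" c 1] z c by (simp add: idem_def)
 also have "inner z (u - c) = 0"
  using eigen_orth[of c z "1/2" "u - c" 0] z c uc comm[of c u] by (simp add: idem_def diff_r)
 finally show "inner y (Nlp c z w) = 0" by simp
qed

end

subsection \<open>Lebesgue measure under linear maps\<close>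

lemma nn_integral_lborel_translate:
 fixes f :: "'a::euclidean_space => ennreal"
 assumes "f \<in> borel_measurable borel"
 shows "(\<integral>\<^sup>+x. f (x + a) \<partial>lborel) = (\<integral>\<^sup>+x. f x \<partial>lborel)"
proof -
 have "(\<integral>\<^sup>+x. f x \<partial>lborel) = (\<integral>\<^sup>+x. f x \<partial>distr lborel borel ((+) a))"
  by (simp add: lborel_distr_plus)
 also have "\<dots> = (\<integral>\<^sup>+x. f (a + x) \<partial>lborel)"
  using assms by (subst nn_integral_distr) auto
 finally show ?thesis by (simp add: add.commute)
qed

text \<open>\<delta> is 1/|det t|, characterised by the effect on integrals; matrices and
  determinants of linear maps are thereby avoided.\<close>

definition scales :: "('a::euclidean_space => 'a) => real => bool" where
 "scales t \<delta> \<longleftrightarrow> \<delta> > 0 \<and> (\<forall>f\<in>borel_measurable borel. (\<integral>\<^sup>+x. f (t x) \<partial>lborel) = ennreal \<delta> * (\<integral>\<^sup>+x. f x \<partial>lborel))"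

lemma scalesD:
 "scales t \<delta> ==> f \<in> borel_measurable borel ==> (\<integral>\<^sup>+x. f (t x) \<partial>lborel) = ennreal \<delta> * (\<integral>\<^sup>+x. f x \<partial>lborel)"
 by (simp add: scales_def)

lemma borel_measurable_linear:
 fixes t :: "'a::euclidean_space => 'b::euclidean_space"
 assumes "linear t"
 shows "t \<in> borel_measurable borel"
 using assms linear_conv_bounded_linear linear_continuous_on borel_measurable_continuous_onI by blast

lemma ball_lborel: "emeasure lborel (ball (a::'a::euclidean_space) r) < \<infinity>"
 "r > 0 ==> emeasure lborel (ball (a::'a::euclidean_space) r) > 0"
proof -
 show "emeasure lborel (ball a r) < \<infinity>" using emeasure_bounded_finite[OF bounded_ball] .
 show "emeasure lborel (ball a r) > 0" if "r > 0"
  using that open_ball[of a r] by (metis ball_eq_empty emeasure_lborel_countable less_eq_real_def not_gr_zero not_le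
    emeasure_eq_0_AE null_sets_def open_not_negligible negligible_iff_null_sets completion.complete2 borel_open sets_lborel null_setsI null_sets_completionI)
qed

text \<open>The uniqueness argument for translation-invariant measure: Tonelli applied to the
  product of f(t y + x) with the indicator of the ball at x, with the translation then moved from
  one factor to the other.\<close>

lemma linear_scales_sym:
 fixes t :: "'a::euclidean_space => 'a"
 assumes lt: "linear t" and inv: "\<And>x. t (t' x) = x" and f: "f \<in> borel_measurable borel"
 shows "emeasure lborel (ball (0::'a) 1) * (\<integral>\<^sup>+y. f (t y) \<partial>lborel)
  = (\<integral>\<^sup>+x. f x \<partial>lborel) * (\<integral>\<^sup>+y. indicator (ball 0 1) (t y) \<partial>lborel)"
proof -
 note [measurable] = f borel_measurable_linear[OF lt]
 let ?A = "indicator (ball (0::'a) 1) :: 'a => ennreal"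
 have [measurable]: "ball (0::'a) 1 \<in> sets borel" by simp
 have "emeasure lborel (ball (0::'a) 1) * (\<integral>\<^sup>+y. f (t y) \<partial>lborel) = (\<integral>\<^sup>+x. ?A x * (\<integral>\<^sup>+y. f (t y) \<partial>lborel) \<partial>lborel)"
  by (simp add: nn_integral_multc)
 also have "\<dots> = (\<integral>\<^sup>+x. \<integral>\<^sup>+y. ?A x * f (t y + x) \<partial>lborel \<partial>lborel)"
 proof (rule nn_integral_cong)
  fix x :: 'a
  have "(\<integral>\<^sup>+y. f (t y) \<partial>lborel) = (\<integral>\<^sup>+y. f (t (y + t' x)) \<partial>lborel)"
   by (rule nn_integral_lborel_translate[symmetric]) measurable
  also have "\<dots> = (\<integral>\<^sup>+y. f (t y + x) \<partial>lborel)" by (simp add: linear_add[OF lt] inv)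
  finally show "?A x * (\<integral>\<^sup>+y. f (t y) \<partial>lborel) = (\<integral>\<^sup>+y. ?A x * f (t y + x) \<partial>lborel)"
   by (simp add: nn_integral_cmult)
 qed
 also have "\<dots> = (\<integral>\<^sup>+y. \<integral>\<^sup>+x. ?A x * f (t y + x) \<partial>lborel \<partial>lborel)"
  by (rule lborel_pair.Fubini') measurable
 also have "\<dots> = (\<integral>\<^sup>+y. \<integral>\<^sup>+x. ?A (x - t y) * f x \<partial>lborel \<partial>lborel)"
 proof (rule nn_integral_cong)
  fix y :: 'a
  show "(\<integral>\<^sup>+x. ?A x * f (t y + x) \<partial>lborel) = (\<integral>\<^sup>+x. ?A (x - t y) * f x \<partial>lborel)"
   using nn_integral_lborel_translate[of "\<lambda>x. ?A (x - t y) * f x" "t y"] by (simp add: add.commute)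
 qed
 also have "\<dots> = (\<integral>\<^sup>+x. \<integral>\<^sup>+y. ?A (x - t y) * f x \<partial>lborel \<partial>lborel)"
  by (rule lborel_pair.Fubini') measurable
 also have "\<dots> = (\<integral>\<^sup>+x. f x * (\<integral>\<^sup>+y. ?A (t y) \<partial>lborel) \<partial>lborel)"
 proof (rule nn_integral_cong)
  fix x :: 'a
  have "(\<integral>\<^sup>+y. ?A (t y) \<partial>lborel) = (\<integral>\<^sup>+y. ?A (t (y + t' (- x))) \<partial>lborel)"
   by (rule nn_integral_lborel_translate[symmetric]) measurable
  also have "\<dots> = (\<integral>\<^sup>+y. ?A (x - t y) \<partial>lborel)"
   by (intro nn_integral_cong) (simp add: linear_add[OF lt] inv indicator_def norm_minus_commute)
  moreover have "(\<integral>\<^sup>+y. ?A (x - t y) * f x \<partial>lborel) = (\<integral>\<^sup>+y. ?A (x - t y) \<partial>lborel) * f x"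
   by (rule nn_integral_multc) measurable
  ultimately show "(\<integral>\<^sup>+y. ?A (x - t y) * f x \<partial>lborel) = f x * (\<integral>\<^sup>+y. ?A (t y) \<partial>lborel)"
   by (simp add: mult.commute)
 qed
 also have "\<dots> = (\<integral>\<^sup>+x. f x \<partial>lborel) * (\<integral>\<^sup>+y. ?A (t y) \<partial>lborel)"
  by (rule nn_integral_multc) measurable
 finally show ?thesis .
qed

lemma linear_scales:
 fixes t :: "'a::euclidean_space => 'a"
 assumes lt: "linear t" and inv: "\<And>x. t (t' x) = x" "\<And>x. t' (t x) = x"
 obtains \<delta> where "scales t \<delta>"
proof -
 let ?V = "emeasure lborel (ball (0::'a) 1)"
 let ?I = "\<integral>\<^sup>+y. indicator (ball (0::'a) 1) (t y) \<partial>lborel"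
 have meas: "t \<in> borel_measurable borel" using borel_measurable_linear[OF lt] .
 have lt': "linear t'"
  by (rule linearI; metis inv linear_add[OF lt] linear_scale[OF lt])
 have set: "{y. t y \<in> ball 0 1} = t' ` ball 0 1"
 proof (intro equalityI subsetI)
  fix y assume "y \<in> {y. t y \<in> ball 0 1}"
  then show "y \<in> t' ` ball 0 1" using inv(2)[of y] image_eqI[of y t' "t y"] by simp
 qed (auto simp: inv)
 have I: "?I = emeasure lborel (t' ` ball 0 1)"
 proof -
  have "?I = (\<integral>\<^sup>+y. indicator (t' ` ball 0 1) y \<partial>lborel)"
   unfolding set[symmetric] by (intro nn_integral_cong) (auto simp: indicator_def)
  also have "\<dots> = emeasure lborel (t' ` ball 0 1)"
   using measurable_sets[OF meas, of "ball 0 1"] unfolding set[symmetric] by (intro nn_integral_indicator) (simp add: vimage_def)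
  finally show ?thesis .
 qed
 have bl': "bounded_linear t'" using lt' linear_conv_bounded_linear by blast
 have fin: "?I < \<infinity>"
  unfolding I by (intro emeasure_bounded_finite bounded_linear_image bl' bounded_ball)
 have pos: "?I > 0"
 proof -
  obtain B where B: "B > 0" "\<And>x. norm (t x) \<le> B * norm x" using lt linear_bounded_pos by blast
  have "ball 0 (1/B) \<subseteq> t' ` ball 0 1"
  proof
   fix y :: 'a assume "y \<in> ball 0 (1/B)"
   then have "B * norm y < 1" using B(1) by (simp add: field_simps)
   then have "norm (t y) < 1" using B(2)[of y] by linarith
   then show "y \<in> t' ` ball 0 1" using set by auto
  qed
  then have "emeasure lborel (ball (0::'a) (1/B)) \<le> ?I"
   unfolding I using measurable_sets[OF meas, of "ball 0 1"] unfolding set[symmetric]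
   by (intro emeasure_mono) (simp_all add: vimage_def)
  moreover have "emeasure lborel (ball (0::'a) (1/B)) > 0" using ball_lborel(2)[of "1/B"] B by simp
  ultimately show ?thesis by (meson less_le_trans)
 qed
 obtain v where v: "?V = ennreal v" "v > 0"
  using ball_lborel(1)[of "0::'a" 1] ball_lborel(2)[of 1 "0::'a"] by (cases ?V) auto
 obtain i where i: "?I = ennreal i" "i > 0"
  using fin pos by (cases ?I) auto
 have "scales t (i / v)"
  unfolding scales_def
 proof (intro conjI ballI)
  show "i / v > 0" using i v by simp
  fix f :: "'a => ennreal" assume f: "f \<in> borel_measurable borel"
  have eq: "ennreal v * (\<integral>\<^sup>+y. f (t y) \<partial>lborel) = (\<integral>\<^sup>+x. f x \<partial>lborel) * ennreal i"
   using linear_scales_sym[OF lt inv(1) f] v i by simp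
  have "(\<integral>\<^sup>+y. f (t y) \<partial>lborel) = ennreal (1/v) * (ennreal v * (\<integral>\<^sup>+y. f (t y) \<partial>lborel))"
   using v by (simp add: mult.assoc[symmetric] ennreal_mult[symmetric])
  also have "\<dots> = (ennreal (1/v) * ennreal i) * (\<integral>\<^sup>+x. f x \<partial>lborel)"
   unfolding eq by (simp only: ac_simps)
  also have "ennreal (1/v) * ennreal i = ennreal (i / v)"
   using v i by (simp add: ennreal_mult[symmetric])
  finally show "(\<integral>\<^sup>+x. f (t x) \<partial>lborel) = ennreal (i / v) * (\<integral>\<^sup>+x. f x \<partial>lborel)" .
 qed
 then show ?thesis using that by blast
qed

lemma scales_unique:
 fixes t :: "'a::euclidean_space => 'a"
 assumes "scales t a" "scales t b"
 shows "a = b"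
proof -
 obtain v where v: "emeasure lborel (ball (0::'a) 1) = ennreal v" "v > 0"
  using ball_lborel(1)[of "0::'a" 1] ball_lborel(2)[of 1 "0::'a"] by (cases "emeasure lborel (ball (0::'a) 1)") auto
 have ind: "(indicator (ball 0 1) :: 'a => ennreal) \<in> borel_measurable borel"
  by (intro borel_measurable_indicator) simp
 have "ennreal a * ennreal v = ennreal b * ennreal v"
  using scalesD[OF assms(1) ind] scalesD[OF assms(2) ind] v by simp
 then have "ennreal (a * v) = ennreal (b * v)"
  using assms v by (simp add: ennreal_mult scales_def less_imp_le)
 then show ?thesis using assms v by (simp add: scales_def)
qed

lemma scales_comp:
 assumes "scales s a" "scales t b" "linear s"
 shows "scales (\<lambda>x. s (t x)) (a * b)"
 unfolding scales_def
proof (intro conjI ballI)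
 show "a * b > 0" using assms by (simp add: scales_def)
 fix f :: "'a => ennreal" assume f: "f \<in> borel_measurable borel"
 then have "(\<lambda>x. f (s x)) \<in> borel_measurable borel"
  using borel_measurable_linear[OF assms(3)] by simp
 from scalesD[OF assms(2) this] scalesD[OF assms(1) f]
 show "(\<integral>\<^sup>+x. f (s (t x)) \<partial>lborel) = ennreal (a * b) * (\<integral>\<^sup>+x. f x \<partial>lborel)"
  using assms by (simp add: scales_def ennreal_mult less_imp_le ac_simps)
qed

lemma scales_id: "scales (\<lambda>x. x) 1"
 by (simp add: scales_def)

lemma scales_inverse:
 assumes "scales t a" "linear t" "linear t'" "\<And>x. t' (t x) = x" "\<And>x. t (t' x) = x"
 shows "scales t' (1 / a)"
proof -
 obtain b where b: "scales t' b" using linear_scales[of t' t] assms by auto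
 have "a * b = 1"
  using scales_unique[OF scales_comp[OF assms(1) b assms(2)]] scales_id assms(5) by simp
 then have "b = 1 / a" by (auto simp: eq_divide_eq mult.commute)
 then show ?thesis using b by simp
qed

lemma scales_isometry:
 assumes "linear t" "\<And>x. t' (t x) = x" "\<And>x. t (t' x) = x" "\<And>x. norm (t x) = norm (x::'a::euclidean_space)"
 shows "scales t 1"
proof -
 obtain b where b: "scales t b" using linear_scales[of t t'] assms by auto
 obtain v where v: "emeasure lborel (ball (0::'a) 1) = ennreal v" "v > 0"
  using ball_lborel(1)[of "0::'a" 1] ball_lborel(2)[of 1 "0::'a"] by (cases "emeasure lborel (ball (0::'a) 1)") auto
 have "(\<integral>\<^sup>+x. indicator (ball 0 1) (t x) \<partial>lborel) = (\<integral>\<^sup>+x. indicator (ball (0::'a) 1) x \<partial>lborel)"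
  by (intro nn_integral_cong) (simp add: indicator_def assms)
 moreover have ind: "(indicator (ball 0 1) :: 'a => ennreal) \<in> borel_measurable borel"
  by (intro borel_measurable_indicator) simp
 ultimately have "ennreal b * ennreal v = ennreal v"
  using scalesD[OF b ind] v by simp
 then have "ennreal (b * v) = ennreal v"
  using b v by (simp add: ennreal_mult scales_def less_imp_le)
 then have "b = 1" using b v by (simp add: scales_def)
 then show ?thesis using b by simp
qed

lemma scales_diagonal_Basis:
 fixes g :: "'a::euclidean_space => real"
 assumes "\<And>b. b \<in> Basis ==> g b > 0"
 shows "scales (\<lambda>x. \<Sum>b\<in>Basis. (g b * inner x b) *\<^sub>R b) (1 / (\<Prod>b\<in>Basis. g b))"
 unfolding scales_def
proof (intro conjI ballI)
 let ?T = "\<lambda>x. \<Sum>b\<in>Basis. (g b * inner x b) *\<^sub>R b :: 'a"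
 define P where "P = (\<Prod>b\<in>Basis. g b)"
 have P: "P > 0" unfolding P_def using assms by (intro prod_pos) auto
 then show "1 / (\<Prod>b\<in>Basis. g b) > 0" by (simp add: P_def)
 fix f :: "'a => ennreal" assume f: "f \<in> borel_measurable borel"
 have "lborel = density (distr lborel borel (\<lambda>x. 0 + (\<Sum>j\<in>Basis. (g j * (x \<bullet> j)) *\<^sub>R j))) (\<lambda>_. ennreal (\<Prod>j\<in>Basis. \<bar>g j\<bar>))"
  by (rule lborel_affine_euclidean) (use assms in force)
 then have L: "lborel = density (distr lborel borel ?T) (\<lambda>_. ennreal P)"
  using assms by (simp add: less_imp_le P_def)
 have "(\<integral>\<^sup>+x. f x \<partial>lborel) = ennreal P * (\<integral>\<^sup>+x. f (?T x) \<partial>lborel)"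
  using f by (subst L) (simp add: nn_integral_density nn_integral_distr nn_integral_cmult)
 then show "(\<integral>\<^sup>+x. f (?T x) \<partial>lborel) = ennreal (1 / (\<Prod>b\<in>Basis. g b)) * (\<integral>\<^sup>+x. f x \<partial>lborel)"
  unfolding P_def[symmetric] using P by (simp add: mult.assoc[symmetric] ennreal_mult[symmetric])
qed

text \<open>An orthonormal eigenbasis is carried to the standard basis by an isometry
  \<open>U\<close>, which has volume factor 1; there the map is diagonal in coordinates.\<close>

lemma scales_diagonal:
 fixes t :: "'a::euclidean_space => 'a"
 assumes lt: "linear t" and fin: "finite B" and card: "card B = DIM('a)"
  and on: "\<And>a b. a \<in> B ==> b \<in> B ==> inner a b = (if a = b then 1 else 0)"
  and tb: "\<And>b. b \<in> B ==> t b = g b *\<^sub>R b" and g: "\<And>b. b \<in> B ==> g b > 0"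
  and expand: "\<And>x. x = (\<Sum>b\<in>B. inner x b *\<^sub>R b)"
 shows "scales t (1 / (\<Prod>b\<in>B. g b))"
proof -
 obtain p where p: "bij_betw p (Basis :: 'a set) B"
  using finite_same_card_bij[of "Basis :: 'a set" B] fin card by auto
 have pB: "p i \<in> B" if "i \<in> Basis" for i using p that by (auto simp: bij_betw_def)
 have pi: "p i = p j \<longleftrightarrow> i = j" if "i \<in> Basis" "j \<in> Basis" for i j
  using p that by (auto simp: bij_betw_def inj_on_def)
 define U where "U x = (\<Sum>i\<in>Basis. inner x i *\<^sub>R p i)" for x :: 'a
 define U' where "U' x = (\<Sum>i\<in>Basis. inner x (p i) *\<^sub>R i)" for x :: 'a
 have lU: "linear U" "linear U'"
  by (intro linearI; simp add: U_def U'_def inner_simps scaleR_add_left sum.distrib scaleR_sum_right)+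
 have ip: "inner (U x) (p i) = inner x i" if "i \<in> Basis" for x i
 proof -
  have "inner (U x) (p i) = (\<Sum>j\<in>Basis. if j = i then inner x i else 0)"
   unfolding U_def inner_sum_left using that by (intro sum.cong) (auto simp: on pB pi)
  then show ?thesis using that by simp
 qed
 have U'U: "U' (U x) = x" for x
  unfolding U'_def using ip by (subst (3) euclidean_representation[symmetric]) (auto intro!: sum.cong)
 have UU': "U (U' x) = x" for x
 proof -
  have "U (U' x) = (\<Sum>i\<in>Basis. inner x (p i) *\<^sub>R p i)"
   unfolding U_def U'_def by (intro sum.cong refl) (simp add: inner_sum_left_Basis)
  also have "\<dots> = (\<Sum>b\<in>B. inner x b *\<^sub>R b)"
   by (rule sum.reindex_bij_betw[OF p])
  finally show ?thesis using expand[of x] by simp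
 qed
 have nU: "norm (U x) = norm x" for x
 proof -
  have "inner (U x) (U x) = (\<Sum>i\<in>Basis. inner x i * inner (U x) (p i))"
   by (subst (2) U_def) (simp add: inner_sum_right)
  also have "\<dots> = (\<Sum>i\<in>Basis. inner x i * inner x i)" using ip by simp
  also have "\<dots> = inner x x" by (simp add: euclidean_inner[symmetric])
  finally show ?thesis by (simp add: norm_eq_sqrt_inner)
 qed
 have sU: "scales U 1" by (rule scales_isometry[OF lU(1) U'U UU' nU])
 have sU': "scales U' 1" using scales_inverse[OF sU lU U'U UU'] by simp
 let ?T = "\<lambda>x. \<Sum>b\<in>Basis. (g (p b) * inner x b) *\<^sub>R b :: 'a"
 have tU: "t (U x) = U (?T x)" for x
  unfolding U_def
  by (simp add: linear_sum[OF lt] linear_scale[OF lt] tb pB inner_sum_left_Basis mult.commute)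
 have lT: "linear ?T"
  by (intro linearI; simp add: inner_simps scaleR_add_left sum.distrib scaleR_sum_right algebra_simps)
 have "t x = U (?T (U' x))" for x using tU[of "U' x"] UU' by simp
 then have teq: "t = (\<lambda>x. U (?T (U' x)))" by blast
 have "scales ?T (1 / (\<Prod>b\<in>Basis. g (p b)))"
  by (rule scales_diagonal_Basis) (use g pB in auto)
 then have "scales t (1 * (1 / (\<Prod>b\<in>Basis. g (p b)) * 1))"
  unfolding teq by (intro scales_comp[OF sU scales_comp[OF _ sU' lT] lU(1)])
 then show ?thesis
  by (simp add: prod.reindex_bij_betw[OF p])
qed

context euclidean_jordan
begin

lemma Dg_eigen:
 "c \<odot> v = v ==> Dg c t v = exp t *\<^sub>R v"
 "c \<odot> v = (1/2) *\<^sub>R v ==> Dg c t v = exp (t/2) *\<^sub>R v"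
 "c \<odot> v = 0 ==> Dg c t v = v"
 using peirce_proj[of c v 1] peirce_proj[of c v "1/2"] peirce_proj[of c v 0]
 by (simp_all add: Dg_def power2_eq_square)

text \<open>\<open>Nlp\<close> raises the eigenvalue of L(c) by 1/2, so conjugation by exp(s L(c))
  multiplies it by exp(s/2).\<close>

lemma Dg_conj:
 assumes c: "idem c" and z: "c \<odot> z = (1/2) *\<^sub>R z"
 shows "Dg c s (Nlp c z x) = exp (s/2) *\<^sub>R Nlp c z (Dg c s x)"
proof -
 note E = peirce_eigen[OF c, of x]
 note P = Nlp_parts[OF c z]
 have e2: "exp (s/2) * exp (s/2) = exp s" by (simp flip: exp_add)
 have 1: "Dg c s (Nlp c z (pE1 c x)) = exp (s/2) *\<^sub>R Nlp c z (Dg c s (pE1 c x))"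
  using Dg_eigen(1)[OF E(1)] P(1)[OF E(1)]
  by (simp add: linear_0[OF linear_Dg] linear_scale[OF linear_Nlp])
 have 2: "Dg c s (Nlp c z (pEh c x)) = exp (s/2) *\<^sub>R Nlp c z (Dg c s (pEh c x))"
  using Dg_eigen(2)[OF E(2)] Dg_eigen(1)[OF conjunct2[OF P(2)[OF E(2)]]]
  by (simp add: linear_scale[OF linear_Nlp] e2)
 have 3: "Dg c s (Nlp c z (pE0 c x)) = exp (s/2) *\<^sub>R Nlp c z (Dg c s (pE0 c x))"
  using Dg_eigen(3)[OF E(3)] Dg_eigen(2)[OF conjunct2[OF P(3)[OF E(3)]]] by simp
 have "Dg c s (Nlp c z (pE1 c x + pEh c x + pE0 c x)) = exp (s/2) *\<^sub>R Nlp c z (Dg c s (pE1 c x + pEh c x + pE0 c x))"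
  by (simp only: linear_add[OF linear_Nlp] linear_add[OF linear_Dg] 1 2 3 scaleR_add_right)
 then show ?thesis by (simp only: peirce_sum)
qed

text \<open>Conjugation by a dilation turns \<open>Tu c z\<close> into its own square, so its Jacobian is 1.\<close>

lemma scales_Tu:
 assumes c: "idem c" and z: "c \<odot> z = (1/2) *\<^sub>R z"
 shows "scales (Tu c z) 1"
proof -
 have i1: "Tu c (- z) (Tu c z x) = x" for x using Tu_inv[OF c z] .
 have "c \<odot> (- z) = (1/2) *\<^sub>R (- z)" using z by (simp add: minus_r)
 then have i2: "Tu c z (Tu c (- z) x) = x" for x using Tu_inv[OF c, of "- z"] by simp
 obtain \<delta> where \<delta>: "scales (Tu c z) \<delta>"
  using linear_scales[OF linear_Tu i2 i1] by blast
 define s where "s = 2 * ln (2::real)"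
 have es: "exp (s/2) = 2" by (simp add: s_def)
 have Di: "Dg c (- s) (Dg c s x) = x" "Dg c s (Dg c (- s) x) = x" for x
  using Dg_inv[OF c, of s x] Dg_inv[OF c, of "- s" x] by auto
 obtain a where a: "scales (Dg c s) a" using linear_scales[OF linear_Dg Di(2) Di(1)] by blast
 have a': "scales (Dg c (- s)) (1 / a)"
  by (rule scales_inverse[OF a linear_Dg linear_Dg Di(1) Di(2)])
 have a0: "a > 0" using a by (simp add: scales_def)
 have conj: "Dg c s (Tu c z x) = Tu c (2 *\<^sub>R z) (Dg c s x)" for x
  unfolding Tu_scale unfolding Tu_def
  by (simp add: linear_add[OF linear_Dg] linear_scale[OF linear_Dg] Dg_conj[OF c z] linear_scale[OF linear_Nlp] es)
 have "scales (\<lambda>x. Dg c s (Tu c z (Dg c (- s) x))) (a * (\<delta> * (1 / a)))"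
  by (intro scales_comp a a' \<delta> linear_Dg linear_Tu)
 then have s2: "scales (Tu c (2 *\<^sub>R z)) \<delta>" using a0 by (simp add: conj Di)
 have "scales (\<lambda>x. Tu c z (Tu c z x)) (\<delta> * \<delta>)" by (intro scales_comp \<delta> linear_Tu)
 moreover have "(\<lambda>x. Tu c z (Tu c z x)) = Tu c (2 *\<^sub>R z)"
  using Tu_add[OF c z, of 1 1] by (auto simp: fun_eq_iff)
 ultimately have "\<delta> * \<delta> = \<delta>" using scales_unique s2 by metis
 then have "\<delta> = 1" using \<delta> by (simp add: scales_def)
 then show ?thesis using \<delta> by simp
qed

text \<open>In an orthonormal eigenbasis of L(c) the product of the factors is exp(t tr L(c)); the
  trace is then rewritten in the standard basis.\<close>

lemma scales_Dg:
 assumes c: "idem c"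
 shows "scales (Dg c t) (exp (- t * (\<Sum>i\<in>Basis. inner (c \<odot> i) i)))"
proof -
 have sub: "subspace {x. c \<odot> x = a *\<^sub>R x}" for a
  by (auto simp: subspace_def lin_simps algebra_simps)
 have "\<exists>B. B \<subseteq> {x. c \<odot> x = a *\<^sub>R x} \<and> pairwise orthogonal B \<and> (\<forall>x\<in>B. norm x = 1) \<and> independent B
    \<and> span B = {x. c \<odot> x = a *\<^sub>R x}" for a
  using orthonormal_basis_subspace[OF sub[of a]] by metis
 then obtain Bs where Bs: "\<And>a. Bs a \<subseteq> {x. c \<odot> x = a *\<^sub>R x}" "\<And>a. pairwise orthogonal (Bs a)"
  "\<And>a x. x \<in> Bs a ==> norm x = 1" "\<And>a. independent (Bs a)" "\<And>a. span (Bs a) = {x. c \<odot> x = a *\<^sub>R x}"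
  by metis
 define B where "B = Bs 1 \<union> Bs (1/2) \<union> Bs 0"
 have fin: "finite B" using Bs(4) by (auto simp: B_def independent_imp_finite)
 have ev: "\<exists>a\<in>{1,1/2,0}. b \<in> Bs a \<and> c \<odot> b = a *\<^sub>R b" if "b \<in> B" for b
  using that Bs(1) unfolding B_def by blast
 have n1: "inner b b = 1" if "b \<in> B" for b
  using ev[OF that] Bs(3) by (auto simp: norm_eq_1)
 have on: "inner a b = (if a = b then 1 else 0)" if ab: "a \<in> B" "b \<in> B" for a b
 proof (cases "a = b")
  case False
  obtain p q where p: "a \<in> Bs p" "c \<odot> a = p *\<^sub>R a" and q: "b \<in> Bs q" "c \<odot> b = q *\<^sub>R b"
   using ev ab by meson
  have "inner a b = 0"
  proof (cases "p = q")
   case True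
   then show ?thesis using Bs(2)[of p] p q False by (auto simp: pairwise_def orthogonal_def)
  qed (use eigen_orth p q in blast)
  then show ?thesis using False by simp
 qed (use n1 ab in simp)
 have spn: "x \<in> span B" for x
 proof -
  have "pE1 c x \<in> span (Bs 1)" "pEh c x \<in> span (Bs (1/2))" "pE0 c x \<in> span (Bs 0)"
   using peirce_eigen[OF c, of x] by (simp_all add: Bs(5))
  then have "pE1 c x \<in> span B" "pEh c x \<in> span B" "pE0 c x \<in> span B"
   using span_mono[of "Bs _" B] by (auto simp: B_def)
  then have "pE1 c x + pEh c x + pE0 c x \<in> span B" by (intro span_add)
  then show ?thesis by (simp only: peirce_sum)
 qed
 have "independent B"
  by (rule pairwise_orthogonal_independent) (use on n1 in \<open>force simp: pairwise_def orthogonal_def\<close>)+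
 then have card: "card B = DIM('a)"
  using basis_card_eq_dim[of B UNIV] spn by auto
 have expand: "x = (\<Sum>b\<in>B. inner x b *\<^sub>R b)" for x
 proof -
  let ?y = "x - (\<Sum>b\<in>B. inner x b *\<^sub>R b)"
  have "inner ?y b = 0" if "b \<in> B" for b
  proof -
   have "inner (\<Sum>b\<in>B. inner x b *\<^sub>R b) b = (\<Sum>a\<in>B. if a = b then inner x b else 0)"
    unfolding inner_sum_left using that by (intro sum.cong) (auto simp: on)
   then show ?thesis using that fin by (simp add: inner_diff_left)
  qed
  then have "orthogonal ?y v" if "v \<in> span B" for v
   using that orthogonal_to_span[of v B ?y] by (auto simp: orthogonal_def)
  then have "inner ?y ?y = 0" using spn[of ?y] by (auto simp: orthogonal_def)
  then show ?thesis by simp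
 qed
 define g where "g b = exp (t * inner (c \<odot> b) b)" for b
 have cb: "c \<odot> b = inner (c \<odot> b) b *\<^sub>R b" if "b \<in> B" for b
  using ev[OF that] n1[OF that] by auto
 have tb: "Dg c t b = g b *\<^sub>R b" if "b \<in> B" for b
 proof -
  obtain a where a: "a \<in> {1,1/2,0}" "c \<odot> b = a *\<^sub>R b" using ev[OF \<open>b \<in> B\<close>] by blast
  then have "g b = exp (t * a)" using n1[OF that] by (simp add: g_def)
  moreover from a consider "c \<odot> b = b" "a = 1" | "c \<odot> b = (1/2) *\<^sub>R b" "a = 1/2" | "c \<odot> b = 0" "a = 0"
   by force
  then have "Dg c t b = exp (t * a) *\<^sub>R b"
   using Dg_eigen[of c b t] by cases simp_all
  ultimately show ?thesis by simp
 qed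
 have "scales (Dg c t) (1 / (\<Prod>b\<in>B. g b))"
  by (rule scales_diagonal[OF linear_Dg fin card on tb _ expand]) (simp_all add: g_def)
 also have "1 / (\<Prod>b\<in>B. g b) = exp (- t * (\<Sum>b\<in>B. inner (c \<odot> b) b))"
  using fin unfolding g_def by (simp add: exp_sum[symmetric] sum_distrib_left[symmetric] exp_minus inverse_eq_divide)
 also have "(\<Sum>b\<in>B. inner (c \<odot> b) b) = (\<Sum>i\<in>Basis. inner (c \<odot> i) i)"
 proof -
  have "(\<Sum>i\<in>Basis. inner (c \<odot> i) i) = (\<Sum>i\<in>Basis. \<Sum>b\<in>B. inner (c \<odot> b) b * (inner b i * inner b i))"
  proof (intro sum.cong refl)
   fix i :: 'a assume "i \<in> Basis"
   have "inner (c \<odot> i) i = (\<Sum>b\<in>B. inner i b * inner (c \<odot> b) i)"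
    by (subst expand[of i]) (simp add: sum_r scale_r inner_sum_left)
   also have "\<dots> = (\<Sum>b\<in>B. inner (c \<odot> b) b * (inner b i * inner b i))"
    by (intro sum.cong refl) (subst cb, auto simp: inner_commute)
   finally show "inner (c \<odot> i) i = (\<Sum>b\<in>B. inner (c \<odot> b) b * (inner b i * inner b i))" .
  qed
  also have "\<dots> = (\<Sum>b\<in>B. inner (c \<odot> b) b * (\<Sum>i\<in>Basis. inner b i * inner b i))"
   by (subst sum.swap) (simp add: sum_distrib_left)
  also have "\<dots> = (\<Sum>b\<in>B. inner (c \<odot> b) b)"
   using n1 by (simp add: euclidean_inner[symmetric])
  finally show ?thesis by simp
 qed
 finally show ?thesis .
qed

subsection \<open>The trace form of a simple algebra\<close>

text \<open>The vector that represents the linear form x -> tr L(x), see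
  \<open>inner_trace_vec\<close>.\<close>

definition trace_vec :: 'a where
 "trace_vec = (\<Sum>i\<in>Basis. i \<odot> i)"

lemma inner_trace_vec: "inner trace_vec x = (\<Sum>i\<in>Basis. inner (x \<odot> i) i)"
 unfolding trace_vec_def inner_sum_left
proof (intro sum.cong refl)
 fix i :: 'a
 have "inner (i \<odot> i) x = inner i (i \<odot> x)" by (rule assoc_inner')
 then show "inner (i \<odot> i) x = inner (x \<odot> i) i" by (simp add: comm[of i x] inner_commute)
qed

text \<open>The trace of a symmetric times a skew operator changes sign under transposition.\<close>

lemma trace_commutator_0:
 fixes f g :: "'a => 'a"
 assumes "\<And>x y. inner (f x) y = inner x (f y)" "\<And>x y. inner (g x) y = - inner x (g y)"
 shows "(\<Sum>i\<in>Basis. inner (f (g i)) i) = 0"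
proof -
 let ?S = "\<Sum>i\<in>Basis. \<Sum>j\<in>Basis. inner (g i) j * inner (f i) j"
 have "(\<Sum>i\<in>Basis. inner (f (g i)) i) = ?S"
  by (intro sum.cong refl) (simp add: assms(1) euclidean_inner[of "g _" "f _"])
 moreover have "?S = (\<Sum>i\<in>Basis. \<Sum>j\<in>Basis. - (inner (g j) i * inner (f j) i))"
 proof (intro sum.cong refl)
  fix i j :: 'a
  show "inner (g i) j * inner (f i) j = - (inner (g j) i * inner (f j) i)"
   using assms(1)[of i j] assms(2)[of i j] by (simp add: inner_commute[of i "g j"] inner_commute[of i "f j"])
 qed
 then have "?S = - ?S" by (subst (2) sum.swap) (simp add: sum_negf)
 ultimately show ?thesis by simp
qed

text \<open>By \<open>commutator_derivation\<close>, tr L((xw)y) - tr L((xy)w) is the trace of the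
  commutator of L(x) with the skew operator D = [L(w), L(y)], hence 0. So the trace form is
  associative, that is, L of its representing vector commutes with every multiplication.\<close>

lemma trace_vec_assoc: "trace_vec \<odot> (y \<odot> w) = y \<odot> (trace_vec \<odot> w)"
proof -
 have eq: "inner trace_vec ((x \<odot> w) \<odot> y) = inner trace_vec ((x \<odot> y) \<odot> w)" for x y w
 proof -
  let ?D = "\<lambda>z. w \<odot> (y \<odot> z) - y \<odot> (w \<odot> z)"
  have D: "inner (?D a) b = - inner a (?D b)" for a b
   by (simp add: inner_simps assoc_inner)
  have "inner trace_vec ((x \<odot> w) \<odot> y) - inner trace_vec ((x \<odot> y) \<odot> w)
   = (\<Sum>i\<in>Basis. inner (x \<odot> ?D i) i) - (\<Sum>i\<in>Basis. inner (?D (x \<odot> i)) i)"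
   unfolding inner_trace_vec sum_subtractf[symmetric] inner_diff_left[symmetric]
   by (simp only: commutator_derivation)
  also have "(\<Sum>i\<in>Basis. inner (x \<odot> ?D i) i) = 0"
   by (rule trace_commutator_0[OF assoc_inner D])
  also have "(\<Sum>i\<in>Basis. inner (?D (x \<odot> i)) i) = (\<Sum>i\<in>Basis. - inner (x \<odot> ?D i) i)"
   by (intro sum.cong refl, subst D, subst assoc_inner) (simp add: inner_commute)
  also have "\<dots> = - (\<Sum>i\<in>Basis. inner (x \<odot> ?D i) i)" by (rule sum_negf)
  also have "(\<Sum>i\<in>Basis. inner (x \<odot> ?D i) i) = 0"
   by (rule trace_commutator_0[OF assoc_inner D])
  finally show ?thesis by simp
 qed
 have "inner x (trace_vec \<odot> (y \<odot> w)) = inner x (y \<odot> (trace_vec \<odot> w))" for x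
 proof -
  have "inner x (y \<odot> (trace_vec \<odot> w)) = inner (trace_vec \<odot> w) (x \<odot> y)"
   by (simp add: assoc_inner' inner_commute)
  also have "\<dots> = inner trace_vec ((y \<odot> x) \<odot> w)"
   unfolding assoc_inner' by (simp add: comm[of x y] comm[of w "y \<odot> x"])
  also have "\<dots> = inner trace_vec (x \<odot> (y \<odot> w))"
   unfolding eq[of y w x, symmetric] by (simp add: comm[of x "y \<odot> w"])
  also have "\<dots> = inner x (trace_vec \<odot> (y \<odot> w))"
   using assoc_inner[of trace_vec x "y \<odot> w"] assoc_inner'[of trace_vec x "y \<odot> w"] by simp
  finally show ?thesis by simp
 qed
 then show ?thesis using vector_eq_ldot by blast
qed

text \<open>Since L(trace_vec) commutes with all multiplications, its eigenspaces are ideals; by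
  simplicity one of them is everything. Evaluate at \<open>e\<close>.\<close>

lemma simple_trace_vec:
 assumes "simple_ja m"
 shows "\<exists>a. trace_vec = a *\<^sub>R e"
proof -
 have ne: "(UNIV :: 'a set) \<noteq> {0}"
  using nonempty_Basis nonzero_Basis by blast
 obtain v l where v: "v \<noteq> 0" "trace_vec \<odot> v = l *\<^sub>R v"
  using symmetric_eigenvector[OF linear_mult[of trace_vec] assoc_inner subspace_UNIV _ ne] by auto
 let ?I = "{x. trace_vec \<odot> x = l *\<^sub>R x}"
 have "subspace ?I" by (auto simp: subspace_def lin_simps algebra_simps)
 moreover have "x \<odot> y \<in> ?I" if "x \<in> ?I" for x y
  using that trace_vec_assoc[of y x] by (simp add: comm[of x y] scale_r)
 ultimately have "?I = {0} \<or> ?I = UNIV"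
  using assms unfolding simple_ja_def by blast
 moreover have "v \<in> ?I" using v by simp
 ultimately have "e \<in> ?I" using v(1) by blast
 then have "trace_vec \<odot> e = l *\<^sub>R e" by simp
 then show ?thesis by (intro exI[of _ l]) simp
qed

end

section \<open>Jordan frames, principal minors and triangular maps\<close>

locale framed_jordan = euclidean_jordan m e
 for m :: "'a::euclidean_space => 'a => 'a" (infixl \<open>\<odot>\<close> 70) and e +
 fixes c :: "nat => 'a" and r :: nat
 assumes simple: "simple_ja m" and frame: "jordan_frame m e c r" and r2: "r \<ge> 2"
begin

definition uu :: "nat => 'a" where
 "uu k = (\<Sum>i=1..k. c i)"

lemma c_prim: "i \<in> {1..r} ==> prim_idem m (c i)"
 and c_orth: "i \<in> {1..r} ==> j \<in> {1..r} ==> i \<noteq> j ==> c i \<odot> c j = 0"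
 and uu_r: "uu r = e"
 using frame by (auto simp: jordan_frame_def uu_def)

lemma c_idem: "i \<in> {1..r} ==> idem (c i)"
 using c_prim prim_idem_idem by blast

lemma uu_c:
 assumes "k \<le> r" "i \<in> {1..r}"
 shows "uu k \<odot> c i = (if i \<le> k then c i else 0)"
proof -
 have "uu k \<odot> c i = (\<Sum>j=1..k. if j = i then c i else 0)"
  unfolding uu_def sum_l using assms c_orth c_idem by (intro sum.cong) (auto simp: idem_def)
 then show ?thesis using assms by simp
qed

lemma uu_uu: "j \<le> k ==> k \<le> r ==> uu k \<odot> uu j = uu j"
 unfolding uu_def[of j] sum_r by (intro sum.cong) (auto simp: uu_c)

lemma uu_idem: "k \<le> r ==> idem (uu k)"
 using uu_uu[of k k] by (simp add: idem_def)

lemma inner_cc: "i \<in> {1..r} ==> j \<in> {1..r} ==> inner (c i) (c j) = (if i = j then 1 else 0)"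
 using prim_idem_norm[OF c_prim] eigen_orth[of "c i" "c i" 1 "c j" 0] c_idem[of i] c_orth[of i j]
 by (auto simp: idem_def)

lemma inner_c_uu: "i \<in> {1..r} ==> k \<le> r ==> inner (c i) (uu k) = (if i \<le> k then 1 else 0)"
proof -
 assume i: "i \<in> {1..r}" and k: "k \<le> r"
 have "inner (c i) (uu k) = (\<Sum>j=1..k. if j = i then 1 else 0)"
  unfolding uu_def inner_sum_right using i k by (intro sum.cong) (auto simp: inner_cc)
 then show ?thesis using i by simp
qed

lemma inner_ee: "inner e e = real r"
proof -
 have "inner e e = (\<Sum>i=1..r. inner (c i) (uu r))"
  unfolding uu_r by (subst (1) uu_r[symmetric]) (simp add: uu_def inner_sum_left)
 also have "\<dots> = (\<Sum>i=1..r. 1)" by (intro sum.cong) (auto simp: inner_c_uu)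
 finally show ?thesis by simp
qed

text \<open>tr L(x) is a multiple of (e|x), and x = e fixes the multiple as n/r because (e|e) = r.
  This is where n/r enters the Jacobians.\<close>

lemma trace_c:
 assumes "i \<in> {1..r}"
 shows "(\<Sum>b\<in>Basis. inner (c i \<odot> b) b) = real DIM('a) / real r"
proof -
 obtain a where a: "trace_vec = a *\<^sub>R e" using simple_trace_vec[OF simple] by blast
 have "a * real r = real DIM('a)"
  using inner_trace_vec[of e] by (simp add: a inner_ee)
 then have "a = real DIM('a) / real r" using r2 by (simp add: field_simps)
 moreover have "inner e (c i) = 1" using inner_c_uu[OF assms, of r] assms by (simp add: uu_r inner_commute)
 ultimately show ?thesis using inner_trace_vec[of "c i"] by (simp add: a)
qed

lemma minor_eq: "k \<le> r ==> minor m c k x = jdet_in m (uu k) (pE1 (uu k) x)"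
 unfolding minor_def uu_def[symmetric] using orth_proj_eq[OF uu_idem] by simp

lemma minor_pos: "k \<le> r ==> x \<in> \<Omega> ==> minor m c k x > 0"
 using minor_eq posspec_det_pos[OF compress_pos[OF _ uu_idem]] by simp

lemma minor_r: "minor m c r x = jdet_in m e x"
 by (simp add: minor_eq uu_r pE1_e)

text \<open>Records what the integrals use of a triangular automorphism: \<open>A k\<close>
  multiplies the k-th minor, and the Jacobian is determined by the multiplier of the full
  determinant, |det t| = (A r)^(n/r).\<close>

definition tri :: "('a => 'a) => (nat => real) => bool" where
 "tri t A \<longleftrightarrow> linear t \<and> bij t \<and> t ` \<Omega> = \<Omega> \<and>
  (\<forall>k\<in>{1..r}. A k > 0 \<and> (\<forall>x\<in>\<Omega>. minor m c k (t x) = A k * minor m c k x)) \<and>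
  scales t (A r powr (- (real DIM('a) / real r)))"

lemma tri_linear: "tri t A ==> linear t" and tri_bij: "tri t A ==> bij t"
 and tri_image: "tri t A ==> t ` \<Omega> = \<Omega>" and tri_in: "tri t A ==> x \<in> \<Omega> ==> t x \<in> \<Omega>"
 and tri_minor: "tri t A ==> k \<in> {1..r} ==> x \<in> \<Omega> ==> minor m c k (t x) = A k * minor m c k x"
 and tri_pos: "tri t A ==> k \<in> {1..r} ==> A k > 0"
 and tri_scales: "tri t A ==> scales t (A r powr (- (real DIM('a) / real r)))"
 by (auto simp: tri_def)

lemma tri_comp:
 assumes s: "tri s A" and t: "tri t B"
 shows "tri (\<lambda>x. s (t x)) (\<lambda>k. A k * B k)"
 unfolding tri_def
proof (intro conjI ballI)
 have rr: "r \<in> {1..r}" using r2 by simp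
 show "linear (\<lambda>x. s (t x))" using linear_compose[OF tri_linear[OF t] tri_linear[OF s]] by (simp add: o_def)
 show "bij (\<lambda>x. s (t x))" using bij_comp[OF tri_bij[OF t] tri_bij[OF s]] by (simp add: o_def)
 show "(\<lambda>x. s (t x)) ` \<Omega> = \<Omega>" using tri_image[OF s] tri_image[OF t] by (metis image_image)
 show "scales (\<lambda>x. s (t x)) ((A r * B r) powr (- (real DIM('a) / real r)))"
  using scales_comp[OF tri_scales[OF s] tri_scales[OF t] tri_linear[OF s]] tri_pos[OF s rr] tri_pos[OF t rr]
  by (simp add: powr_mult)
 fix k assume k: "k \<in> {1..r}"
 show "A k * B k > 0" using tri_pos[OF s k] tri_pos[OF t k] by simp
 fix x assume x: "x \<in> \<Omega>"
 show "minor m c k (s (t x)) = A k * B k * minor m c k x"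
  using tri_minor[OF s k tri_in[OF t x]] tri_minor[OF t k x] by simp
qed

lemma tri_inv:
 assumes t: "tri t A"
 shows "tri (inv t) (\<lambda>k. 1 / A k)"
 unfolding tri_def
proof (intro conjI ballI)
 have rr: "r \<in> {1..r}" using r2 by simp
 note b = tri_bij[OF t]
 have i: "inv t (t x) = x" "t (inv t x) = x" for x
  using b by (auto simp: bij_is_inj bij_is_surj surj_f_inv_f)
 show l: "linear (inv t)"
  using tri_linear[OF t] b by (simp add: bij_is_inj inj_linear_imp_inv_linear)
 show "bij (inv t)" using b by (rule bij_imp_bij_inv)
 show im: "inv t ` \<Omega> = \<Omega>"
  using tri_image[OF t] b by (metis bij_is_inj image_inv_f_f)
 have "scales (inv t) (1 / A r powr (- (real DIM('a) / real r)))"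
  by (rule scales_inverse[OF tri_scales[OF t] tri_linear[OF t] l i])
 then show "scales (inv t) ((1 / A r) powr (- (real DIM('a) / real r)))"
  using tri_pos[OF t rr] by (simp add: powr_divide)
 fix k assume k: "k \<in> {1..r}"
 show "1 / A k > 0" using tri_pos[OF t k] by simp
 fix x assume x: "x \<in> \<Omega>"
 then have "inv t x \<in> \<Omega>" using im by blast
 from tri_minor[OF t k this] i show "minor m c k (inv t x) = 1 / A k * minor m c k x"
  using tri_pos[OF t k] by simp
qed

text \<open>The flow of L(c_i) changes ln of the k-th minor at rate (c_i|u_k), which is 1 for i
  \<le> k and 0 otherwise.\<close>

lemma tri_Dg:
 assumes i: "i \<in> {1..r}"
 shows "tri (Dg (c i) t) (\<lambda>k. if i \<le> k then exp t else 1)"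
proof -
 note ci = c_idem[OF i]
 have inv: "Dg (c i) (- t) (Dg (c i) t x) = x" "Dg (c i) t (Dg (c i) (- t) x) = x" for x
  using Dg_inv[OF ci, of t x] Dg_inv[OF ci, of "- t" x] by auto
 have rate1: "rate (m (c i)) (uu k) (if i \<le> k then 1 else 0)" if "k \<le> r" for k
  using rate_mult_1[OF uu_idem[OF that], of "c i"] rate_mult_0[OF uu_idem[OF that], of "c i"]
   uu_c[OF that i] inner_c_uu[OF i that] by auto
 have ratee: "rate (m (c i)) e 1" using rate1[of r] i by (simp add: uu_r)
 have D0: "Dg (c i) 0 x = x" for x by (simp add: Dg_def peirce_sum)
 have stay: "Dg (c i) s x \<in> \<Omega>" if "x \<in> \<Omega>" for x s
  using flow_stays[OF linear_mult ratee, of "\<lambda>s. Dg (c i) s x"] Dg_flow[OF ci] that by (simp add: D0)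
 show ?thesis
  unfolding tri_def
 proof (intro conjI ballI)
  show "linear (Dg (c i) t)" by (rule linear_Dg)
  show "bij (Dg (c i) t)" by (rule o_bij[of "Dg (c i) (- t)"]) (auto simp: fun_eq_iff inv)
  show "Dg (c i) t ` \<Omega> = \<Omega>"
   using stay inv by (auto simp: image_iff) (metis)
  show "scales (Dg (c i) t) ((if i \<le> r then exp t else 1) powr (- (real DIM('a) / real r)))"
   using scales_Dg[OF ci, of t] trace_c[OF i] i by (simp add: powr_def mult.commute)
  fix k assume k: "k \<in> {1..r}"
  show "0 < (if i \<le> k then exp t else 1)" by simp
  fix x assume x: "x \<in> \<Omega>"
  have "jdet_in m (uu k) (pE1 (uu k) (Dg (c i) t x)) = exp ((if i \<le> k then 1 else 0) * t) * jdet_in m (uu k) (pE1 (uu k) x)"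
   using flow_det[OF linear_mult ratee uu_idem rate1, of k "\<lambda>s. Dg (c i) s x"] Dg_flow[OF ci] x k by (simp add: D0)
  then show "minor m c k (Dg (c i) t x) = (if i \<le> k then exp t else 1) * minor m c k x"
   using k by (simp add: minor_eq)
 qed
qed

text \<open>The condition that \<open>uu j\<close> fixes \<open>z\<close> makes \<open>z\<close>
  couple \<open>c j\<close> only to earlier frame elements. Then the flow lies inside
  \<open>V1 (uu k)\<close> in the sense of \<open>rate_Nlp_1\<close> when k \<ge> j, and is
  invisible to the k-th minor when k < j.\<close>

lemma tri_Tu:
 assumes j: "j \<in> {1..r}" and z: "c j \<odot> z = (1/2) *\<^sub>R z" and uz: "uu j \<odot> z = z"
 shows "tri (Tu (c j) z) (\<lambda>k. 1)"
proof -
 note cj = c_idem[OF j]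
 have z': "c j \<odot> (- z) = (1/2) *\<^sub>R (- z)" using z by (simp add: minus_r)
 have inv: "Tu (c j) (- z) (Tu (c j) z x) = x" "Tu (c j) z (Tu (c j) (- z) x) = x" for x
  using Tu_inv[OF cj z, of x] Tu_inv[OF cj z', of x] by auto
 have rate1: "rate (Nlp (c j) z) (uu k) 0" if k: "k \<le> r" for k
 proof (cases "j \<le> k")
  case True
  have "uu k \<odot> z = z"
   using V1_mono[OF uu_idem[OF k] uu_idem uu_uu[OF True k]] uz j by (auto simp: V1_def)
  then show ?thesis using rate_Nlp_1[OF cj z uu_idem[OF k]] uu_c[OF k j] True by simp
 next
  case False
  then show ?thesis using rate_Nlp_0[OF cj z uu_idem[OF k]] uu_c[OF k j] by simp
 qed
 have ratee: "rate (Nlp (c j) z) e 0" using rate1[of r] by (simp add: uu_r)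
 have T0: "Tu (c j) 0 x = x" for x using Tu_scale[of "c j" 0 z x] by simp
 have stay: "Tu (c j) (s *\<^sub>R z) x \<in> \<Omega>" if "x \<in> \<Omega>" for x s
  using flow_stays[OF linear_Nlp ratee, of "\<lambda>s. Tu (c j) (s *\<^sub>R z) x"] Tu_flow[OF cj z] that by (simp add: T0)
 have st: "Tu (c j) z x \<in> \<Omega>" "Tu (c j) (- z) x \<in> \<Omega>" if "x \<in> \<Omega>" for x
  using stay[OF that, of 1] stay[OF that, of "-1"] by auto
 show ?thesis
  unfolding tri_def
 proof (intro conjI ballI)
  show "linear (Tu (c j) z)" by (rule linear_Tu)
  show "bij (Tu (c j) z)" by (rule o_bij[of "Tu (c j) (- z)"]) (auto simp: fun_eq_iff inv)
  show "Tu (c j) z ` \<Omega> = \<Omega>"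
   using st inv by (auto simp: image_iff) (metis)
  show "scales (Tu (c j) z) (1 powr (- (real DIM('a) / real r)))"
   using scales_Tu[OF cj z] by simp
  fix k assume k: "k \<in> {1..r}"
  show "0 < (1::real)" by simp
  fix x assume x: "x \<in> \<Omega>"
  have "jdet_in m (uu k) (pE1 (uu k) (Tu (c j) (1 *\<^sub>R z) x)) = exp (0 * 1) * jdet_in m (uu k) (pE1 (uu k) (Tu (c j) (0 *\<^sub>R z) x))"
   using k x
   by (intro flow_det[where x = "\<lambda>s. Tu (c j) (s *\<^sub>R z) x", OF linear_Nlp ratee uu_idem rate1 Tu_flow[OF cj z]])
    (auto simp: T0)
  then show "minor m c k (Tu (c j) z x) = 1 * minor m c k x"
   using k by (simp add: minor_eq T0)
 qed
qed

subsection \<open>Transitivity by Gauss elimination\<close>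

text \<open>A decomposition within \<open>V1 d\<close> has (d|d) = 1 members, so the space is a
  line.\<close>

lemma prim_V1:
 assumes c: "prim_idem m d" and x: "d \<odot> x = x"
 shows "x = inner x d *\<^sub>R d"
proof -
 obtain k l f where J: "jspec m d x k l f" using ex_jspec[OF prim_idem_idem[OF c] x] by blast
 have "real k = inner d d"
  using jspec_inner_sum2[OF J, of "\<lambda>_. 1" "\<lambda>_. 1"] jspec_sums(1)[OF J] by simp
 then have k: "k = 1" using prim_idem_norm[OF c] by simp
 then have "f 0 = d" "x = l 0 *\<^sub>R f 0" using jspec_sums[OF J] by auto
 then show ?thesis using prim_idem_norm[OF c] by simp
qed

definition tl_sum :: "nat => (nat => real) => 'a" where
 "tl_sum k \<alpha> = (\<Sum>l\<in>{k<..r}. \<alpha> l *\<^sub>R c l)"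

text \<open>The state of the elimination: beyond index \<open>k\<close> the element is already
  diagonal, the rest lives in the block \<open>V1 (uu k)\<close>.\<close>

definition red :: "nat => 'a => bool" where
 "red k x \<longleftrightarrow> (\<exists>\<alpha>. uu k \<odot> (x - tl_sum k \<alpha>) = x - tl_sum k \<alpha>)"

lemma Dg_c: "i \<in> {1..r} ==> l \<in> {1..r} ==> Dg (c i) t (c l) = (if l = i then exp t *\<^sub>R c i else c l)"
 using Dg_eigen(1)[of "c i" "c i" t] Dg_eigen(3)[of "c i" "c l" t] c_idem[of i] c_orth[of i l]
 by (auto simp: idem_def)

lemma Dg_diag:
 assumes comp: "\<And>s t. R s ==> R t ==> R (\<lambda>x. s (t x))"
  and dg: "\<And>i t. i \<in> {1..r} ==> R (Dg (c i) t)"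
  and \<alpha>: "\<And>l. l \<in> {1..r} ==> \<alpha> l > 0" and one: "\<And>l. l \<in> {j<..r} ==> \<alpha> l = 1" and j: "j \<le> r"
 shows "\<exists>s. R s \<and> s (\<Sum>l=1..r. \<alpha> l *\<^sub>R c l) = e"
 using \<alpha> one j
proof (induction j arbitrary: \<alpha>)
 case 0
 have "(\<Sum>l=1..r. \<alpha> l *\<^sub>R c l) = e"
  using 0 unfolding uu_r[symmetric] uu_def by (intro sum.cong) auto
 moreover have "Dg (c 1) 0 e = e" by (simp add: Dg_def peirce_sum)
 moreover have "R (Dg (c 1) 0)" using dg r2 by simp
 ultimately show ?case by metis
next
 case (Suc j)
 let ?i = "Suc j"
 have i: "?i \<in> {1..r}" using Suc by simp
 have "Dg (c ?i) (- ln (\<alpha> ?i)) (\<Sum>l=1..r. \<alpha> l *\<^sub>R c l) = (\<Sum>l=1..r. (\<alpha>(?i := 1)) l *\<^sub>R c l)"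
  unfolding linear_sum[OF linear_Dg] linear_scale[OF linear_Dg]
  using Suc.prems(1)[OF i] i by (intro sum.cong) (auto simp: Dg_c exp_minus)
 moreover obtain s where s: "R s" "s (\<Sum>l=1..r. (\<alpha>(?i := 1)) l *\<^sub>R c l) = e"
 proof -
  have "(\<alpha>(?i := 1)) l > 0" if "l \<in> {1..r}" for l using Suc.prems(1)[OF that] by simp
  moreover have "(\<alpha>(?i := 1)) l = 1" if "l \<in> {j<..r}" for l
   using that Suc.prems(2)[of l] by (cases "l = ?i") auto
  moreover have "j \<le> r" using Suc.prems(3) by simp
  ultimately show ?thesis using Suc.IH[of "\<alpha>(?i := 1)"] that by blast
 qed
 ultimately have "s (Dg (c ?i) (- ln (\<alpha> ?i)) (\<Sum>l=1..r. \<alpha> l *\<^sub>R c l)) = e" by simp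
 then show ?case using comp[OF s(1) dg[OF i, of "- ln (\<alpha> ?i)"]] by blast
qed

text \<open>Gauss elimination from the last index downwards, followed by rescaling of the diagonal
  to \<open>e\<close>. The class \<open>R\<close> of admissible maps is left abstract because the
  scheme runs once with triangular maps and once with their adjoints.\<close>

lemma eliminate:
 assumes comp: "\<And>s t. R s ==> R t ==> R (\<lambda>x. s (t x))"
  and Om: "\<And>s x. R s ==> x \<in> \<Omega> ==> s x \<in> \<Omega>"
  and dg: "\<And>i t. i \<in> {1..r} ==> R (Dg (c i) t)"
  and el: "\<And>k x. k \<in> {1..r} ==> x \<in> \<Omega> ==> red k x ==>
   \<exists>s. R s \<and> linear s \<and> (\<forall>y. uu k \<odot> y = y \<longrightarrow> uu k \<odot> s y = s y) \<and> (\<forall>l\<in>{k<..r}. s (c l) = c l)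
     \<and> pEh (c k) (s x) = 0"
  and x: "x \<in> \<Omega>" and k: "k \<le> r" and red: "red k x"
 shows "\<exists>s. R s \<and> s x = e"
 using x k red
proof (induction k arbitrary: x)
 case 0
 then obtain \<alpha> where "uu 0 \<odot> (x - tl_sum 0 \<alpha>) = x - tl_sum 0 \<alpha>" by (auto simp: red_def)
 moreover have "{0<..r} = {1..r}" by auto
 ultimately have xs: "x = (\<Sum>l=1..r. \<alpha> l *\<^sub>R c l)" by (simp add: uu_def tl_sum_def)
 have "\<alpha> l > 0" if l: "l \<in> {1..r}" for l
 proof -
  have "inner x (c l) = (\<Sum>i=1..r. if i = l then \<alpha> l else 0)"
   unfolding xs inner_sum_left using l by (intro sum.cong) (auto simp: inner_cc)
  then have "inner x (c l) = \<alpha> l" using l by simp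
  moreover have "c l \<noteq> 0" using c_prim[OF l] by (simp add: prim_idem_def)
  ultimately show ?thesis using \<Omega>_inner_pos[OF 0(1) idem_in_Q[OF c_idem[OF l]]] by simp
 qed
 note \<alpha> = this
 show ?case unfolding xs
 proof (rule Dg_diag[where j = r])
  show "R (\<lambda>x. s (t x))" if "R s" "R t" for s t by (rule comp[OF that])
  show "R (Dg (c i) t)" if "i \<in> {1..r}" for i t by (rule dg[OF that])
 qed (use \<alpha> in auto)
next
 case (Suc j)
 let ?k = "Suc j"
 have k: "?k \<in> {1..r}" using Suc by simp
 let ?c = "c ?k"
 note ck = c_idem[OF k]
 obtain \<alpha> where \<alpha>: "uu ?k \<odot> (x - tl_sum ?k \<alpha>) = x - tl_sum ?k \<alpha>"
  using Suc.prems by (auto simp: red_def)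
 obtain s where s: "R s" "linear s" "\<And>y. uu ?k \<odot> y = y ==> uu ?k \<odot> s y = s y"
  "\<And>l. l \<in> {?k<..r} ==> s (c l) = c l" "pEh ?c (s x) = 0"
  using el[OF k Suc.prems(1,3)] by auto
 have stl: "s (tl_sum ?k \<alpha>) = tl_sum ?k \<alpha>"
  unfolding tl_sum_def linear_sum[OF s(2)] linear_scale[OF s(2)] using s(4) by (intro sum.cong) auto
 define y where "y = s x - tl_sum ?k \<alpha>"
 have uy: "uu ?k \<odot> y = y"
  using s(3)[OF \<alpha>] stl by (simp add: y_def linear_diff[OF s(2)])
 have ctl: "?c \<odot> tl_sum ?k \<alpha> = 0"
  unfolding tl_sum_def sum_r using k by (intro sum.neutral) (auto simp: scale_r c_orth)
 have "pEh ?c (tl_sum ?k \<alpha>) = 0" by (simp add: pEh_def ctl)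
 then have yh: "pEh ?c y = 0"
  unfolding y_def linear_diff[OF linear_pEh] using s(5) by simp
 \<comment> \<open>With the half component removed, the corner component is a multiple of
   \<open>c ?k\<close>, as \<open>c ?k\<close> is primitive; it becomes the next diagonal
   entry.\<close>
 define \<beta> where "\<beta> = inner (pE1 ?c y) ?c"
 have y1: "pE1 ?c y = \<beta> *\<^sub>R ?c"
  unfolding \<beta>_def by (rule prim_V1[OF c_prim[OF k] pE1_in[OF ck]])
 have ysum: "y = \<beta> *\<^sub>R ?c + pE0 ?c y" using peirce_sum[of ?c y] yh y1 by simp
 have "tl_sum j (\<alpha>(?k := \<beta>)) = \<beta> *\<^sub>R ?c + tl_sum ?k \<alpha>"
 proof -
  have "{j<..r} = insert ?k {?k<..r}" using k by auto
  then have "tl_sum j (\<alpha>(?k := \<beta>)) = \<beta> *\<^sub>R ?c + (\<Sum>l\<in>{?k<..r}. (\<alpha>(?k := \<beta>)) l *\<^sub>R c l)"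
   by (simp add: tl_sum_def)
  also have "(\<Sum>l\<in>{?k<..r}. (\<alpha>(?k := \<beta>)) l *\<^sub>R c l) = tl_sum ?k \<alpha>"
   unfolding tl_sum_def by (intro sum.cong) auto
  finally show ?thesis .
 qed
 then have sx: "s x - tl_sum j (\<alpha>(?k := \<beta>)) = pE0 ?c y"
  using ysum by (simp add: y_def algebra_simps)
 have "uu ?k \<odot> pE0 ?c y = pE0 ?c y"
 proof -
  have "pE0 ?c y = y - \<beta> *\<^sub>R ?c" using ysum by (simp add: algebra_simps)
  then show ?thesis using uy uu_c[OF _ k, of ?k] Suc.prems by (simp add: diff_r scale_r)
 qed
 moreover have "uu j = uu ?k - ?c" by (simp add: uu_def)
 ultimately have "uu j \<odot> pE0 ?c y = pE0 ?c y"
  using peirce_eigen(3)[OF ck] by (simp add: diff_l)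
 then have "red j (s x)" unfolding red_def using sx by metis
 then obtain s' where s': "R s'" "s' (s x) = e"
  using Suc.IH[OF Om[OF s(1) Suc.prems(1)]] Suc.prems by auto
 then show ?case using comp[OF s'(1) s(1)] by blast
qed

lemma red_r: "red r x"
 by (auto simp: red_def uu_r)

lemma pE0_complement: "pE0 d x = pE1 (e - d) x"
 by (rule euclidean_eqI) (simp add: pE0_def pE1_def lin_simps inner_simps algebra_simps)

text \<open>The 0-component is the compression to e - d, with eigenvalues at least eps; on the half
  space L(e - d) is 1/2, so the form is at least eps |z|^2 / 2.\<close>

lemma pE0_half_pos:
 assumes x: "x \<in> \<Omega>" and d: "idem d" and z: "d \<odot> z = (1/2) *\<^sub>R z" "z \<noteq> 0"
 shows "inner (pE0 d x \<odot> z) z > 0"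
proof -
 obtain eps where eps: "eps > 0" "x - eps *\<^sub>R e \<in> Q" using x by (auto simp: in_\<Omega>_iff)
 have ed: "idem (e - d)" using idem_diff[OF idem_e d] by simp
 obtain k l f where J: "jspec m (e - d) (pE1 (e - d) x) k l f" using compress_ex_spec[OF ed] by blast
 have "0 < eps * (inner z z / 2)" using eps z by simp
 also have "inner z z / 2 = inner ((e - d) \<odot> z) z" using z by (simp add: diff_l inner_simps)
 also have "eps * \<dots> = (\<Sum>i<k. eps * inner (f i \<odot> z) z)"
  by (subst jspec_sums(1)[OF J, symmetric]) (simp add: sum_l inner_sum_left sum_distrib_left)
 also have "\<dots> \<le> (\<Sum>i<k. l i * inner (f i \<odot> z) z)"
  using compress_spec[OF eps(2) J] idem_psd[OF jspec_idem[OF J]] by (intro sum_mono mult_right_mono) auto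
 also have "\<dots> = inner (pE1 (e - d) x \<odot> z) z"
  by (subst jspec_sums(2)[OF J]) (simp add: sum_l scale_l inner_sum_left)
 finally show ?thesis by (simp add: pE0_complement)
qed

text \<open>Only first-order terms can land in the half space: \<open>Nlp\<close> reaches it from
  the 0-space and \<open>Nlp'\<close> from the 1-space, while second-order terms go one step
  further.\<close>

lemma pEh_Tu:
 assumes d: "idem d" and z: "d \<odot> z = (1/2) *\<^sub>R z"
 shows "pEh d (Tu d z x) = pEh d x + 2 *\<^sub>R (z \<odot> pE0 d x)"
  and "pEh d (Tu' d z x) = pEh d x + 2 *\<^sub>R (z \<odot> pE1 d x)"
proof -
 note E = peirce_eigen[OF d, of x]
 note P = Nlp_parts[OF d z] note P' = Nlp'_parts[OF d z]
 let ?N = "Nlp d z" let ?N' = "Nlp' d z"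
 have x: "x = pE1 d x + pEh d x + pE0 d x" by (simp only: peirce_sum)
 have N: "?N x = ?N (pEh d x) + ?N (pE0 d x)"
  using P(1)[OF E(1)] by (subst x) (simp only: linear_add[OF linear_Nlp] add_0)
 have N1: "?N (?N (pEh d x)) = 0" using P(1) conjunct2[OF P(2)[OF E(2)]] by blast
 note h = conjunct2[OF P(2)[OF E(2)]] and o = conjunct2[OF P(3)[OF E(3)]]
 have NN: "?N (?N x) = ?N (?N (pE0 d x))" unfolding N linear_add[OF linear_Nlp] N1 by simp
 have "Tu d z x = (pE1 d x + ?N (pEh d x) + (1/2) *\<^sub>R ?N (?N (pE0 d x))) + (pEh d x + ?N (pE0 d x)) + pE0 d x"
  unfolding Tu_def NN by (subst (1) x) (simp add: N)
 moreover have "d \<odot> (pE1 d x + ?N (pEh d x) + (1/2) *\<^sub>R ?N (?N (pE0 d x))) = pE1 d x + ?N (pEh d x) + (1/2) *\<^sub>R ?N (?N (pE0 d x))"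
  using E(1) h conjunct2[OF P(2)[OF o]] by (simp only: add_r scale_r)
 moreover have "d \<odot> (pEh d x + ?N (pE0 d x)) = (1/2) *\<^sub>R (pEh d x + ?N (pE0 d x))"
  using E(2) o by (simp only: add_r scaleR_add_right)
 ultimately have "pEh d (Tu d z x) = pEh d x + ?N (pE0 d x)"
  using peirce_proj_sum(2)[OF d _ _ E(3)] by metis
 then show "pEh d (Tu d z x) = pEh d x + 2 *\<^sub>R (z \<odot> pE0 d x)" using conjunct1[OF P(3)[OF E(3)]] by simp
 have N': "?N' x = ?N' (pE1 d x) + ?N' (pEh d x)"
  using P'(1)[OF E(3)] by (subst x) (simp only: linear_add[OF linear_Nlp'] add_0_right)
 have N1': "?N' (?N' (pEh d x)) = 0" using P'(1) conjunct2[OF P'(2)[OF E(2)]] by blast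
 note h' = conjunct2[OF P'(2)[OF E(2)]] and o' = conjunct2[OF P'(3)[OF E(1)]]
 have NN': "?N' (?N' x) = ?N' (?N' (pE1 d x))" unfolding N' linear_add[OF linear_Nlp'] N1' by simp
 have "Tu' d z x = pE1 d x + (pEh d x + ?N' (pE1 d x)) + (pE0 d x + ?N' (pEh d x) + (1/2) *\<^sub>R ?N' (?N' (pE1 d x)))"
  unfolding Tu'_def NN' by (subst (1) x) (simp add: N')
 moreover have "d \<odot> (pE0 d x + ?N' (pEh d x) + (1/2) *\<^sub>R ?N' (?N' (pE1 d x))) = 0"
  using E(3) h' conjunct2[OF P'(2)[OF o']] by (simp add: add_r scale_r)
 moreover have "d \<odot> (pEh d x + ?N' (pE1 d x)) = (1/2) *\<^sub>R (pEh d x + ?N' (pE1 d x))"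
  using E(2) o' by (simp only: add_r scaleR_add_right)
 ultimately have "pEh d (Tu' d z x) = pEh d x + ?N' (pE1 d x)"
  using peirce_proj_sum(2)[OF d E(1)] by metis
 then show "pEh d (Tu' d z x) = pEh d x + 2 *\<^sub>R (z \<odot> pE1 d x)" using conjunct1[OF P'(3)[OF E(1)]] by simp
qed

lemma Tu_preserves:
 assumes u: "idem u" and d: "u \<odot> d = d" and z: "u \<odot> z = z"
 shows "u \<odot> y = y ==> u \<odot> Tu d z y = Tu d z y" "u \<odot> y = y ==> u \<odot> Tu' d z y = Tu' d z y"
proof -
 have N: "u \<odot> Nlp d z y = Nlp d z y" "u \<odot> Nlp' d z y = Nlp' d z y" if "u \<odot> y = y" for y
  using peirce_11[OF u z that] peirce_11[OF u d that]
   peirce_11[OF u z peirce_11[OF u d that]] peirce_11[OF u d peirce_11[OF u z that]]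
  by (simp_all add: Nlp_def Nlp'_def lin_simps)
 show "u \<odot> y = y ==> u \<odot> Tu d z y = Tu d z y" "u \<odot> y = y ==> u \<odot> Tu' d z y = Tu' d z y"
  by (simp_all add: Tu_def Tu'_def add_r scale_r N)
qed

lemma Tu_fixes:
 assumes u: "idem u" and d: "u \<odot> d = d" and z: "u \<odot> z = z" and y: "u \<odot> y = 0"
 shows "Tu d z y = y" "Tu' d z y = y"
 using peirce_10[OF u d y] peirce_10[OF u z y]
 by (simp_all add: Tu_def Tu'_def Nlp_def Nlp'_def)

lemma red_half:
 assumes k: "k \<in> {1..r}" and red: "red k x"
 shows "uu k \<odot> pEh (c k) x = pEh (c k) x"
proof -
 have u: "idem (uu k)" and uc: "uu k \<odot> c k = c k" using k uu_idem uu_c[of k k] by auto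
 obtain \<alpha> where \<alpha>: "uu k \<odot> (x - tl_sum k \<alpha>) = x - tl_sum k \<alpha>"
  using red by (auto simp: red_def)
 have "c k \<odot> tl_sum k \<alpha> = 0"
  unfolding tl_sum_def sum_r using k by (intro sum.neutral) (auto simp: scale_r c_orth)
 then have "pEh (c k) x = pEh (c k) (x - tl_sum k \<alpha>)" by (simp add: pEh_def diff_r)
 then show ?thesis
  using peirce_11[OF u uc \<alpha>] peirce_11[OF u uc peirce_11[OF u uc \<alpha>]] by (simp add: pEh_def lin_simps)
qed

lemma red_mult:
 assumes k: "k \<in> {1..r}" and red: "red k x" and z: "uu k \<odot> z = z"
 shows "uu k \<odot> (pE0 (c k) x \<odot> z) = pE0 (c k) x \<odot> z"
proof -
 have u: "idem (uu k)" and uc: "uu k \<odot> c k = c k" using k uu_idem uu_c[of k k] by auto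
 obtain \<alpha> where \<alpha>: "uu k \<odot> (x - tl_sum k \<alpha>) = x - tl_sum k \<alpha>"
  using red by (auto simp: red_def)
 let ?y = "x - tl_sum k \<alpha>"
 have ct: "c k \<odot> tl_sum k \<alpha> = 0"
  unfolding tl_sum_def sum_r using k by (intro sum.neutral) (auto simp: scale_r c_orth)
 have "uu k \<odot> tl_sum k \<alpha> = 0"
  unfolding tl_sum_def sum_r using k by (intro sum.neutral) (auto simp: scale_r uu_c)
 then have tz: "tl_sum k \<alpha> \<odot> z = 0" using peirce_10[OF u z] comm[of "tl_sum k \<alpha>" z] by simp
 have "pE0 (c k) x = pE0 (c k) ?y + tl_sum k \<alpha>" using ct by (simp add: pE0_def diff_r)
 then have "pE0 (c k) x \<odot> z = pE0 (c k) ?y \<odot> z" by (simp add: add_l tz)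
 moreover have "uu k \<odot> pE0 (c k) ?y = pE0 (c k) ?y"
  using \<alpha> peirce_11[OF u uc \<alpha>] peirce_11[OF u uc peirce_11[OF u uc \<alpha>]] by (simp add: pE0_def lin_simps)
 ultimately show ?thesis using peirce_11[OF u _ z] by simp
qed

text \<open>For \<open>Tu\<close> the equation 2 z x_0 = -x_half is solvable because multiplication
  by x_0 is definite, hence injective and therefore onto, on the finite-dimensional space
  \<open>W\<close>. For \<open>Tu'\<close> the relevant component is a c_k with a > 0, and the
  solution is explicit.\<close>

lemma elim_step:
 assumes k: "k \<in> {1..r}" and x: "x \<in> \<Omega>" and red: "red k x"
 shows "\<exists>z. c k \<odot> z = (1/2) *\<^sub>R z \<and> uu k \<odot> z = z \<and> pEh (c k) (Tu (c k) z x) = 0"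
  and "\<exists>z. c k \<odot> z = (1/2) *\<^sub>R z \<and> uu k \<odot> z = z \<and> pEh (c k) (Tu' (c k) z x) = 0"
proof -
 note ck = c_idem[OF k]
 define W where "W = {z. c k \<odot> z = (1/2) *\<^sub>R z \<and> uu k \<odot> z = z}"
 have sW: "subspace W" by (auto simp: subspace_def W_def lin_simps algebra_simps)
 have hW: "pEh (c k) x \<in> W"
  using red_half[OF k red] peirce_eigen(2)[OF ck] by (simp add: W_def)
 let ?f = "m (pE0 (c k) x)"
 have fW: "?f ` W \<subseteq> W"
  using red_mult[OF k red] peirce_0h[OF ck peirce_eigen(3)[OF ck]] by (auto simp: W_def)
 have inj: "inj_on ?f (span W)"
 proof (rule inj_onI)
  fix a b assume ab: "a \<in> span W" "b \<in> span W" "?f a = ?f b"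
  then have "a - b \<in> W" using sW by (metis span_eq_iff subspace_diff)
  moreover have "?f (a - b) = 0" using ab by (simp add: diff_r)
  ultimately show "a = b"
   using pE0_half_pos[OF x ck, of "a - b"] by (force simp: W_def)
 qed
 have "?f ` W = W"
 proof (rule subspace_dim_equal)
  show "subspace (?f ` W)" by (rule linear_subspace_image[OF linear_mult sW])
  show "dim W \<le> dim (?f ` W)" using dim_image_eq[OF linear_mult inj] by simp
 qed (use sW fW in auto)
 then obtain z where z: "z \<in> W" "pE0 (c k) x \<odot> z = - ((1/2) *\<^sub>R pEh (c k) x)"
  using hW sW by (metis (no_types, lifting) image_iff subspace_neg subspace_scale)
 have zh: "c k \<odot> z = (1/2) *\<^sub>R z" and zu: "uu k \<odot> z = z" using z by (auto simp: W_def)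
 have "pEh (c k) (Tu (c k) z x) = 0"
  unfolding pEh_Tu(1)[OF ck zh] comm[of z "pE0 (c k) x"] z(2) by simp
 then show "\<exists>z. c k \<odot> z = (1/2) *\<^sub>R z \<and> uu k \<odot> z = z \<and> pEh (c k) (Tu (c k) z x) = 0"
  using zh zu by blast
 define a where "a = inner (pE1 (c k) x) (c k)"
 have x1: "pE1 (c k) x = a *\<^sub>R c k"
  unfolding a_def by (rule prim_V1[OF c_prim[OF k] pE1_in[OF ck]])
 have "inner (c k) (pE1 (c k) x) = inner (c k) x" using inner_pE1[OF ck, of "c k" x] ck by (simp add: idem_def)
 moreover have "c k \<noteq> 0" using c_prim[OF k] by (simp add: prim_idem_def)
 ultimately have a: "a > 0"
  using \<Omega>_inner_pos[OF x idem_in_Q[OF ck]] by (simp add: a_def inner_commute)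
 define y where "y = (- (1 / a)) *\<^sub>R pEh (c k) x"
 have "y \<in> W" unfolding y_def by (rule subspace_scale[OF sW hW])
 then have yh: "c k \<odot> y = (1/2) *\<^sub>R y" and yu: "uu k \<odot> y = y" by (auto simp: W_def)
 have "pEh (c k) (Tu' (c k) y x) = pEh (c k) x + a *\<^sub>R y"
  unfolding pEh_Tu(2)[OF ck yh] x1 scale_r comm[of y "c k"] yh by simp
 also have "\<dots> = 0" using a by (simp add: y_def)
 finally show "\<exists>z. c k \<odot> z = (1/2) *\<^sub>R z \<and> uu k \<odot> z = z \<and> pEh (c k) (Tu' (c k) z x) = 0"
  using yh yu by blast
qed

lemma uu_above: "k \<in> {1..r} ==> l \<in> {k<..r} ==> uu k \<odot> c l = 0"
 using uu_c[of k l] by auto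

theorem tri_transitive:
 assumes "x \<in> \<Omega>"
 obtains t A where "tri t A" "t e = x"
proof -
 define R where "R s \<longleftrightarrow> (\<exists>A. tri s A)" for s
 have "\<exists>s. R s \<and> s x = e"
 proof (rule eliminate[OF _ _ _ _ assms order_refl red_r])
  show "R (\<lambda>x. s (t x))" if "R s" "R t" for s t using that tri_comp unfolding R_def by blast
  show "s x \<in> \<Omega>" if "R s" "x \<in> \<Omega>" for s x using that tri_in unfolding R_def by blast
  show "R (Dg (c i) t)" if "i \<in> {1..r}" for i t using that tri_Dg unfolding R_def by blast
  fix k x assume k: "k \<in> {1..r}" and x: "x \<in> \<Omega>" "red k x"
  obtain z where z: "c k \<odot> z = (1/2) *\<^sub>R z" "uu k \<odot> z = z" "pEh (c k) (Tu (c k) z x) = 0"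
   using elim_step(1)[OF k x] by blast
  have u: "idem (uu k)" "uu k \<odot> c k = c k" using k uu_idem uu_c[of k k] by auto
  show "\<exists>s. R s \<and> linear s \<and> (\<forall>y. uu k \<odot> y = y \<longrightarrow> uu k \<odot> s y = s y) \<and> (\<forall>l\<in>{k<..r}. s (c l) = c l)
     \<and> pEh (c k) (s x) = 0"
   using tri_Tu[OF k z(1,2)] linear_Tu Tu_preserves(1)[OF u z(2)] Tu_fixes(1)[OF u z(2) uu_above[OF k]] z(3)
   unfolding R_def by (intro exI[of _ "Tu (c k) z"]) blast
 qed
 then obtain s A where s: "tri s A" "s x = e" by (auto simp: R_def)
 then have "inv s e = x" using tri_bij[OF s(1)] by (metis bij_is_inj inv_f_f)
 then show ?thesis using that[OF tri_inv[OF s(1)]] by blast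
qed

lemma posspecI:
 assumes "\<And>z. z \<in> Q ==> z \<noteq> 0 ==> inner x z > 0"
 shows "x \<in> \<Omega>"
proof -
 obtain k l d where J: "jspec m e x k l d" using ex_jspec_e by blast
 have "l i > 0" if "i < k" for i
 proof -
  have "d i \<noteq> 0" using jspec_inner_dd[OF J that that] by auto
  then show ?thesis using assms[OF idem_in_Q[OF jspec_idem[OF J that]]] jspec_eigen[OF J that] by simp
 qed
 then show ?thesis using J unfolding posspec_e_iff[symmetric] posspec_def by blast
qed

lemma tri_Q:
 assumes t: "tri t A" and "x \<in> Q"
 shows "t x \<in> Q"
proof -
 have "continuous_on (closure \<Omega>) t"
  using tri_linear[OF t] linear_conv_bounded_linear linear_continuous_on by blast
 then have "t ` closure \<Omega> \<subseteq> closure (t ` \<Omega>)"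
  by (intro image_closure_subset closed_closure closure_subset)
 then show ?thesis using assms(2) tri_image[OF t] closure_\<Omega> by auto
qed

lemma tri_adjoint_in:
 assumes t: "tri t A" and adj: "\<And>x y. inner (t x) y = inner x (s y)" and x: "x \<in> \<Omega>"
 shows "s x \<in> \<Omega>"
proof (rule posspecI)
 fix z assume z: "z \<in> Q" "z \<noteq> 0"
 have "t z \<noteq> 0" using z tri_bij[OF t] tri_linear[OF t] by (metis bij_is_inj injD linear_0)
 then show "inner (s x) z > 0"
  using \<Omega>_inner_pos[OF x tri_Q[OF t z(1)]] adj[of z x] by (simp add: inner_commute)
qed

text \<open>Laplace transforms live in the dual variable, on which the adjoints act. Their
  transitivity is shown by a separate elimination, with \<open>Dg\<close> self-adjoint and
  \<open>Tu'\<close> adjoint to \<open>Tu\<close>.\<close>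

theorem tri_adjoint_transitive:
 assumes "x \<in> \<Omega>"
 obtains t t' A where "tri t A" "\<And>x y. inner (t x) y = inner x (t' y)" "t' e = x"
proof -
 define R where "R s \<longleftrightarrow> (\<exists>t A. tri t A \<and> (\<forall>x y. inner (t x) y = inner x (s y)))" for s
 have "\<exists>s. R s \<and> s x = e"
 proof (rule eliminate[OF _ _ _ _ assms order_refl red_r])
  show "R (\<lambda>x. s (t x))" if s: "R s" and t: "R t" for s t
  proof -
   obtain a A where a: "tri a A" "\<forall>x y. inner (a x) y = inner x (s y)" using s by (auto simp: R_def)
   obtain b B where b: "tri b B" "\<forall>x y. inner (b x) y = inner x (t y)" using t by (auto simp: R_def)
   have "\<forall>x y. inner (b (a x)) y = inner x (s (t y))" using a b by simp
   then show ?thesis using tri_comp[OF b(1) a(1)] unfolding R_def by blast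
  qed
  show "s x \<in> \<Omega>" if "R s" "x \<in> \<Omega>" for s x using that tri_adjoint_in unfolding R_def by blast
  show "R (Dg (c i) t)" if "i \<in> {1..r}" for i t
  proof -
   have "inner (Dg (c i) t x) y = inner x (Dg (c i) t y)" for x y
    by (simp add: Dg_def pE1_def pEh_def pE0_def inner_simps assoc_inner)
   then show ?thesis using tri_Dg[OF that] unfolding R_def by blast
  qed
  fix k x assume k: "k \<in> {1..r}" and x: "x \<in> \<Omega>" "red k x"
  obtain z where z: "c k \<odot> z = (1/2) *\<^sub>R z" "uu k \<odot> z = z" "pEh (c k) (Tu' (c k) z x) = 0"
   using elim_step(2)[OF k x] by blast
  have u: "idem (uu k)" "uu k \<odot> c k = c k" using k uu_idem uu_c[of k k] by auto
  have "R (Tu' (c k) z)" unfolding R_def using tri_Tu[OF k z(1,2)] inner_Tu by blast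
  then show "\<exists>s. R s \<and> linear s \<and> (\<forall>y. uu k \<odot> y = y \<longrightarrow> uu k \<odot> s y = s y) \<and> (\<forall>l\<in>{k<..r}. s (c l) = c l)
     \<and> pEh (c k) (s x) = 0"
   using linear_Tu' Tu_preserves(2)[OF u z(2)] Tu_fixes(2)[OF u z(2) uu_above[OF k]] z(3)
   by (intro exI[of _ "Tu' (c k) z"]) blast
 qed
 then obtain s t A where s: "tri t A" "\<And>x y. inner (t x) y = inner x (s y)" "s x = e"
  by (auto simp: R_def)
 \<comment> \<open>Elimination sends \<open>x\<close> to \<open>e\<close> by the adjoint of
   \<open>t\<close>; the map from \<open>e\<close> to \<open>x\<close> is the adjoint of the
   inverse.\<close>
 define t' where "t' = adjoint (inv t)"
 have adj: "inner (inv t a) b = inner a (t' b)" for a b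
  unfolding t'_def using adjoint_works[OF tri_linear[OF tri_inv[OF s(1)]]] by simp
 have "inner y (t' e) = inner y x" for y
 proof -
  have "inner y (t' e) = inner (inv t y) (s x)" using adj[of y e] s(3) by simp
  also have "\<dots> = inner (t (inv t y)) x" using s(2) by simp
  also have "t (inv t y) = y" using tri_bij[OF s(1)] by (simp add: bij_is_surj surj_f_inv_f)
  finally show ?thesis .
 qed
 then have "t' e = x" using vector_eq_ldot by blast
 then show ?thesis using that[OF tri_inv[OF s(1)] adj] by blast
qed

end

text \<open>Summation by parts. With a_j = ln \<Delta>_j it turns powers of minors into powers
  \<nu>_j of the quotients \<Delta>_j / \<Delta>_{j-1}.\<close>

lemma sum_sdiff:
 fixes \<nu> a :: "nat => real"
 assumes "r \<ge> 1" "a 0 = 0"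
 shows "(\<Sum>j=1..r. sdiff r \<nu> j * a j) = (\<Sum>j=1..r. \<nu> j * (a j - a (j - 1)))"
proof -
 obtain n where r: "r = Suc n" using assms by (cases r) auto
 have "(\<Sum>j=1..n. sdiff r \<nu> j * a j) = (\<Sum>j=1..n. \<nu> j * a j) - (\<Sum>j=1..n. \<nu> (Suc j) * a j)"
  unfolding sum_subtractf[symmetric] by (intro sum.cong) (auto simp: sdiff_def r algebra_simps)
 moreover have "(\<Sum>j=1..r. \<nu> j * (a j - a (j - 1))) = (\<Sum>j=1..r. \<nu> j * a j) - (\<Sum>j=1..r. \<nu> j * a (j - 1))"
  by (simp add: sum_subtractf right_diff_distrib)
 moreover have "(\<Sum>j=1..r. \<nu> j * a (j - 1)) = (\<Sum>j=1..n. \<nu> (Suc j) * a j)"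
 proof -
  have "(\<Sum>j=1..r. \<nu> j * a (j - 1)) = (\<Sum>j=0..n. \<nu> (Suc j) * a j)"
   unfolding r One_nat_def sum.shift_bounds_cl_Suc_ivl by simp
  also have "\<dots> = (\<Sum>j=1..n. \<nu> (Suc j) * a j)"
   using assms(2) by (simp add: sum.atLeast_Suc_atMost)
  finally show ?thesis .
 qed
 ultimately show ?thesis by (simp add: r sdiff_def)
qed

lemma sdiff_add: "sdiff r (\<lambda>j. (a j :: 'b::ab_group_add) + b j) j = sdiff r a j + sdiff r b j"
 by (simp add: sdiff_def)

lemma sdiff_const: "sdiff r (\<lambda>_. (a::'b::ab_group_add)) j = (if j = r then a else 0)"
 by (simp add: sdiff_def)

section \<open>Generalised powers and their characters\<close>

context framed_jordan
begin

abbreviation gp :: "(nat => real) => 'a => real" where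
 "gp \<equiv> gpow m c r"

definition chi :: "(nat => real) => (nat => real) => real" where
 "chi A \<nu> = (\<Prod>j=1..r. A j powr sdiff r \<nu> j)"

lemma gp_pos: "x \<in> \<Omega> ==> gp \<nu> x > 0"
 unfolding gpow_def using minor_pos[of _ x] by (intro prod_pos) force

lemma gp_add: "x \<in> \<Omega> ==> gp (\<lambda>j. a j + b j) x = gp a x * gp b x"
 unfolding gpow_def sdiff_add prod.distrib[symmetric] by (intro prod.cong refl powr_add)

lemma gp_const: "gp (\<lambda>_. a) x = jdet_in m e x powr a" if "x \<in> \<Omega>"
proof -
 have "gp (\<lambda>_. a) x = (\<Prod>j=1..r. if j = r then jdet_in m e x powr a else 1)"
  unfolding gpow_def sdiff_const using minor_pos[of _ x] that minor_r[of x]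
  by (intro prod.cong refl) (auto simp: less_imp_neq[THEN not_sym])
 then show ?thesis using r2 by simp
qed

lemma gp_jdet: "x \<in> \<Omega> ==> gp \<nu> x * jdet_in m e x powr a = gp (\<lambda>j. \<nu> j + a) x"
 using gp_add[of x \<nu> "\<lambda>_. a"] gp_const by simp

lemma chi_add: "tri t A ==> chi A (\<lambda>j. a j + b j) = chi A a * chi A b"
 unfolding chi_def sdiff_add prod.distrib[symmetric] by (intro prod.cong refl powr_add)

lemma chi_pos: "tri t A ==> chi A \<nu> > 0"
 unfolding chi_def using tri_pos[of t A] by (intro prod_pos) force

lemma chi_const: "tri t A ==> chi A (\<lambda>_. a) = A r powr a"
proof -
 assume t: "tri t A"
 have "chi A (\<lambda>_. a) = (\<Prod>j=1..r. if j = r then A r powr a else 1)"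
  unfolding chi_def sdiff_const using tri_pos[OF t] by (intro prod.cong refl) (auto simp: less_imp_neq[THEN not_sym])
 then show ?thesis using r2 by simp
qed

lemma gp_tri: "tri t A ==> x \<in> \<Omega> ==> gp \<nu> (t x) = chi A \<nu> * gp \<nu> x"
 unfolding gpow_def chi_def prod.distrib[symmetric]
 by (intro prod.cong refl) (auto simp: tri_minor powr_mult)

lemma convex_on_neg_ldu:
 assumes u: "idem u"
 shows "convex_on \<Omega> (\<lambda>x. - ldu u x)"
proof (rule convex_onI)
 fix t :: real and x y assume t: "0 < t" "t < 1" and xy: "x \<in> \<Omega>" "y \<in> \<Omega>"
 define w where "w = (1 - t) *\<^sub>R x + t *\<^sub>R y"
 have w: "w \<in> \<Omega>" unfolding w_def using convex_\<Omega> xy t by (simp add: convex_alt)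
 obtain v where v: "is_inv u w v" using ex_is_inv[OF w u] .
 have "(1 - t) * (ldu u x - ldu u w) + t * (ldu u y - ldu u w) \<le> (1 - t) * inner v (x - w) + t * inner v (y - w)"
  using t ldu_tangent[OF xy(1) v] ldu_tangent[OF xy(2) v] by (intro add_mono mult_left_mono) auto
 also have "\<dots> = inner v ((1 - t) *\<^sub>R (x - w) + t *\<^sub>R (y - w))" by (simp add: inner_simps)
 also have "(1 - t) *\<^sub>R (x - w) + t *\<^sub>R (y - w) = 0"
  unfolding w_def by (rule euclidean_eqI) (simp add: inner_simps algebra_simps)
 finally show "- ldu u ((1 - t) *\<^sub>R x + t *\<^sub>R y) \<le> (1 - t) * - ldu u x + t * - ldu u y"
  unfolding w_def[symmetric] by (simp add: algebra_simps)
qed (rule convex_\<Omega>)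

text \<open>The supergradient inequality makes -ln of the minor convex, and convex functions on an
  open set are continuous; no polynomial formula for the minor is involved.\<close>

lemma continuous_minor: "k \<le> r ==> continuous_on \<Omega> (minor m c k)"
proof -
 assume k: "k \<le> r"
 have "continuous_on \<Omega> (\<lambda>x. - ldu (uu k) x)"
  by (rule convex_on_continuous[OF open_\<Omega> convex_on_neg_ldu[OF uu_idem[OF k]]])
 then have "continuous_on \<Omega> (\<lambda>x. exp (- (- ldu (uu k) x)))"
  by (rule continuous_on_exp[OF continuous_on_minus])
 moreover have "exp (- (- ldu (uu k) x)) = minor m c k x" if "x \<in> \<Omega>" for x
  using minor_pos[OF k that] by (simp add: ldu_def minor_eq[OF k])
 ultimately show ?thesis by (simp cong: continuous_on_cong)
qed

lemma continuous_gp: "continuous_on \<Omega> (gp \<nu>)"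
 unfolding gpow_def
 by (intro continuous_on_prod continuous_on_powr continuous_minor continuous_on_const)
  (auto simp: less_imp_neq[OF minor_pos, THEN not_sym])

lemma meas_\<Omega> [measurable]: "\<Omega> \<in> sets borel"
 using open_\<Omega> by simp

lemma meas_Q [measurable]: "Q \<in> sets borel"
 using closed_Q by simp

lemma meas_gp: "(\<lambda>x. indicator \<Omega> x * gp \<nu> x) \<in> borel_measurable borel"
 using borel_measurable_continuous_on_indicator[OF meas_\<Omega> continuous_gp[of \<nu>]] by simp

lemma meas_gp_enn [measurable]: "(\<lambda>x. indicator \<Omega> x * ennreal (gp \<nu> x)) \<in> borel_measurable borel"
proof -
 have "(\<lambda>x. ennreal (indicator \<Omega> x * gp \<nu> x)) \<in> borel_measurable borel"
  using meas_gp by measurable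
 moreover have "ennreal (indicator \<Omega> x * gp \<nu> x) = indicator \<Omega> x * ennreal (gp \<nu> x)" for x
  by (simp add: indicator_def)
 ultimately show ?thesis by simp
qed

lemma tri_in_iff: "tri t A ==> t x \<in> \<Omega> \<longleftrightarrow> x \<in> \<Omega>"
 using tri_image[of t A] tri_bij[of t A] by (metis bij_is_inj inj_image_mem_iff)

text \<open>The density contributes \<open>chi A \<nu>\<close>; the Jacobian is the inverse of the
  character of constant weight n/r, hence the shift by n/r.\<close>

lemma tri_nn_integral:
 assumes t: "tri t A" and f: "f \<in> borel_measurable borel"
 shows "(\<integral>\<^sup>+x. indicator \<Omega> x * ennreal (gp \<nu> x) * f (t x) \<partial>lborel)
  = ennreal (1 / chi A (\<lambda>j. \<nu> j + (real DIM('a) / real r))) * (\<integral>\<^sup>+x. indicator \<Omega> x * ennreal (gp \<nu> x) * f x \<partial>lborel)"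
proof -
 let ?F = "\<lambda>x. indicator \<Omega> x * ennreal (gp \<nu> x) * f x"
 have Fm: "?F \<in> borel_measurable borel"
  by (intro borel_measurable_times_ennreal meas_gp_enn f)
 have ft: "(\<lambda>x. f (t x)) \<in> borel_measurable borel"
  using measurable_compose[OF borel_measurable_linear[OF tri_linear[OF t]] f] .
 let ?d = "A r powr (- (real DIM('a) / real r))"
 have "ennreal (chi A \<nu>) * (\<integral>\<^sup>+x. indicator \<Omega> x * ennreal (gp \<nu> x) * f (t x) \<partial>lborel)
   = (\<integral>\<^sup>+x. ennreal (chi A \<nu>) * (indicator \<Omega> x * ennreal (gp \<nu> x) * f (t x)) \<partial>lborel)"
  using borel_measurable_times_ennreal[OF meas_gp_enn ft] by (intro nn_integral_cmult[symmetric]) simp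
 also have "\<dots> = (\<integral>\<^sup>+x. ?F (t x) \<partial>lborel)"
 proof (rule nn_integral_cong)
  fix x
  show "ennreal (chi A \<nu>) * (indicator \<Omega> x * ennreal (gp \<nu> x) * f (t x)) = ?F (t x)"
   using tri_in_iff[OF t, of x] gp_tri[OF t, of x \<nu>] chi_pos[OF t, of \<nu>] gp_pos[of x \<nu>]
   by (cases "x \<in> \<Omega>") (simp_all add: ennreal_mult less_imp_le mult.assoc)
 qed
 also have "\<dots> = ennreal ?d * (\<integral>\<^sup>+x. ?F x \<partial>lborel)"
  by (rule scalesD[OF tri_scales[OF t] Fm])
 finally have eq: "ennreal (chi A \<nu>) * (\<integral>\<^sup>+x. indicator \<Omega> x * ennreal (gp \<nu> x) * f (t x) \<partial>lborel)
  = ennreal ?d * (\<integral>\<^sup>+x. ?F x \<partial>lborel)" .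
 have c0: "chi A \<nu> > 0" using chi_pos[OF t] .
 have "(\<integral>\<^sup>+x. indicator \<Omega> x * ennreal (gp \<nu> x) * f (t x) \<partial>lborel)
  = ennreal (1 / chi A \<nu>) * (ennreal (chi A \<nu>) * (\<integral>\<^sup>+x. indicator \<Omega> x * ennreal (gp \<nu> x) * f (t x) \<partial>lborel))"
  using c0 by (simp add: mult.assoc[symmetric] ennreal_mult[symmetric])
 also have "\<dots> = (ennreal (1 / chi A \<nu>) * ennreal ?d) * (\<integral>\<^sup>+x. ?F x \<partial>lborel)"
  unfolding eq by (simp only: mult.assoc)
 also have "ennreal (1 / chi A \<nu>) * ennreal ?d = ennreal (1 / chi A (\<lambda>j. \<nu> j + (real DIM('a) / real r)))"
  using c0 by (simp add: ennreal_mult[symmetric] chi_add[OF t] chi_const[OF t] powr_minus divide_inverse)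
 finally show ?thesis .
qed

text \<open>Homogeneity of degree k of the k-th minor: any decomposition with unit
  \<open>uu k\<close> has (u_k|u_k) = k members.\<close>

lemma tri_scaleR:
 assumes a: "a > 0"
 shows "tri (\<lambda>x. a *\<^sub>R x) (\<lambda>k. a ^ k)"
 unfolding tri_def
proof (intro conjI ballI)
 show "linear (\<lambda>x::'a. a *\<^sub>R x)" by (intro linear_compose_scale_right linear_id[unfolded id_def])
 show "bij ((*\<^sub>R) a :: 'a => 'a)" using less_imp_neq[OF a, THEN not_sym]
  by (intro o_bij[of "\<lambda>x::'a. (1/a) *\<^sub>R x"]) (auto simp: fun_eq_iff)
 show "(*\<^sub>R) a ` \<Omega> = \<Omega>"
 proof
  show "(*\<^sub>R) a ` \<Omega> \<subseteq> \<Omega>" using \<Omega>_scale a by auto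
  show "\<Omega> \<subseteq> (*\<^sub>R) a ` \<Omega>"
  proof
   fix x assume "x \<in> \<Omega>"
   then have "(1/a) *\<^sub>R x \<in> \<Omega>" using \<Omega>_scale[of x "1/a"] a by simp
   moreover have "x = a *\<^sub>R ((1/a) *\<^sub>R x)" using a by simp
   ultimately show "x \<in> (*\<^sub>R) a ` \<Omega>" by blast
  qed
 qed
 have "scales (\<lambda>x::'a. \<Sum>b\<in>Basis. (a * inner x b) *\<^sub>R b) (1 / (\<Prod>b\<in>(Basis::'a set). a))"
  using scales_diagonal_Basis[of "\<lambda>_::'a. a"] a by blast
 moreover have "(\<Sum>b\<in>Basis. (a * inner x b) *\<^sub>R b) = a *\<^sub>R x" for x :: 'a
  using euclidean_representation[of "a *\<^sub>R x"] by simp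
 ultimately have "scales (\<lambda>x::'a. a *\<^sub>R x) (1 / a ^ DIM('a))" by simp
 moreover have "(a ^ r) powr (- (real DIM('a) / real r)) = 1 / a ^ DIM('a)"
 proof -
  have "(a ^ r) powr x = a powr (real r * x)" for x
   by (subst powr_realpow[OF a, symmetric]) (simp add: powr_powr)
  then have "(a ^ r) powr (- (real DIM('a) / real r)) = a powr (real r * - (real DIM('a) / real r))" .
  also have "real r * - (real DIM('a) / real r) = - real DIM('a)" using r2 by simp
  finally show ?thesis using a by (simp add: powr_minus powr_realpow divide_inverse)
 qed
 ultimately show "scales ((*\<^sub>R) a :: 'a => 'a) ((a ^ r) powr (- (real DIM('a) / real r)))" by simp
 fix k assume k: "k \<in> {1..r}"
 show "a ^ k > 0" using a by simp
 fix x assume x: "x \<in> \<Omega>"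
 let ?u = "uu k"
 have kr: "k \<le> r" using k by simp
 obtain n l d where J: "jspec m ?u (pE1 ?u x) n l d" "\<forall>i<n. l i > 0"
  using compress_pos[OF x uu_idem[OF kr]] by (auto simp: posspec_def)
 have J': "jspec m ?u (pE1 ?u (a *\<^sub>R x)) n (\<lambda>i. a * l i) d"
  using J(1) by (auto simp: jspec_def linear_scale[OF linear_pE1] scaleR_sum_right)
 have "real n = inner ?u ?u"
  using jspec_inner_sum2[OF J(1), of "\<lambda>_. 1" "\<lambda>_. 1"] jspec_sums(1)[OF J(1)] by simp
 also have "inner ?u ?u = (\<Sum>i=1..k. inner (c i) ?u)"
  by (subst (1) uu_def) (simp add: inner_sum_left)
 also have "\<dots> = (\<Sum>i=1..k. 1)" using kr by (intro sum.cong) (auto simp: inner_c_uu)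
 finally have "n = k" by simp
 then show "minor m c k (a *\<^sub>R x) = a ^ k * minor m c k x"
  unfolding minor_eq[OF kr] using jdet_eq[OF J] jdet_eq[OF J'] J(2) a by (simp add: prod.distrib)
qed

lemma chi_scaleR:
 assumes a: "a > 0"
 shows "chi (\<lambda>k. a ^ k) \<nu> = a powr (\<Sum>j=1..r. \<nu> j)"
proof -
 have "chi (\<lambda>k. a ^ k) \<nu> = (\<Prod>j=1..r. a powr (sdiff r \<nu> j * real j))"
  unfolding chi_def using a by (intro prod.cong refl) (simp add: powr_powr powr_realpow[symmetric] mult.commute)
 also have "\<dots> = a powr (\<Sum>j=1..r. sdiff r \<nu> j * real j)" using a by (simp add: powr_sum)
 also have "(\<Sum>j=1..r. sdiff r \<nu> j * real j) = (\<Sum>j=1..r. \<nu> j * (real j - real (j - 1)))"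
  using r2 by (intro sum_sdiff) auto
 also have "\<dots> = (\<Sum>j=1..r. \<nu> j)" by (intro sum.cong) auto
 finally show ?thesis .
qed

text \<open>Hadamard's inequality for the k-th compression, tested on the idempotents that
  diagonalise the (k-1)-st one together with \<open>c k\<close>.\<close>

lemma minor_ratio:
 assumes k: "k \<in> {1..r}" and x: "x \<in> \<Omega>"
 shows "minor m c k x \<le> minor m c (k - 1) x * inner x (c k)"
proof -
 let ?u = "uu (k - 1)" let ?v = "uu k"
 have k1: "k - 1 \<le> r" and k2: "k \<le> r" using k by auto
 have v: "?v = ?u + c k" using k by (cases k) (auto simp: uu_def)
 obtain n l d where J: "jspec m ?u (pE1 ?u x) n l d" and l: "\<forall>i<n. l i > 0"
  using compress_pos[OF x uu_idem[OF k1]] by (auto simp: posspec_def)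
 have uc: "?u \<odot> c k = 0" using uu_c[OF k1 k] k by auto
 have o: "d i \<odot> c k = 0" "c k \<odot> d i = 0" if "i < n" for i
  using peirce_10[OF uu_idem[OF k1] jspec_V1[OF J that] uc] comm[of "c k" "d i"] by auto
 have J': "jspec m ?v (pE1 ?u x + 0 *\<^sub>R c k) (Suc n) (l(n := 0)) (d(n := c k))"
  using J c_prim[OF k] o v unfolding jspec_def by (auto simp: less_Suc_eq)
 let ?z = "pE1 ?v x"
 have pz: "posspec ?v ?z" by (rule compress_pos[OF x uu_idem[OF k2]])
 have ip: "inner ?z ((d(n := c k)) i) = (if i < n then l i else inner x (c k))" if "i < Suc n" for i
 proof -
  have "inner ?z ((d(n := c k)) i) = inner x ((d(n := c k)) i)"
   using inner_pE1[OF uu_idem[OF k2] jspec_V1[OF J' that]] by (simp add: inner_commute)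
  moreover have "inner x (d i) = l i" if "i < n" for i
   using inner_pE1[OF uu_idem[OF k1] jspec_V1[OF J that]] jspec_eigen[OF J that] by (simp add: inner_commute)
  ultimately show ?thesis using that by (auto simp: less_Suc_eq)
 qed
 have "minor m c k x \<le> (\<Prod>i<Suc n. inner ?z ((d(n := c k)) i))"
  unfolding minor_eq[OF k2] by (rule jdet_hadamard(1)[OF J' pz])
 also have "\<dots> = (\<Prod>i<n. l i) * inner x (c k)"
  using ip[of n] ip by (simp add: prod.lessThan_Suc)
 finally show ?thesis unfolding minor_eq[OF k1] jdet_eq[OF J l] .
qed

lemma minor_0: "minor m c 0 x = 1"
proof -
 have "uu 0 = 0" by (simp add: uu_def)
 moreover have "jspec m 0 (pE1 0 x) 0 (\<lambda>_. 1) (\<lambda>_. 0)" by (simp add: jspec_def pE1_def)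
 ultimately show ?thesis using jdet_eq[of 0 "pE1 0 x" 0] minor_eq[of 0 x] by simp
qed

text \<open>After summation by parts the power is a product of (\<Delta>_j /
  \<Delta>_{j-1})^{\<nu>_j}, and each quotient is at most (x|c_j), which is at most |x|.\<close>

lemma gp_bound:
 assumes x: "x \<in> \<Omega>" and \<nu>: "\<And>j. j \<in> {1..r} ==> \<nu> j \<ge> 0"
 shows "gp \<nu> x \<le> (1 + norm x) powr (\<Sum>j=1..r. \<nu> j)"
proof -
 have mp: "minor m c j x > 0" if "j \<le> r" for j using minor_pos[OF that x] .
 have "ln (gp \<nu> x) = (\<Sum>j=1..r. sdiff r \<nu> j * ln (minor m c j x))"
  unfolding gpow_def using mp by (subst ln_prod) (auto simp: ln_powr less_imp_neq[THEN not_sym])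
 also have "\<dots> = (\<Sum>j=1..r. \<nu> j * (ln (minor m c j x) - ln (minor m c (j - 1) x)))"
  using r2 by (intro sum_sdiff) (auto simp: minor_0)
 also have "\<dots> \<le> (\<Sum>j=1..r. \<nu> j * ln (1 + norm x))"
 proof (intro sum_mono mult_left_mono \<nu>)
  fix j assume j: "j \<in> {1..r}"
  have j1: "j - 1 \<le> r" "j \<le> r" using j by auto
  have "norm (c j) = 1" using inner_cc[OF j j] by (simp add: norm_eq_sqrt_inner)
  then have "inner x (c j) \<le> 1 + norm x"
   using norm_cauchy_schwarz[of x "c j"] by simp
  then have "minor m c j x \<le> minor m c (j - 1) x * (1 + norm x)"
   using minor_ratio[OF j x] mp[OF j1(1)] by (meson less_imp_le mult_left_mono order_trans)
  then have "ln (minor m c j x) \<le> ln (minor m c (j - 1) x * (1 + norm x))"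
   using mp[OF j1(1)] mp[OF j1(2)] by (intro ln_mono) (auto intro!: mult_pos_pos add_pos_nonneg)
  also have "\<dots> = ln (minor m c (j - 1) x) + ln (1 + norm x)"
   using mp[OF j1(1)] by (intro ln_mult_pos) (auto intro: add_pos_nonneg)
  finally show "ln (minor m c j x) - ln (minor m c (j - 1) x) \<le> ln (1 + norm x)" by simp
 qed
 also have "\<dots> = ln ((1 + norm x) powr (\<Sum>j=1..r. \<nu> j))"
  by (simp add: ln_powr sum_distrib_right add_nonneg_eq_0_iff)
 finally show ?thesis
  using gp_pos[OF x, of \<nu>] by (subst (asm) ln_le_cancel_iff) (auto simp: add_nonneg_eq_0_iff)
qed

end

subsection \<open>Smooth functions\<close>

definition smooth1 :: "(real => real) => bool" where
 "smooth1 g \<longleftrightarrow> (\<exists>G. G 0 = g \<and> (\<forall>k x. (G k has_real_derivative G (Suc k) x) (at x)))"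

lemma smooth1_deriv:
 assumes "smooth1 g"
 obtains g' where "smooth1 g'" "\<And>x. (g has_real_derivative g' x) (at x)"
proof -
 obtain G where G: "G 0 = g" "\<And>k x. (G k has_real_derivative G (Suc k) x) (at x)"
  using assms by (auto simp: smooth1_def)
 have "smooth1 (G 1)" unfolding smooth1_def using G(2) by (intro exI[of _ "\<lambda>k. G (Suc k)"]) auto
 then show ?thesis using that[of "G 1"] G(1) G(2)[of 0] by simp
qed

text \<open>A class given by closure rules and stable under directional derivatives; this stability
  is what coinduction for \<open>smooth_fun\<close> asks for.\<close>

inductive Sm :: "('a::euclidean_space => real) => bool" where
 Sm_const: "Sm (\<lambda>_. a)"
| Sm_linear: "linear f ==> Sm f"
| Sm_add: "Sm f ==> Sm g ==> Sm (\<lambda>x. f x + g x)"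
| Sm_mult: "Sm f ==> Sm g ==> Sm (\<lambda>x. f x * g x)"
| Sm_comp: "smooth1 h ==> Sm f ==> Sm (\<lambda>x. h (f x))"

lemma Sm_deriv:
 "Sm f ==> \<exists>D. (\<forall>x. (f has_derivative D x) (at x)) \<and> (\<forall>v. Sm (\<lambda>x. D x v))"
proof (induction rule: Sm.induct)
 case (Sm_const a)
 then show ?case by (intro exI[of _ "\<lambda>_ _. 0"]) (auto intro: Sm.Sm_const)
next
 case (Sm_linear f)
 then show ?case by (intro exI[of _ "\<lambda>_. f"]) (auto intro: Sm.Sm_const simp: linear_imp_has_derivative)
next
 case (Sm_add f g)
 then obtain Df Dg where D: "\<And>x. (f has_derivative Df x) (at x)" "\<And>v. Sm (\<lambda>x. Df x v)"
  "\<And>x. (g has_derivative Dg x) (at x)" "\<And>v. Sm (\<lambda>x. Dg x v)" by metis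
 show ?case
  using has_derivative_add[OF D(1) D(3)] Sm.Sm_add[OF D(2) D(4)]
  by (intro exI[of _ "\<lambda>x v. Df x v + Dg x v"]) blast
next
 case (Sm_mult f g)
 then obtain Df Dg where D: "\<And>x. (f has_derivative Df x) (at x)" "\<And>v. Sm (\<lambda>x. Df x v)"
  "\<And>x. (g has_derivative Dg x) (at x)" "\<And>v. Sm (\<lambda>x. Dg x v)" by metis
 show ?case
  using has_derivative_mult[OF D(1) D(3)]
   Sm.Sm_add[OF Sm.Sm_mult[OF Sm_mult.hyps(1) D(4)] Sm.Sm_mult[OF D(2) Sm_mult.hyps(2)]]
  by (intro exI[of _ "\<lambda>x v. f x * Dg x v + Df x v * g x"]) blast
next
 case (Sm_comp h f)
 then obtain Df where D: "\<And>x. (f has_derivative Df x) (at x)" "\<And>v. Sm (\<lambda>x. Df x v)" by metis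
 obtain h' where h': "smooth1 h'" "\<And>x. (h has_real_derivative h' x) (at x)"
  using smooth1_deriv Sm_comp(1) by blast
 have "((\<lambda>x. h (f x)) has_derivative (\<lambda>v. h' (f x) * Df x v)) (at x)" for x
  using has_derivative_compose[OF D(1)[of x] h'(2)[of "f x", unfolded has_field_derivative_def]]
  by (simp add: mult.commute)
 moreover have "Sm (\<lambda>x. h' (f x) * Df x v)" for v
  by (rule Sm.Sm_mult[OF Sm.Sm_comp[OF h'(1) Sm_comp.hyps(2)] D(2)])
 ultimately show ?case by (intro exI[of _ "\<lambda>x v. h' (f x) * Df x v"]) blast
qed

lemma Sm_smooth_fun:
 assumes "Sm f"
 shows "smooth_fun f"
 using assms
proof (coinduction arbitrary: f)
 case (smooth_fun f)
 then obtain D where D: "\<And>x. (f has_derivative D x) (at x)" "\<And>v. Sm (\<lambda>x. D x v)"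
  using Sm_deriv by blast
 then have "frechet_derivative f (at x) = D x" for x
  using frechet_derivative_at by metis
 then show ?case using D by (auto simp: differentiable_def)
qed

lemma Sm_compose_linear: "Sm f ==> linear t ==> Sm (\<lambda>x. f (t x))"
proof (induction rule: Sm.induct)
 case (Sm_linear f)
 then show ?case using Sm.Sm_linear[of "f \<circ> t"] linear_compose[of t f] by (simp add: o_def)
next
 case (Sm_add f g)
 then show ?case using Sm.Sm_add[of "\<lambda>x. f (t x)" "\<lambda>x. g (t x)"] by simp
next
 case (Sm_mult f g)
 then show ?case using Sm.Sm_mult[of "\<lambda>x. f (t x)" "\<lambda>x. g (t x)"] by simp
next
 case (Sm_comp h f)
 then show ?case using Sm.Sm_comp[of h "\<lambda>x. f (t x)"] by simp
qed (rule Sm.Sm_const)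

lemma Sm_sum: "finite S ==> (\<And>i. i \<in> S ==> Sm (f i)) ==> Sm (\<lambda>x. \<Sum>i\<in>S. f i x)"
proof (induction S rule: finite_induct)
 case empty
 then show ?case using Sm_const[of 0] by simp
next
 case (insert i S)
 then show ?case using Sm_add[of "f i" "\<lambda>x. \<Sum>i\<in>S. f i x"] by simp
qed

lemma Sm_inner_left: "Sm (\<lambda>x. inner a x)"
 by (intro Sm_linear linearI) (simp_all add: inner_simps)

lemma Sm_norm_sq: "Sm (\<lambda>x. (norm (x - a))\<^sup>2)"
proof -
 have "Sm (\<lambda>x. \<Sum>b\<in>Basis. (inner b x + - inner b a) * (inner b x + - inner b a))"
  by (rule Sm_sum[OF finite_Basis Sm_mult[OF Sm_add[OF Sm_inner_left Sm_const] Sm_add[OF Sm_inner_left Sm_const]]])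
 moreover have "(\<Sum>b\<in>Basis. (inner b x + - inner b a) * (inner b x + - inner b a)) = (norm (x - a))\<^sup>2" for x
  unfolding power2_norm_eq_inner by (subst euclidean_inner) (simp add: inner_simps inner_commute)
 ultimately show ?thesis by simp
qed

lemma Sm_continuous: "Sm f ==> continuous_on UNIV f"
 using Sm_deriv has_derivative_continuous continuous_at_imp_continuous_on by metis

lemma Sm_measurable: "Sm f ==> f \<in> borel_measurable borel"
 using Sm_continuous borel_measurable_continuous_onI by blast

lemma Sm_real_smooth1:
 fixes f :: "real => real"
 assumes "Sm f"
 shows "smooth1 f"
proof -
 have ex: "\<exists>f'. Sm f' \<and> (\<forall>x. (f has_real_derivative f' x) (at x))" if f: "Sm f" for f :: "real => real"
 proof -
  obtain D where D: "\<And>x. (f has_derivative D x) (at x)" "\<And>v. Sm (\<lambda>x. D x v)"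
   using Sm_deriv[OF f] by blast
  have "(f has_real_derivative D x 1) (at x)" for x
  proof -
   have "linear (D x)" using D(1) has_derivative_linear by blast
   then have "D x v = D x 1 * v" for v using linear_scale[of "D x" v 1] by (simp add: mult.commute)
   then have "D x = (*) (D x 1)" by (rule ext)
   then show ?thesis using D(1)[of x] unfolding has_field_derivative_def by metis
  qed
  then show ?thesis using D(2)[of 1] by blast
 qed
 define d where "d f = (SOME f'. Sm f' \<and> (\<forall>x. (f has_real_derivative f' x) (at x)))" for f :: "real => real"
 have d: "Sm (d f) \<and> (\<forall>x. (f has_real_derivative d f x) (at x))" if "Sm f" for f
  unfolding d_def by (rule someI_ex[OF ex[OF that]])
 have S: "Sm ((d ^^ k) f)" for k using assms d by (induction k) auto
 show ?thesis
  unfolding smooth1_def using d[OF S] by (intro exI[of _ "\<lambda>k. (d ^^ k) f"]) auto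
qed

lemma smooth1_exp_minus: "smooth1 (\<lambda>x. exp (- x))"
 unfolding smooth1_def
 by (intro exI[of _ "\<lambda>k x. (- 1) ^ k * exp (- x)"]) (auto intro!: derivative_eq_intros)

text \<open>Functions p(1/x) exp(-1/x) extended by 0. Differentiation stays in the family and acts
  on polynomials by p -> X^2 (p - p').\<close>

definition flat :: "real poly => real => real" where
 "flat p x = (if x > 0 then poly p (1 / x) * exp (- (1 / x)) else 0)"

lemma poly_exp_lim: "((\<lambda>y. poly p y * exp (- y)) \<longlongrightarrow> 0) at_top" for p :: "real poly"
proof -
 have "((\<lambda>y. \<Sum>i\<le>degree p. coeff p i * (y ^ i / exp y)) \<longlongrightarrow> (\<Sum>i\<le>degree p. coeff p i * 0)) at_top"
  by (intro tendsto_sum tendsto_mult tendsto_const tendsto_power_div_exp_0)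
 moreover have "poly p y * exp (- y) = (\<Sum>i\<le>degree p. coeff p i * (y ^ i / exp y))" for y
  by (simp add: poly_altdef sum_distrib_right exp_minus divide_inverse mult.assoc)
 ultimately show ?thesis by simp
qed

lemma flat_deriv: "(flat p has_real_derivative flat (monom 1 2 * (p - pderiv p)) x) (at x)"
proof (cases "x = 0")
 case False
 then consider "x > 0" | "x < 0" by linarith
 then show ?thesis
 proof cases
  case 1
  have "((\<lambda>x. poly p (1 / x) * exp (- (1 / x))) has_real_derivative flat (monom 1 2 * (p - pderiv p)) x) (at x)"
   using 1 by (auto intro!: derivative_eq_intros simp: flat_def poly_monom field_simps power2_eq_square)
  moreover have "eventually (\<lambda>y. flat p y = poly p (1 / y) * exp (- (1 / y))) (nhds x)"
   using eventually_nhds_in_open[of "{0<..}" x] 1 by (auto elim!: eventually_mono simp: flat_def)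
  ultimately show ?thesis by (subst DERIV_cong_ev[OF refl _ refl])
 next
  case 2
  have "eventually (\<lambda>y. flat p y = 0) (nhds x)"
   using eventually_nhds_in_open[of "{..<0}" x] 2 by (auto elim!: eventually_mono simp: flat_def)
  moreover have "((\<lambda>_. 0) has_real_derivative flat (monom 1 2 * (p - pderiv p)) x) (at x)"
   using 2 by (simp add: flat_def)
  ultimately show ?thesis by (subst DERIV_cong_ev[OF refl _ refl])
 qed
next
 case True
 have r: "((\<lambda>h. flat p h / h) \<longlongrightarrow> 0) (at_right 0)"
 proof -
  have "((\<lambda>h. poly (pCons 0 p) (inverse h) * exp (- inverse h)) \<longlongrightarrow> 0) (at_right 0)"
   using filterlim_compose[OF poly_exp_lim filterlim_inverse_at_top_right] .
  moreover have "eventually (\<lambda>h. poly (pCons 0 p) (inverse h) * exp (- inverse h) = flat p h / h) (at_right 0)"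
   unfolding eventually_at_right_field by (intro exI[of _ 1]) (auto simp: flat_def field_simps)
  ultimately show ?thesis by (rule Lim_transform_eventually)
 qed
 have l: "((\<lambda>h. flat p h / h) \<longlongrightarrow> 0) (at_left 0)"
 proof (rule Lim_transform_eventually[OF tendsto_const])
  show "eventually (\<lambda>h. 0 = flat p h / h) (at_left 0)"
   unfolding eventually_at_left_field by (intro exI[of _ "-1"]) (auto simp: flat_def)
 qed
 have "((\<lambda>h. flat p h / h) \<longlongrightarrow> 0) (at 0)" using l r filterlim_split_at by blast
 then show ?thesis unfolding True DERIV_def by (simp add: flat_def)
qed

definition bmp :: "real => real" where
 "bmp = flat 1"

lemma smooth1_bmp: "smooth1 bmp"
 unfolding smooth1_def bmp_def
 by (intro exI[of _ "\<lambda>k. flat (((\<lambda>p. monom 1 2 * (p - pderiv p)) ^^ k) 1)"]) (auto simp: flat_deriv)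

lemma bmp_pos: "x > 0 ==> bmp x > 0" and bmp_zero: "x \<le> 0 ==> bmp x = 0" and bmp_nonneg: "bmp x \<ge> 0"
 by (auto simp: bmp_def flat_def)

text \<open>A bump supported in [1,2]. Staying away from 0 makes its Mellin transform entire, and t
  \<ge> 1 on the support makes that transform positive for nonnegative exponents.\<close>

definition bet :: "real => real" where
 "bet t = bmp ((t - 1) * (2 - t))"

lemma Sm_bet: "Sm bet"
proof -
 have id: "Sm (\<lambda>t::real. t)" by (intro Sm_linear linear_id[unfolded id_def])
 have "Sm (\<lambda>t::real. (- 1) * t)" by (rule Sm_mult[OF Sm_const id])
 then have "Sm (\<lambda>t. bmp ((t + - 1) * (2 + (- 1) * t)))"
  by (rule Sm_comp[OF smooth1_bmp Sm_mult[OF Sm_add[OF id Sm_const] Sm_add[OF Sm_const]]])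
 moreover have "(\<lambda>t. bmp ((t + - 1) * (2 + (- 1) * t))) = bet" by (auto simp: bet_def)
 ultimately show ?thesis by simp
qed

lemma bet_nonneg: "bet t \<ge> 0" and bet_zero: "t \<notin> {1<..<2} ==> bet t = 0" and bet_pos: "t \<in> {1<..<2} ==> bet t > 0"
proof -
 show "bet t \<ge> 0" by (simp add: bet_def bmp_nonneg)
 show "t \<in> {1<..<2} ==> bet t > 0" by (auto simp: bet_def intro!: bmp_pos)
 show "bet t = 0" if "t \<notin> {1<..<2}"
 proof -
  have "t \<le> 1 \<or> t \<ge> 2" using that by auto
  then have "(t - 1) * (2 - t) \<le> 0" by (auto simp: mult_nonpos_nonneg mult_nonneg_nonpos)
  then show ?thesis by (simp add: bet_def bmp_zero)
 qed
qed

lemma continuous_bet: "continuous_on S bet"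
 using Sm_continuous[OF Sm_bet] continuous_on_subset by blast

lemma bet_measurable [measurable]: "bet \<in> borel_measurable borel"
 by (rule Sm_measurable[OF Sm_bet])

lemma bet_integrable: "integrable lborel bet"
proof -
 have "set_integrable lborel {1..2} bet"
  by (intro borel_integrable_atLeastAtMost' continuous_bet)
 moreover have "(\<lambda>t. indicator {1..2} t *\<^sub>R bet t) = bet"
 proof (rule ext)
  fix t show "indicator {1..2} t *\<^sub>R bet t = bet t"
   by (cases "t \<in> {1<..<2}") (use bet_zero[of t] in auto)
 qed
 ultimately show ?thesis unfolding set_integrable_def by simp
qed

text \<open>A smooth step, constant up to 1 and zero from 2 on. Defining it as a superposition of
  indicators of \<rho> < t prepares the layer-cake computation in \<open>II_layer\<close>.\<close>

definition psi :: "real => real" where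
 "psi \<rho> = (\<integral>t. indicator {\<rho><..} t * bet t \<partial>lborel)"

lemma psi_integrable: "integrable lborel (\<lambda>t. indicator {\<rho><..} t * bet t)"
 using integrable_mult_indicator[OF _ bet_integrable, of "{\<rho><..}"] by simp

lemma psi_nonneg: "psi \<rho> \<ge> 0"
 unfolding psi_def by (intro integral_nonneg_AE) (auto simp: bet_nonneg)

lemma psi_zero: "\<rho> \<ge> 2 ==> psi \<rho> = 0"
proof -
 assume "\<rho> \<ge> 2"
 then have "(\<lambda>t. indicator {\<rho><..} t * bet t) = (\<lambda>_. 0)" using bet_zero by (auto simp: indicator_def)
 then show ?thesis unfolding psi_def by simp
qed

lemma psi_one: "\<rho> \<le> 1 ==> psi \<rho> = psi 0"
proof -
 assume r: "\<rho> \<le> 1"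
 have "(\<lambda>t. indicator {\<rho><..} t * bet t) = (\<lambda>t. indicator {0<..} t * bet t)"
 proof (rule ext)
  fix t show "indicator {\<rho><..} t * bet t = indicator {0<..} t * bet t"
   by (cases "t \<in> {1<..<2}") (use bet_zero[of t] r in auto)
 qed
 then show ?thesis unfolding psi_def by simp
qed

lemma psi_enn: "ennreal (psi \<rho>) = (\<integral>\<^sup>+t. indicator {\<rho><..} t * ennreal (bet t) \<partial>lborel)"
proof -
 have "ennreal (psi \<rho>) = (\<integral>\<^sup>+t. ennreal (indicator {\<rho><..} t * bet t) \<partial>lborel)"
  unfolding psi_def using psi_integrable by (intro nn_integral_eq_integral[symmetric]) (auto simp: bet_nonneg)
 also have "\<dots> = (\<integral>\<^sup>+t. indicator {\<rho><..} t * ennreal (bet t) \<partial>lborel)"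
  by (intro nn_integral_cong) (simp add: indicator_def)
 finally show ?thesis .
qed

lemma psi_split:
 assumes "a \<le> b"
 shows "psi a = integral {a..b} bet + psi b"
proof -
 have "psi a = (\<integral>t. indicator {a<..b} t * bet t + indicator {b<..} t * bet t \<partial>lborel)"
  unfolding psi_def using assms by (intro Bochner_Integration.integral_cong) (auto simp: indicator_def)
 also have "\<dots> = (\<integral>t. indicator {a<..b} t * bet t \<partial>lborel) + psi b"
  unfolding psi_def using integrable_mult_indicator[OF _ bet_integrable, of "{a<..b}"] psi_integrable
  by (intro Bochner_Integration.integral_add) auto
 also have "(\<integral>t. indicator {a<..b} t * bet t \<partial>lborel) = (LINT t:{a..b}|lborel. bet t)"
  unfolding set_lebesgue_integral_def
 proof (rule integral_cong_AE)
  have "AE t in lborel. t \<noteq> a" by (rule AE_lborel_singleton)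
  then show "AE t in lborel. indicator {a<..b} t * bet t = indicator {a..b} t *\<^sub>R bet t"
   by eventually_elim (auto simp: indicator_def)
 qed auto
 also have "\<dots> = integral {a..b} bet"
  by (intro set_borel_integral_eq_integral borel_integrable_atLeastAtMost' continuous_bet)
 finally show ?thesis .
qed

lemma psi_deriv: "(psi has_real_derivative - bet x) (at x)"
proof -
 have "((\<lambda>y. integral {x - 1..y} bet) has_real_derivative bet x) (at x within {x - 1..x + 1})"
  by (intro integral_has_real_derivative continuous_bet) auto
 then have "((\<lambda>y. integral {x - 1..y} bet) has_real_derivative bet x) (at x)"
  by (simp add: at_within_Icc_at)
 then have "((\<lambda>y. psi (x - 1) - integral {x - 1..y} bet) has_real_derivative 0 - bet x) (at x)"
  by (intro DERIV_diff DERIV_const)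
 moreover have "psi y = psi (x - 1) - integral {x - 1..y} bet" if "y \<in> {x - 1<..}" for y
  using psi_split[of "x - 1" y] that by simp
 then have "eventually (\<lambda>y. psi y = psi (x - 1) - integral {x - 1..y} bet) (nhds x)"
  using eventually_nhds_in_open[of "{x - 1<..}" x] by (auto elim!: eventually_mono)
 ultimately show ?thesis by (subst DERIV_cong_ev[OF refl _ refl]) auto
qed

lemma smooth1_psi: "smooth1 psi"
proof -
 obtain G where G: "G 0 = bet" "\<And>k x. (G k has_real_derivative G (Suc k) x) (at x)"
  using Sm_real_smooth1[OF Sm_bet] by (auto simp: smooth1_def)
 have d: "((case k of 0 => psi | Suc k => (\<lambda>x. - G k x)) has_real_derivative (case Suc k of 0 => psi | Suc k => (\<lambda>x. - G k x)) x) (at x)" for k x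
  using psi_deriv[of x] G DERIV_minus[OF G(2)] by (cases k) auto
 show ?thesis unfolding smooth1_def
  by (intro exI[of _ "\<lambda>k. case k of 0 => psi | Suc k => (\<lambda>x. - G k x)"]) (use d in auto)
qed

lemma psi_0_pos: "psi 0 > 0"
proof -
 have "(\<integral>\<^sup>+t. indicator {0<..} t * ennreal (bet t) \<partial>lborel) \<noteq> 0"
 proof
  assume "(\<integral>\<^sup>+t. indicator {0<..} t * ennreal (bet t) \<partial>lborel) = 0"
  then have "AE t in lborel. indicator {0<..} t * ennreal (bet t) = 0"
   by (subst (asm) nn_integral_0_iff_AE) auto
  then have "AE t in lborel. t \<notin> {1<..<2::real}"
   by eventually_elim (use bet_pos in \<open>force simp: indicator_def\<close>)
  then have "emeasure lborel {1<..<2::real} = 0"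
   by (subst (asm) AE_iff_measurable[of "{1<..<2}"]) auto
  then show False by simp
 qed
 then show ?thesis using psi_enn[of 0] psi_nonneg[of 0] by (simp add: less_le) (metis ennreal_0)
qed

definition cut :: "real => 'a::euclidean_space => real" where
 "cut R x = psi ((1 / R\<^sup>2) * (norm (x - 0))\<^sup>2) * (1 / psi 0)"

lemma Sm_cut: "Sm (cut R)"
 unfolding cut_def by (rule Sm_mult[OF Sm_comp[OF smooth1_psi Sm_mult[OF Sm_const Sm_norm_sq]] Sm_const])

lemma cut_nonneg: "cut R x \<ge> 0"
 unfolding cut_def using psi_nonneg psi_0_pos by simp

lemma psi_le: "psi \<rho> \<le> psi 0"
proof (cases "\<rho> \<le> 0")
 case True
 then show ?thesis using psi_one[of \<rho>] by simp
next
 case False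
 then show ?thesis unfolding psi_def using psi_integrable
  by (intro integral_mono) (auto simp: indicator_def bet_nonneg)
qed

lemma cut_le_1: "cut R x \<le> 1"
 unfolding cut_def using psi_le psi_0_pos by simp

lemma cut_one: "norm x \<le> R ==> R > 0 ==> cut R x = 1"
proof -
 assume "norm x \<le> R" "R > 0"
 then have "(norm x)\<^sup>2 \<le> R\<^sup>2" by (intro power_mono) auto
 then have "(1 / R\<^sup>2) * (norm (x - 0))\<^sup>2 \<le> 1" using \<open>R > 0\<close> by (simp add: field_simps)
 from psi_one[OF this] show ?thesis using psi_0_pos by (simp add: cut_def)
qed

lemma cut_support: "R > 0 ==> bounded {x. cut R x \<noteq> 0}"
proof -
 assume R: "R > 0"
 have "{x. cut R x \<noteq> 0} \<subseteq> cball 0 (2 * R)"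
 proof
  fix x assume "x \<in> {x. cut R x \<noteq> (0::real)}"
  then have "\<not> (1 / R\<^sup>2) * (norm (x - 0))\<^sup>2 \<ge> 2" using psi_zero by (auto simp: cut_def)
  then have "(norm x)\<^sup>2 < 2 * R\<^sup>2" using R by (simp add: field_simps)
  also have "\<dots> \<le> (2 * R)\<^sup>2" by (simp add: power2_eq_square)
  finally have "norm x < 2 * R" using R power2_less_imp_less[of "norm x" "2 * R"] by simp
  then show "x \<in> cball 0 (2 * R)" by simp
 qed
 then show ?thesis using bounded_subset bounded_cball by blast
qed

subsection \<open>Uniqueness of separately entire continuations\<close>

lemma sdiff_holomorphic: "(\<lambda>w. sdiff r (z(k := w)) j) holomorphic_on UNIV" for z :: "nat => complex"
 unfolding sdiff_def fun_upd_def
 by (cases "j = r"; cases "j = k"; cases "j + 1 = k") (auto intro!: holomorphic_intros)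

text \<open>The one-variable identity theorem applied to one coordinate after the other, each time
  along a real ray, of which Z + 1 is an accumulation point. Holomorphy in each variable separately
  suffices.\<close>

lemma separately_entire_zero:
 fixes G :: "(nat => complex) => complex" and s :: "nat => real"
 assumes hol: "\<And>z j. j \<in> {1..r} ==> (\<lambda>w. G (z(j := w))) holomorphic_on UNIV"
  and zero: "\<And>\<zeta> :: nat => real. (\<And>j. j \<in> {1..r} ==> \<zeta> j > Z) ==> G (\<lambda>j. cplx (\<zeta> j)) = 0"
 shows "G (\<lambda>j. cplx (s j)) = 0"
proof -
 \<comment> \<open>At stage \<open>k\<close> the first k coordinates are arbitrary complex numbers
   and the others still real and large. Coordinates outside {1..r} are frozen at the values of
   \<open>s\<close>, so that the point of interest is reached at the end.\<close>
 have "\<forall>z. (\<forall>j\<in>{k<..r}. \<exists>x>Z. z j = cplx x) \<and> (\<forall>j. j \<notin> {1..r} \<longrightarrow> z j = cplx (s j)) \<longrightarrow> G z = 0"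
  if "k \<le> r" for k
  using that
 proof (induction k)
  case 0
  show ?case
  proof (intro allI impI, elim conjE)
   fix z assume z: "\<forall>j\<in>{0<..r}. \<exists>x>Z. z j = cplx x" "\<forall>j. j \<notin> {1..r} \<longrightarrow> z j = cplx (s j)"
   have re: "Re (z j) > Z \<and> z j = cplx (Re (z j))" if "j \<in> {1..r}" for j
   proof -
    have "j \<in> {0<..r}" using that by simp
    then obtain x where "x > Z" "z j = cplx x" using z(1) by blast
    then show ?thesis by simp
   qed
   have eq: "z j = cplx (Re (z j))" for j
   proof (cases "j \<in> {1..r}")
    case False
    then have "z j = cplx (s j)" using z(2) by blast
    then show ?thesis by simp
   qed (use re in blast)
   have zz: "(\<lambda>j. cplx (Re (z j))) = z" by (rule ext) (rule eq[symmetric])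
   have "G (\<lambda>j. cplx (Re (z j))) = 0" by (rule zero) (use re in blast)
   then show "G z = 0" unfolding zz .
  qed
 next
  case (Suc k)
  show ?case
  proof (intro allI impI, elim conjE)
   fix z assume z: "\<forall>j\<in>{Suc k<..r}. \<exists>x>Z. z j = cplx x" "\<forall>j. j \<notin> {1..r} \<longrightarrow> z j = cplx (s j)"
   let ?f = "\<lambda>w. G (z(Suc k := w))"
   have f: "?f holomorphic_on UNIV" using hol Suc by simp
   have f0: "?f w = 0" if w: "w \<in> cplx ` {Z<..}" for w
   proof -
    obtain x where x: "x > Z" "w = cplx x" using w by auto
    have "\<exists>x>Z. (z(Suc k := w)) j = cplx x" if "j \<in> {k<..r}" for j
    proof (cases "j = Suc k")
     case True
     then show ?thesis using x by auto
    next
     case False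
     then have "j \<in> {Suc k<..r}" using that by simp
     then show ?thesis using z(1) False by simp
    qed
    moreover have "(z(Suc k := w)) j = cplx (s j)" if "j \<notin> {1..r}" for j
    proof -
     have "j \<noteq> Suc k" using that Suc.prems by auto
     then show ?thesis using z(2) that by simp
    qed
    moreover have "k \<le> r" using Suc.prems by simp
    ultimately show ?thesis using Suc.IH by blast
   qed
   have "cplx (Z + 1) islimpt cplx ` {Z<..}"
   proof (subst islimpt_sequential, intro exI conjI allI)
    show "cplx (Z + 1 + inverse (real (Suc n))) \<in> cplx ` {Z<..} - {cplx (Z + 1)}" for n
    proof -
     define i where "i = inverse (real (Suc n))"
     have "i > 0" by (simp add: i_def)
     then have "Z + 1 + inverse (real (Suc n)) \<in> {Z<..}" "Z + 1 + inverse (real (Suc n)) \<noteq> Z + 1"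
      unfolding i_def[symmetric] by auto
     then show ?thesis by (simp only: Diff_iff imageI singleton_iff of_real_eq_iff) simp
    qed
    have "(\<lambda>n. cplx (Z + 1 + inverse (real (Suc n)))) \<longlonglongrightarrow> cplx (Z + 1 + 0)"
     by (intro tendsto_intros LIMSEQ_inverse_real_of_nat)
    then show "(\<lambda>n. cplx (Z + 1 + inverse (real (Suc n)))) \<longlonglongrightarrow> cplx (Z + 1)" by simp
   qed
   then have "?f (z (Suc k)) = 0"
    using analytic_continuation[OF f open_UNIV connected_UNIV _ _ _ f0] by blast
   then show "G z = 0" by simp
  qed
 qed
 from this[OF order_refl] show ?thesis by auto
qed

lemma nn_integral_exp_tail: "ennreal (exp (- \<rho>)) = (\<integral>\<^sup>+t. indicator {\<rho><..} t * ennreal (exp (- t)) \<partial>lborel)"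
proof -
 have lim: "((\<lambda>x::real. - exp (- x)) \<longlongrightarrow> 0) at_top"
  using tendsto_minus[OF filterlim_compose[OF exp_at_bot filterlim_uminus_at_bot_at_top]] by simp
 have "(\<integral>\<^sup>+t. ennreal (exp (- t)) * indicator {\<rho>..} t \<partial>lborel) = ennreal (0 - (- exp (- \<rho>)))"
  by (rule nn_integral_FTC_atLeast[OF _ _ _ lim]) (auto intro!: derivative_eq_intros)
 moreover have "(\<integral>\<^sup>+t. indicator {\<rho><..} t * ennreal (exp (- t)) \<partial>lborel) = (\<integral>\<^sup>+t. ennreal (exp (- t)) * indicator {\<rho>..} t \<partial>lborel)"
 proof (rule nn_integral_cong_AE)
  have "AE t in lborel. t \<noteq> \<rho>" by (rule AE_lborel_singleton)
  then show "AE t in lborel. indicator {\<rho><..} t * ennreal (exp (- t)) = ennreal (exp (- t)) * indicator {\<rho>..} t"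
   by eventually_elim (auto simp: indicator_def)
 qed
 ultimately show ?thesis by simp
qed

lemma nn_integral_Gamma:
 assumes "S > -1"
 shows "(\<integral>\<^sup>+t. indicator {0<..} t * ennreal (exp (- t) * t powr S) \<partial>lborel) = ennreal (Gamma (S + 1))"
proof -
 have "((\<lambda>t. t powr (S + 1 - 1) / exp t) has_integral Gamma (S + 1)) {0..}"
  using assms by (intro Gamma_integral_real) simp
 then have "((\<lambda>t. if t \<in> {0..} then t powr (S + 1 - 1) / exp t else 0) has_integral Gamma (S + 1)) UNIV"
  unfolding has_integral_restrict_UNIV .
 moreover have "(\<lambda>t. if t \<in> {0..} then t powr (S + 1 - 1) / exp t else 0) = (\<lambda>t. indicator {0..} t * (exp (- t) * t powr S))"
  by (auto simp: fun_eq_iff exp_minus divide_inverse)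
 ultimately have "((\<lambda>t. indicator {0..} t * (exp (- t) * t powr S)) has_integral Gamma (S + 1)) UNIV" by simp
 then have "(\<integral>\<^sup>+t. ennreal (indicator {0..} t * (exp (- t) * t powr S)) \<partial>lborel) = ennreal (Gamma (S + 1))"
  by (intro nn_integral_has_integral_lborel) auto
 moreover have "(\<integral>\<^sup>+t. indicator {0<..} t * ennreal (exp (- t) * t powr S) \<partial>lborel) = (\<integral>\<^sup>+t. ennreal (indicator {0..} t * (exp (- t) * t powr S)) \<partial>lborel)"
 proof (rule nn_integral_cong_AE)
  have "AE t in lborel. t \<noteq> (0::real)" by (rule AE_lborel_singleton)
  then show "AE t in lborel. indicator {0<..} t * ennreal (exp (- t) * t powr S) = ennreal (indicator {0..} t * (exp (- t) * t powr S))"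
   by eventually_elim (auto simp: indicator_def)
 qed
 ultimately show ?thesis by simp
qed

lemma enn2real_cmult: "a \<ge> 0 ==> enn2real (ennreal a * x) = a * enn2real x"
 by (simp add: enn2real_mult)

section \<open>The measure mu_s: relative invariance and support\<close>

locale mu_jordan = framed_jordan m e c r
 for m :: "'a::euclidean_space => 'a => 'a" (infixl \<open>\<odot>\<close> 70) and e c r +
 fixes s :: "nat => real" and M :: "'a measure"
 assumes s_nonneg: "\<And>j. j \<in> {1..r} ==> s j \<ge> 0" and mu: "is_mu m e c r s M"
begin

lemma sets_M [measurable_cong]: "sets M = sets borel"
 using mu by (simp add: is_mu_def)

lemma space_M [simp]: "space M = UNIV"
 using sets_eq_imp_space_eq[OF sets_M] by simp

lemma M_compact: "compact K ==> emeasure M K < \<infinity>"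
 using mu by (simp add: is_mu_def)

lemma sigma_finite_M: "sigma_finite_measure M"
proof
 show "\<exists>A. countable A \<and> A \<subseteq> sets M \<and> \<Union> A = space M \<and> (\<forall>a\<in>A. emeasure M a \<noteq> \<infinity>)"
 proof (intro exI[of _ "range (\<lambda>n. cball (0::'a) (real n))"] conjI)
  show "\<Union> (range (\<lambda>n. cball (0::'a) (real n))) = space M"
   using real_arch_simple by (auto simp: dist_norm)
  show "\<forall>a\<in>range (\<lambda>n. cball (0::'a) (real n)). emeasure M a \<noteq> \<infinity>"
   using M_compact[OF compact_cball] by (auto simp: less_top)
 qed (auto simp: sets_M)
qed

text \<open>A common bound beyond which a parameter lies in the convergence region and exceeds n/r.
  The second property makes the exponents \<zeta> - n/r nonnegative, so that \<open>gp_bound\<close>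
  applies.\<close>

definition Zb :: real where
 "Zb = real DIM('a) / real r + (\<Sum>j=1..r. \<bar>g0 DIM('a) r j\<bar>)"

lemma Zb_g0: "j \<in> {1..r} ==> g0 DIM('a) r j \<le> Zb"
proof -
 assume j: "j \<in> {1..r}"
 have "g0 DIM('a) r j \<le> \<bar>g0 DIM('a) r j\<bar>" by simp
 also have "\<dots> \<le> (\<Sum>j=1..r. \<bar>g0 DIM('a) r j\<bar>)" using j by (intro member_le_sum) auto
 finally show ?thesis by (simp add: Zb_def add_increasing)
qed

lemma Zb_nr: "Zb \<ge> real DIM('a) / real r"
 by (simp add: Zb_def sum_nonneg)

text \<open>The pairing with mu_\<zeta> before division by the Gamma factor, as an extended
  nonnegative number, so that no integrability has to be settled in advance.\<close>

definition II :: "(nat => real) => ('a => ennreal) => ennreal" where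
 "II \<zeta> f = (\<integral>\<^sup>+x. indicator \<Omega> x * ennreal (gp (\<lambda>j. \<zeta> j - real DIM('a) / real r) x) * f x \<partial>lborel)"

lemma II_tri:
 assumes t: "tri t A" and f: "f \<in> borel_measurable borel"
 shows "II \<zeta> (\<lambda>x. f (t x)) = ennreal (1 / chi A \<zeta>) * II \<zeta> f"
 unfolding II_def using tri_nn_integral[OF t f, of "\<lambda>j. \<zeta> j - real DIM('a) / real r"] by simp

lemma gpowc_real:
 assumes "x \<in> \<Omega>"
 shows "gpowc m c r (\<lambda>j. cplx (\<zeta> j)) x = cplx (gp \<zeta> x)"
proof -
 have "exp (sdiff r (\<lambda>j. cplx (\<zeta> j)) j * cplx (ln (minor m c j x)))
   = cplx (minor m c j x powr sdiff r \<zeta> j)" if "j \<in> {1..r}" for j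
 proof -
  have "sdiff r (\<lambda>j. cplx (\<zeta> j)) j = cplx (sdiff r \<zeta> j)" by (simp add: sdiff_def)
  moreover have "minor m c j x > 0" using minor_pos that assms by simp
  ultimately show ?thesis by (simp add: powr_def exp_of_real[symmetric] mult.commute)
 qed
 then show ?thesis unfolding gpowc_def gpow_def by (simp add: of_real_prod)
qed

lemma cone_integral:
 fixes \<phi> :: "'a => real"
 assumes \<phi>: "\<phi> \<in> borel_measurable borel" "\<And>x. \<phi> x \<ge> 0"
 shows "(\<integral>x. indicator \<Omega> x * (gp (\<lambda>j. \<zeta> j - real DIM('a) / real r) x * \<phi> x) \<partial>lborel) = enn2real (II \<zeta> (\<lambda>x. ennreal (\<phi> x)))"
proof -
 let ?g = "gp (\<lambda>j. \<zeta> j - real DIM('a) / real r)"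
 have "(\<lambda>x. (indicator \<Omega> x * ?g x) * \<phi> x) \<in> borel_measurable borel"
  by (intro borel_measurable_times meas_gp \<phi>)
 then have meas: "(\<lambda>x. indicator \<Omega> x * (?g x * \<phi> x)) \<in> borel_measurable lborel" by (simp add: mult.assoc)
 have nn: "indicator \<Omega> x * (?g x * \<phi> x) \<ge> 0" for x
  using gp_pos[of x "\<lambda>j. \<zeta> j - real DIM('a) / real r"] \<phi>(2) by (auto simp: indicator_def less_imp_le)
 have "(\<integral>x. indicator \<Omega> x * (?g x * \<phi> x) \<partial>lborel) = enn2real (\<integral>\<^sup>+x. ennreal (indicator \<Omega> x * (?g x * \<phi> x)) \<partial>lborel)"
  using meas nn by (intro integral_eq_nn_integral) auto
 also have "(\<integral>\<^sup>+x. ennreal (indicator \<Omega> x * (?g x * \<phi> x)) \<partial>lborel) = II \<zeta> (\<lambda>x. ennreal (\<phi> x))"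
  unfolding II_def
 proof (rule nn_integral_cong)
  fix x
  show "ennreal (indicator \<Omega> x * (?g x * \<phi> x)) = indicator \<Omega> x * ennreal (?g x) * ennreal (\<phi> x)"
   using gp_pos[of x "\<lambda>j. \<zeta> j - real DIM('a) / real r"] \<phi>(2)[of x]
   by (cases "x \<in> \<Omega>") (simp_all add: ennreal_mult less_imp_le)
 qed
 finally show ?thesis .
qed

lemma mu_pair_real:
 fixes \<phi> :: "'a => real"
 assumes \<phi>: "\<phi> \<in> borel_measurable borel" "\<And>x. \<phi> x \<ge> 0"
 shows "mu_pair m e c r (\<lambda>j. cplx (\<zeta> j)) \<phi>
  = cplx (enn2real (II \<zeta> (\<lambda>x. ennreal (\<phi> x))) / enn2real (II \<zeta> (\<lambda>x. ennreal (exp (- inner e x)))))"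
proof -
 let ?g = "gp (\<lambda>j. \<zeta> j - real DIM('a) / real r)"
 let ?z = "\<lambda>j. cplx (\<zeta> j)"
 have g: "gpowc m c r ?z x * cplx (jdet_in m e x powr (- real DIM('a) / real r)) = cplx (?g x)"
  if "x \<in> \<Omega>" for x
  using gp_jdet[OF that, of \<zeta> "- real DIM('a) / real r"] gpowc_real[OF that, of \<zeta>]
  by (simp flip: of_real_mult)
 have "gammaO m e c r ?z = (\<integral>x. cplx (indicator \<Omega> x * (?g x * exp (- inner e x))) \<partial>lborel)"
  unfolding gammaO_def set_lebesgue_integral_def
 proof (rule Bochner_Integration.integral_cong[OF refl])
  fix x
  show "indicator \<Omega> x *\<^sub>R (cplx (exp (- inner e x)) * gpowc m c r ?z x * cplx (jdet_in m e x powr (- real DIM('a) / real r)))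
   = cplx (indicator \<Omega> x * (?g x * exp (- inner e x)))"
  proof (cases "x \<in> \<Omega>")
   case True
   then show ?thesis using g[OF True] by (simp add: mult.assoc)
  qed simp
 qed
 also have "\<dots> = cplx (enn2real (II \<zeta> (\<lambda>x. ennreal (exp (- inner e x)))))"
  by (subst integral_complex_of_real, subst cone_integral) auto
 finally have G: "gammaO m e c r ?z = cplx (enn2real (II \<zeta> (\<lambda>x. ennreal (exp (- inner e x)))))" .
 have "mu_pair m e c r ?z \<phi> = (\<integral>x. cplx (indicator \<Omega> x * (?g x * \<phi> x)) / gammaO m e c r ?z \<partial>lborel)"
  unfolding mu_pair_def set_lebesgue_integral_def
 proof (rule Bochner_Integration.integral_cong[OF refl])
  fix x
  show "indicator \<Omega> x *\<^sub>R (cplx (\<phi> x) * gpowc m c r ?z x / gammaO m e c r ?z * cplx (jdet_in m e x powr (- real DIM('a) / real r)))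
   = cplx (indicator \<Omega> x * (?g x * \<phi> x)) / gammaO m e c r ?z"
  proof (cases "x \<in> \<Omega>")
   case True
   have "cplx (\<phi> x) * gpowc m c r ?z x / gammaO m e c r ?z * cplx (jdet_in m e x powr (- real DIM('a) / real r))
    = (gpowc m c r ?z x * cplx (jdet_in m e x powr (- real DIM('a) / real r))) * cplx (\<phi> x) / gammaO m e c r ?z"
    by simp
   then show ?thesis unfolding g[OF True] using True by simp
  qed simp
 qed
 also have "\<dots> = cplx (\<integral>x. indicator \<Omega> x * (?g x * \<phi> x) \<partial>lborel) / gammaO m e c r ?z"
  by (subst integral_divide_zero, subst integral_complex_of_real) simp
 also have "\<dots> = cplx (enn2real (II \<zeta> (\<lambda>x. ennreal (\<phi> x))) / enn2real (II \<zeta> (\<lambda>x. ennreal (exp (- inner e x)))))"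
  unfolding G cone_integral[OF \<phi>] by simp
 finally show ?thesis .
qed

definition testp :: "('a => real) => bool" where
 "testp \<phi> \<longleftrightarrow> Sm \<phi> \<and> bounded {x. \<phi> x \<noteq> 0} \<and> (\<forall>x. \<phi> x \<ge> 0)"

lemma testp_meas: "testp \<phi> ==> \<phi> \<in> borel_measurable borel"
 using Sm_measurable by (auto simp: testp_def)

text \<open>What is used of the analytic continuation: entire in each variable, the quotient of two
  \<open>II\<close> at large real parameters, the \<open>M\<close>-integral at
  \<open>s\<close>.\<close>

definition contin :: "('a => real) => ((nat => complex) => complex) => bool" where
 "contin \<phi> G \<longleftrightarrow> (\<forall>z. \<forall>j\<in>{1..r}. (\<lambda>w. G (z(j := w))) holomorphic_on UNIV) \<and>
  (\<forall>\<zeta>. (\<forall>j\<in>{1..r}. \<zeta> j > Zb) \<longrightarrow> G (\<lambda>j. cplx (\<zeta> j)) =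
    cplx (enn2real (II \<zeta> (\<lambda>x. ennreal (\<phi> x))) / enn2real (II \<zeta> (\<lambda>x. ennreal (exp (- inner e x)))))) \<and>
  G (\<lambda>j. cplx (s j)) = cplx (\<integral>x. \<phi> x \<partial>M)"

lemma continD:
 assumes "contin \<phi> G"
 shows "j \<in> {1..r} ==> (\<lambda>w. G (z(j := w))) holomorphic_on UNIV"
  "(\<And>j. j \<in> {1..r} ==> \<zeta> j > Zb) ==> G (\<lambda>j. cplx (\<zeta> j)) =
   cplx (enn2real (II \<zeta> (\<lambda>x. ennreal (\<phi> x))) / enn2real (II \<zeta> (\<lambda>x. ennreal (exp (- inner e x)))))"
  "G (\<lambda>j. cplx (s j)) = cplx (\<integral>x. \<phi> x \<partial>M)"
 using assms unfolding contin_def by blast+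

lemma testp_mu:
 assumes tp: "testp \<phi>"
 shows "integrable M \<phi>" "\<exists>G. contin \<phi> G"
proof -
 have "test_fun \<phi>" using assms Sm_smooth_fun by (auto simp: testp_def test_fun_def)
 note * = mu[unfolded is_mu_def, THEN conjunct2, THEN conjunct2, THEN spec[of _ \<phi>], THEN mp, OF this]
 show "integrable M \<phi>" using * by (rule conjunct1)
 from conjunct2[OF *] obtain G where
  G: "\<forall>z j. j \<in> {1..r} \<longrightarrow> (\<lambda>w. G (z(j := w))) holomorphic_on UNIV"
  "\<forall>z. (\<forall>j\<in>{1..r}. Re (z j) > g0 DIM('a) r j) \<longrightarrow> G z = mu_pair m e c r z \<phi>"
  "G (\<lambda>j. cplx (s j)) = cplx (\<integral>x. \<phi> x \<partial>M)"
  by (elim exE conjE)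
 have "G (\<lambda>j. cplx (\<zeta> j)) = cplx (enn2real (II \<zeta> (\<lambda>x. ennreal (\<phi> x))) / enn2real (II \<zeta> (\<lambda>x. ennreal (exp (- inner e x)))))"
  if z: "\<forall>j\<in>{1..r}. \<zeta> j > Zb" for \<zeta>
 proof -
  have "\<forall>j\<in>{1..r}. Re (cplx (\<zeta> j)) > g0 DIM('a) r j"
  proof
   fix j assume j: "j \<in> {1..r}"
   then have "Zb < \<zeta> j" using z by blast
   then show "Re (cplx (\<zeta> j)) > g0 DIM('a) r j" using Zb_g0[OF j] by simp
  qed
  then have "G (\<lambda>j. cplx (\<zeta> j)) = mu_pair m e c r (\<lambda>j. cplx (\<zeta> j)) \<phi>"
   using G(2)[THEN spec[of _ "\<lambda>j. cplx (\<zeta> j)"], THEN mp] by simp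
  moreover have "\<phi> x \<ge> 0" for x using tp by (simp add: testp_def)
  ultimately show ?thesis using mu_pair_real[OF testp_meas[OF tp]] by simp
 qed
 then have "contin \<phi> G" unfolding contin_def using G(1,3) by simp
 then show "\<exists>G. contin \<phi> G" by blast
qed

lemma testp_tri:
 assumes \<phi>: "testp \<phi>" and t: "tri t A"
 shows "testp (\<lambda>x. \<phi> (t x))"
proof -
 have "{x. \<phi> (t x) \<noteq> 0} = inv t ` {x. \<phi> x \<noteq> 0}"
 proof (intro equalityI subsetI)
  fix x assume "x \<in> {x. \<phi> (t x) \<noteq> 0}"
  then show "x \<in> inv t ` {x. \<phi> x \<noteq> 0}"
   using inv_f_f[OF bij_is_inj[OF tri_bij[OF t]], of x] by (intro image_eqI[of _ _ "t x"]) auto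
 qed (auto simp: surj_f_inv_f[OF bij_is_surj[OF tri_bij[OF t]]])
 moreover have "bounded (inv t ` {x. \<phi> x \<noteq> 0})"
  using \<phi> tri_linear[OF tri_inv[OF t]] linear_conv_bounded_linear bounded_linear_image by (auto simp: testp_def)
 ultimately show ?thesis
  using \<phi> Sm_compose_linear[OF _ tri_linear[OF t]] by (auto simp: testp_def)
qed

text \<open>For large parameters this is the change of variables \<open>II_tri\<close>, with the
  same Gamma factor on both sides. The character is entire in the parameter, so the identity between
  continuations persists down to \<open>s\<close>.\<close>

lemma M_tri:
 assumes \<phi>: "testp \<phi>" and t: "tri t A"
 shows "(\<integral>x. \<phi> (t x) \<partial>M) = (1 / chi A s) * (\<integral>x. \<phi> x \<partial>M)"
proof -
 obtain G where "contin \<phi> G" using testp_mu(2)[OF \<phi>] by blast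
 note G = continD[OF this]
 obtain H where "contin (\<lambda>x. \<phi> (t x)) H" using testp_mu(2)[OF testp_tri[OF \<phi> t]] by blast
 note H = continD[OF this]
 define X where "X z = (\<Prod>j=1..r. exp (- (sdiff r z j * cplx (ln (A j)))))" for z
 have Xh: "(\<lambda>w. X (z(j := w))) holomorphic_on UNIV" for z j
  unfolding X_def by (intro holomorphic_intros sdiff_holomorphic)
 have Xr: "X (\<lambda>j. cplx (\<zeta> j)) = cplx (1 / chi A \<zeta>)" for \<zeta>
 proof -
  have "X (\<lambda>j. cplx (\<zeta> j)) = (\<Prod>j=1..r. cplx (1 / (A j powr sdiff r \<zeta> j)))"
   unfolding X_def
  proof (intro prod.cong refl)
   fix j assume j: "j \<in> {1..r}"
   have "sdiff r (\<lambda>j. cplx (\<zeta> j)) j = cplx (sdiff r \<zeta> j)" by (simp add: sdiff_def)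
   moreover have "1 / (A j powr sdiff r \<zeta> j) = exp (- (sdiff r \<zeta> j * ln (A j)))"
    using tri_pos[OF t j] by (simp add: powr_def exp_minus divide_inverse)
   ultimately show "exp (- (sdiff r (\<lambda>j. cplx (\<zeta> j)) j * cplx (ln (A j)))) = cplx (1 / (A j powr sdiff r \<zeta> j))"
    by (simp add: exp_of_real[symmetric])
  qed
  also have "\<dots> = cplx (1 / chi A \<zeta>)"
   unfolding chi_def of_real_prod[symmetric] by (simp add: prod_dividef)
  finally show ?thesis .
 qed
 have "H (\<lambda>j. cplx (s j)) - X (\<lambda>j. cplx (s j)) * G (\<lambda>j. cplx (s j)) = 0"
 proof (rule separately_entire_zero[where G = "\<lambda>z. H z - X z * G z" and Z = Zb and r = r])
  show "(\<lambda>w. H (z(j := w)) - X (z(j := w)) * G (z(j := w))) holomorphic_on UNIV" if "j \<in> {1..r}" for z j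
   using H(1)[OF that] G(1)[OF that] Xh by (intro holomorphic_intros)
  fix \<zeta> :: "nat => real" assume z: "\<And>j. j \<in> {1..r} ==> \<zeta> j > Zb"
  have "(\<lambda>x. ennreal (\<phi> x)) \<in> borel_measurable borel" using testp_meas[OF \<phi>] by simp
  from II_tri[OF t this, of \<zeta>]
  have "enn2real (II \<zeta> (\<lambda>x. ennreal (\<phi> (t x)))) = (1 / chi A \<zeta>) * enn2real (II \<zeta> (\<lambda>x. ennreal (\<phi> x)))"
   using chi_pos[OF t, of \<zeta>] by (simp add: enn2real_cmult)
  moreover have "G (\<lambda>j. cplx (\<zeta> j)) =
   cplx (enn2real (II \<zeta> (\<lambda>x. ennreal (\<phi> x))) / enn2real (II \<zeta> (\<lambda>x. ennreal (exp (- inner e x)))))"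
   by (rule G(2)) (rule z)
  moreover have "H (\<lambda>j. cplx (\<zeta> j)) =
   cplx (enn2real (II \<zeta> (\<lambda>x. ennreal (\<phi> (t x)))) / enn2real (II \<zeta> (\<lambda>x. ennreal (exp (- inner e x)))))"
   by (rule H(2)) (rule z)
  ultimately show "H (\<lambda>j. cplx (\<zeta> j)) - X (\<lambda>j. cplx (\<zeta> j)) * G (\<lambda>j. cplx (\<zeta> j)) = 0"
   unfolding Xr by simp
 qed
 then have "cplx (\<integral>x. \<phi> (t x) \<partial>M) = cplx ((1 / chi A s) * (\<integral>x. \<phi> x \<partial>M))"
  unfolding G(3) H(3) Xr by simp
 then show ?thesis by (simp only: of_real_eq_iff)
qed

lemma M_tri_nn:
 assumes \<phi>: "testp \<phi>" and t: "tri t A"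
 shows "(\<integral>\<^sup>+x. ennreal (\<phi> (t x)) \<partial>M) = ennreal (1 / chi A s) * (\<integral>\<^sup>+x. ennreal (\<phi> x) \<partial>M)"
proof -
 have i: "integrable M \<phi>" "integrable M (\<lambda>x. \<phi> (t x))"
  using testp_mu(1)[OF \<phi>] testp_mu(1)[OF testp_tri[OF \<phi> t]] by auto
 have nn: "\<phi> x \<ge> 0" for x using \<phi> by (simp add: testp_def)
 have "(\<integral>\<^sup>+x. ennreal (\<phi> (t x)) \<partial>M) = ennreal (\<integral>x. \<phi> (t x) \<partial>M)"
  using i nn by (intro nn_integral_eq_integral) auto
 also have "\<dots> = ennreal (1 / chi A s) * ennreal (\<integral>x. \<phi> x \<partial>M)"
  unfolding M_tri[OF \<phi> t] using chi_pos[OF t, of s] nn by (intro ennreal_mult) auto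
 also have "ennreal (\<integral>x. \<phi> x \<partial>M) = (\<integral>\<^sup>+x. ennreal (\<phi> x) \<partial>M)"
  using i nn by (intro nn_integral_eq_integral[symmetric]) auto
 finally show ?thesis .
qed

text \<open>For a bump supported off the closed cone the pairing is 0 at all large parameters, hence
  at \<open>s\<close>. Countably many balls cover the complement.\<close>

lemma M_null_off_Q: "emeasure M (- Q) = 0"
proof -
 have ball0: "emeasure M (ball a \<rho>) = 0" if sub: "ball a \<rho> \<subseteq> - Q" and \<rho>: "\<rho> > 0" for a \<rho>
 proof -
  define \<phi> where "\<phi> x = bmp (\<rho>\<^sup>2 + (- 1) * (norm (x - a))\<^sup>2)" for x
  have "Sm \<phi>" unfolding \<phi>_def
   by (rule Sm_comp[OF smooth1_bmp Sm_add[OF Sm_const Sm_mult[OF Sm_const Sm_norm_sq]]])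
  moreover have ph: "\<phi> x > 0 \<longleftrightarrow> x \<in> ball a \<rho>" "\<phi> x \<ge> 0" for x
  proof -
   have "\<rho>\<^sup>2 + (- 1) * (norm (x - a))\<^sup>2 > 0 \<longleftrightarrow> norm (x - a) < \<rho>"
    using \<rho> power2_less_imp_less[of "norm (x - a)" \<rho>] power_strict_mono[of "norm (x - a)" \<rho> 2] by auto
   then show "\<phi> x > 0 \<longleftrightarrow> x \<in> ball a \<rho>"
    unfolding \<phi>_def using bmp_pos[of "\<rho>\<^sup>2 + (- 1) * (norm (x - a))\<^sup>2"] bmp_zero[of "\<rho>\<^sup>2 + (- 1) * (norm (x - a))\<^sup>2"]
    by (cases "norm (x - a) < \<rho>") (auto simp: dist_norm norm_minus_commute)
   show "\<phi> x \<ge> 0" by (simp add: \<phi>_def bmp_nonneg)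
  qed
  then have "{x. \<phi> x \<noteq> 0} \<subseteq> ball a \<rho>" by (force simp: less_le)
  ultimately have tp: "testp \<phi>"
   using ph bounded_subset[OF bounded_ball] unfolding testp_def by blast
  obtain G where "contin \<phi> G" using testp_mu(2)[OF tp] by blast
  note G = continD[OF this]
  have z0: "indicator \<Omega> x * (v::ennreal) * ennreal (\<phi> x) = 0" for x v
  proof (cases "x \<in> \<Omega>")
   case True
   then have "x \<notin> ball a \<rho>" using sub \<Omega>_sub_Q by blast
   then have "\<phi> x = 0" using ph[of x] by linarith
   then show ?thesis by simp
  qed simp
  have II0: "II \<zeta> (\<lambda>x. ennreal (\<phi> x)) = 0" for \<zeta> unfolding II_def z0 by simp
  have "G (\<lambda>j. cplx (s j)) = 0"
  proof (rule separately_entire_zero[where Z = Zb and r = r])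
   show "(\<lambda>w. G (z(j := w))) holomorphic_on UNIV" if "j \<in> {1..r}" for z j by (rule G(1)[OF that])
   fix \<zeta> :: "nat => real" assume z: "\<And>j. j \<in> {1..r} ==> \<zeta> j > Zb"
   have "G (\<lambda>j. cplx (\<zeta> j)) =
    cplx (enn2real (II \<zeta> (\<lambda>x. ennreal (\<phi> x))) / enn2real (II \<zeta> (\<lambda>x. ennreal (exp (- inner e x)))))"
    by (rule G(2)) (rule z)
   then show "G (\<lambda>j. cplx (\<zeta> j)) = 0" by (simp add: II0)
  qed
  then have "(\<integral>x. \<phi> x \<partial>M) = 0" using G(3) by simp
  then have "AE x in M. \<phi> x = 0"
   using integral_nonneg_eq_0_iff_AE[OF testp_mu(1)[OF tp]] ph(2) by simp
  then have "AE x in M. x \<notin> ball a \<rho>" by eventually_elim (use ph in force)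
  then show ?thesis by (subst (asm) AE_iff_measurable[of "ball a \<rho>"]) (auto simp: sets_M)
 qed
 define F where "F = {ball a \<rho> | a \<rho>. \<rho> > 0 \<and> ball a \<rho> \<subseteq> - Q}"
 have UF: "\<Union> F = - Q"
 proof
  show "- Q \<subseteq> \<Union> F"
  proof
   fix x assume "x \<in> - Q"
   moreover have "open (- Q)" using closed_Q by (rule open_Compl)
   ultimately obtain \<rho> where "\<rho> > 0" "ball x \<rho> \<subseteq> - Q" using open_contains_ball by blast
   then show "x \<in> \<Union> F" unfolding F_def by (intro UnionI[of "ball x \<rho>"]) auto
  qed
 qed (auto simp: F_def)
 obtain F' where F': "F' \<subseteq> F" "countable F'" "\<Union> F' = \<Union> F"
  using Lindelof[of F] by (auto simp: F_def)
 have "(\<Union>B\<in>F'. B) \<in> null_sets M"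
  using F' ball0 by (intro null_sets_UN') (auto simp: F_def null_sets_def sets_M)
 then show ?thesis using F'(3) UF by (simp add: null_sets_def)
qed

end

section \<open>Nontriviality of the measure near the origin\<close>

lemma open_lborel_pos:
 fixes S :: "'a::euclidean_space set"
 assumes "open S" "S \<noteq> {}"
 shows "emeasure lborel S > 0"
proof -
 obtain a \<rho> where "\<rho> > 0" "ball a \<rho> \<subseteq> S" using assms open_contains_ball by blast
 then show ?thesis
  using ball_lborel(2)[of \<rho> a] emeasure_mono[of "ball a \<rho>" S lborel] assms by (simp add: less_le_trans)
qed

lemma bet_mellin_holomorphic:
 "(\<lambda>w. integral {1..2} (\<lambda>t. cplx (bet t) * exp (w * cplx (ln t)))) holomorphic_on UNIV"
proof -
 have "(\<lambda>w. integral (cbox 1 2) (\<lambda>t. cplx (bet t) * exp (w * cplx (ln t)))) holomorphic_on UNIV"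
 proof (rule leibniz_rule_holomorphic[where fx = "\<lambda>w t. cplx (bet t) * (cplx (ln t) * exp (w * cplx (ln t)))"])
  show "((\<lambda>w. cplx (bet t) * exp (w * cplx (ln t))) has_field_derivative
    cplx (bet t) * (cplx (ln t) * exp (w * cplx (ln t)))) (at w within UNIV)" for w t
   by (auto intro!: derivative_eq_intros)
  show "(\<lambda>t. cplx (bet t) * exp (w * cplx (ln t))) integrable_on cbox 1 2" for w
   by (intro integrable_continuous continuous_intros continuous_bet) auto
  show "continuous_on (UNIV \<times> cbox 1 2) (\<lambda>(w, t). cplx (bet t) * (cplx (ln t) * exp (w * cplx (ln t))))"
   unfolding case_prod_unfold
   by (intro continuous_intros continuous_on_compose2[OF continuous_bet[of UNIV]]) auto
 qed simp
 then show ?thesis by simp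
qed

lemma bet_mellin_real:
 "integral {1..2} (\<lambda>t. cplx (bet t) * exp (cplx S * cplx (ln t)))
  = cplx (integral {1..2} (\<lambda>t. bet t * t powr S))"
proof -
 have "integral {1..2} (\<lambda>t. cplx (bet t) * exp (cplx S * cplx (ln t)))
  = integral {1..2} (cplx \<circ> (\<lambda>t. bet t * t powr S))"
 proof (rule integral_cong)
  fix t :: real assume "t \<in> {1..2}"
  then have "exp (cplx S * cplx (ln t)) = cplx (t powr S)"
   by (simp add: powr_def exp_of_real[symmetric])
  then show "cplx (bet t) * exp (cplx S * cplx (ln t)) = (cplx \<circ> (\<lambda>t. bet t * t powr S)) t"
   by simp
 qed
 also have "\<dots> = cplx (integral {1..2} (\<lambda>t. bet t * t powr S))"
  by (intro integral_linear bounded_linear_of_real integrable_continuous_interval continuous_intros continuous_bet) auto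
 finally show ?thesis .
qed

lemma bet_mellin_nn:
 "(\<integral>\<^sup>+t. indicator {0<..} t * ennreal (t powr S) * ennreal (bet t) \<partial>lborel) = ennreal (integral {1..2} (\<lambda>t. bet t * t powr S))"
proof -
 have "((\<lambda>t. bet t * t powr S) has_integral integral {1..2} (\<lambda>t. bet t * t powr S)) {1..2}"
  by (intro integrable_integral integrable_continuous_interval continuous_intros continuous_bet) auto
 then have "((\<lambda>t. if t \<in> {1..2} then bet t * t powr S else 0) has_integral integral {1..2} (\<lambda>t. bet t * t powr S)) UNIV"
  unfolding has_integral_restrict_UNIV .
 moreover have "(\<lambda>t. if t \<in> {1..2} then bet t * t powr S else 0) = (\<lambda>t. bet t * t powr S)"
 proof (rule ext)
  fix t show "(if t \<in> {1..2} then bet t * t powr S else 0) = bet t * t powr S"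
   by (cases "t \<in> {1<..<2}") (use bet_zero[of t] in auto)
 qed
 ultimately have "(\<integral>\<^sup>+t. ennreal (bet t * t powr S) \<partial>lborel) = ennreal (integral {1..2} (\<lambda>t. bet t * t powr S))"
  by (intro nn_integral_has_integral_lborel) (auto simp: bet_nonneg)
 moreover have "indicator {0<..} t * ennreal (t powr S) * ennreal (bet t) = ennreal (bet t * t powr S)" for t
  by (cases "t \<in> {1<..<2}") (use bet_zero[of t] bet_nonneg[of t] in \<open>auto simp: ennreal_mult mult.commute\<close>)
 ultimately show ?thesis by simp
qed

lemma bet_mellin_pos:
 assumes "S \<ge> 0"
 shows "integral {1..2} (\<lambda>t. bet t * t powr S) > 0"
proof -
 have "0 < psi 0" by (rule psi_0_pos)
 also have "psi 0 = psi 1" using psi_one[of 1] by simp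
 also have "\<dots> = integral {1..2} bet" using psi_split[of 1 2] psi_zero[of 2] by simp
 also have "\<dots> \<le> integral {1..2} (\<lambda>t. bet t * t powr S)"
 proof (rule integral_le)
  show "bet integrable_on {1..2}" "(\<lambda>t. bet t * t powr S) integrable_on {1..2}"
   by (intro integrable_continuous_interval continuous_intros continuous_bet; auto)+
  fix t :: real assume "t \<in> {1..2}"
  then have "t powr S \<ge> 1" using assms by (simp add: ge_one_powr_ge_zero)
  then show "bet t \<le> bet t * t powr S" using bet_nonneg[of t] mult_left_mono[of 1 "t powr S" "bet t"] by simp
 qed
 finally show ?thesis .
qed

context mu_jordan
begin

definition NN :: "(nat => real) => ennreal" where
 "NN \<zeta> = II \<zeta> (\<lambda>x. indicator {x. inner e x < 1} x)"

lemma meas_half [measurable]: "{x. inner e x < t} \<in> sets borel"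
 by (simp add: open_halfspace_lt)

lemma II_half:
 assumes t: "t > 0"
 shows "II \<zeta> (\<lambda>x. indicator {x. inner e x < t} x) = ennreal (t powr (\<Sum>j=1..r. \<zeta> j)) * NN \<zeta>"
proof -
 have T: "tri (\<lambda>x. (1/t) *\<^sub>R x) (\<lambda>k. (1/t) ^ k)" using t by (intro tri_scaleR) simp
 have "indicator {x. inner e x < t} x = (indicator {x. inner e x < 1} ((1/t) *\<^sub>R x) :: ennreal)" for x
  using t by (simp add: indicator_def field_simps)
 then have "II \<zeta> (\<lambda>x. indicator {x. inner e x < t} x) = ennreal (1 / chi (\<lambda>k. (1/t) ^ k) \<zeta>) * NN \<zeta>"
  unfolding NN_def by (simp only:) (rule II_tri[OF T], measurable)
 also have "1 / chi (\<lambda>k. (1/t) ^ k) \<zeta> = t powr (\<Sum>j=1..r. \<zeta> j)"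
  using t by (subst chi_scaleR) (auto simp: powr_divide)
 finally show ?thesis .
qed

lemma meas_II: "f \<in> borel_measurable borel ==> (\<lambda>x. indicator \<Omega> x * ennreal (gp \<nu> x) * f x) \<in> borel_measurable borel"
 by (intro borel_measurable_times_ennreal meas_gp_enn)

text \<open>Layer-cake formula: a function of (e|x) is a superposition of the half-spaces (e|x) < t,
  whose measure is homogeneous in t. All dependence on the cone collects in the factor
  \<open>NN\<close>, and a one-dimensional Mellin integral remains.\<close>

lemma II_layer:
 assumes b: "b \<in> borel_measurable borel"
 shows "II \<zeta> (\<lambda>x. \<integral>\<^sup>+t. indicator {inner e x<..} t * b t \<partial>lborel)
  = NN \<zeta> * (\<integral>\<^sup>+t. indicator {0<..} t * ennreal (t powr (\<Sum>j=1..r. \<zeta> j)) * b t \<partial>lborel)"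
proof -
 let ?g = "\<lambda>x. indicator \<Omega> x * ennreal (gp (\<lambda>j. \<zeta> j - real DIM('a) / real r) x)"
 note [measurable] = b
 have gm [measurable]: "?g \<in> borel_measurable borel" by (rule meas_gp_enn)
 have ind: "indicator {inner e x<..} t = (indicator {p. inner e (fst p) < snd p} (x, t) :: ennreal)" for x :: 'a and t
  by (simp add: indicator_def)
 have om: "{p. inner e (fst p) < snd p} \<in> sets (borel :: ('a \<times> real) measure)"
  by (intro borel_open open_Collect_less continuous_intros)
 have [measurable]: "{p. inner e (fst p) < snd p} \<in> sets (lborel \<Otimes>\<^sub>M (lborel :: real measure))"
  using om unfolding lborel_prod by simp
 have [measurable]: "?g \<in> borel_measurable lborel" "b \<in> borel_measurable lborel" using gm b by simp_all
 have jm: "(\<lambda>p. ?g (fst p) * (indicator {p. inner e (fst p) < snd p} p * b (snd p))) \<in> borel_measurable (lborel \<Otimes>\<^sub>M lborel)"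
  by measurable
 have "II \<zeta> (\<lambda>x. \<integral>\<^sup>+t. indicator {inner e x<..} t * b t \<partial>lborel)
  = (\<integral>\<^sup>+x. \<integral>\<^sup>+t. ?g x * (indicator {p. inner e (fst p) < snd p} (x, t) * b t) \<partial>lborel \<partial>lborel)"
  unfolding II_def ind by (intro nn_integral_cong nn_integral_cmult[symmetric]) measurable
 also have "\<dots> = (\<integral>\<^sup>+t. \<integral>\<^sup>+x. ?g x * (indicator {p. inner e (fst p) < snd p} (x, t) * b t) \<partial>lborel \<partial>lborel)"
  by (rule lborel_pair.Fubini'[symmetric]) (use jm in \<open>simp add: case_prod_unfold\<close>)
 also have "\<dots> = (\<integral>\<^sup>+t. NN \<zeta> * (indicator {0<..} t * ennreal (t powr (\<Sum>j=1..r. \<zeta> j)) * b t) \<partial>lborel)"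
 proof (rule nn_integral_cong)
  fix t :: real
  have "(\<integral>\<^sup>+x. ?g x * (indicator {p. inner e (fst p) < snd p} (x, t) * b t) \<partial>lborel)
   = (\<integral>\<^sup>+x. ?g x * indicator {x. inner e x < t} x * b t \<partial>lborel)"
   by (intro nn_integral_cong) (simp add: indicator_def mult.assoc)
  also have "\<dots> = II \<zeta> (\<lambda>x. indicator {x. inner e x < t} x) * b t"
   unfolding II_def by (intro nn_integral_multc) measurable
  also have "\<dots> = NN \<zeta> * (indicator {0<..} t * ennreal (t powr (\<Sum>j=1..r. \<zeta> j)) * b t)"
  proof (cases "t > 0")
   case True
   then show ?thesis by (simp add: II_half[OF True] ac_simps)
  next
   case False
   have z0: "?g x * indicator {x. inner e x < t} x = 0" for x
    using \<Omega>_inner_pos[OF e_in_\<Omega>, of x] \<Omega>_sub_Q False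
    by (cases "x \<in> \<Omega>"; cases "x = 0") (auto simp: indicator_def)
   have "II \<zeta> (\<lambda>x. indicator {x. inner e x < t} x) = 0" unfolding II_def z0 by simp
   then show ?thesis using False by simp
  qed
  finally show "(\<integral>\<^sup>+x. ?g x * (indicator {p. inner e (fst p) < snd p} (x, t) * b t) \<partial>lborel)
   = NN \<zeta> * (indicator {0<..} t * ennreal (t powr (\<Sum>j=1..r. \<zeta> j)) * b t)" .
 qed
 also have "\<dots> = NN \<zeta> * (\<integral>\<^sup>+t. indicator {0<..} t * ennreal (t powr (\<Sum>j=1..r. \<zeta> j)) * b t \<partial>lborel)"
  by (intro nn_integral_cmult) measurable
 finally show ?thesis .
qed

lemma NN_finite_pos:
 assumes z: "\<And>j. j \<in> {1..r} ==> \<zeta> j > Zb"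
 shows "NN \<zeta> < \<infinity>" "NN \<zeta> > 0"
proof -
 let ?\<nu> = "\<lambda>j. \<zeta> j - real DIM('a) / real r"
 let ?S = "\<Sum>j=1..r. ?\<nu> j"
 have nu: "?\<nu> j \<ge> 0" if "j \<in> {1..r}" for j using z[OF that] Zb_nr by simp
 have S0: "?S \<ge> 0" by (intro sum_nonneg nu)
 have "NN \<zeta> \<le> (\<integral>\<^sup>+x. ennreal (2 powr ?S) * indicator (cball (0::'a) 1) x \<partial>lborel)"
  unfolding NN_def II_def
 proof (rule nn_integral_mono)
  fix x
  show "indicator \<Omega> x * ennreal (gp ?\<nu> x) * indicator {x. inner e x < 1} x \<le> ennreal (2 powr ?S) * indicator (cball (0::'a) 1) x"
  proof (cases "x \<in> \<Omega> \<and> inner e x < 1")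
   case True
   then have nx: "norm x \<le> 1" using Q_norm_le[of x] \<Omega>_sub_Q by force
   have "gp ?\<nu> x \<le> (1 + norm x) powr ?S" using gp_bound[of x ?\<nu>] nu True by blast
   also have "\<dots> \<le> 2 powr ?S" using nx S0 by (intro powr_mono2) auto
   finally show ?thesis using True nx by (simp add: ennreal_leI)
  qed (auto simp: indicator_def)
 qed
 also have "\<dots> < \<infinity>"
  using emeasure_bounded_finite[OF bounded_cball, of "0::'a" 1] by (subst nn_integral_cmult_indicator) (auto simp: ennreal_mult_less_top)
 finally show "NN \<zeta> < \<infinity>" .
 have "NN \<zeta> \<noteq> 0"
 proof
  let ?U = "\<Omega> \<inter> {x. inner e x < 1}"
  assume "NN \<zeta> = 0"
  then have "AE x in lborel. indicator \<Omega> x * ennreal (gp ?\<nu> x) * indicator {x. inner e x < 1} x = 0"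
   unfolding NN_def II_def by (subst (asm) nn_integral_0_iff_AE) (auto intro!: meas_II)
  then have "AE x in lborel. x \<notin> ?U"
  proof eventually_elim
   case (elim x)
   then show ?case using gp_pos[of x ?\<nu>] by (auto simp: indicator_def split: if_splits)
  qed
  then have "emeasure lborel ?U = 0"
   by (subst (asm) AE_iff_measurable[of ?U]) auto
  moreover have "open ?U" by (intro open_Int open_\<Omega> open_halfspace_lt)
  moreover have "(1 / (2 * real r)) *\<^sub>R e \<in> ?U"
   using \<Omega>_scale[OF e_in_\<Omega>, of "1 / (2 * real r)"] r2 by (simp add: inner_ee)
  then have "?U \<noteq> {}" by blast
  ultimately show False using open_lborel_pos[of ?U] by simp
 qed
 then show "NN \<zeta> > 0" by (simp add: zero_less_iff_neq_zero)
qed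

text \<open>A step in (e|x) is not compactly supported on the whole space; the cutoff repairs this
  and is invisible on the cone, where |x| \<le> (e|x).\<close>

definition phi0 :: "'a => real" where
 "phi0 x = psi (inner e x) * cut 2 x"

lemma testp_phi0: "testp phi0"
proof -
 have "Sm phi0" unfolding phi0_def by (rule Sm_mult[OF Sm_comp[OF smooth1_psi Sm_inner_left] Sm_cut])
 moreover have "{x. phi0 x \<noteq> 0} \<subseteq> {x. cut 2 x \<noteq> 0}" by (auto simp: phi0_def)
 then have "bounded {x. phi0 x \<noteq> 0}" using cut_support[of 2] bounded_subset by auto
 moreover have "phi0 x \<ge> 0" for x by (simp add: phi0_def psi_nonneg cut_nonneg)
 ultimately show ?thesis by (simp add: testp_def)
qed

lemma phi0_\<Omega>: "x \<in> \<Omega> ==> phi0 x = psi (inner e x)"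
proof -
 assume x: "x \<in> \<Omega>"
 show ?thesis
 proof (cases "inner e x \<ge> 2")
  case True
  then show ?thesis using psi_zero[OF True] by (simp add: phi0_def)
 next
  case False
  then have "norm x \<le> 2" using Q_norm_le[of x] x \<Omega>_sub_Q by force
  then show ?thesis using cut_one[of x 2] by (simp add: phi0_def)
 qed
qed

text \<open>By \<open>II_layer\<close>, \<open>NN\<close> cancels and the pairing is the Mellin
  transform of \<open>bet\<close> at S over \<Gamma>(S + 1), where S is the sum of the parameters.
  This is entire since 1/\<Gamma> is, so the formula holds at \<open>s\<close>; there S \<ge> 0 and
  both factors are positive.\<close>

lemma phi0_pos: "(\<integral>x. phi0 x \<partial>M) > 0"
proof -
 obtain G where "contin phi0 G" using testp_mu(2)[OF testp_phi0] by blast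
 note G = continD[OF this]
 define F where "F w = integral {1..2} (\<lambda>t. cplx (bet t) * exp (w * cplx (ln t)))" for w
 define H where "H z = F (\<Sum>j=1..r. z j) * rGamma ((\<Sum>j=1..r. z j) + 1)" for z :: "nat => complex"
 have Hr: "H (\<lambda>j. cplx (\<zeta> j)) = cplx (integral {1..2} (\<lambda>t. bet t * t powr (\<Sum>j=1..r. \<zeta> j)) / Gamma ((\<Sum>j=1..r. \<zeta> j) + 1))" for \<zeta>
 proof -
  let ?S = "\<Sum>j=1..r. \<zeta> j"
  have "H (\<lambda>j. cplx (\<zeta> j)) = F (cplx ?S) * rGamma (cplx (?S + 1))"
   by (simp add: H_def)
  also have "\<dots> = cplx (integral {1..2} (\<lambda>t. bet t * t powr ?S)) * cplx (rGamma (?S + 1))"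
   unfolding F_def bet_mellin_real rGamma_complex_of_real ..
  finally show ?thesis by (simp add: rGamma_inverse_Gamma divide_inverse)
 qed
 have Hh: "(\<lambda>w. H (z(j := w))) holomorphic_on UNIV" if "j \<in> {1..r}" for z j
 proof -
  have sum: "(\<Sum>i=1..r. (z(j := w)) i) = w + (\<Sum>i\<in>{1..r} - {j}. z i)" for w
   using that by (subst sum.remove[of _ j]) auto
  have Fh: "F holomorphic_on UNIV" unfolding F_def by (rule bet_mellin_holomorphic)
  have "(\<lambda>w. F (w + (\<Sum>i\<in>{1..r} - {j}. z i))) holomorphic_on UNIV"
   by (rule holomorphic_on_compose_gen[OF _ Fh, unfolded o_def]) (auto intro!: holomorphic_intros)
  then show ?thesis unfolding H_def sum by (intro holomorphic_intros)
 qed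
 have "G (\<lambda>j. cplx (s j)) - H (\<lambda>j. cplx (s j)) = 0"
 proof (rule separately_entire_zero[where G = "\<lambda>z. G z - H z" and Z = Zb and r = r])
  show "(\<lambda>w. G (z(j := w)) - H (z(j := w))) holomorphic_on UNIV" if "j \<in> {1..r}" for z j
   by (intro holomorphic_on_diff G(1)[OF that] Hh[OF that])
  fix \<zeta> :: "nat => real" assume z: "\<And>j. j \<in> {1..r} ==> \<zeta> j > Zb"
  let ?S = "\<Sum>j=1..r. \<zeta> j"
  have "Zb \<ge> 0" using Zb_nr by (meson divide_nonneg_nonneg of_nat_0_le_iff order_trans)
  then have S0: "?S \<ge> 0" using z by (intro sum_nonneg) (force intro: less_imp_le)
  obtain N where N: "NN \<zeta> = ennreal N" "N > 0"
  proof -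
   have "NN \<zeta> < \<infinity>" by (rule NN_finite_pos(1)) (rule z)
   moreover have "NN \<zeta> > 0" by (rule NN_finite_pos(2)) (rule z)
   ultimately show ?thesis using that by (cases "NN \<zeta>") auto
  qed
  have "II \<zeta> (\<lambda>x. ennreal (phi0 x)) = II \<zeta> (\<lambda>x. \<integral>\<^sup>+t. indicator {inner e x<..} t * ennreal (bet t) \<partial>lborel)"
   unfolding II_def psi_enn[symmetric] by (intro nn_integral_cong) (auto simp: phi0_\<Omega> indicator_def)
  also have "\<dots> = ennreal N * ennreal (integral {1..2} (\<lambda>t. bet t * t powr ?S))"
   using II_layer[of "\<lambda>t. ennreal (bet t)" \<zeta>] N by (simp add: bet_mellin_nn)
  finally have 1: "enn2real (II \<zeta> (\<lambda>x. ennreal (phi0 x))) = N * integral {1..2} (\<lambda>t. bet t * t powr ?S)"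
   using N bet_mellin_pos[OF S0] by (simp add: enn2real_mult)
  have "II \<zeta> (\<lambda>x. ennreal (exp (- inner e x))) = II \<zeta> (\<lambda>x. \<integral>\<^sup>+t. indicator {inner e x<..} t * ennreal (exp (- t)) \<partial>lborel)"
   by (simp only: nn_integral_exp_tail[symmetric])
  also have "\<dots> = ennreal N * (\<integral>\<^sup>+t. indicator {0<..} t * ennreal (t powr ?S) * ennreal (exp (- t)) \<partial>lborel)"
   using II_layer[of "\<lambda>t. ennreal (exp (- t))" \<zeta>] N by simp
  also have "(\<integral>\<^sup>+t. indicator {0<..} t * ennreal (t powr ?S) * ennreal (exp (- t)) \<partial>lborel) = (\<integral>\<^sup>+t. indicator {0<..} t * ennreal (exp (- t) * t powr ?S) \<partial>lborel)"
   by (intro nn_integral_cong) (simp add: ennreal_mult ac_simps)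
  also have "\<dots> = ennreal (Gamma (?S + 1))" using S0 by (intro nn_integral_Gamma) simp
  finally have 2: "enn2real (II \<zeta> (\<lambda>x. ennreal (exp (- inner e x)))) = N * Gamma (?S + 1)"
   using N S0 Gamma_real_pos[of "?S + 1"] by (simp add: enn2real_mult)
  have "G (\<lambda>j. cplx (\<zeta> j)) =
   cplx (enn2real (II \<zeta> (\<lambda>x. ennreal (phi0 x))) / enn2real (II \<zeta> (\<lambda>x. ennreal (exp (- inner e x)))))"
   by (rule G(2)) (rule z)
  then show "G (\<lambda>j. cplx (\<zeta> j)) - H (\<lambda>j. cplx (\<zeta> j)) = 0"
   unfolding Hr 1 2 using N(2) by simp
 qed
 then have "cplx (\<integral>x. phi0 x \<partial>M) = cplx (integral {1..2} (\<lambda>t. bet t * t powr (\<Sum>j=1..r. s j)) / Gamma ((\<Sum>j=1..r. s j) + 1))"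
  unfolding G(3) Hr by simp
 then have "(\<integral>x. phi0 x \<partial>M) = integral {1..2} (\<lambda>t. bet t * t powr (\<Sum>j=1..r. s j)) / Gamma ((\<Sum>j=1..r. s j) + 1)"
  by (simp only: of_real_eq_iff)
 moreover have "(\<Sum>j=1..r. s j) \<ge> 0" by (intro sum_nonneg s_nonneg)
 ultimately show ?thesis using bet_mellin_pos by (simp add: Gamma_real_pos)
qed

text \<open>Dilations rescale the positive integral of \<open>phi0\<close> by a positive factor. If
  a ball around 0 carried no mass, a dilation squeezing the support of \<open>phi0\<close> into it
  (a = 2R/eps) would make that integral 0.\<close>

lemma M_near_0:
 assumes "eps > 0"
 shows "emeasure M (Q \<inter> ball 0 eps) > 0"
proof (rule ccontr)
 assume "\<not> ?thesis"
 then have q0: "emeasure M (Q \<inter> ball 0 eps) = 0" by (simp add: not_gr_zero)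
 have "emeasure M (ball 0 eps) \<le> emeasure M ((Q \<inter> ball 0 eps) \<union> (- Q))"
  by (intro emeasure_mono) (auto simp: sets_M meas_Q)
 also have "\<dots> \<le> emeasure M (Q \<inter> ball 0 eps) + emeasure M (- Q)"
  by (intro emeasure_subadditive) (auto simp: sets_M meas_Q)
 finally have b0: "emeasure M (ball 0 eps) = 0" using q0 M_null_off_Q by simp
 obtain R where R: "R > 0" "\<And>x. phi0 x \<noteq> 0 ==> norm x \<le> R"
  using testp_phi0 unfolding testp_def bounded_pos by blast
 define a where "a = 2 * R / eps"
 have a: "a > 0" using R assms by (simp add: a_def)
 have "AE x in M. x \<notin> ball 0 eps"
  using b0 by (subst AE_iff_measurable[of "ball 0 eps"]) (auto simp: sets_M)
 then have "AE x in M. phi0 (a *\<^sub>R x) = 0"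
 proof eventually_elim
  case (elim x)
  then have "norm (a *\<^sub>R x) \<ge> a * eps" using a by simp
  then have "norm (a *\<^sub>R x) > R" using R assms by (simp add: a_def)
  then show ?case using R(2)[of "a *\<^sub>R x"] by force
 qed
 then have "(\<integral>x. phi0 (a *\<^sub>R x) \<partial>M) = 0" by (rule integral_eq_zero_AE)
 moreover have "(\<integral>x. phi0 (a *\<^sub>R x) \<partial>M) = (1 / chi (\<lambda>k. a ^ k) s) * (\<integral>x. phi0 x \<partial>M)"
  by (rule M_tri[OF testp_phi0 tri_scaleR[OF a]])
 ultimately show False using phi0_pos chi_pos[OF tri_scaleR[OF a], of s] by simp
qed

section \<open>The Laplace transform of the measure\<close>

definition LL :: "'a => ennreal" where
 "LL \<xi> = (\<integral>\<^sup>+y. indicator Q y * ennreal (exp (- inner y \<xi>)) \<partial>M)"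

lemma LL_eq: "LL \<xi> = (\<integral>\<^sup>+y. ennreal (exp (- inner y \<xi>)) \<partial>M)"
proof -
 have "AE y in M. y \<in> Q"
  using M_null_off_Q by (subst AE_iff_measurable[of "- Q"]) (auto simp: sets_M meas_Q)
 then show ?thesis unfolding LL_def by (intro nn_integral_cong_AE) (auto simp: indicator_def elim!: eventually_mono)
qed

text \<open>Relative invariance is available for compactly supported test functions; exponentials
  are cut off at growing radii and Fatou's lemma passes to the limit. The resulting inequality is in
  the direction that bounds 1/LL from above.\<close>

lemma LL_tri:
 assumes t: "tri t A" and adj: "\<And>x y. inner (t x) y = inner x (t' y)"
 shows "ennreal (1 / chi A s) * LL \<xi> \<le> LL (t' \<xi>)"
proof -
 define \<phi> where "\<phi> k x = exp (- (inner \<xi> x)) * cut (real (Suc k)) x" for k x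
 have tp: "testp (\<phi> k)" for k
 proof -
  have "Sm (\<phi> k)" unfolding \<phi>_def by (rule Sm_mult[OF Sm_comp[OF smooth1_exp_minus Sm_inner_left] Sm_cut])
  moreover have "{x. \<phi> k x \<noteq> 0} \<subseteq> {x. cut (real (Suc k)) x \<noteq> 0}" by (auto simp: \<phi>_def)
  then have "bounded {x. \<phi> k x \<noteq> 0}" using cut_support[of "real (Suc k)"] bounded_subset by auto
  ultimately show ?thesis by (auto simp: testp_def \<phi>_def cut_nonneg)
 qed
 have le: "ennreal (1 / chi A s) * (\<integral>\<^sup>+x. ennreal (\<phi> k x) \<partial>M) \<le> LL (t' \<xi>)" for k
  unfolding M_tri_nn[OF tp t, symmetric] LL_eq
 proof (intro nn_integral_mono ennreal_leI)
  fix x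
  have "\<phi> k (t x) \<le> exp (- (inner \<xi> (t x))) * 1" unfolding \<phi>_def using cut_le_1 by (intro mult_left_mono) auto
  also have "inner \<xi> (t x) = inner x (t' \<xi>)" using adj[of x \<xi>] by (simp add: inner_commute)
  finally show "\<phi> k (t x) \<le> exp (- inner x (t' \<xi>))" by simp
 qed
 have lim: "ennreal (exp (- inner x \<xi>)) = liminf (\<lambda>k. ennreal (\<phi> k x))" for x
 proof -
  have "eventually (\<lambda>k. \<phi> k x = exp (- inner x \<xi>)) sequentially"
   using eventually_ge_at_top[of "nat \<lceil>norm x\<rceil>"]
  proof eventually_elim
   case (elim k)
   then have "norm x \<le> real (Suc k)" by linarith
   then show ?case using cut_one[of x "real (Suc k)"] by (simp add: \<phi>_def inner_commute)
  qed
  then have "(\<lambda>k. ennreal (\<phi> k x)) \<longlonglongrightarrow> ennreal (exp (- inner x \<xi>))"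
   by (intro tendsto_eventually) (auto elim!: eventually_mono)
  then show ?thesis by (simp add: lim_imp_Liminf)
 qed
 have meas: "(\<lambda>x. ennreal (\<phi> k x)) \<in> borel_measurable M" for k
  using testp_meas[OF tp] by (simp add: measurable_cong_sets[OF sets_M refl])
 have "LL \<xi> = (\<integral>\<^sup>+x. liminf (\<lambda>k. ennreal (\<phi> k x)) \<partial>M)" unfolding LL_eq lim ..
 also have "\<dots> \<le> liminf (\<lambda>k. \<integral>\<^sup>+x. ennreal (\<phi> k x) \<partial>M)" by (rule nn_integral_liminf[OF meas])
 finally have "ennreal (1 / chi A s) * LL \<xi> \<le> ennreal (1 / chi A s) * liminf (\<lambda>k. \<integral>\<^sup>+x. ennreal (\<phi> k x) \<partial>M)"
  by (rule mult_left_mono) simp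
 also have "\<dots> \<le> LL (t' \<xi>)"
 proof -
  have "(\<integral>\<^sup>+x. ennreal (\<phi> k x) \<partial>M) \<le> ennreal (chi A s) * LL (t' \<xi>)" for k
  proof -
   have "(\<integral>\<^sup>+x. ennreal (\<phi> k x) \<partial>M) = ennreal (chi A s) * (ennreal (1 / chi A s) * (\<integral>\<^sup>+x. ennreal (\<phi> k x) \<partial>M))"
    using chi_pos[OF t, of s] by (simp add: mult.assoc[symmetric] ennreal_mult[symmetric])
   also have "\<dots> \<le> ennreal (chi A s) * LL (t' \<xi>)" by (intro mult_left_mono le) simp
   finally show ?thesis .
  qed
  then have "liminf (\<lambda>k. \<integral>\<^sup>+x. ennreal (\<phi> k x) \<partial>M) \<le> ennreal (chi A s) * LL (t' \<xi>)"
   by (intro Liminf_le) (auto intro: always_eventually)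
  then have "ennreal (1 / chi A s) * liminf (\<lambda>k. \<integral>\<^sup>+x. ennreal (\<phi> k x) \<partial>M) \<le> ennreal (1 / chi A s) * (ennreal (chi A s) * LL (t' \<xi>))"
   by (rule mult_left_mono) simp
  also have "\<dots> = LL (t' \<xi>)"
   using chi_pos[OF t, of s] by (simp add: mult.assoc[symmetric] ennreal_mult[symmetric])
  finally show ?thesis .
 qed
 finally show ?thesis .
qed

text \<open>Only the mass in the unit ball around 0 is kept, where the exponential is at least
  exp(-R). Bounded sets thus have a uniform lower bound even though \<open>LL\<close> may be
  infinite.\<close>

lemma LL_lower: "\<exists>l>0. \<forall>\<xi>. norm \<xi> \<le> R \<longrightarrow> ennreal l \<le> LL \<xi>"
proof -
 let ?B = "Q \<inter> ball (0::'a) 1"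
 have "emeasure M ?B \<le> emeasure M (cball 0 1)" by (intro emeasure_mono) (auto simp: sets_M)
 also have "\<dots> < \<infinity>" by (rule M_compact) simp
 finally obtain b where b: "emeasure M ?B = ennreal b" "b > 0"
  using M_near_0[of 1] by (cases "emeasure M ?B") auto
 have "ennreal (exp (- R) * b) \<le> LL \<xi>" if "norm \<xi> \<le> R" for \<xi>
 proof -
  have "ennreal (exp (- R) * b) = (\<integral>\<^sup>+y. ennreal (exp (- R)) * indicator ?B y \<partial>M)"
   using b by (subst nn_integral_cmult_indicator) (auto simp: sets_M meas_Q ennreal_mult)
  also have "\<dots> \<le> LL \<xi>"
   unfolding LL_def
  proof (rule nn_integral_mono)
   fix y
   show "ennreal (exp (- R)) * indicator ?B y \<le> indicator Q y * ennreal (exp (- inner y \<xi>))"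
   proof (cases "y \<in> ?B")
    case True
    have "inner y \<xi> \<le> norm y * norm \<xi>" by (rule norm_cauchy_schwarz)
    also have "\<dots> \<le> 1 * R" using True that by (intro mult_mono) auto
    finally show ?thesis using True by (simp add: ennreal_leI)
   qed simp
  qed
  finally show ?thesis .
 qed
 then show ?thesis using b by (intro exI[of _ "exp (- R) * b"]) simp
qed

end

subsection \<open>Plancherel's theorem\<close>

lemma borel_measurable_cnj [measurable (raw)]:
 "f \<in> borel_measurable M ==> (\<lambda>x. cnj (f x)) \<in> borel_measurable M"
 by (erule measurable_compose) (intro borel_measurable_continuous_onI continuous_intros)

lemma integrable_exp_pos: "integrable lborel (\<lambda>t. indicator {0<..} t * exp (- t) :: real)"
proof (rule integrableI_nonneg)
 have "(\<integral>\<^sup>+t. ennreal (indicator {0<..} t * exp (- t)) \<partial>lborel) = (\<integral>\<^sup>+t. indicator {0<..} t * ennreal (exp (- t)) \<partial>lborel)"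
  by (intro nn_integral_cong) (simp add: indicator_def)
 also have "\<dots> = ennreal (exp (- 0))" by (rule nn_integral_exp_tail[symmetric])
 finally show "(\<integral>\<^sup>+t. ennreal (indicator {0<..} t * exp (- t)) \<partial>lborel) < \<infinity>" by simp
qed auto

lemma integral_exp_half:
 fixes a :: complex
 assumes a: "Re a = 1"
 shows "integrable lborel (\<lambda>t. indicator {0<..} t *\<^sub>R exp (- (a * cplx t)))"
  and "(\<integral>t. indicator {0<..} t *\<^sub>R exp (- (a * cplx t)) \<partial>lborel) = 1 / a"
proof -
 show int: "integrable lborel (\<lambda>t. indicator {0<..} t *\<^sub>R exp (- (a * cplx t)))"
 proof (rule Bochner_Integration.integrable_bound[OF integrable_exp_pos])
  show "(\<lambda>t. indicator {0<..} t *\<^sub>R exp (- (a * cplx t))) \<in> borel_measurable lborel" by measurable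
  show "AE t in lborel. norm (indicator {0<..} t *\<^sub>R exp (- (a * cplx t))) \<le> norm (indicator {0<..} t * exp (- t) :: real)"
   using a by (auto simp: indicator_def)
 qed
 have a0: "a \<noteq> 0" using a by auto
 let ?F = "\<lambda>t. - (exp (- (a * cplx t)) / a)"
 have "(LBINT t=0..\<infinity>. exp (- (a * cplx t))) = 0 - (- (1 / a))"
 proof (rule interval_integral_FTC_integrable[where F = ?F])
  show "(0::ereal) < \<infinity>" by simp
  show "(?F has_vector_derivative exp (- (a * cplx t))) (at t)" for t
   using a0 by (auto intro!: derivative_eq_intros has_vector_derivative_real_field simp: field_simps)
  show "isCont (\<lambda>t. exp (- (a * cplx t))) t" for t by (intro continuous_intros)
  show "set_integrable lborel (einterval 0 \<infinity>) (\<lambda>t. exp (- (a * cplx t)))"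
  proof -
   have "einterval 0 \<infinity> = {0<..}" by (auto simp: einterval_def zero_ereal_def)
   then show ?thesis using int by (simp add: set_integrable_def)
  qed
  have "((\<lambda>t. ?F t) \<longlongrightarrow> - (exp (- (a * cplx 0)) / a)) (at_right 0)"
   by (intro tendsto_intros) (use a0 in auto)
  then show "((?F \<circ> real_of_ereal) \<longlongrightarrow> - (1 / a)) (at_right 0)"
   by (simp add: zero_ereal_def ereal_tendsto_simps)
  have "((\<lambda>t. ?F t) \<longlongrightarrow> 0) at_top"
  proof (rule Lim_null_comparison)
   have "((\<lambda>x::real. exp (- x)) \<longlongrightarrow> 0) at_top"
    by (rule filterlim_compose[OF exp_at_bot filterlim_uminus_at_bot_at_top])
   then show "((\<lambda>x::real. exp (- x) * (1 / norm a)) \<longlongrightarrow> 0) at_top" by (rule tendsto_mult_left_zero)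
   show "eventually (\<lambda>t. norm (?F t) \<le> exp (- t) * (1 / norm a)) at_top"
    using a by (intro always_eventually allI) (simp add: norm_divide)
  qed
  then show "((?F \<circ> real_of_ereal) \<longlongrightarrow> 0) (at_left \<infinity>)"
   by (simp add: ereal_tendsto_simps)
 qed
 moreover have "einterval 0 \<infinity> = {0<..}" by (auto simp: einterval_def zero_ereal_def)
 ultimately show "(\<integral>t. indicator {0<..} t *\<^sub>R exp (- (a * cplx t)) \<partial>lborel) = 1 / a"
  by (simp add: interval_lebesgue_integral_def set_lebesgue_integral_def)
qed

lemma integral_uminus_real: "(\<integral>t. f (- t) \<partial>lborel) = (\<integral>t. f t \<partial>lborel)" for f :: "real => complex"
 using lborel_integral_real_affine[of "-1" f 0] by simp

lemma exp_abs_transform: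
 fixes x :: real
 shows "integrable lborel (\<lambda>t. cplx (exp (- \<bar>t\<bar>)) * cis (- (x * t)))"
  and "(\<integral>t. cplx (exp (- \<bar>t\<bar>)) * cis (- (x * t)) \<partial>lborel) = cplx (2 / (1 + x\<^sup>2))"
proof -
 let ?a = "Complex 1 x" let ?b = "Complex 1 (- x)"
 let ?f = "\<lambda>t. indicator {0<..} t *\<^sub>R exp (- (?a * cplx t))"
 let ?g = "\<lambda>t. indicator {0<..} t *\<^sub>R exp (- (?b * cplx t))"
 have f: "integrable lborel ?f" "(\<integral>t. ?f t \<partial>lborel) = 1 / ?a" by (rule integral_exp_half, simp)+
 have g: "integrable lborel ?g" "(\<integral>t. ?g t \<partial>lborel) = 1 / ?b" by (rule integral_exp_half, simp)+
 have g': "integrable lborel (\<lambda>t. ?g (- t))" using lborel_integrable_real_affine[OF g(1), of "-1" 0] by simp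
 have ev: "AE t in lborel. ?f t + ?g (- t) = cplx (exp (- \<bar>t\<bar>)) * cis (- (x * t))"
 proof -
  have "AE t in lborel. t \<noteq> (0::real)" by (rule AE_lborel_singleton)
  then show ?thesis
  proof eventually_elim
   case (elim t)
   have 1: "exp (- (?a * cplx t)) = cplx (exp (- t)) * cis (- (x * t))"
    by (simp add: complex_eq_iff Re_exp Im_exp)
   have 2: "exp (- (?b * cplx (- t))) = cplx (exp t) * cis (- (x * t))"
    by (simp add: complex_eq_iff Re_exp Im_exp)
   show ?case using elim unfolding 1 2 by (auto simp: indicator_def)
  qed
 qed
 have m: "(\<lambda>t. cplx (exp (- \<bar>t\<bar>)) * cis (- (x * t))) \<in> borel_measurable lborel"
  unfolding cis_conv_exp by measurable
 show "integrable lborel (\<lambda>t. cplx (exp (- \<bar>t\<bar>)) * cis (- (x * t)))"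
  by (rule integrable_cong_AE_imp[OF Bochner_Integration.integrable_add[OF f(1) g'] m ev])
 have "(\<integral>t. cplx (exp (- \<bar>t\<bar>)) * cis (- (x * t)) \<partial>lborel) = (\<integral>t. ?f t + ?g (- t) \<partial>lborel)"
  by (rule integral_cong_AE[OF m _ ev[THEN AE_symmetric]]) (use f(1) g' in auto)
 also have "\<dots> = 1 / ?a + 1 / ?b"
 proof -
  have "(\<integral>t. ?g (- t) \<partial>lborel) = 1 / ?b" unfolding g(2)[symmetric] by (rule integral_uminus_real)
  then show ?thesis unfolding Bochner_Integration.integral_add[OF f(1) g'] f(2) by (simp only:)
 qed
 also have "\<dots> = cplx (2 / (1 + x\<^sup>2))"
 proof -
  have "?a * ?b = cplx (1 + x\<^sup>2)" by (simp add: complex_eq_iff power2_eq_square)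
  moreover have "?a + ?b = 2" by (simp add: complex_eq_iff)
  moreover have "?a \<noteq> 0" "?b \<noteq> 0" by (auto simp: complex_eq_iff)
  ultimately show ?thesis by (simp add: add_divide_eq_iff divide_add_eq_iff) (simp add: field_simps)
 qed
 finally show "(\<integral>t. cplx (exp (- \<bar>t\<bar>)) * cis (- (x * t)) \<partial>lborel) = cplx (2 / (1 + x\<^sup>2))" .
qed

lemma integrable_cauchy: "integrable lborel (\<lambda>x::real. 1 / (1 + x\<^sup>2))"
proof (rule integrableI_nonneg)
 let ?f = "\<lambda>x::real. 1 / (1 + x\<^sup>2)"
 have pos: "(\<integral>\<^sup>+x. ennreal (?f x) * indicator {0..} x \<partial>lborel) = ennreal (pi / 2 - arctan 0)"
  by (rule nn_integral_FTC_atLeast[OF _ _ _ tendsto_arctan_at_top])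
   (auto intro!: derivative_eq_intros simp: inverse_eq_divide)
 have "(\<integral>\<^sup>+x. ennreal (?f x) * indicator {..0} x \<partial>lborel) = (\<integral>\<^sup>+x. ennreal (?f x) * indicator {0..} x \<partial>lborel)"
  using nn_integral_real_affine[of "\<lambda>x. ennreal (?f x) * indicator {..0} x" "-1" 0]
  by (simp add: indicator_def)
 then have neg: "(\<integral>\<^sup>+x. ennreal (?f x) * indicator {..0} x \<partial>lborel) = ennreal (pi / 2 - arctan 0)"
  using pos by simp
 have "(\<integral>\<^sup>+x. ennreal (?f x) \<partial>lborel) \<le> (\<integral>\<^sup>+x. ennreal (?f x) * indicator {0..} x + ennreal (?f x) * indicator {..0} x \<partial>lborel)"
  by (intro nn_integral_mono) (auto simp: indicator_def)
 also have "\<dots> = ennreal (pi / 2 - arctan 0) + ennreal (pi / 2 - arctan 0)"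
  unfolding pos[symmetric] by (subst nn_integral_add) (simp_all add: neg pos)
 also have "\<dots> < \<infinity>" by simp
 finally show "(\<integral>\<^sup>+x. ennreal (?f x) \<partial>lborel) < \<infinity>" .
qed auto

lemma lborel_prod_integral:
 fixes f :: "'a::euclidean_space => real => 'b::{real_normed_field,banach,second_countable_topology}"
 assumes "\<And>b. b \<in> Basis ==> integrable lborel (f b)"
 shows "integrable lborel (\<lambda>x. \<Prod>b\<in>Basis. f b (inner x b))"
  and "(\<integral>x. (\<Prod>b\<in>Basis. f b (inner x b)) \<partial>lborel) = (\<Prod>b\<in>Basis. \<integral>t. f b t \<partial>lborel)"
proof -
 interpret product_sigma_finite "\<lambda>_::'a. lborel :: real measure" ..
 let ?T = "\<lambda>f. \<Sum>b\<in>(Basis::'a set). f b *\<^sub>R b"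
 have T: "?T \<in> measurable (\<Pi>\<^sub>M b\<in>Basis. lborel) borel" by measurable
 have [measurable]: "f b \<in> borel_measurable borel" if "b \<in> Basis" for b
  using borel_measurable_integrable[OF assms[OF that]] by simp
 have m: "(\<lambda>x. \<Prod>b\<in>Basis. f b (inner x b)) \<in> borel_measurable borel"
  by (intro borel_measurable_prod) measurable
 have c: "(\<Prod>b\<in>Basis. f b (inner (?T g) b)) = (\<Prod>b\<in>Basis. f b (g b))" for g
  by (intro prod.cong) (simp_all add: inner_sum_left_Basis)
 show "integrable lborel (\<lambda>x. \<Prod>b\<in>Basis. f b (inner x b))"
  unfolding lborel_eq[where 'a = 'a]
  by (subst integrable_distr_eq[OF T m], unfold c) (intro product_integrable_prod assms finite_Basis)
 show "(\<integral>x. (\<Prod>b\<in>Basis. f b (inner x b)) \<partial>lborel) = (\<Prod>b\<in>Basis. \<integral>t. f b t \<partial>lborel)"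
  unfolding lborel_eq[where 'a = 'a]
  by (subst integral_distr[OF T m], unfold c) (intro product_integral_prod assms finite_Basis)
qed

text \<open>The product Poisson-type pair: \<open>kk\<close> regularises frequency integrals, and
  its transform \<open>KK\<close> is explicit, positive and integrable. \<open>KK\<close> also
  serves as the decay majorant of slices.\<close>

definition kk :: "'a::euclidean_space => real" where
 "kk \<xi> = (\<Prod>b\<in>Basis. exp (- \<bar>inner \<xi> b\<bar>))"
definition KK :: "'a::euclidean_space => real" where
 "KK x = (\<Prod>b\<in>Basis. 2 / (1 + (inner x b)\<^sup>2))"

definition FT :: "('a::euclidean_space => complex) => 'a => complex" where
 "FT g \<xi> = (\<integral>x. g x * cis (- inner x \<xi>) \<partial>lborel)"

lemma kk_pos: "kk \<xi> > 0" and kk_le_1: "kk \<xi> \<le> 1" and KK_pos: "KK x > 0"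
 unfolding kk_def KK_def by (auto intro!: prod_pos prod_le_1 divide_pos_pos add_pos_nonneg)

lemma kk_meas [measurable]: "kk \<in> borel_measurable borel" and KK_meas [measurable]: "KK \<in> borel_measurable borel"
 unfolding kk_def KK_def by measurable

lemma cis_sum: "finite S ==> cis (\<Sum>i\<in>S. f i) = (\<Prod>i\<in>S. cis (f i))"
 by (induction S rule: finite_induct) (simp_all flip: cis_mult)

lemma kk_cis: "cplx (kk \<xi>) * cis (- inner \<xi> x) = (\<Prod>b\<in>Basis. cplx (exp (- \<bar>inner \<xi> b\<bar>)) * cis (- (inner x b * inner \<xi> b)))"
proof -
 have "cis (- inner \<xi> x) = (\<Prod>b\<in>Basis. cis (- (inner x b * inner \<xi> b)))"
  by (subst euclidean_inner) (simp add: sum_negf[symmetric] cis_sum mult.commute)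
 then show ?thesis by (simp add: kk_def prod.distrib)
qed

lemma kk_integrable: "integrable lborel kk" and FT_kk: "FT (\<lambda>\<xi>. cplx (kk \<xi>)) x = cplx (KK x)"
proof -
 have "integrable lborel (\<lambda>\<xi>. cplx (kk \<xi>) * cis (- inner \<xi> x))" for x :: 'a
  unfolding kk_cis by (intro lborel_prod_integral exp_abs_transform)
 from this[of 0] show "integrable lborel (kk :: 'a => real)" by (simp add: complex_of_real_integrable_eq)
 show "FT (\<lambda>\<xi>. cplx (kk \<xi>)) x = cplx (KK x)"
  unfolding FT_def kk_cis KK_def
  by (subst lborel_prod_integral) (simp_all add: exp_abs_transform)
qed

lemma KK_integrable: "integrable lborel KK"
 unfolding KK_def
 by (intro lborel_prod_integral(1)) (use integrable_cauchy in \<open>simp add: divide_inverse\<close>)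

text \<open>Its value is (2 pi)^n, the Plancherel constant for the unnormalised transform
  \<open>FT\<close>; it is carried along as a positive number.\<close>

definition KI :: "'a::euclidean_space itself => real" where
 "KI _ = integral\<^sup>L lborel (KK :: 'a => real)"

lemma KI_pos: "KI TYPE('a::euclidean_space) > 0"
proof -
 have "integral\<^sup>L lborel (KK :: 'a => real) \<noteq> 0"
 proof
  assume "integral\<^sup>L lborel (KK :: 'a => real) = 0"
  then have "AE x in (lborel :: 'a measure). KK x = 0"
   by (subst (asm) integral_nonneg_eq_0_iff_AE[OF KK_integrable]) (auto simp: less_imp_le KK_pos)
  then have "AE x in (lborel :: 'a measure). False"
  proof eventually_elim
   case (elim x)
   then show ?case using KK_pos[of x] by simp
  qed
  then have "emeasure lborel (UNIV :: 'a set) = 0" by (subst (asm) AE_iff_measurable[of UNIV]) auto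
  then show False by simp
 qed
 moreover have "integral\<^sup>L lborel (KK :: 'a => real) \<ge> 0" by (intro integral_nonneg_AE) (auto simp: KK_pos less_imp_le)
 ultimately show ?thesis by (simp add: KI_def)
qed

lemma meas_cis_inner [measurable]: "(\<lambda>p. cis (- inner (fst p) (snd p))) \<in> borel_measurable (lborel \<Otimes>\<^sub>M (lborel :: 'a::euclidean_space measure))"
proof -
 have "(\<lambda>p. cis (- inner (fst p) (snd p))) \<in> borel_measurable (borel :: ('a \<times> 'a) measure)"
  unfolding cis_conv_exp by (intro borel_measurable_continuous_onI continuous_intros)
 then show ?thesis unfolding lborel_prod by simp
qed

lemma cis_inner_meas [measurable]: "(\<lambda>x. cis (- inner x \<xi>)) \<in> borel_measurable borel"
 "(\<lambda>x. cis (- inner \<xi> x)) \<in> borel_measurable borel"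
 unfolding cis_conv_exp by (intro borel_measurable_continuous_onI continuous_intros)+

lemma FT_integrable:
 assumes "integrable lborel g"
 shows "integrable lborel (\<lambda>x. g x * cis (- inner x \<xi>))"
 by (rule Bochner_Integration.integrable_bound[OF assms]) (use assms in \<open>auto simp: norm_mult\<close>)

lemma FT_bound: "norm (FT g \<xi>) \<le> (\<integral>x. norm (g x) \<partial>lborel)"
 unfolding FT_def using integral_norm_bound[of lborel "\<lambda>x. g x * cis (- inner x \<xi>)"] by (simp add: norm_mult)

lemma FT_meas:
 assumes "integrable lborel g"
 shows "FT g \<in> borel_measurable borel"
proof -
 have [measurable]: "g \<in> borel_measurable lborel" using assms by simp
 have "(\<lambda>\<xi>. \<integral>x. g x * cis (- inner \<xi> x) \<partial>lborel) \<in> borel_measurable lborel"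
  by (rule lborel.borel_measurable_lebesgue_integral) (use meas_cis_inner in \<open>simp add: case_prod_unfold\<close>)
 then show ?thesis unfolding FT_def by (simp add: inner_commute)
qed

lemma FT_continuous:
 assumes g: "integrable lborel g"
 shows "continuous_on UNIV (FT g)"
proof (rule continuous_at_imp_continuous_on, intro ballI)
 fix \<xi> :: 'a
 show "isCont (FT g) \<xi>"
  unfolding continuous_at_sequentially o_def FT_def
 proof (intro allI impI)
  fix X :: "nat => 'a" assume X: "X \<longlonglongrightarrow> \<xi>"
  show "(\<lambda>n. \<integral>x. g x * cis (- inner x (X n)) \<partial>lborel) \<longlonglongrightarrow> (\<integral>x. g x * cis (- inner x \<xi>) \<partial>lborel)"
  proof (rule integral_dominated_convergence[where w = "\<lambda>x. norm (g x)"])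
   show "integrable lborel (\<lambda>x. norm (g x))" using g by simp
   show "AE x in lborel. (\<lambda>n. g x * cis (- inner x (X n))) \<longlonglongrightarrow> g x * cis (- inner x \<xi>)"
    unfolding cis_conv_exp by (intro always_eventually allI tendsto_intros X)
  qed (use g in \<open>auto simp: norm_mult\<close>)
 qed
qed

lemma FT_mult_formula:
 fixes g h :: "'a::euclidean_space => complex"
 assumes g: "integrable lborel g" and h: "integrable lborel h"
 shows "(\<integral>\<xi>. FT g \<xi> * h \<xi> \<partial>lborel) = (\<integral>x. g x * FT h x \<partial>lborel)"
proof -
 have [measurable]: "g \<in> borel_measurable lborel" "h \<in> borel_measurable lborel" using g h by simp_all
 let ?f = "\<lambda>x \<xi>. g x * (h \<xi> * cis (- inner x \<xi>))"
 have m: "case_prod ?f \<in> borel_measurable (lborel \<Otimes>\<^sub>M lborel)"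
  using meas_cis_inner by (simp add: case_prod_unfold)
 have int: "integrable (lborel \<Otimes>\<^sub>M lborel) (case_prod ?f)"
 proof (rule lborel_pair.Fubini_integrable[OF m])
  have "(\<lambda>x. \<integral>y. norm (case_prod ?f (x, y)) \<partial>lborel) = (\<lambda>x. norm (g x) * (\<integral>y. norm (h y) \<partial>lborel))"
   by (simp add: norm_mult)
  then show "integrable lborel (\<lambda>x. \<integral>y. norm (case_prod ?f (x, y)) \<partial>lborel)" using g by simp
  have "integrable lborel (\<lambda>y. g x * (h y * cis (- inner x y)))" for x
   using FT_integrable[OF h, of x] by (simp add: inner_commute)
  then show "AE x in lborel. integrable lborel (\<lambda>y. case_prod ?f (x, y))" by simp
 qed
 have "(\<integral>\<xi>. FT g \<xi> * h \<xi> \<partial>lborel) = (\<integral>\<xi>. \<integral>x. ?f x \<xi> \<partial>lborel \<partial>lborel)"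
 proof (intro Bochner_Integration.integral_cong refl)
  fix \<xi>
  have "FT g \<xi> * h \<xi> = (\<integral>x. g x * cis (- inner x \<xi>) * h \<xi> \<partial>lborel)"
   unfolding FT_def by (rule integral_mult_left_zero[symmetric])
  also have "\<dots> = (\<integral>x. ?f x \<xi> \<partial>lborel)"
   by (intro Bochner_Integration.integral_cong) (simp_all add: ac_simps)
  finally show "FT g \<xi> * h \<xi> = (\<integral>x. ?f x \<xi> \<partial>lborel)" .
 qed
 also have "\<dots> = (\<integral>x. \<integral>\<xi>. ?f x \<xi> \<partial>lborel \<partial>lborel)" by (rule lborel_pair.Fubini_integral[OF int])
 also have "\<dots> = (\<integral>x. g x * FT h x \<partial>lborel)"
  unfolding FT_def by (simp add: inner_commute)
 finally show ?thesis .
qed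

lemma integral_lborel_affine:
 fixes f :: "'a::euclidean_space => complex"
 assumes f: "f \<in> borel_measurable borel" and c: "c \<noteq> 0"
 shows "(\<integral>x. f x \<partial>lborel) = (\<bar>c\<bar> ^ DIM('a)) *\<^sub>R (\<integral>x. f (t + c *\<^sub>R x) \<partial>lborel)"
proof -
 have "(\<integral>x. f x \<partial>lborel) = (\<integral>x. f x \<partial>density (distr lborel borel (\<lambda>x. t + c *\<^sub>R x)) (\<lambda>_. ennreal (\<bar>c\<bar> ^ DIM('a))))"
  using lborel_affine[OF c, of t] by simp
 also have "\<dots> = (\<integral>x. (\<bar>c\<bar> ^ DIM('a)) *\<^sub>R f x \<partial>distr lborel borel (\<lambda>x. t + c *\<^sub>R x))"
  using f by (intro integral_density) auto
 also have "\<dots> = (\<integral>x. (\<bar>c\<bar> ^ DIM('a)) *\<^sub>R f (t + c *\<^sub>R x) \<partial>lborel)"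
  using f by (intro integral_distr) auto
 finally show ?thesis by simp
qed

text \<open>Continuity and boundedness make the approximate identity converge pointwise with a
  dominating function; boundedness also keeps the class closed under products, so squares of slices
  belong to it.\<close>

definition nice :: "('a::euclidean_space => complex) => bool" where
 "nice g \<longleftrightarrow> continuous_on UNIV g \<and> bounded (range g) \<and> integrable lborel g"

lemma nice_meas: "nice g ==> g \<in> borel_measurable borel"
 unfolding nice_def using borel_measurable_continuous_onI by blast

lemma nice_bound:
 assumes "nice g"
 obtains B where "B > 0" "\<And>x. norm (g x) \<le> B"
 using assms unfolding nice_def bounded_pos by auto

lemma FT_kk_shift:
 fixes x y :: "'a::euclidean_space"
 assumes eps: "eps > 0"
 shows "FT (\<lambda>\<xi>. cplx (kk (eps *\<^sub>R \<xi>)) * cis (- inner x \<xi>)) y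
  = cplx ((1 / eps ^ DIM('a)) * KK ((1/eps) *\<^sub>R (x + y)))"
proof -
 let ?f = "\<lambda>\<xi>. cplx (kk \<xi>) * cis (- inner \<xi> ((1/eps) *\<^sub>R (x + y)))"
 have m: "?f \<in> borel_measurable borel" by measurable
 have "cplx (KK ((1/eps) *\<^sub>R (x + y))) = (\<integral>\<xi>. ?f \<xi> \<partial>lborel)"
  using FT_kk[of "(1/eps) *\<^sub>R (x + y)"] by (simp add: FT_def)
 also have "\<dots> = (\<bar>eps\<bar> ^ DIM('a)) *\<^sub>R (\<integral>\<xi>. ?f (0 + eps *\<^sub>R \<xi>) \<partial>lborel)"
  using eps by (intro integral_lborel_affine[OF m]) simp
 also have "(\<lambda>\<xi>. ?f (0 + eps *\<^sub>R \<xi>)) = (\<lambda>\<xi>. cplx (kk (eps *\<^sub>R \<xi>)) * cis (- inner x \<xi>) * cis (- inner \<xi> y))"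
  using eps by (intro ext) (simp add: inner_simps inner_commute cis_mult mult.assoc)
 finally show ?thesis using eps by (simp add: FT_def scaleR_conv_of_real field_simps)
qed

lemma kk_scale_integrable: "eps > 0 ==> integrable lborel (\<lambda>\<xi>::'a::euclidean_space. kk (eps *\<^sub>R \<xi>))"
proof -
 assume eps: "eps > 0"
 have "lborel = density (distr lborel borel (\<lambda>x::'a. 0 + eps *\<^sub>R x)) (\<lambda>_. ennreal (\<bar>eps\<bar> ^ DIM('a)))"
  using lborel_affine[of eps "0::'a"] eps by simp
 then have "integrable (density (distr lborel borel (\<lambda>x::'a. 0 + eps *\<^sub>R x)) (\<lambda>_. ennreal (\<bar>eps\<bar> ^ DIM('a)))) kk"
  using kk_integrable by metis
 then have "integrable (distr lborel borel (\<lambda>x::'a. 0 + eps *\<^sub>R x)) (\<lambda>x. (\<bar>eps\<bar> ^ DIM('a)) *\<^sub>R kk x)"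
  by (subst (asm) integrable_density) auto
 then have "integrable lborel (\<lambda>x::'a. (\<bar>eps\<bar> ^ DIM('a)) *\<^sub>R kk (0 + eps *\<^sub>R x))"
  by (subst (asm) integrable_distr_eq) auto
 then show ?thesis using eps by simp
qed

text \<open>The damped frequency integral becomes, by the multiplication formula, an average of
  \<open>h\<close> against the approximate identity with kernel \<open>KK\<close>. As eps tends to 0
  the damping disappears on the left and the kernel contributes its mass \<open>KI\<close> on the
  right.\<close>

lemma plancherel_eps:
 fixes g h :: "'a::euclidean_space => complex"
 assumes g: "nice g" and h: "nice h" and eps: "eps > 0"
 shows "(\<integral>\<xi>. FT g \<xi> * (cnj (FT h \<xi>) * cplx (kk (eps *\<^sub>R \<xi>))) \<partial>lborel)
   = (\<integral>x. g x * (\<integral>v. cnj (h (x - eps *\<^sub>R v)) * cplx (KK v) \<partial>lborel) \<partial>lborel)"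
proof -
 have ig: "integrable lborel g" and ih: "integrable lborel h" using g h by (auto simp: nice_def)
 let ?k = "\<lambda>\<xi>. cplx (kk (eps *\<^sub>R \<xi>))"
 let ?\<phi> = "\<lambda>\<xi>. cnj (FT h \<xi>) * ?k \<xi>"
 have ik: "integrable lborel ?k" by (intro integrable_of_real kk_scale_integrable eps)
 have [measurable]: "FT h \<in> borel_measurable borel" by (rule FT_meas[OF ih])
 have [measurable]: "h \<in> borel_measurable borel" by (rule nice_meas[OF h])
 have i\<phi>: "integrable lborel ?\<phi>"
 proof (rule Bochner_Integration.integrable_bound)
  show "integrable lborel (\<lambda>\<xi>. (\<integral>x. norm (h x) \<partial>lborel) * kk (eps *\<^sub>R \<xi>))"
   by (intro integrable_mult_right kk_scale_integrable eps)
  show "AE \<xi> in lborel. norm (?\<phi> \<xi>) \<le> norm ((\<integral>x. norm (h x) \<partial>lborel) * kk (eps *\<^sub>R \<xi>))"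
  proof (intro always_eventually allI)
   fix \<xi> :: 'a
   have "norm (?\<phi> \<xi>) = norm (FT h \<xi>) * kk (eps *\<^sub>R \<xi>)" using kk_pos[of "eps *\<^sub>R \<xi>"] by (simp add: norm_mult)
   also have "\<dots> \<le> (\<integral>x. norm (h x) \<partial>lborel) * kk (eps *\<^sub>R \<xi>)"
    using FT_bound[of h \<xi>] kk_pos[of "eps *\<^sub>R \<xi>"] by (intro mult_right_mono) auto
   also have "\<dots> \<le> norm ((\<integral>x. norm (h x) \<partial>lborel) * kk (eps *\<^sub>R \<xi>))" by simp
   finally show "norm (?\<phi> \<xi>) \<le> norm ((\<integral>x. norm (h x) \<partial>lborel) * kk (eps *\<^sub>R \<xi>))" .
  qed
 qed measurable
 have F\<phi>: "FT ?\<phi> x = (\<integral>v. cnj (h (x - eps *\<^sub>R v)) * cplx (KK v) \<partial>lborel)" for x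
 proof -
  let ?h = "\<lambda>y. cnj (h (- y))"
  have ih': "integrable lborel ?h"
  proof -
   have "integrable lborel (\<lambda>x. h (0 + (- 1) *\<^sub>R x))"
   proof -
    have L: "lborel = distr lborel borel (\<lambda>x::'a. 0 + (- 1) *\<^sub>R x)"
     using lborel_affine[of "-1" "0::'a"] by (simp add: density_1)
    have "integrable (distr lborel borel (\<lambda>x::'a. 0 + (- 1) *\<^sub>R x)) h" using ih L by simp
    then show ?thesis by (subst (asm) integrable_distr_eq) auto
   qed
   then show ?thesis by simp
  qed
  have Fh: "cnj (FT h \<xi>) = FT ?h \<xi>" for \<xi>
  proof -
   have "FT ?h \<xi> = (\<integral>y. cnj (h (- y)) * cis (- inner y \<xi>) \<partial>lborel)" by (simp add: FT_def)
   also have "\<dots> = (\<bar>- 1\<bar> ^ DIM('a)) *\<^sub>R (\<integral>y. cnj (h (- (0 + (- 1) *\<^sub>R y))) * cis (- inner (0 + (- 1) *\<^sub>R y) \<xi>) \<partial>lborel)"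
    by (rule integral_lborel_affine) measurable
   also have "\<dots> = (\<integral>y. cnj (h y * cis (- inner y \<xi>)) \<partial>lborel)" by (simp add: cis_cnj)
   also have "\<dots> = cnj (FT h \<xi>)" unfolding FT_def by (rule Bochner_Integration.integral_cnj)
   finally show ?thesis by simp
  qed
  let ?kx = "\<lambda>\<xi>. ?k \<xi> * cis (- inner x \<xi>)"
  have ikx: "integrable lborel ?kx" using FT_integrable[OF ik, of x] by (simp add: inner_commute)
  have "FT ?\<phi> x = (\<integral>\<xi>. FT ?h \<xi> * ?kx \<xi> \<partial>lborel)"
   unfolding Fh FT_def[of "\<lambda>\<xi>. FT ?h \<xi> * ?k \<xi>"] by (simp add: inner_commute mult.assoc)
  also have "\<dots> = (\<integral>y. ?h y * FT ?kx y \<partial>lborel)" by (rule FT_mult_formula[OF ih' ikx])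
  also have "\<dots> = (\<integral>y. cnj (h (- y)) * cplx ((1 / eps ^ DIM('a)) * KK ((1/eps) *\<^sub>R (x + y))) \<partial>lborel)"
   unfolding FT_kk_shift[OF eps] ..
  also have "\<dots> = (\<bar>eps\<bar> ^ DIM('a)) *\<^sub>R (\<integral>v. cnj (h (- (- x + eps *\<^sub>R v))) * cplx ((1 / eps ^ DIM('a)) * KK ((1/eps) *\<^sub>R (x + (- x + eps *\<^sub>R v)))) \<partial>lborel)"
  proof (rule integral_lborel_affine)
   show "eps \<noteq> 0" using eps by simp
  qed measurable
  also have "\<dots> = (\<integral>v. cnj (h (x - eps *\<^sub>R v)) * cplx (KK v) \<partial>lborel)"
  proof -
   have "(\<lambda>v. cnj (h (- (- x + eps *\<^sub>R v))) * cplx ((1 / eps ^ DIM('a)) * KK ((1/eps) *\<^sub>R (x + (- x + eps *\<^sub>R v)))))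
    = (\<lambda>v. (1 / eps ^ DIM('a)) *\<^sub>R (cnj (h (x - eps *\<^sub>R v)) * cplx (KK v)))"
    using eps by (intro ext) (simp add: scaleR_conv_of_real)
   then show ?thesis using eps by simp
  qed
  finally show ?thesis .
 qed
 show ?thesis unfolding FT_mult_formula[OF ig i\<phi>] F\<phi> ..
qed

lemma plancherel_limit:
 fixes g h :: "'a::euclidean_space => complex"
 assumes g: "nice g" and h: "nice h" and eps: "eps \<longlonglongrightarrow> 0" and eps0: "\<And>n. eps n > 0"
 shows "(\<lambda>n. \<integral>\<xi>. FT g \<xi> * (cnj (FT h \<xi>) * cplx (kk (eps n *\<^sub>R \<xi>))) \<partial>lborel)
   \<longlonglongrightarrow> cplx (KI TYPE('a)) * (\<integral>x. g x * cnj (h x) \<partial>lborel)"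
proof -
 obtain B where B: "B > 0" "\<And>x. norm (h x) \<le> B" using nice_bound[OF h] by blast
 have [measurable]: "h \<in> borel_measurable borel" "g \<in> borel_measurable borel" using nice_meas g h by auto
 have ig: "integrable lborel g" using g by (simp add: nice_def)
 have hc: "isCont h x" for x using h by (simp add: nice_def continuous_on_eq_continuous_at)
 let ?H = "\<lambda>n x. \<integral>v. cnj (h (x - eps n *\<^sub>R v)) * cplx (KK v) \<partial>lborel"
 have iK: "integrable lborel (\<lambda>v::'a. B * KK v)" by (intro integrable_mult_right KK_integrable)
 have bd: "norm (cnj (h w) * cplx (KK v)) \<le> B * KK v" for w v
  using B(2)[of w] KK_pos[of v] by (simp add: norm_mult mult_right_mono less_imp_le)
 have Hm: "?H n \<in> borel_measurable lborel" for n
  by (rule lborel.borel_measurable_lebesgue_integral) measurable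
 have Hb: "norm (?H n x) \<le> B * KI TYPE('a)" for n x
 proof -
  have "norm (?H n x) \<le> (\<integral>v. norm (cnj (h (x - eps n *\<^sub>R v)) * cplx (KK v)) \<partial>lborel)"
   by (rule integral_norm_bound)
  also have "\<dots> \<le> (\<integral>v. B * KK (v::'a) \<partial>lborel)"
  proof (rule Bochner_Integration.integral_mono)
   show "integrable lborel (\<lambda>v::'a. B * KK v)" by (rule iK)
   show "norm (cnj (h (x - eps n *\<^sub>R v)) * cplx (KK v)) \<le> B * KK v" for v by (rule bd)
   have "norm (norm (cnj (h (x - eps n *\<^sub>R v)) * cplx (KK v))) \<le> norm (B * KK v)" for v
    using order_trans[OF bd[of "x - eps n *\<^sub>R v" v] abs_ge_self] by (simp only: real_norm_def abs_norm_cancel)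
   then show "integrable lborel (\<lambda>v. norm (cnj (h (x - eps n *\<^sub>R v)) * cplx (KK v)))"
    by (intro Bochner_Integration.integrable_bound[OF iK] always_eventually allI) measurable
  qed
  finally have "norm (?H n x) \<le> (\<integral>v. B * KK (v::'a) \<partial>lborel)" .
  then show ?thesis by (simp add: KI_def)
 qed
 have Hlim: "(\<lambda>n. ?H n x) \<longlonglongrightarrow> cnj (h x) * cplx (KI TYPE('a))" for x
 proof -
  have "(\<lambda>n. ?H n x) \<longlonglongrightarrow> (\<integral>v. cnj (h x) * cplx (KK (v::'a)) \<partial>lborel)"
  proof (rule integral_dominated_convergence[where w = "\<lambda>v::'a. B * KK v"])
   show "AE v in lborel. (\<lambda>n. cnj (h (x - eps n *\<^sub>R v)) * cplx (KK v)) \<longlonglongrightarrow> cnj (h x) * cplx (KK v)"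
   proof (intro always_eventually allI tendsto_intros)
    fix v :: 'a
    have "(\<lambda>n. x - eps n *\<^sub>R v) \<longlonglongrightarrow> x - 0 *\<^sub>R v" by (intro tendsto_intros eps)
    then show "(\<lambda>n. h (x - eps n *\<^sub>R v)) \<longlonglongrightarrow> h x" using isCont_tendsto_compose[OF hc] by simp
   qed
  qed (use iK bd in auto)
  then show ?thesis by (simp add: KI_def)
 qed
 have "(\<lambda>n. \<integral>x. g x * ?H n x \<partial>lborel) \<longlonglongrightarrow> (\<integral>x. g x * (cnj (h x) * cplx (KI TYPE('a))) \<partial>lborel)"
 proof (rule integral_dominated_convergence[where w = "\<lambda>x. norm (g x) * (B * KI TYPE('a))"
    and s = "\<lambda>n x. g x * ?H n x" and f = "\<lambda>x. g x * (cnj (h x) * cplx (KI TYPE('a)))"])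
  show "integrable lborel (\<lambda>x. norm (g x) * (B * KI TYPE('a)))" using ig by simp
  show "AE x in lborel. norm (g x * ?H n x) \<le> norm (g x) * (B * KI TYPE('a))" for n
   using Hb by (intro always_eventually allI) (simp add: norm_mult mult_left_mono)
  show "AE x in lborel. (\<lambda>n. g x * ?H n x) \<longlonglongrightarrow> g x * (cnj (h x) * cplx (KI TYPE('a)))"
   by (intro always_eventually allI tendsto_mult tendsto_const Hlim)
  show "(\<lambda>x. g x * ?H n x) \<in> borel_measurable lborel" for n
   by (rule borel_measurable_times[OF _ Hm]) simp
 qed measurable
 moreover have "(\<integral>x. g x * (cnj (h x) * cplx (KI TYPE('a))) \<partial>lborel)
   = cplx (KI TYPE('a)) * (\<integral>x. g x * cnj (h x) \<partial>lborel)"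
  unfolding mult.assoc[symmetric] by (subst integral_mult_left_zero) (rule mult.commute)
 ultimately show ?thesis unfolding plancherel_eps[OF g h eps0] by (simp only:)
qed

lemma kk_limit: "(\<lambda>n. kk (inverse (real (Suc n)) *\<^sub>R \<xi>)) \<longlonglongrightarrow> 1"
proof -
 have "(\<lambda>n. kk (inverse (real (Suc n)) *\<^sub>R \<xi>)) \<longlonglongrightarrow> kk (0 *\<^sub>R \<xi>)"
  unfolding kk_def by (intro tendsto_intros LIMSEQ_inverse_real_of_nat)
 then show ?thesis by (simp add: kk_def)
qed

lemma nice_sq_integrable:
 assumes g: "nice g"
 shows "integrable lborel (\<lambda>x. (norm (g x))\<^sup>2)"
proof -
 obtain B where B: "B > 0" "\<And>x. norm (g x) \<le> B" using nice_bound[OF g] by blast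
 have [measurable]: "g \<in> borel_measurable borel" using nice_meas g by auto
 show ?thesis
 proof (rule Bochner_Integration.integrable_bound)
  show "integrable lborel (\<lambda>x. B * norm (g x))" using g by (simp add: nice_def)
  show "AE x in lborel. norm ((norm (g x))\<^sup>2) \<le> norm (B * norm (g x))"
   using B by (intro always_eventually allI) (auto simp: power2_eq_square abs_mult intro!: mult_right_mono)
 qed measurable
qed

text \<open>With g = h the damped integrals increase to the undamped one, so monotone convergence
  gives the identity before square integrability of the transform is known.\<close>

theorem plancherel_nn:
 fixes g :: "'a::euclidean_space => complex"
 assumes g: "nice g"
 shows "(\<integral>\<^sup>+\<xi>. ennreal ((norm (FT g \<xi>))\<^sup>2) \<partial>lborel) = ennreal (KI TYPE('a)) * (\<integral>\<^sup>+x. ennreal ((norm (g x))\<^sup>2) \<partial>lborel)"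
proof -
 have ig: "integrable lborel g" using g by (simp add: nice_def)
 have [measurable]: "FT g \<in> borel_measurable borel" by (rule FT_meas[OF ig])
 let ?e = "\<lambda>n. inverse (real (Suc n))"
 let ?f = "\<lambda>n \<xi>. (norm (FT g \<xi>))\<^sup>2 * kk (?e n *\<^sub>R \<xi>)"
 have i: "integrable lborel (?f n)" for n
 proof (rule Bochner_Integration.integrable_bound)
  show "integrable lborel (\<lambda>\<xi>. (\<integral>x. norm (g x) \<partial>lborel)\<^sup>2 * kk (?e n *\<^sub>R \<xi>))"
   by (intro integrable_mult_right kk_scale_integrable) simp
  show "AE \<xi> in lborel. norm (?f n \<xi>) \<le> norm ((\<integral>x. norm (g x) \<partial>lborel)\<^sup>2 * kk (?e n *\<^sub>R \<xi>))"
   using FT_bound[of g] kk_pos[of "?e n *\<^sub>R _"]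
   by (intro always_eventually allI) (auto simp: abs_mult less_imp_le intro!: mult_mono power_mono)
 qed measurable
 have "(\<lambda>n. \<integral>\<xi>. FT g \<xi> * (cnj (FT g \<xi>) * cplx (kk (?e n *\<^sub>R \<xi>))) \<partial>lborel)
   \<longlonglongrightarrow> cplx (KI TYPE('a)) * (\<integral>x. g x * cnj (g x) \<partial>lborel)"
  by (rule plancherel_limit[OF g g LIMSEQ_inverse_real_of_nat]) simp
 moreover have "(\<integral>\<xi>. FT g \<xi> * (cnj (FT g \<xi>) * cplx (kk (?e n *\<^sub>R \<xi>))) \<partial>lborel) = cplx (\<integral>\<xi>. ?f n \<xi> \<partial>lborel)" for n
 proof -
  have zz: "z * (cnj z * cplx a) = cplx ((norm z)\<^sup>2 * a)" for z a
   by (simp add: mult.assoc[symmetric] complex_norm_square[symmetric])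
  show ?thesis unfolding zz by (rule integral_complex_of_real)
 qed
 moreover have "(\<integral>x. g x * cnj (g x) \<partial>lborel) = cplx (\<integral>x. (norm (g x))\<^sup>2 \<partial>lborel)"
  unfolding complex_norm_square[symmetric] of_real_power[symmetric] by (rule integral_complex_of_real)
 ultimately have "(\<lambda>n. cplx (\<integral>\<xi>. ?f n \<xi> \<partial>lborel)) \<longlonglongrightarrow> cplx (KI TYPE('a) * (\<integral>x. (norm (g x))\<^sup>2 \<partial>lborel))"
  by (simp only: of_real_mult)
 then have lim: "(\<lambda>n. \<integral>\<xi>. ?f n \<xi> \<partial>lborel) \<longlonglongrightarrow> KI TYPE('a) * (\<integral>x. (norm (g x))\<^sup>2 \<partial>lborel)"
  by (simp only: tendsto_of_real_iff)
 have "(\<lambda>n. \<integral>\<^sup>+\<xi>. ennreal (?f n \<xi>) \<partial>lborel) \<longlonglongrightarrow> (\<integral>\<^sup>+\<xi>. ennreal ((norm (FT g \<xi>))\<^sup>2) \<partial>lborel)"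
 proof (rule nn_integral_LIMSEQ)
  show "incseq (\<lambda>n \<xi>. ennreal (?f n \<xi>))"
  proof (rule incseq_SucI, rule le_funI, intro ennreal_leI mult_left_mono)
   fix n and \<xi> :: 'a
   have "?e (Suc n) \<le> ?e n" by (simp add: field_simps)
   then show "kk (?e n *\<^sub>R \<xi>) \<le> kk (?e (Suc n) *\<^sub>R \<xi>)"
    unfolding kk_def by (intro prod_mono) (auto simp: abs_mult intro!: mult_right_mono simp del: of_nat_Suc)
  qed simp
  show "(\<lambda>n. ennreal (?f n \<xi>)) \<longlonglongrightarrow> ennreal ((norm (FT g \<xi>))\<^sup>2)" for \<xi>
   using tendsto_mult[OF tendsto_const kk_limit, of "(norm (FT g \<xi>))\<^sup>2"] by (intro tendsto_ennrealI) simp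
 qed measurable
 moreover have "(\<integral>\<^sup>+\<xi>. ennreal (?f n \<xi>) \<partial>lborel) = ennreal (\<integral>\<xi>. ?f n \<xi> \<partial>lborel)" for n
  by (intro nn_integral_eq_integral i) (auto simp: less_imp_le kk_pos)
 ultimately have "(\<lambda>n. ennreal (\<integral>\<xi>. ?f n \<xi> \<partial>lborel)) \<longlonglongrightarrow> (\<integral>\<^sup>+\<xi>. ennreal ((norm (FT g \<xi>))\<^sup>2) \<partial>lborel)" by simp
 then have "(\<integral>\<^sup>+\<xi>. ennreal ((norm (FT g \<xi>))\<^sup>2) \<partial>lborel) = ennreal (KI TYPE('a) * (\<integral>x. (norm (g x))\<^sup>2 \<partial>lborel))"
  using tendsto_ennrealI[OF lim] LIMSEQ_unique by blast
 also have "\<dots> = ennreal (KI TYPE('a)) * ennreal (\<integral>x. (norm (g x))\<^sup>2 \<partial>lborel)"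
  using KI_pos[where 'a = 'a] by (intro ennreal_mult) (auto simp: less_imp_le)
 also have "ennreal (\<integral>x. (norm (g x))\<^sup>2 \<partial>lborel) = (\<integral>\<^sup>+x. ennreal ((norm (g x))\<^sup>2) \<partial>lborel)"
  by (intro nn_integral_eq_integral[symmetric] nice_sq_integrable[OF g]) auto
 finally show ?thesis .
qed

lemma FT_sq_integrable:
 assumes g: "nice g"
 shows "integrable lborel (\<lambda>\<xi>. (norm (FT g \<xi>))\<^sup>2)"
proof (rule integrableI_nonneg)
 have ig: "integrable lborel g" using g by (simp add: nice_def)
 show "(\<lambda>\<xi>. (norm (FT g \<xi>))\<^sup>2) \<in> borel_measurable lborel" using FT_meas[OF ig] by simp
 have "(\<integral>\<^sup>+x. ennreal ((norm (g x))\<^sup>2) \<partial>lborel) < \<infinity>"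
  using nn_integral_eq_integral[OF nice_sq_integrable[OF g]] by simp
 then show "(\<integral>\<^sup>+\<xi>. ennreal ((norm (FT g \<xi>))\<^sup>2) \<partial>lborel) < \<infinity>"
  unfolding plancherel_nn[OF g] by (simp add: ennreal_mult_less_top)
qed auto

text \<open>Square integrability from \<open>plancherel_nn\<close> now provides the dominating
  function |FT g|^2 + |FT h|^2.\<close>

theorem parseval:
 fixes g h :: "'a::euclidean_space => complex"
 assumes g: "nice g" and h: "nice h"
 shows "(\<integral>\<xi>. FT g \<xi> * cnj (FT h \<xi>) \<partial>lborel) = cplx (KI TYPE('a)) * (\<integral>x. g x * cnj (h x) \<partial>lborel)"
proof -
 let ?e = "\<lambda>n. inverse (real (Suc n))"
 have [measurable]: "FT g \<in> borel_measurable borel" "FT h \<in> borel_measurable borel"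
  using FT_meas g h by (auto simp: nice_def)
 have "(\<lambda>n. \<integral>\<xi>. FT g \<xi> * (cnj (FT h \<xi>) * cplx (kk (?e n *\<^sub>R \<xi>))) \<partial>lborel) \<longlonglongrightarrow> (\<integral>\<xi>. FT g \<xi> * (cnj (FT h \<xi>) * cplx 1) \<partial>lborel)"
 proof (rule integral_dominated_convergence[where w = "\<lambda>\<xi>. (norm (FT g \<xi>))\<^sup>2 + (norm (FT h \<xi>))\<^sup>2"])
  show "integrable lborel (\<lambda>\<xi>. (norm (FT g \<xi>))\<^sup>2 + (norm (FT h \<xi>))\<^sup>2)"
   using FT_sq_integrable g h by (intro Bochner_Integration.integrable_add) auto
  show "AE \<xi> in lborel. (\<lambda>n. FT g \<xi> * (cnj (FT h \<xi>) * cplx (kk (?e n *\<^sub>R \<xi>)))) \<longlonglongrightarrow> FT g \<xi> * (cnj (FT h \<xi>) * cplx 1)"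
   by (intro always_eventually allI tendsto_intros tendsto_of_real kk_limit)
  show "AE \<xi> in lborel. norm (FT g \<xi> * (cnj (FT h \<xi>) * cplx (kk (?e n *\<^sub>R \<xi>)))) \<le> (norm (FT g \<xi>))\<^sup>2 + (norm (FT h \<xi>))\<^sup>2" for n
  proof (intro always_eventually allI)
   fix \<xi> :: 'a
   have "norm (FT g \<xi> * (cnj (FT h \<xi>) * cplx (kk (?e n *\<^sub>R \<xi>)))) = norm (FT g \<xi>) * norm (FT h \<xi>) * kk (?e n *\<^sub>R \<xi>)"
    using kk_pos[of "?e n *\<^sub>R \<xi>"] by (simp add: norm_mult del: of_nat_Suc)
   also have "\<dots> \<le> norm (FT g \<xi>) * norm (FT h \<xi>) * 1" by (intro mult_left_mono kk_le_1) simp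
   also have "\<dots> \<le> (norm (FT g \<xi>))\<^sup>2 + (norm (FT h \<xi>))\<^sup>2"
   proof -
    have "0 \<le> norm (FT g \<xi>) * norm (FT h \<xi>)" by simp
    then show ?thesis using sum_squares_bound[of "norm (FT g \<xi>)" "norm (FT h \<xi>)"] by linarith
   qed
   finally show "norm (FT g \<xi> * (cnj (FT h \<xi>) * cplx (kk (?e n *\<^sub>R \<xi>)))) \<le> (norm (FT g \<xi>))\<^sup>2 + (norm (FT h \<xi>))\<^sup>2" .
  qed
 qed measurable
 moreover have "(\<lambda>n. \<integral>\<xi>. FT g \<xi> * (cnj (FT h \<xi>) * cplx (kk (?e n *\<^sub>R \<xi>))) \<partial>lborel)
   \<longlonglongrightarrow> cplx (KI TYPE('a)) * (\<integral>x. g x * cnj (h x) \<partial>lborel)"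
  by (rule plancherel_limit[OF g h LIMSEQ_inverse_real_of_nat]) simp
 ultimately have "(\<integral>\<xi>. FT g \<xi> * (cnj (FT h \<xi>) * cplx 1) \<partial>lborel) = cplx (KI TYPE('a)) * (\<integral>x. g x * cnj (h x) \<partial>lborel)"
  using LIMSEQ_unique by blast
 then show ?thesis by simp
qed

text \<open>Parseval for \<open>g\<close> and the conjugate of \<open>g\<close> times a character.
  The convolution formula arises this way with transforms that are only square integrable.\<close>

lemma FT_square:
 fixes g :: "'a::euclidean_space => complex"
 assumes g: "nice g"
 shows "cplx (KI TYPE('a)) * FT (\<lambda>x. g x * g x) \<xi> = (\<integral>\<eta>. FT g \<eta> * FT g (\<xi> - \<eta>) \<partial>lborel)"
proof -
 let ?h = "\<lambda>x. cnj (g x * cis (- inner x \<xi>))"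
 have ig: "integrable lborel g" using g by (simp add: nice_def)
 have h: "nice ?h"
 proof -
  have "continuous_on UNIV ?h"
   using g unfolding nice_def cis_conv_exp by (intro continuous_intros) auto
  moreover have "bounded (range ?h)"
   using g unfolding nice_def bounded_iff by (auto simp: norm_mult)
  moreover have "integrable lborel ?h"
   using integrable_bounded_linear[OF bounded_linear_cnj FT_integrable[OF ig, of \<xi>]] by simp
  ultimately show ?thesis by (simp add: nice_def)
 qed
 have "cnj (FT ?h \<eta>) = FT g (\<xi> - \<eta>)" for \<eta>
 proof -
  have "cnj (FT ?h \<eta>) = (\<integral>x. cnj (?h x * cis (- inner x \<eta>)) \<partial>lborel)"
   unfolding FT_def by (rule Bochner_Integration.integral_cnj[symmetric])
  also have "\<dots> = FT g (\<xi> - \<eta>)"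
   unfolding FT_def by (intro Bochner_Integration.integral_cong refl) (simp add: cis_cnj cis_mult inner_diff_right mult.assoc algebra_simps)
  finally show ?thesis .
 qed
 then have "(\<integral>\<eta>. FT g \<eta> * FT g (\<xi> - \<eta>) \<partial>lborel) = cplx (KI TYPE('a)) * (\<integral>x. g x * cnj (?h x) \<partial>lborel)"
  using parseval[OF g h] by simp
 then show ?thesis by (simp add: FT_def mult.assoc)
qed

subsection \<open>Holomorphic functions on tube domains\<close>

text \<open>Complex scalar multiplication on the complexification, whose points x + iy are the pairs
  (x, y).\<close>

definition cm :: "complex => 'a::real_vector \<times> 'a => 'a \<times> 'a" where
 "cm \<zeta> w = (Re \<zeta> *\<^sub>R fst w - Im \<zeta> *\<^sub>R snd w, Re \<zeta> *\<^sub>R snd w + Im \<zeta> *\<^sub>R fst w)"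

lemma cm_add: "cm (a + b) w = cm a w + cm b w" and cm_scaleR: "cm (t *\<^sub>R a) w = t *\<^sub>R cm a w"
 by (simp_all add: cm_def scaleR_add_left algebra_simps)

lemma linear_cm1: "linear (\<lambda>\<zeta>. cm \<zeta> w)"
 by (intro linearI) (simp_all add: cm_add cm_scaleR)

lemma linear_cm2: "linear (cm \<zeta>)"
 by (intro linearI) (simp_all add: cm_def algebra_simps)

lemma cm_cm: "cm a (cm b w) = cm (a * b) w"
 by (simp add: cm_def algebra_simps)

lemma cm_1: "cm 1 w = w"
 by (simp add: cm_def)

lemma cm_0: "cm 0 w = 0"
 by (simp add: cm_def zero_prod_def)

lemma norm_cm: "norm (cm \<zeta> w) = norm \<zeta> * norm w" for w :: "'a::euclidean_space \<times> 'a"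
proof -
 have "(norm (cm \<zeta> w))\<^sup>2 = ((Re \<zeta>)\<^sup>2 + (Im \<zeta>)\<^sup>2) * (norm w)\<^sup>2"
  unfolding power2_norm_eq_inner by (cases w) (simp add: cm_def inner_prod_def inner_simps algebra_simps power2_eq_square inner_commute)
 also have "\<dots> = (norm \<zeta> * norm w)\<^sup>2" by (simp add: cmod_power2 power_mult_distrib)
 finally show ?thesis by (simp add: power2_eq_iff_nonneg)
qed

definition Thol :: "'a::euclidean_space set => ('a \<times> 'a => complex) => bool" where
 "Thol S F \<longleftrightarrow> (\<forall>x y. y \<in> S \<longrightarrow> (\<exists>D. (F has_derivative D) (at (x, y)) \<and> (\<forall>u v. D (- v, u) = \<i> * D (u, v))))"

lemma Thol_const: "Thol S (\<lambda>_. a)"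
 unfolding Thol_def by (intro allI impI exI[of _ "\<lambda>_. 0"]) auto

lemma Thol_mult:
 assumes "Thol S F" "Thol S G"
 shows "Thol S (\<lambda>z. F z * G z)"
 unfolding Thol_def
proof (intro allI impI)
 fix x y assume "y \<in> S"
 then obtain D E where D: "(F has_derivative D) (at (x, y))" "\<And>u v. D (- v, u) = \<i> * D (u, v)"
  and E: "(G has_derivative E) (at (x, y))" "\<And>u v. E (- v, u) = \<i> * E (u, v)"
  using assms unfolding Thol_def by metis
 have "((\<lambda>z. F z * G z) has_derivative (\<lambda>w. F (x, y) * E w + D w * G (x, y))) (at (x, y))"
  by (rule has_derivative_mult[OF D(1) E(1)])
 then show "\<exists>D'. ((\<lambda>z. F z * G z) has_derivative D') (at (x, y)) \<and> (\<forall>u v. D' (- v, u) = \<i> * D' (u, v))"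
  by (intro exI[of _ "\<lambda>w. F (x, y) * E w + D w * G (x, y)"]) (simp add: D(2) E(2) algebra_simps)
qed

lemma Thol_prod: "finite I ==> (\<And>i. i \<in> I ==> Thol S (f i)) ==> Thol S (\<lambda>z. \<Prod>i\<in>I. f i z)"
proof (induction I rule: finite_induct)
 case (insert i I)
 then show ?case using Thol_mult[of S "f i" "\<lambda>z. \<Prod>i\<in>I. f i z"] by simp
qed (simp add: Thol_const)

lemma Thol_comp:
 assumes F: "Thol S F" and h: "\<And>x y. y \<in> S ==> (h has_field_derivative h' (F (x, y))) (at (F (x, y)))"
 shows "Thol S (\<lambda>z. h (F z))"
 unfolding Thol_def
proof (intro allI impI)
 fix x y assume y: "y \<in> S"
 then obtain D where D: "(F has_derivative D) (at (x, y))" "\<And>u v. D (- v, u) = \<i> * D (u, v)"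
  using F unfolding Thol_def by metis
 have "((\<lambda>z. h (F z)) has_derivative (\<lambda>w. h' (F (x, y)) * D w)) (at (x, y))"
  using has_derivative_compose[OF D(1) h[OF y, unfolded has_field_derivative_def]] .
 then show "\<exists>D'. ((\<lambda>z. h (F z)) has_derivative D') (at (x, y)) \<and> (\<forall>u v. D' (- v, u) = \<i> * D' (u, v))"
  by (intro exI[of _ "\<lambda>w. h' (F (x, y)) * D w"]) (simp add: D(2) algebra_simps)
qed

lemma Thol_affine: "Thol S (\<lambda>z. a + b * Complex (inner (fst z) v) (inner (snd z) v))"
 unfolding Thol_def
proof (intro allI impI)
 fix x y
 let ?L = "\<lambda>z. b * Complex (inner (fst z) v) (inner (snd z) v)"
 have "linear ?L" by (intro linearI) (simp_all add: complex_eq_iff inner_simps algebra_simps)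
 then have "(?L has_derivative ?L) (at (x, y))" by (rule linear_imp_has_derivative)
 from has_derivative_add[OF has_derivative_const this, of a]
 have "((\<lambda>z. a + ?L z) has_derivative ?L) (at (x, y))" by simp
 then show "\<exists>D. ((\<lambda>z. a + ?L z) has_derivative D) (at (x, y)) \<and> (\<forall>u v. D (- v, u) = \<i> * D (u, v))"
  by (intro exI[of _ ?L]) (simp add: complex_eq_iff)
qed

lemma Thol_continuous: "Thol (S::'a::euclidean_space set) F ==> continuous_on (UNIV \<times> S) F"
proof (intro continuous_at_imp_continuous_on ballI)
 fix z :: "'a \<times> 'a" assume "Thol S F" "z \<in> UNIV \<times> S"
 then obtain D where "(F has_derivative D) (at z)" unfolding Thol_def by (metis mem_Times_iff prod.collapse)
 then show "isCont F z" by (rule has_derivative_continuous)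
qed

lemma Thol_meas:
 assumes "open S" "Thol S F"
 shows "(\<lambda>p. indicator (UNIV \<times> S) p *\<^sub>R F p) \<in> borel_measurable borel"
 using assms by (intro borel_measurable_continuous_on_indicator Thol_continuous) (auto intro!: borel_open open_Times)

lemma Thol_line:
 assumes F: "Thol S F" and y: "snd (z0 + cm \<zeta> w) \<in> S"
 shows "\<exists>d. ((\<lambda>\<zeta>. F (z0 + cm \<zeta> w)) has_field_derivative d) (at \<zeta>)"
proof -
 obtain D where D: "(F has_derivative D) (at (z0 + cm \<zeta> w))" "\<And>u v. D (- v, u) = \<i> * D (u, v)"
  using F y unfolding Thol_def by (metis prod.collapse)
 have lD: "linear D" using D(1) has_derivative_linear by blast
 have "((\<lambda>\<zeta>. cm \<zeta> w) has_derivative (\<lambda>\<zeta>. cm \<zeta> w)) (at \<zeta>)"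
  by (rule linear_imp_has_derivative[OF linear_cm1])
 from has_derivative_add[OF has_derivative_const this, of z0]
 have "((\<lambda>\<zeta>. z0 + cm \<zeta> w) has_derivative (\<lambda>\<zeta>. cm \<zeta> w)) (at \<zeta>)" by simp
 from has_derivative_compose[OF this D(1)]
 have "((\<lambda>\<zeta>. F (z0 + cm \<zeta> w)) has_derivative (\<lambda>h. D (cm h w))) (at \<zeta>)" .
 moreover have "D (cm h w) = D w * h" for h
 proof -
  have "cm h w = Re h *\<^sub>R w + Im h *\<^sub>R (- snd w, fst w)" by (cases w) (simp add: cm_def)
  then have "D (cm h w) = Re h *\<^sub>R D w + Im h *\<^sub>R D (- snd w, fst w)"
   by (simp only: linear_add[OF lD] linear_scale[OF lD])
  also have "\<dots> = Re h *\<^sub>R D w + Im h *\<^sub>R (\<i> * D w)" using D(2)[of "snd w" "fst w"] by simp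
  also have "\<dots> = h * D w" by (subst (3) complex_eq) (simp add: scaleR_conv_of_real algebra_simps)
  finally show ?thesis by (simp add: mult.commute)
 qed
 then have "(\<lambda>h. D (cm h w)) = (*) (D w)" by (intro ext)
 ultimately show ?thesis unfolding has_field_derivative_def by auto
qed

lemma circle_mean_norm:
 assumes h: "f holomorphic_on cball 0 1"
 shows "ennreal (norm (f 0)) \<le> (\<integral>\<^sup>+t. indicator {0..1} t * ennreal (norm (f (exp (2 * of_real pi * \<i> * of_real t)))) \<partial>lborel)"
proof -
 let ?E = "\<lambda>t::real. exp (2 * of_real pi * \<i> * of_real t)"
 have nE: "norm (?E t) = 1" for t by (simp add: norm_exp_eq_Re)
 have fc: "continuous_on (cball 0 1) f" using h holomorphic_on_imp_continuous_on by blast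
 have gc: "continuous_on S (\<lambda>t. f (?E t))" for S
  by (rule continuous_on_compose2[OF fc]) (auto intro!: continuous_intros simp: nE)
 have ci: "((\<lambda>u. f u / (u - 0)) has_contour_integral (2 * of_real pi * \<i> * f 0)) (circlepath 0 1)"
  by (rule Cauchy_integral_circlepath_simple[OF h]) simp
 have ci2: "((\<lambda>t. f (?E t) / ?E t * (2 * of_real pi * \<i> * ?E t)) has_integral (2 * of_real pi * \<i> * f 0)) {0..1}"
 proof (rule has_integral_eq[OF _ ci[unfolded has_contour_integral_def]])
  fix t :: real assume "t \<in> {0..1}"
  then have "vector_derivative (circlepath 0 1) (at t within {0..1}) = 2 * of_real pi * \<i> * ?E t"
   using vector_derivative_circlepath01[of t 0 1] by simp
  then show "f (circlepath 0 1 t) / (circlepath 0 1 t - 0) * vector_derivative (circlepath 0 1) (at t within {0..1})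
    = f (?E t) / ?E t * (2 * of_real pi * \<i> * ?E t)" by (simp only: circlepath) simp
 qed
 define c where "c = 2 * of_real pi * \<i>"
 have "c \<noteq> 0" by (simp add: c_def)
 then have cc: "inverse c * (c * z) = z" for z by (simp add: mult.assoc[symmetric])
 have "((\<lambda>t. c * f (?E t)) has_integral c * f 0) {0..1}"
  using has_integral_eq[OF _ ci2, of "\<lambda>t. c * f (?E t)"] by (simp add: c_def)
 from has_integral_mult_right[OF this, of "inverse c"]
 have hi: "((\<lambda>t. f (?E t)) has_integral f 0) {0..1}" unfolding cc .
 have "norm (f 0) = norm (integral {0..1} (\<lambda>t. f (?E t)))" using integral_unique[OF hi] by simp
 also have "\<dots> \<le> integral {0..1} (\<lambda>t. norm (f (?E t)))"
  by (intro integral_norm_bound_integral integrable_continuous_interval continuous_intros gc) simp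
 finally have le: "norm (f 0) \<le> integral {0..1} (\<lambda>t. norm (f (?E t)))" .
 have si: "set_integrable lborel {0..1} (\<lambda>t. norm (f (?E t)))"
  by (intro borel_integrable_atLeastAtMost' continuous_intros gc)
 have "ennreal (norm (f 0)) \<le> ennreal (integral {0..1} (\<lambda>t. norm (f (?E t))))" by (rule ennreal_leI[OF le])
 also have "integral {0..1} (\<lambda>t. norm (f (?E t))) = (\<integral>t. indicator {0..1} t * norm (f (?E t)) \<partial>lborel)"
  using set_borel_integral_eq_integral(2)[OF si] by (simp add: set_lebesgue_integral_def)
 also have "ennreal \<dots> = (\<integral>\<^sup>+t. ennreal (indicator {0..1} t * norm (f (?E t))) \<partial>lborel)"
  using si by (intro nn_integral_eq_integral[symmetric]) (auto simp: set_integrable_def)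
 also have "\<dots> = (\<integral>\<^sup>+t. indicator {0..1} t * ennreal (norm (f (?E t))) \<partial>lborel)"
  by (intro nn_integral_cong) (simp add: indicator_def)
 finally show ?thesis .
qed

text \<open>On each complex line through \<open>z0\<close> the circle mean bounds the centre value.
  Integrating over directions \<open>w\<close> in the ball, each rotation by a unit complex scalar
  is an isometry of the real space of dimension 2n and drops out.\<close>

lemma Thol_mean_value:
 fixes F :: "'a::euclidean_space \<times> 'a => complex"
 assumes S: "open S" and F: "Thol S F" and \<rho>: "\<rho> > 0" and sub: "ball (snd z0) \<rho> \<subseteq> S"
 shows "emeasure lborel (ball (0::'a \<times> 'a) \<rho>) * ennreal (norm (F z0)) \<le> (\<integral>\<^sup>+w. indicator (ball z0 \<rho>) w * ennreal (norm (F w)) \<partial>lborel)"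
proof -
 let ?E = "\<lambda>t::real. exp (2 * of_real pi * \<i> * of_real t) :: complex"
 have nE: "norm (?E t) = 1" for t by (simp add: norm_exp_eq_Re)
 define g where "g w = indicator (ball z0 \<rho>) w * ennreal (norm (F w))" for w
 have sub2: "snd w \<in> S" if "w \<in> ball z0 \<rho>" for w
 proof -
  have "dist (snd z0) (snd w) \<le> dist z0 w" by (rule dist_snd_le)
  then show ?thesis using that sub by (auto intro!: subsetD[OF sub])
 qed
 have gm [measurable]: "g \<in> borel_measurable borel"
 proof -
  have "(\<lambda>w. indicator (ball z0 \<rho>) w * ennreal (norm (indicator (UNIV \<times> S) w *\<^sub>R F w))) \<in> borel_measurable borel"
   by (intro borel_measurable_times_ennreal measurable_compose[OF _ measurable_ennreal] measurable_compose[OF Thol_meas[OF S F] borel_measurable_norm] borel_measurable_indicator) simp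
  moreover have "g = (\<lambda>w. indicator (ball z0 \<rho>) w * ennreal (norm (indicator (UNIV \<times> S) w *\<^sub>R F w)))"
   using sub2 by (intro ext) (auto simp: g_def indicator_def mem_Times_iff)
  ultimately show ?thesis by (simp only:)
 qed
 have Emeas: "(\<lambda>p. z0 + cm (?E (snd p)) (fst p)) \<in> borel_measurable (borel :: (('a \<times> 'a) \<times> real) measure)"
  unfolding cm_def by (intro borel_measurable_continuous_onI continuous_intros)
 have jm: "(\<lambda>(w, t). g (z0 + cm (?E t) w)) \<in> borel_measurable (lborel \<Otimes>\<^sub>M (lborel :: real measure))"
  using measurable_compose[OF Emeas gm] unfolding lborel_prod by (simp add: case_prod_unfold)
 have line: "indicator (ball 0 \<rho>) w * ennreal (norm (F z0)) \<le> (\<integral>\<^sup>+t. indicator {0..1} t * g (z0 + cm (?E t) w) \<partial>lborel)" for w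
 proof (cases "w \<in> ball 0 \<rho>")
  case True
  then have nw: "norm w < \<rho>" by simp
  have inb: "z0 + cm \<zeta> w \<in> ball z0 \<rho>" if "norm \<zeta> \<le> 1" for \<zeta>
  proof -
   have "norm (cm \<zeta> w) \<le> 1 * norm w" unfolding norm_cm using that by (intro mult_right_mono) auto
   then show ?thesis using nw by (simp add: dist_norm)
  qed
  have "(\<lambda>\<zeta>. F (z0 + cm \<zeta> w)) holomorphic_on cball 0 1"
  proof -
   have "\<exists>d. ((\<lambda>\<zeta>. F (z0 + cm \<zeta> w)) has_field_derivative d) (at \<zeta> within cball 0 1)" if "\<zeta> \<in> cball 0 1" for \<zeta>
    using Thol_line[OF F sub2[OF inb]] that has_field_derivative_at_within by fastforce
   then show ?thesis unfolding holomorphic_on_def field_differentiable_def by blast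
  qed
  from circle_mean_norm[OF this]
  have "ennreal (norm (F z0)) \<le> (\<integral>\<^sup>+t. indicator {0..1} t * ennreal (norm (F (z0 + cm (?E t) w))) \<partial>lborel)"
   by (simp add: cm_0)
  also have "\<dots> = (\<integral>\<^sup>+t. indicator {0..1} t * g (z0 + cm (?E t) w) \<partial>lborel)"
   using inb nE by (intro nn_integral_cong) (simp add: g_def)
  finally show ?thesis using True by simp
 qed simp
 have rot: "(\<integral>\<^sup>+w. g (z0 + cm (?E t) w) \<partial>lborel) = (\<integral>\<^sup>+w. g w \<partial>lborel)" for t
 proof -
  have "scales (cm (?E t) :: 'a \<times> 'a => 'a \<times> 'a) 1"
  proof -
   have "?E (- t) * ?E t = 1" "?E t * ?E (- t) = 1" by (simp_all flip: exp_add)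
   then have "cm (?E (- t)) (cm (?E t) x) = x" "cm (?E t) (cm (?E (- t)) x) = x" for x :: "'a \<times> 'a"
    by (simp_all add: cm_cm cm_1)
   moreover have "norm (cm (?E t) x) = norm x" for x :: "'a \<times> 'a" by (simp add: norm_cm nE)
   ultimately show ?thesis by (rule scales_isometry[OF linear_cm2])
  qed
  from scalesD[OF this, of "\<lambda>w. g (z0 + w)"]
  have "(\<integral>\<^sup>+w. g (z0 + cm (?E t) w) \<partial>lborel) = (\<integral>\<^sup>+w. g (z0 + w) \<partial>lborel)" by simp
  also have "\<dots> = (\<integral>\<^sup>+w. g w \<partial>lborel)"
   using nn_integral_lborel_translate[OF gm, of z0] by (simp add: add.commute)
  finally show ?thesis .
 qed
 have "emeasure lborel (ball (0::'a \<times> 'a) \<rho>) * ennreal (norm (F z0)) = (\<integral>\<^sup>+w. indicator (ball 0 \<rho>) w * ennreal (norm (F z0)) \<partial>(lborel :: ('a \<times> 'a) measure))"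
  by (subst nn_integral_multc) (auto intro!: borel_measurable_indicator)
 also have "\<dots> \<le> (\<integral>\<^sup>+w. \<integral>\<^sup>+t. indicator {0..1} t * g (z0 + cm (?E t) w) \<partial>lborel \<partial>lborel)"
  by (intro nn_integral_mono line)
 also have "\<dots> = (\<integral>\<^sup>+t. \<integral>\<^sup>+w. indicator {0..1} t * g (z0 + cm (?E t) w) \<partial>lborel \<partial>lborel)"
  by (rule lborel_pair.Fubini'[symmetric]) (use jm in \<open>simp add: case_prod_unfold\<close>)
 also have "\<dots> = (\<integral>\<^sup>+t. indicator {0..1} t * (\<integral>\<^sup>+w. g (z0 + cm (?E t) w) \<partial>lborel) \<partial>lborel)"
 proof (rule nn_integral_cong)
  fix t :: real
  have "(\<lambda>w. g (z0 + cm (?E t) w)) \<in> borel_measurable borel"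
   using borel_measurable_linear[OF linear_cm2[of "?E t"]] by measurable
  then show "(\<integral>\<^sup>+w. indicator {0..1} t * g (z0 + cm (?E t) w) \<partial>lborel) = indicator {0..1} t * (\<integral>\<^sup>+w. g (z0 + cm (?E t) w) \<partial>lborel)"
   by (intro nn_integral_cmult) simp
 qed
 also have "\<dots> = (\<integral>\<^sup>+w. g w \<partial>lborel)" unfolding rot by (subst nn_integral_multc) auto
 finally show ?thesis by (simp add: g_def)
qed

lemma integrable_lborel_shift:
 fixes d :: "'a::euclidean_space => 'b::{banach,second_countable_topology}"
 assumes "integrable lborel d"
 shows "integrable lborel (\<lambda>x. d (x + a))"
proof -
 have "integrable (distr lborel borel ((+) a)) d" using assms by (simp add: lborel_distr_plus)
 then have "integrable lborel (\<lambda>x. d (a + x))" by (rule integrable_distr[rotated]) simp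
 then show ?thesis by (simp add: add.commute)
qed

lemma integral_lborel_shift:
 fixes d :: "'a::euclidean_space => 'b::{banach,second_countable_topology}"
 assumes "integrable lborel d"
 shows "(\<integral>x. d (x + a) \<partial>lborel) = (\<integral>x. d x \<partial>lborel)"
proof -
 have "(\<integral>x. d x \<partial>lborel) = (\<integral>x. d x \<partial>(distr lborel borel ((+) a)))" by (simp add: lborel_distr_plus)
 also have "\<dots> = (\<integral>x. d (a + x) \<partial>lborel)" using assms by (intro integral_distr) auto
 finally show ?thesis by (simp add: add.commute)
qed

lemma integral_average_shift:
 fixes d :: "'a::euclidean_space => complex"
 assumes d: "integrable lborel d" and R: "R > 0"
 shows "integrable lborel (\<lambda>x. \<integral>\<tau>. indicator {-R..R} \<tau> *\<^sub>R d (x + \<tau> *\<^sub>R u) \<partial>lborel)"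
  and "(\<integral>x. (\<integral>\<tau>. indicator {-R..R} \<tau> *\<^sub>R d (x + \<tau> *\<^sub>R u) \<partial>lborel) \<partial>lborel) = (2 * R) *\<^sub>R (\<integral>x. d x \<partial>lborel)"
proof -
 have [measurable]: "d \<in> borel_measurable borel" using borel_measurable_integrable[OF d] by simp
 let ?f = "\<lambda>(\<tau>::real) x. indicator {-R..R} \<tau> *\<^sub>R d (x + \<tau> *\<^sub>R u)"
 have m: "case_prod ?f \<in> borel_measurable (lborel \<Otimes>\<^sub>M lborel)" by measurable
 have nrm: "(\<integral>x. norm (?f \<tau> x) \<partial>lborel) = indicator {-R..R} \<tau> * (\<integral>x. norm (d x) \<partial>lborel)" for \<tau>
  using integral_lborel_shift[OF integrable_norm[OF d], of "\<tau> *\<^sub>R u"] by simp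
 have int: "integrable (lborel \<Otimes>\<^sub>M lborel) (case_prod ?f)"
 proof (rule lborel_pair.Fubini_integrable[OF m])
  show "integrable lborel (\<lambda>\<tau>. \<integral>x. norm (case (\<tau>, x) of (\<tau>, x) => ?f \<tau> x) \<partial>lborel)"
   unfolding prod.case nrm using R by (intro integrable_mult_left integrable_real_indicator) auto
  show "AE \<tau> in lborel. integrable lborel (\<lambda>x. case (\<tau>, x) of (\<tau>, x) => ?f \<tau> x)"
   using integrable_lborel_shift[OF d] by (intro always_eventually allI) simp
 qed
 show "integrable lborel (\<lambda>x. \<integral>\<tau>. ?f \<tau> x \<partial>lborel)"
  using lborel_pair.integrable_snd[OF int] by simp
 have "(\<integral>x. (\<integral>\<tau>. ?f \<tau> x \<partial>lborel) \<partial>lborel) = (\<integral>\<tau>. (\<integral>x. ?f \<tau> x \<partial>lborel) \<partial>lborel)"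
  by (rule lborel_pair.Fubini_integral[OF int])
 also have "\<dots> = (\<integral>\<tau>. indicator {-R..R} \<tau> *\<^sub>R (\<integral>x. d x \<partial>lborel) \<partial>lborel)"
  using integral_lborel_shift[OF d] by simp
 also have "\<dots> = (2 * R) *\<^sub>R (\<integral>x. d x \<partial>lborel)" using R by simp
 finally show "(\<integral>x. (\<integral>\<tau>. ?f \<tau> x \<partial>lborel) \<partial>lborel) = (2 * R) *\<^sub>R (\<integral>x. d x \<partial>lborel)" .
qed

lemma Thol_slice:
 assumes "Thol S F" "y \<in> S"
 shows "continuous_on UNIV (\<lambda>x. F (x, y))"
 by (rule continuous_on_compose2[OF Thol_continuous[OF assms(1)]]) (use assms(2) in \<open>auto intro!: continuous_intros\<close>)

lemma slice_integrable:
 assumes "continuous_on UNIV g" "\<And>x. norm (g x) \<le> C * KK x"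
 shows "integrable lborel (g :: 'a::euclidean_space => complex)"
proof (rule Bochner_Integration.integrable_bound[of lborel "\<lambda>x. C * KK x"])
 show "integrable lborel (\<lambda>x::'a. C * KK x)" by (intro integrable_mult_right KK_integrable)
 show "g \<in> borel_measurable lborel" using borel_measurable_continuous_onI[OF assms(1)] by simp
 have "norm (g x) \<le> norm (C * KK x)" for x using assms(2)[of x] by (metis abs_ge_self order_trans real_norm_def)
 then show "AE x in lborel. norm (g x) \<le> norm (C * KK x)" by simp
qed

text \<open>Cauchy's theorem for the rectangle |\<tau>| \<le> R, 0 \<le> \<sigma> \<le> 1 in the
  complex line through (x, y0) with direction u, in the form of a primitive on a convex domain. The
  horizontal sides differ by the vertical ones, which have length 1 and are bounded by
  \<open>bd\<close>.\<close>

lemma strip_bound: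
 fixes k :: "'a::euclidean_space \<times> 'a => complex"
 assumes S: "open S" "convex S" and k: "Thol S k" and y: "y0 \<in> S" "y0 + u \<in> S" and R: "R > 0"
  and bd: "\<And>x \<sigma>. 0 \<le> \<sigma> ==> \<sigma> \<le> 1 ==> norm (k (x, y0 + \<sigma> *\<^sub>R u)) \<le> C * KK x"
 shows "norm (\<integral>\<tau>. indicator {-R..R} \<tau> *\<^sub>R (k (x + \<tau> *\<^sub>R u, y0) - k (x + \<tau> *\<^sub>R u, y0 + u)) \<partial>lborel)
  \<le> C * KK (x + R *\<^sub>R u) + C * KK (x - R *\<^sub>R u)"
proof -
 define \<phi> where "\<phi> \<zeta> = k ((x, y0) + cm \<zeta> (u, 0))" for \<zeta>
 have \<phi>: "\<phi> \<zeta> = k (x + Re \<zeta> *\<^sub>R u, y0 + Im \<zeta> *\<^sub>R u)" for \<zeta> by (simp add: \<phi>_def cm_def)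
 define T where "T = (\<lambda>\<zeta>. y0 + Im \<zeta> *\<^sub>R u) -` S"
 have oT: "open T" unfolding T_def by (intro open_vimage S continuous_intros)
 have cT: "convex T"
 proof (rule convexI)
  fix a b :: complex and p q :: real assume ab: "a \<in> T" "b \<in> T" "0 \<le> p" "0 \<le> q" "p + q = 1"
  have "y0 + Im (p *\<^sub>R a + q *\<^sub>R b) *\<^sub>R u = p *\<^sub>R (y0 + Im a *\<^sub>R u) + q *\<^sub>R (y0 + Im b *\<^sub>R u)"
   using ab(5) by (simp add: algebra_simps) (metis scaleR_add_left scaleR_one)
  also have "\<dots> \<in> S" using ab by (intro convexD[OF S(2)]) (auto simp: T_def)
  finally show "p *\<^sub>R a + q *\<^sub>R b \<in> T" by (simp add: T_def)
 qed
 have "\<exists>d. (\<phi> has_field_derivative d) (at \<zeta>)" if "\<zeta> \<in> T" for \<zeta>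
  unfolding \<phi>_def using that by (intro Thol_line[OF k]) (simp add: T_def cm_def)
 then have hol: "\<phi> holomorphic_on T" using oT by (auto simp: holomorphic_on_open)
 obtain g where g: "\<And>z. z \<in> T ==> (g has_field_derivative \<phi> z) (at z within T)"
  using holomorphic_convex_primitive'[OF cT oT hol] by blast
 have g': "(g has_field_derivative \<phi> z) (at z within A)" if "z \<in> T" for z A
  using g[OF that] at_within_open[OF that oT] has_field_derivative_at_within by metis
 have inT: "Complex \<tau> \<sigma> \<in> T" if "0 \<le> \<sigma>" "\<sigma> \<le> 1" for \<tau> \<sigma>
 proof -
  have "y0 + \<sigma> *\<^sub>R u = (1 - \<sigma>) *\<^sub>R y0 + \<sigma> *\<^sub>R (y0 + u)" by (simp add: algebra_simps)
  also have "\<dots> \<in> S" using that y by (intro convexD[OF S(2)]) auto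
  finally show ?thesis by (simp add: T_def)
 qed
 have hi: "((\<lambda>\<tau>. \<phi> (Complex \<tau> \<sigma>)) has_integral g (Complex R \<sigma>) - g (Complex (- R) \<sigma>)) {-R..R}"
  if \<sigma>: "0 \<le> \<sigma>" "\<sigma> \<le> 1" for \<sigma>
 proof (rule fundamental_theorem_of_calculus)
  show "- R \<le> R" using R by simp
  fix \<tau> assume "\<tau> \<in> {-R..R}"
  have "((\<lambda>\<tau>. Complex \<tau> \<sigma>) has_vector_derivative 1) (at \<tau> within {-R..R})"
   unfolding Complex_eq by (auto intro!: derivative_eq_intros)
  from field_vector_diff_chain_within[OF this g'[OF inT[OF \<sigma>]]]
  show "((\<lambda>\<tau>. g (Complex \<tau> \<sigma>)) has_vector_derivative \<phi> (Complex \<tau> \<sigma>)) (at \<tau> within {-R..R})" by (simp add: o_def)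
 qed
 have vb: "norm (g (Complex a 0) - g (Complex a 1)) \<le> C * KK (x + a *\<^sub>R u)" for a
 proof -
  let ?s = "closed_segment (Complex a 0) (Complex a 1)"
  have seg: "\<exists>\<sigma>. 0 \<le> \<sigma> \<and> \<sigma> \<le> 1 \<and> z = Complex a \<sigma>" if "z \<in> ?s" for z
   using that by (auto simp: closed_segment_def complex_eq_iff algebra_simps)
  have "norm (g (Complex a 0) - g (Complex a 1)) \<le> C * KK (x + a *\<^sub>R u) * norm (Complex a 0 - Complex a 1)"
  proof (rule field_differentiable_bound)
   fix z assume "z \<in> ?s"
   then obtain \<sigma> where \<sigma>: "0 \<le> \<sigma>" "\<sigma> \<le> 1" "z = Complex a \<sigma>" using seg by blast
   show "(g has_field_derivative \<phi> z) (at z within ?s)" using g'[OF inT[OF \<sigma>(1,2)]] \<sigma>(3) by simp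
   show "norm (\<phi> z) \<le> C * KK (x + a *\<^sub>R u)" using bd[OF \<sigma>(1,2)] by (simp add: \<phi> \<sigma>(3))
  qed auto
  also have "norm (Complex a 0 - Complex a 1) = 1" by (simp add: cmod_def)
  finally show ?thesis by simp
 qed
 let ?d = "\<lambda>\<tau>. \<phi> (Complex \<tau> 0) - \<phi> (Complex \<tau> 1)"
 have hd: "(?d has_integral (g (Complex R 0) - g (Complex (- R) 0)) - (g (Complex R 1) - g (Complex (- R) 1))) {-R..R}"
  by (rule has_integral_diff[OF hi hi]) auto
 have \<phi>c: "continuous_on A (\<lambda>\<tau>. \<phi> (Complex \<tau> \<sigma>))" if \<sigma>: "0 \<le> \<sigma>" "\<sigma> \<le> 1" for \<sigma> A
  by (rule continuous_on_compose2[OF holomorphic_on_imp_continuous_on[OF hol]])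
   (use inT[OF \<sigma>] in \<open>auto simp: Complex_eq intro!: continuous_intros\<close>)
 have "set_integrable lborel {-R..R} ?d"
  by (rule borel_integrable_atLeastAtMost') (intro continuous_on_diff \<phi>c, auto)
 from set_borel_integral_eq_integral(2)[OF this]
 have "(\<integral>\<tau>. indicator {-R..R} \<tau> *\<^sub>R ?d \<tau> \<partial>lborel) = integral {-R..R} ?d" by (simp add: set_lebesgue_integral_def)
 also have "\<dots> = (g (Complex R 0) - g (Complex R 1)) - (g (Complex (- R) 0) - g (Complex (- R) 1))"
  using integral_unique[OF hd] by simp
 also have "norm \<dots> \<le> C * KK (x + R *\<^sub>R u) + C * KK (x + (- R) *\<^sub>R u)"
  by (rule order_trans[OF norm_triangle_ineq4 add_mono[OF vb vb]])
 finally show ?thesis by (simp add: \<phi>)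
qed

lemma exp_ii_Complex: "exp (- \<i> * Complex a b) = exp b *\<^sub>R cis (- a)"
 by (simp add: complex_eq_iff Re_exp Im_exp)

text \<open>The difference \<open>d\<close> of the two integrands is averaged along translates by
  \<tau> u. Integrating \<open>strip_bound\<close> over all \<open>x\<close> gives 2R |integral of
  d| \<le> 2L with L independent of R, so the integral vanishes; no coordinates adapted to u are
  chosen.\<close>

theorem contour_shift:
 fixes G :: "'a::euclidean_space \<times> 'a => complex"
 assumes S: "open S" "convex S" and G: "Thol S G" and y: "y0 \<in> S" "y1 \<in> S"
  and bd: "\<And>x y. y \<in> closed_segment y0 y1 ==> norm (G (x, y)) \<le> C * KK x"
 shows "exp (inner y0 \<xi>) *\<^sub>R FT (\<lambda>x. G (x, y0)) \<xi> = exp (inner y1 \<xi>) *\<^sub>R FT (\<lambda>x. G (x, y1)) \<xi>"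
proof -
 define k where "k z = G z * exp (0 + - \<i> * Complex (inner (fst z) \<xi>) (inner (snd z) \<xi>))" for z
 have k1: "k (x, y) = exp (inner y \<xi>) *\<^sub>R (G (x, y) * cis (- inner x \<xi>))" for x y
 proof -
  have "exp (0 + - \<i> * Complex (inner x \<xi>) (inner y \<xi>)) = exp (inner y \<xi>) *\<^sub>R cis (- inner x \<xi>)"
   by (simp only: add_0 exp_ii_Complex)
  then show ?thesis by (simp only: k_def fst_conv snd_conv mult_scaleR_right)
 qed
 have kT: "Thol S k" unfolding k_def
  by (intro Thol_mult G Thol_comp[where h = exp and h' = exp] Thol_affine DERIV_exp)
 define u where "u = y1 - y0"
 have y1: "y1 = y0 + u" by (simp add: u_def)
 define E where "E = exp ((norm y0 + norm y1) * norm \<xi>)"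
 have C0: "C * KK x \<ge> 0" for x :: 'a using bd[of y0 x] norm_ge_zero order_trans by (metis ends_in_segment(1))
 have kb: "norm (k (x, y)) \<le> C * E * KK x" if "y \<in> closed_segment y0 y1" for x y
 proof -
  have "norm y \<le> norm y0 + norm y1"
   using that by (auto simp: closed_segment_def intro!: order_trans[OF norm_triangle_ineq] add_mono mult_left_le_one_le)
  then have "inner y \<xi> \<le> (norm y0 + norm y1) * norm \<xi>"
   by (intro order_trans[OF norm_cauchy_schwarz] mult_right_mono) auto
  then have "exp (inner y \<xi>) \<le> E" by (simp add: E_def)
  then have "exp (inner y \<xi>) * norm (G (x, y)) \<le> E * (C * KK x)"
   using bd[OF that] by (intro mult_mono) (auto simp: E_def)
  then show ?thesis by (simp add: k1 norm_mult mult.assoc mult.left_commute)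
 qed
 have ki: "integrable lborel (\<lambda>x. k (x, y))" if "y \<in> {y0, y1}" for y
 proof (rule slice_integrable[of _ "C * E"])
  show "continuous_on UNIV (\<lambda>x. k (x, y))" using that y by (intro Thol_slice[OF kT]) auto
  show "norm (k (x, y)) \<le> C * E * KK x" for x using that by (intro kb) auto
 qed
 have Phi: "(\<integral>x. k (x, y) \<partial>lborel) = exp (inner y \<xi>) *\<^sub>R FT (\<lambda>x. G (x, y)) \<xi>" for y
  unfolding k1 FT_def by simp
 define d where "d x = k (x, y0) - k (x, y1)" for x
 have di: "integrable lborel d" unfolding d_def by (intro Bochner_Integration.integrable_diff ki) auto
 let ?\<delta> = "norm (\<integral>x. d x \<partial>lborel)"
 let ?L = "C * E * KI TYPE('a)"
 have Ki: "integrable lborel (\<lambda>x::'a. C * E * KK (x + a))" for a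
  by (intro integrable_mult_right integrable_lborel_shift KK_integrable)
 have KI: "(\<integral>x. C * E * KK (x + a) \<partial>lborel) = ?L" for a :: 'a
  using integral_lborel_shift[OF KK_integrable, of a] by (simp add: KI_def)
 have main: "R * ?\<delta> \<le> ?L" if R: "R > 0" for R
 proof -
  let ?D = "\<lambda>x. \<integral>\<tau>. indicator {-R..R} \<tau> *\<^sub>R d (x + \<tau> *\<^sub>R u) \<partial>lborel"
  have D: "norm (?D x) \<le> C * E * KK (x + R *\<^sub>R u) + C * E * KK (x + - (R *\<^sub>R u))" for x
  proof -
   have "norm (k (x, y0 + \<sigma> *\<^sub>R u)) \<le> C * E * KK x" if "0 \<le> \<sigma>" "\<sigma> \<le> 1" for x \<sigma>
    by (rule kb) (use that in \<open>auto simp: closed_segment_def u_def algebra_simps intro!: exI[of _ \<sigma>]\<close>)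
   from strip_bound[OF S kT y(1) y(2)[unfolded y1] R this]
   show ?thesis by (simp add: d_def y1)
  qed
  have "2 * R * ?\<delta> = norm (\<integral>x. ?D x \<partial>lborel)"
   unfolding integral_average_shift(2)[OF di R] using R by simp
  also have "\<dots> \<le> (\<integral>x. norm (?D x) \<partial>lborel)" by (rule integral_norm_bound)
  also have "\<dots> \<le> (\<integral>x. C * E * KK (x + R *\<^sub>R u) + C * E * KK (x + - (R *\<^sub>R u)) \<partial>lborel)"
   by (rule Bochner_Integration.integral_mono[OF integrable_norm[OF integral_average_shift(1)[OF di R]] Bochner_Integration.integrable_add[OF Ki Ki] D])
  also have "\<dots> = ?L + ?L" unfolding Bochner_Integration.integral_add[OF Ki Ki] KI ..
  finally show ?thesis by simp
 qed
 have "?\<delta> = 0"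
 proof (rule ccontr)
  assume "?\<delta> \<noteq> 0"
  then have p: "?\<delta> > 0" by simp
  have "(\<bar>?L\<bar> + 1) / ?\<delta> * ?\<delta> = \<bar>?L\<bar> + 1" using p by (intro nonzero_divide_eq_eq[THEN iffD1, symmetric]) auto
  moreover have "(\<bar>?L\<bar> + 1) / ?\<delta> > 0" using p by (intro divide_pos_pos) auto
  ultimately show False using main[of "(\<bar>?L\<bar> + 1) / ?\<delta>"] by linarith
 qed
 then have "(\<integral>x. k (x, y0) \<partial>lborel) = (\<integral>x. k (x, y1) \<partial>lborel)"
  using ki by (simp add: d_def)
 then show ?thesis unfolding Phi .
qed

subsection \<open>Damping\<close>

text \<open>The function 1 - i eps (z|v) on the complexification; its real part is 1 + eps (y|v),
  which is at least 1 on the tube for v in the cone.\<close>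

definition Lf :: "real => 'a::euclidean_space => 'a \<times> 'a => complex" where
 "Lf eps v z = 1 + (- \<i> * cplx eps) * Complex (inner (fst z) v) (inner (snd z) v)"

lemma Lf_norm:
 assumes "eps > 0" "inner y v \<ge> 0"
 shows "(norm (Lf eps v (x, y)))\<^sup>2 \<ge> 1 + eps\<^sup>2 * (inner x v)\<^sup>2" "norm (Lf eps v (x, y)) \<ge> 1"
proof -
 have "(norm (Lf eps v (x, y)))\<^sup>2 = (1 + eps * inner y v)\<^sup>2 + eps\<^sup>2 * (inner x v)\<^sup>2"
  by (simp add: Lf_def cmod_power2 power_mult_distrib)
 moreover have "(1 + eps * inner y v)\<^sup>2 \<ge> 1" using assms by (intro one_le_power) simp
 ultimately show a: "(norm (Lf eps v (x, y)))\<^sup>2 \<ge> 1 + eps\<^sup>2 * (inner x v)\<^sup>2" by simp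
 have "1\<^sup>2 \<le> (norm (Lf eps v (x, y)))\<^sup>2" by (rule order_trans[OF _ a]) simp
 then show "norm (Lf eps v (x, y)) \<ge> 1" by (rule power2_le_imp_le) simp
qed

lemma Lf_Thol: "Thol S (Lf eps v)"
 using Thol_affine[of S 1 "- \<i> * cplx eps" v] unfolding Lf_def .

lemma Thol_inverse:
 assumes "Thol S F" "\<And>x y. y \<in> S ==> F (x, y) \<noteq> 0"
 shows "Thol S (\<lambda>z. inverse (F z))"
 by (rule Thol_comp[OF assms(1), where h' = "\<lambda>z. - (inverse z ^ Suc (Suc 0))"]) (rule DERIV_inverse[OF assms(2)])

context euclidean_jordan
begin

text \<open>Small enough that all e + eta b remain in the cone. Damping is possible in cone
  directions only, and each coordinate (x|b) is recovered from the two cone directions e and e + eta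
  b.\<close>

definition eta :: real where "eta = (SOME \<eta>. \<eta> > 0 \<and> (\<forall>b\<in>Basis. e + \<eta> *\<^sub>R b \<in> \<Omega>))"

lemma eta: "eta > 0" "b \<in> Basis ==> e + eta *\<^sub>R b \<in> \<Omega>"
proof -
 obtain \<rho> where \<rho>: "\<rho> > 0" "ball e \<rho> \<subseteq> \<Omega>" using open_\<Omega> e_in_\<Omega> open_contains_ball by blast
 have "\<exists>\<eta>. \<eta> > 0 \<and> (\<forall>b\<in>Basis. e + \<eta> *\<^sub>R b \<in> \<Omega>)"
  using \<rho> by (intro exI[of _ "\<rho> / 2"]) (auto intro!: subsetD[OF \<rho>(2)] simp: dist_norm)
 from someI_ex[OF this] show "eta > 0" "b \<in> Basis ==> e + eta *\<^sub>R b \<in> \<Omega>" by (auto simp: eta_def)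
qed

text \<open>A holomorphic damping factor: it tends to 1 as eps tends to 0 and decays like KK along slices.\<close>
definition EE :: "real => 'a \<times> 'a => complex" where
 "EE eps z = (\<Prod>b\<in>Basis. inverse (Lf eps (e + eta *\<^sub>R b) z * Lf eps e z) * inverse (Lf eps (e + eta *\<^sub>R b) z * Lf eps e z))"

lemma inner_\<Omega>_nonneg: "y \<in> \<Omega> ==> v \<in> \<Omega> ==> inner y v \<ge> 0"
 using Q_dual \<Omega>_sub_Q by (metis Q_iff_\<Omega>_dual subsetD)

lemma Lf_nz: "eps > 0 ==> y \<in> \<Omega> ==> v \<in> \<Omega> ==> Lf eps v (x, y) \<noteq> 0"
 using Lf_norm(2)[OF _ inner_\<Omega>_nonneg, of eps y v x] by force

lemma EE_Thol: "eps > 0 ==> Thol \<Omega> (EE eps)"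
 unfolding EE_def
 by (intro Thol_prod finite_Basis Thol_mult Thol_inverse Lf_Thol) (auto dest: Lf_nz[OF _ _ eta(2)] Lf_nz[OF _ _ e_in_\<Omega>])

lemma EE_norm: "norm (EE eps (x, y)) = (\<Prod>b\<in>Basis. inverse ((norm (Lf eps (e + eta *\<^sub>R b) (x, y)))\<^sup>2 * (norm (Lf eps e (x, y)))\<^sup>2))"
 unfolding EE_def prod_norm[symmetric]
 by (intro prod.cong) (simp_all add: norm_mult norm_inverse power2_eq_square mult_ac)

lemma EE_le_1:
 assumes eps: "eps > 0" and y: "y \<in> \<Omega>"
 shows "norm (EE eps (x, y)) \<le> 1"
 unfolding EE_norm
proof (intro prod_le_1 conjI)
 fix b :: 'a assume b: "b \<in> Basis"
 have "1 \<le> (norm (Lf eps (e + eta *\<^sub>R b) (x, y)))\<^sup>2" "1 \<le> (norm (Lf eps e (x, y)))\<^sup>2"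
  using Lf_norm(2)[OF eps inner_\<Omega>_nonneg[OF y eta(2)[OF b]]] Lf_norm(2)[OF eps inner_\<Omega>_nonneg[OF y e_in_\<Omega>]]
  by (auto intro!: one_le_power)
 then have "1 * 1 \<le> (norm (Lf eps (e + eta *\<^sub>R b) (x, y)))\<^sup>2 * (norm (Lf eps e (x, y)))\<^sup>2" by (intro mult_mono) auto
 then show "inverse ((norm (Lf eps (e + eta *\<^sub>R b) (x, y)))\<^sup>2 * (norm (Lf eps e (x, y)))\<^sup>2) \<le> 1"
  by (intro inverse_le_1_iff[THEN iffD2]) auto
qed simp

text \<open>A coordinate of \<open>x\<close> is a difference of (x|e + eta b) and (x|e), and the two
  factors \<open>Lf\<close> control one each. Inverting twice produces the squared moduli that match
  the quadratic decay of \<open>KK\<close>.\<close>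

lemma EE_decay:
 assumes eps: "eps > 0"
 shows "\<exists>C. \<forall>x y. y \<in> \<Omega> \<longrightarrow> norm (EE eps (x, y)) \<le> C * KK x"
proof -
 \<comment> \<open>Both summands of 1 + (x|b)^2 have to be absorbed: this requires D \<ge> 1 and D
   eps^2 \<ge> 2/eta^2.\<close>
 define D where "D = 1 + 2 / (eta\<^sup>2 * eps\<^sup>2)"
 have D: "D \<ge> 1" "D * eps\<^sup>2 \<ge> 2 / eta\<^sup>2" using eps eta(1) by (auto simp: D_def field_simps)
 have sq: "(a - c)\<^sup>2 \<le> 2 * (a\<^sup>2 + c\<^sup>2)" for a c :: real
  using zero_le_power2[of "a + c"] by (simp add: power2_eq_square algebra_simps)
 have "norm (EE eps (x, y)) \<le> (\<Prod>b\<in>(Basis::'a set). D / 2) * KK x" if y: "y \<in> \<Omega>" for x y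
  unfolding EE_norm KK_def prod.distrib[symmetric]
 proof (rule prod_mono, intro conjI)
  fix b :: 'a assume b: "b \<in> Basis"
  let ?a = "inner x (e + eta *\<^sub>R b)" let ?c = "inner x e"
  have "inner x b = (?a - ?c) / eta" using eta(1) by (simp add: inner_simps)
  then have "(inner x b)\<^sup>2 = (?a - ?c)\<^sup>2 / eta\<^sup>2" by (simp only: power_divide)
  also have "\<dots> \<le> 2 * (?a\<^sup>2 + ?c\<^sup>2) / eta\<^sup>2" by (intro divide_right_mono sq) simp
  finally have "(inner x b)\<^sup>2 \<le> (2 / eta\<^sup>2) * (?a\<^sup>2 + ?c\<^sup>2)" by simp
  also have "\<dots> \<le> D * eps\<^sup>2 * (?a\<^sup>2 + ?c\<^sup>2)" by (intro mult_right_mono D) simp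
  finally have "1 + (inner x b)\<^sup>2 \<le> D * (1 + eps\<^sup>2 * ?a\<^sup>2 + eps\<^sup>2 * ?c\<^sup>2)" using D(1) by (simp add: algebra_simps)
  also have "\<dots> \<le> D * ((1 + eps\<^sup>2 * ?a\<^sup>2) * (1 + eps\<^sup>2 * ?c\<^sup>2))"
   using D(1) by (intro mult_left_mono) (simp_all add: algebra_simps)
  also have "\<dots> \<le> D * ((norm (Lf eps (e + eta *\<^sub>R b) (x, y)))\<^sup>2 * (norm (Lf eps e (x, y)))\<^sup>2)"
   using D(1) by (intro mult_left_mono mult_mono Lf_norm(1) eps inner_\<Omega>_nonneg y eta(2) b e_in_\<Omega>) auto
  finally have "1 + (inner x b)\<^sup>2 \<le> D * ((norm (Lf eps (e + eta *\<^sub>R b) (x, y)))\<^sup>2 * (norm (Lf eps e (x, y)))\<^sup>2)" (is "?p \<le> D * ?q") .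
  moreover have "?p > 0" by (simp add: add_pos_nonneg)
  moreover have "?q > 0"
   using Lf_nz[OF eps y eta(2)[OF b]] Lf_nz[OF eps y e_in_\<Omega>] by simp
  ultimately show "inverse ?q \<le> D / 2 * (2 / ?p)" by (simp add: field_simps)
 qed simp
 then show ?thesis by blast
qed

lemma EE_limit: "(\<lambda>n. EE (inverse (real (Suc n))) z) \<longlonglongrightarrow> 1"
proof -
 have L: "(\<lambda>n. Lf (inverse (real (Suc n))) v z) \<longlonglongrightarrow> 1 + (- \<i> * cplx 0) * Complex (inner (fst z) v) (inner (snd z) v)" for v
  unfolding Lf_def by (intro tendsto_intros LIMSEQ_inverse_real_of_nat)
 then have L1: "(\<lambda>n. Lf (inverse (real (Suc n))) v z) \<longlonglongrightarrow> 1" for v by simp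
 have "(\<lambda>n. EE (inverse (real (Suc n))) z) \<longlonglongrightarrow> (\<Prod>b\<in>(Basis::'a set). inverse (1 * 1) * inverse (1 * 1))"
  unfolding EE_def by (intro tendsto_prod tendsto_mult tendsto_inverse L1) auto
 then show ?thesis by simp
qed

end

subsection \<open>The Fourier transform of a Hardy function\<close>

context mu_jordan
begin

lemma Tonelli_M:
 assumes "case_prod f \<in> borel_measurable (borel \<Otimes>\<^sub>M borel)"
 shows "(\<integral>\<^sup>+t. \<integral>\<^sup>+y. f t y \<partial>M \<partial>lborel) = (\<integral>\<^sup>+y. \<integral>\<^sup>+t. f t y \<partial>lborel \<partial>M)"
proof -
 interpret P: pair_sigma_finite lborel M
  by (intro pair_sigma_finite.intro sigma_finite_M lborel.sigma_finite_measure_axioms)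
 have "sets (lborel \<Otimes>\<^sub>M M) = sets (borel \<Otimes>\<^sub>M borel)" by (intro sets_pair_measure_cong) (simp_all add: sets_M)
 then have "case_prod f \<in> borel_measurable (lborel \<Otimes>\<^sub>M M)"
  using assms by (subst measurable_cong_sets[of _ "borel \<Otimes>\<^sub>M borel"]) auto
 from P.Fubini'[OF this] show ?thesis by simp
qed

lemma LL_meas [measurable]: "LL \<in> borel_measurable borel"
proof -
 interpret sigma_finite_measure M by (rule sigma_finite_M)
 show ?thesis unfolding LL_def by measurable
qed

end

locale h2_fun = mu_jordan m e c r s M
 for m :: "'a::euclidean_space => 'a => 'a" (infixl \<open>\<odot>\<close> 70) and e c r s M +
 fixes F :: "'a \<times> 'a => complex" and AA :: real
 assumes F_Thol: "Thol \<Omega> F" and F_meas [measurable]: "F \<in> borel_measurable borel" and AA0: "AA \<ge> 0"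
  and F_bound: "\<And>t. t \<in> \<Omega> ==>
   (\<integral>\<^sup>+y. indicator Q y * (\<integral>\<^sup>+x. ennreal ((cmod (F (x, y + t)))\<^sup>2) \<partial>lborel) \<partial>M) \<le> ennreal AA"
begin

definition hh :: "'a => ennreal" where
 "hh y = (\<integral>\<^sup>+x. ennreal ((cmod (F (x, y)))\<^sup>2) \<partial>lborel)"

lemma hh_meas [measurable]: "hh \<in> borel_measurable borel"
 unfolding hh_def by measurable

text \<open>The hypothesis bounds the slice norms only after integration over y + t against
  \<open>M\<close>. Averaging over t in a ball and keeping the mass of \<open>M\<close> near 0 turns
  this into Lebesgue integrability of \<open>hh\<close> near \<open>y0\<close>; the mean value
  inequality then bounds F uniformly in x.\<close>

lemma F_local_bound:
 assumes "y0 \<in> \<Omega>"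
 shows "\<exists>\<rho>>0. \<exists>B. \<forall>x y. y \<in> ball y0 \<rho> \<longrightarrow> norm (F (x, y)) \<le> B"
proof -
 obtain \<rho>0 where \<rho>0: "\<rho>0 > 0" "ball y0 \<rho>0 \<subseteq> \<Omega>" using assms open_\<Omega> open_contains_ball by blast
 define \<rho> where "\<rho> = \<rho>0 / 4"
 have \<rho>: "\<rho> > 0" "ball y0 (3 * \<rho>) \<subseteq> \<Omega>" using \<rho>0 by (auto simp: \<rho>_def intro!: subsetD[OF \<rho>0(2)])
 have [measurable]: "ball y0 (2 * \<rho>) \<in> sets borel" "ball y0 (3 * \<rho>) \<in> sets borel" by simp_all
 define I where "I = (\<integral>\<^sup>+y. indicator (ball y0 (2 * \<rho>)) y * hh y \<partial>lborel)"
 have "I < \<infinity>"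
 proof -
  let ?f = "\<lambda>t y. indicator (ball y0 (3 * \<rho>)) t * (indicator Q y * hh (y + t))"
  have fm: "case_prod ?f \<in> borel_measurable (borel \<Otimes>\<^sub>M borel)" by measurable
  have "emeasure M (Q \<inter> ball 0 \<rho>) * I = (\<integral>\<^sup>+y. indicator (Q \<inter> ball 0 \<rho>) y * I \<partial>M)"
   by (subst nn_integral_multc) (auto simp: sets_M intro!: borel_measurable_indicator)
  also have "\<dots> \<le> (\<integral>\<^sup>+y. \<integral>\<^sup>+t. ?f t y \<partial>lborel \<partial>M)"
  proof (rule nn_integral_mono)
   fix y
   show "indicator (Q \<inter> ball 0 \<rho>) y * I \<le> (\<integral>\<^sup>+t. ?f t y \<partial>lborel)"
   proof (cases "y \<in> Q \<inter> ball 0 \<rho>")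
    case True
    have "I = (\<integral>\<^sup>+t. indicator (ball y0 (2 * \<rho>)) (t + y) * hh (t + y) \<partial>lborel)"
     unfolding I_def by (rule nn_integral_lborel_translate[symmetric]) measurable
    also have "\<dots> \<le> (\<integral>\<^sup>+t. ?f t y \<partial>lborel)"
    proof (rule nn_integral_mono)
     fix t
     have "t \<in> ball y0 (3 * \<rho>)" if "t + y \<in> ball y0 (2 * \<rho>)"
     proof -
      have "norm (y0 - t) \<le> norm (y0 - (t + y)) + norm y"
       using norm_triangle_ineq[of "y0 - (t + y)" y] by (simp add: algebra_simps)
      then show ?thesis using that True by (simp add: dist_norm)
     qed
     then show "indicator (ball y0 (2 * \<rho>)) (t + y) * hh (t + y) \<le> ?f t y"
      using True by (auto simp: indicator_def add.commute)
    qed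
    finally show ?thesis using True by simp
   qed simp
  qed
  also have "\<dots> = (\<integral>\<^sup>+t. \<integral>\<^sup>+y. ?f t y \<partial>M \<partial>lborel)" by (rule Tonelli_M[OF fm, symmetric])
  also have "\<dots> \<le> (\<integral>\<^sup>+t. indicator (ball y0 (3 * \<rho>)) t * ennreal AA \<partial>lborel)"
  proof (rule nn_integral_mono)
   fix t
   show "(\<integral>\<^sup>+y. ?f t y \<partial>M) \<le> indicator (ball y0 (3 * \<rho>)) t * ennreal AA"
    using F_bound[of t] \<rho>(2) by (cases "t \<in> ball y0 (3 * \<rho>)") (auto simp: hh_def)
  qed
  also have "\<dots> = emeasure lborel (ball y0 (3 * \<rho>)) * ennreal AA" by (subst nn_integral_multc) (auto intro!: borel_measurable_indicator)
  also have "\<dots> < \<infinity>" using ball_lborel(1)[of y0 "3 * \<rho>"] by (simp add: ennreal_mult_less_top)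
  finally show ?thesis using M_near_0[OF \<rho>(1)] by (auto simp: ennreal_mult_less_top top.not_eq_extremum)
 qed
 then obtain i where i: "I = ennreal i" "i \<ge> 0" by (cases I) auto
 obtain v where v: "emeasure lborel (ball (0::'a \<times> 'a) \<rho>) = ennreal v" "v > 0"
  using ball_lborel(1)[of "0::'a \<times> 'a" \<rho>] ball_lborel(2)[of \<rho> "0::'a \<times> 'a"] \<rho>(1)
  by (cases "emeasure lborel (ball (0::'a \<times> 'a) \<rho>)") auto
 have "norm (F (x, y)) \<le> sqrt (i / v)" if y: "y \<in> ball y0 \<rho>" for x y
 proof -
  have tri: "y' \<in> ball y0 (2 * \<rho>)" if "dist y y' < \<rho>" for y'
   using dist_triangle[of y0 y' y] y that by simp
  have "ball y \<rho> \<subseteq> ball y0 (2 * \<rho>)" using tri by auto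
  also have "\<dots> \<subseteq> \<Omega>" using \<rho> by (auto intro!: subsetD[OF \<rho>(2)])
  finally have sub: "ball (snd (x, y)) \<rho> \<subseteq> \<Omega>" by simp
  \<comment> \<open>The mean value inequality is applied to F F, which is holomorphic too and whose
    modulus is the integrable quantity |F|^2.\<close>
  have "ennreal v * ennreal (norm (F (x, y) * F (x, y))) \<le> (\<integral>\<^sup>+w. indicator (ball (x, y) \<rho>) w * ennreal (norm (F w * F w)) \<partial>lborel)"
   using Thol_mean_value[OF open_\<Omega> Thol_mult[OF F_Thol F_Thol] \<rho>(1) sub] by (simp add: v)
  also have "\<dots> \<le> (\<integral>\<^sup>+w. indicator (ball y0 (2 * \<rho>)) (snd w) * ennreal ((cmod (F w))\<^sup>2) \<partial>lborel)"
  proof (rule nn_integral_mono)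
   fix w :: "'a \<times> 'a"
   have "snd w \<in> ball y0 (2 * \<rho>)" if "w \<in> ball (x, y) \<rho>"
    using that dist_snd_le[of "(x, y)" w] by (intro tri) simp
   then show "indicator (ball (x, y) \<rho>) w * ennreal (norm (F w * F w)) \<le> indicator (ball y0 (2 * \<rho>)) (snd w) * ennreal ((cmod (F w))\<^sup>2)"
    by (auto simp: indicator_def norm_mult power2_eq_square)
  qed
  also have "\<dots> = (\<integral>\<^sup>+y. \<integral>\<^sup>+x. indicator (ball y0 (2 * \<rho>)) y * ennreal ((cmod (F (x, y)))\<^sup>2) \<partial>lborel \<partial>lborel)"
  proof -
   have [measurable]: "F \<in> borel_measurable (borel \<Otimes>\<^sub>M borel)" by (simp add: borel_prod)
   have "(\<lambda>w. indicator (ball y0 (2 * \<rho>)) (snd w) * ennreal ((cmod (F w))\<^sup>2)) \<in> borel_measurable (borel \<Otimes>\<^sub>M borel)" by measurable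
   then show ?thesis
    unfolding lborel_prod[symmetric] by (subst lborel_pair.nn_integral_snd[symmetric]) (simp_all add: lborel_prod borel_prod)
  qed
  also have "\<dots> = I" unfolding I_def hh_def by (intro nn_integral_cong nn_integral_cmult) measurable
  finally have "ennreal (v * (norm (F (x, y)))\<^sup>2) \<le> ennreal i"
   using v(2) by (simp add: i ennreal_mult norm_mult power2_eq_square)
  then have "(norm (F (x, y)))\<^sup>2 \<le> i / v" using v(2) i(2) by (simp add: field_simps)
  then show ?thesis by (rule real_le_rsqrt)
 qed
 then show ?thesis using \<rho>(1) by blast
qed

lemma F_compact_bound:
 assumes K: "compact K" "K \<subseteq> \<Omega>"
 shows "\<exists>B\<ge>0. \<forall>x. \<forall>y\<in>K. norm (F (x, y)) \<le> B"
proof -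
 have "\<exists>\<rho> B. y0 \<in> \<Omega> \<longrightarrow> \<rho> > 0 \<and> (\<forall>x y. y \<in> ball y0 \<rho> \<longrightarrow> norm (F (x, y)) \<le> B)" for y0
  using F_local_bound[of y0] by blast
 then obtain \<rho> B where \<rho>: "\<And>y0. y0 \<in> \<Omega> ==> \<rho> y0 > 0"
  and B: "\<And>y0 x y. y0 \<in> \<Omega> ==> y \<in> ball y0 (\<rho> y0) ==> norm (F (x, y)) \<le> B y0" by metis
 have cov: "K \<subseteq> (\<Union>y\<in>K. ball y (\<rho> y))" using \<rho> K(2) by (force intro!: UN_I)
 obtain T where T: "T \<subseteq> K" "finite T" "K \<subseteq> (\<Union>y\<in>T. ball y (\<rho> y))"
  using compactE_image[OF K(1), of K "\<lambda>y. ball y (\<rho> y)"] cov by (metis open_ball)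
 show ?thesis
 proof (intro exI[of _ "\<Sum>y\<in>T. \<bar>B y\<bar>"] conjI allI ballI)
  show "0 \<le> (\<Sum>y\<in>T. \<bar>B y\<bar>)" by (intro sum_nonneg) simp
  fix x y assume "y \<in> K"
  then obtain y0 where y0: "y0 \<in> T" "y \<in> ball y0 (\<rho> y0)" using T(3) by blast
  have "norm (F (x, y)) \<le> B y0" using y0 T(1) K(2) by (intro B) auto
  also have "\<dots> \<le> \<bar>B y0\<bar>" by simp
  also have "\<dots> \<le> (\<Sum>y\<in>T. \<bar>B y\<bar>)" by (rule member_le_sum[OF y0(1)]) (use T in auto)
  finally show "norm (F (x, y)) \<le> (\<Sum>y\<in>T. \<bar>B y\<bar>)" .
 qed
qed

definition G :: "real => 'a \<times> 'a => complex" where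
 "G eps z = F z * EE eps z"

lemma G_Thol: "eps > 0 ==> Thol \<Omega> (G eps)"
 using Thol_mult[OF F_Thol EE_Thol] unfolding G_def .

lemma G_le: "eps > 0 ==> y \<in> \<Omega> ==> norm (G eps (x, y)) \<le> norm (F (x, y))"
 using EE_le_1[of eps y x] by (simp add: G_def norm_mult mult_left_le)

lemma G_decay:
 assumes eps: "eps > 0" and K: "compact K" "K \<subseteq> \<Omega>"
 shows "\<exists>C. \<forall>x. \<forall>y\<in>K. norm (G eps (x, y)) \<le> C * KK x"
proof -
 obtain B where B: "B \<ge> 0" "\<And>x y. y \<in> K ==> norm (F (x, y)) \<le> B" using F_compact_bound[OF K] by blast
 obtain C where C: "\<And>x y. y \<in> \<Omega> ==> norm (EE eps (x, y)) \<le> C * KK x" using EE_decay[OF eps] by blast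
 have "norm (G eps (x, y)) \<le> B * C * KK x" if "y \<in> K" for x y
  unfolding G_def norm_mult mult.assoc using that K(2) B by (intro mult_mono C) auto
 then show ?thesis by blast
qed

lemma G_nice:
 assumes eps: "eps > 0" and y: "y \<in> \<Omega>"
 shows "nice (\<lambda>x. G eps (x, y))"
proof -
 have K: "compact {y}" "{y} \<subseteq> \<Omega>" using y by auto
 obtain B where B: "\<And>x. norm (F (x, y)) \<le> B" using F_compact_bound[OF K] by auto
 obtain C where C: "\<And>x. norm (G eps (x, y)) \<le> C * KK x" using G_decay[OF eps K] by auto
 have co: "continuous_on UNIV (\<lambda>x. G eps (x, y))" by (rule Thol_slice[OF G_Thol[OF eps] y])
 have "bounded (range (\<lambda>x. G eps (x, y)))"
  unfolding bounded_iff using order_trans[OF G_le[OF eps y] B] by (intro exI[of _ B]) auto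
 then show ?thesis using co slice_integrable[OF co C] by (simp add: nice_def)
qed

text \<open>The common Fourier-Laplace density of all slices; e is just a base point, and
  \<open>FT_G\<close> shows independence of it by moving the contour.\<close>

definition ff :: "real => 'a => complex" where
 "ff eps \<xi> = exp (inner e \<xi>) *\<^sub>R FT (\<lambda>x. G eps (x, e)) \<xi>"

lemma FT_G:
 assumes eps: "eps > 0" and y: "y \<in> \<Omega>"
 shows "FT (\<lambda>x. G eps (x, y)) \<xi> = exp (- inner y \<xi>) *\<^sub>R ff eps \<xi>"
proof -
 have "closed_segment e y \<subseteq> \<Omega>" using y e_in_\<Omega> convex_\<Omega> by (simp add: closed_segment_subset)
 then obtain C where "\<And>x w. w \<in> closed_segment e y ==> norm (G eps (x, w)) \<le> C * KK x"
  using G_decay[OF eps compact_segment] by blast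
 then have "ff eps \<xi> = exp (inner y \<xi>) *\<^sub>R FT (\<lambda>x. G eps (x, y)) \<xi>"
  unfolding ff_def by (rule contour_shift[OF open_\<Omega> convex_\<Omega> G_Thol[OF eps] e_in_\<Omega> y])
 then show ?thesis by (simp flip: exp_add)
qed

lemma ff_continuous: "eps > 0 ==> continuous_on UNIV (ff eps)"
 unfolding ff_def using G_nice[OF _ e_in_\<Omega>] by (intro continuous_intros FT_continuous) (simp add: nice_def)

lemma ff_meas: "eps > 0 ==> ff eps \<in> borel_measurable borel"
 by (intro borel_measurable_continuous_onI ff_continuous)

lemma ff_plancherel:
 assumes eps: "eps > 0" and y: "y \<in> \<Omega>"
 shows "(\<integral>\<^sup>+\<xi>. ennreal ((cmod (ff eps \<xi>))\<^sup>2 * exp (- inner y (2 *\<^sub>R \<xi>))) \<partial>lborel) \<le> ennreal (KI TYPE('a)) * hh y"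
proof -
 have "(cmod (FT (\<lambda>x. G eps (x, y)) \<xi>))\<^sup>2 = (cmod (ff eps \<xi>))\<^sup>2 * exp (- inner y (2 *\<^sub>R \<xi>))" for \<xi>
  unfolding FT_G[OF eps y] by (simp add: power_mult_distrib mult.commute flip: exp_double)
 then have "(\<integral>\<^sup>+\<xi>. ennreal ((cmod (ff eps \<xi>))\<^sup>2 * exp (- inner y (2 *\<^sub>R \<xi>))) \<partial>lborel)
   = ennreal (KI TYPE('a)) * (\<integral>\<^sup>+x. ennreal ((cmod (G eps (x, y)))\<^sup>2) \<partial>lborel)"
  using plancherel_nn[OF G_nice[OF eps y]] by simp
 also have "\<dots> \<le> ennreal (KI TYPE('a)) * hh y"
  unfolding hh_def by (intro mult_left_mono nn_integral_mono ennreal_leI power_mono G_le eps y) auto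
 finally show ?thesis .
qed

text \<open>Plancherel on the slice over y + t, integrated in y against \<open>M\<close>: Tonelli
  collects exp(-2(y|\<xi>)) into \<open>LL\<close> at 2 \<xi>.\<close>

lemma ff_weighted:
 assumes eps: "eps > 0" and t: "t \<in> \<Omega>"
 shows "(\<integral>\<^sup>+\<xi>. ennreal ((cmod (ff eps \<xi>))\<^sup>2 * exp (- inner t (2 *\<^sub>R \<xi>))) * LL (2 *\<^sub>R \<xi>) \<partial>lborel) \<le> ennreal (KI TYPE('a) * AA)"
proof -
 note [measurable] = ff_meas[OF eps]
 let ?a = "\<lambda>\<xi>. (cmod (ff eps \<xi>))\<^sup>2"
 let ?f = "\<lambda>\<xi> y. indicator Q y * ennreal (?a \<xi> * exp (- inner (y + t) (2 *\<^sub>R \<xi>)))"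
 have fm: "case_prod ?f \<in> borel_measurable (borel \<Otimes>\<^sub>M borel)" by measurable
 have "(\<integral>\<^sup>+\<xi>. ennreal (?a \<xi> * exp (- inner t (2 *\<^sub>R \<xi>))) * LL (2 *\<^sub>R \<xi>) \<partial>lborel) = (\<integral>\<^sup>+\<xi>. \<integral>\<^sup>+y. ?f \<xi> y \<partial>M \<partial>lborel)"
 proof (rule nn_integral_cong)
  fix \<xi>
  have "ennreal (?a \<xi> * exp (- inner t (2 *\<^sub>R \<xi>))) * LL (2 *\<^sub>R \<xi>)
    = (\<integral>\<^sup>+y. ennreal (?a \<xi> * exp (- inner t (2 *\<^sub>R \<xi>))) * (indicator Q y * ennreal (exp (- inner y (2 *\<^sub>R \<xi>)))) \<partial>M)"
   unfolding LL_def by (rule nn_integral_cmult[symmetric]) (simp add: measurable_cong_sets[OF sets_M refl])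
  also have "\<dots> = (\<integral>\<^sup>+y. ?f \<xi> y \<partial>M)"
   by (intro nn_integral_cong)
    (simp add: indicator_def ennreal_mult'[symmetric] inner_add_left distrib_left mult.assoc exp_add[symmetric] add.commute)
  finally show "ennreal (?a \<xi> * exp (- inner t (2 *\<^sub>R \<xi>))) * LL (2 *\<^sub>R \<xi>) = (\<integral>\<^sup>+y. ?f \<xi> y \<partial>M)" .
 qed
 also have "\<dots> = (\<integral>\<^sup>+y. \<integral>\<^sup>+\<xi>. ?f \<xi> y \<partial>lborel \<partial>M)" by (rule Tonelli_M[OF fm])
 also have "\<dots> \<le> (\<integral>\<^sup>+y. ennreal (KI TYPE('a)) * (indicator Q y * hh (y + t)) \<partial>M)"
 proof (rule nn_integral_mono)
  fix y
  show "(\<integral>\<^sup>+\<xi>. ?f \<xi> y \<partial>lborel) \<le> ennreal (KI TYPE('a)) * (indicator Q y * hh (y + t))"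
  proof (cases "y \<in> Q")
   case True
   then have "y + t \<in> \<Omega>" using \<Omega>_add_Q[OF t, of y] by (simp add: add.commute[of t y])
   from ff_plancherel[OF eps this] show ?thesis using True by simp
  qed simp
 qed
 also have "\<dots> = ennreal (KI TYPE('a)) * (\<integral>\<^sup>+y. indicator Q y * hh (y + t) \<partial>M)"
  by (rule nn_integral_cmult) (simp add: measurable_cong_sets[OF sets_M refl])
 also have "\<dots> \<le> ennreal (KI TYPE('a)) * ennreal AA" using F_bound[OF t] by (intro mult_left_mono) (auto simp: hh_def)
 finally show ?thesis using KI_pos[where 'a='a] AA0 by (simp add: ennreal_mult less_imp_le)
qed

text \<open>Where the transform does not vanish, the bound with weight exp(-2(t|x)) rules out any direction
 in which the exponential can blow up as t goes to infinity in the cone.\<close>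
lemma ff_zero:
 assumes eps: "eps > 0" and \<xi>0: "\<xi>0 \<notin> Q"
 shows "ff eps \<xi>0 = 0"
proof (rule ccontr)
 assume nz: "ff eps \<xi>0 \<noteq> 0"
 obtain y0 where y0: "y0 \<in> \<Omega>" "inner y0 \<xi>0 < 0" using \<xi>0 Q_iff_\<Omega>_dual[of \<xi>0] by force
 define a where "a = cmod (ff eps \<xi>0) / 2"
 define b where "b = - inner y0 \<xi>0 / 2"
 have ab: "a > 0" "b > 0" using nz y0 by (auto simp: a_def b_def)
 have "open {\<xi>. a < cmod (ff eps \<xi>)}" "open {\<xi>. inner y0 \<xi> < - b}"
  by (intro open_Collect_less continuous_intros ff_continuous[OF eps])+
 then have "open ({\<xi>. a < cmod (ff eps \<xi>)} \<inter> {\<xi>. inner y0 \<xi> < - b})" by (rule open_Int)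
 moreover have "\<xi>0 \<in> {\<xi>. a < cmod (ff eps \<xi>)} \<inter> {\<xi>. inner y0 \<xi> < - b}"
  using nz y0 by (auto simp: a_def b_def)
 ultimately obtain \<rho> where \<rho>: "\<rho> > 0" "ball \<xi>0 \<rho> \<subseteq> {\<xi>. a < cmod (ff eps \<xi>)} \<inter> {\<xi>. inner y0 \<xi> < - b}"
  using open_contains_ball by blast
 obtain l where l: "l > 0" "\<And>\<xi>. norm \<xi> \<le> 2 * (norm \<xi>0 + \<rho>) ==> ennreal l \<le> LL \<xi>" using LL_lower by blast
 obtain v where v: "emeasure lborel (ball \<xi>0 \<rho>) = ennreal v" "v > 0"
  using ball_lborel(1)[of \<xi>0 \<rho>] ball_lborel(2)[OF \<rho>(1), of \<xi>0] by (cases "emeasure lborel (ball \<xi>0 \<rho>)") auto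
 have main: "a\<^sup>2 * (2 * \<tau> * b) * l * v \<le> KI TYPE('a) * AA" if \<tau>: "\<tau> > 0" for \<tau>
 proof -
  have "ennreal (a\<^sup>2 * (2 * \<tau> * b) * l * v) = (\<integral>\<^sup>+\<xi>. indicator (ball \<xi>0 \<rho>) \<xi> * (ennreal (a\<^sup>2 * (2 * \<tau> * b)) * ennreal l) \<partial>lborel)"
   using ab l(1) \<tau> v by (subst nn_integral_multc) (auto simp: ennreal_mult'[symmetric] mult_ac intro!: borel_measurable_indicator)
  also have "\<dots> \<le> (\<integral>\<^sup>+\<xi>. ennreal ((cmod (ff eps \<xi>))\<^sup>2 * exp (- inner (\<tau> *\<^sub>R y0) (2 *\<^sub>R \<xi>))) * LL (2 *\<^sub>R \<xi>) \<partial>lborel)"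
  proof (rule nn_integral_mono)
   fix \<xi>
   show "indicator (ball \<xi>0 \<rho>) \<xi> * (ennreal (a\<^sup>2 * (2 * \<tau> * b)) * ennreal l)
    \<le> ennreal ((cmod (ff eps \<xi>))\<^sup>2 * exp (- inner (\<tau> *\<^sub>R y0) (2 *\<^sub>R \<xi>))) * LL (2 *\<^sub>R \<xi>)"
   proof (cases "\<xi> \<in> ball \<xi>0 \<rho>")
    case True
    then have x: "a \<le> cmod (ff eps \<xi>)" "inner y0 \<xi> \<le> - b" using \<rho>(2) by auto
    have "norm \<xi> \<le> norm \<xi>0 + \<rho>" using True norm_triangle_sub[of \<xi> \<xi>0] by (simp add: dist_norm norm_minus_commute)
    then have L: "ennreal l \<le> LL (2 *\<^sub>R \<xi>)" by (intro l(2)) simp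
    have "2 * \<tau> * b \<le> 2 * \<tau> * (- inner y0 \<xi>)" using x(2) \<tau> by (intro mult_left_mono) auto
    also have "\<dots> = - inner (\<tau> *\<^sub>R y0) (2 *\<^sub>R \<xi>)" by simp
    also have "\<dots> \<le> exp (- inner (\<tau> *\<^sub>R y0) (2 *\<^sub>R \<xi>))" using exp_ge_add_one_self order_trans[OF _ exp_ge_add_one_self] by (meson le_add_same_cancel2 zero_le_one)
    finally have "a\<^sup>2 * (2 * \<tau> * b) \<le> (cmod (ff eps \<xi>))\<^sup>2 * exp (- inner (\<tau> *\<^sub>R y0) (2 *\<^sub>R \<xi>))"
     using x(1) ab \<tau> by (intro mult_mono power_mono) auto
    then show ?thesis using True L by (auto intro!: mult_mono ennreal_leI)
   qed simp
  qed
  also have "\<dots> \<le> ennreal (KI TYPE('a) * AA)" by (rule ff_weighted[OF eps \<Omega>_scale[OF y0(1) \<tau>]])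
  finally show ?thesis using KI_pos[where 'a='a] AA0 by (simp add: less_imp_le)
 qed
 define k where "k = a\<^sup>2 * (2 * b) * l * v"
 have k: "k > 0" using ab l(1) v(2) by (simp add: k_def)
 have "(KI TYPE('a) * AA + 1) / k > 0" using k KI_pos[where 'a='a] AA0 by (intro divide_pos_pos) (auto intro!: add_nonneg_pos)
 moreover have "\<tau> * k \<le> KI TYPE('a) * AA" if "\<tau> > 0" for \<tau> using main[OF that] by (simp add: k_def mult_ac)
 ultimately have "(KI TYPE('a) * AA + 1) / k * k \<le> KI TYPE('a) * AA" by blast
 then show False using k by simp
qed

text \<open>Let t tend to 0 along multiples of \<open>e\<close>, with Fatou's lemma.\<close>

lemma ff_L2:
 assumes eps: "eps > 0"
 shows "(\<integral>\<^sup>+\<xi>. ennreal ((cmod (ff eps \<xi>))\<^sup>2) * LL (2 *\<^sub>R \<xi>) \<partial>lborel) \<le> ennreal (KI TYPE('a) * AA)"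
proof -
 note [measurable] = ff_meas[OF eps]
 let ?t = "\<lambda>n. inverse (real (Suc n)) *\<^sub>R e"
 let ?u = "\<lambda>n \<xi>. ennreal ((cmod (ff eps \<xi>))\<^sup>2 * exp (- inner (?t n) (2 *\<^sub>R \<xi>))) * LL (2 *\<^sub>R \<xi>)"
 \<comment> \<open>Multiplication in the extended reals is not continuous at 0 times infinity, and
   \<open>LL\<close> may be infinite; zeros of \<open>ff\<close> are therefore treated
   apart.\<close>
 have lim: "(\<lambda>n. ?u n \<xi>) \<longlonglongrightarrow> ennreal ((cmod (ff eps \<xi>))\<^sup>2) * LL (2 *\<^sub>R \<xi>)" for \<xi>
 proof (cases "ff eps \<xi> = 0")
  case False
  have "(\<lambda>n. (cmod (ff eps \<xi>))\<^sup>2 * exp (- inner (?t n) (2 *\<^sub>R \<xi>))) \<longlonglongrightarrow> (cmod (ff eps \<xi>))\<^sup>2 * exp (- inner (0 *\<^sub>R e) (2 *\<^sub>R \<xi>))"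
   by (intro tendsto_intros LIMSEQ_inverse_real_of_nat)
  then have "(\<lambda>n. ennreal ((cmod (ff eps \<xi>))\<^sup>2 * exp (- inner (?t n) (2 *\<^sub>R \<xi>)))) \<longlonglongrightarrow> ennreal ((cmod (ff eps \<xi>))\<^sup>2)"
   by (intro tendsto_ennrealI) simp
  then show ?thesis using False by (intro tendsto_mult_ennreal tendsto_const) auto
 qed simp
 have "(\<integral>\<^sup>+\<xi>. ennreal ((cmod (ff eps \<xi>))\<^sup>2) * LL (2 *\<^sub>R \<xi>) \<partial>lborel) = (\<integral>\<^sup>+\<xi>. liminf (\<lambda>n. ?u n \<xi>) \<partial>lborel)"
  by (intro nn_integral_cong lim_imp_Liminf[symmetric] lim) simp
 also have "\<dots> \<le> liminf (\<lambda>n. \<integral>\<^sup>+\<xi>. ?u n \<xi> \<partial>lborel)" by (rule nn_integral_liminf) measurable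
 also have "\<dots> \<le> ennreal (KI TYPE('a) * AA)"
 proof (rule Liminf_le)
  show "\<forall>\<^sub>F n in sequentially. (\<integral>\<^sup>+\<xi>. ?u n \<xi> \<partial>lborel) \<le> ennreal (KI TYPE('a) * AA)"
   by (intro always_eventually allI ff_weighted[OF eps] \<Omega>_scale e_in_\<Omega>) simp
 qed simp
 finally show ?thesis .
qed

end

subsection \<open>Invariant integrals over the cone\<close>

lemma scales_integral:
 fixes g :: "'a::euclidean_space => complex"
 assumes t: "scales t \<delta>" "linear t" and g: "integrable lborel g"
 shows "integrable lborel (\<lambda>x. g (t x))" "(\<integral>x. g (t x) \<partial>lborel) = \<delta> *\<^sub>R (\<integral>x. g x \<partial>lborel)"
proof -
 have [measurable]: "t \<in> borel_measurable borel" by (rule borel_measurable_linear[OF t(2)])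
 have gm [measurable]: "g \<in> borel_measurable borel" using borel_measurable_integrable[OF g] by simp
 have \<delta>: "\<delta> > 0" using t(1) by (simp add: scales_def)
 have eq: "distr lborel borel t = density lborel (\<lambda>_. ennreal \<delta>)"
 proof (rule measure_eqI)
  fix A assume "A \<in> sets (distr lborel borel t)"
  then have A [measurable]: "A \<in> sets borel" by simp
  have "emeasure (distr lborel borel t) A = (\<integral>\<^sup>+x. indicator A x \<partial>distr lborel borel t)" by simp
  also have "\<dots> = (\<integral>\<^sup>+x. indicator A (t x) \<partial>lborel)" by (rule nn_integral_distr) auto
  also have "\<dots> = ennreal \<delta> * (\<integral>\<^sup>+x. indicator A x \<partial>lborel)" by (rule scalesD[OF t(1)]) simp
  also have "\<dots> = emeasure (density lborel (\<lambda>_. ennreal \<delta>)) A" by (subst emeasure_density) (auto simp: nn_integral_cmult)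
  finally show "emeasure (distr lborel borel t) A = emeasure (density lborel (\<lambda>_. ennreal \<delta>)) A" .
 qed simp
 have "integrable (density lborel (\<lambda>_. ennreal \<delta>)) g"
  using g \<delta> by (subst integrable_density) auto
 then show "integrable lborel (\<lambda>x. g (t x))"
  unfolding eq[symmetric] by (rule integrable_distr[rotated]) simp
 have "(\<integral>x. g (t x) \<partial>lborel) = (\<integral>x. g x \<partial>distr lborel borel t)" by (rule integral_distr[symmetric]) auto
 also have "\<dots> = (\<integral>x. \<delta> *\<^sub>R g x \<partial>lborel)" unfolding eq using \<delta> by (subst integral_density) auto
 finally show "(\<integral>x. g (t x) \<partial>lborel) = \<delta> *\<^sub>R (\<integral>x. g x \<partial>lborel)" by simp
qed

lemma nice_kk: "nice (\<lambda>x::'a::euclidean_space. cplx (kk x))"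
proof -
 have "continuous_on UNIV (\<lambda>x::'a. cplx (kk x))" unfolding kk_def by (intro continuous_intros)
 moreover have "bounded (range (\<lambda>x::'a. cplx (kk x)))"
 proof -
  have "norm (cplx (kk x)) \<le> 1" for x :: 'a using kk_le_1[of x] kk_pos[of x] by simp
  then show ?thesis unfolding bounded_iff by (intro exI[of _ 1]) blast
 qed
 ultimately show ?thesis unfolding nice_def using kk_integrable by (intro conjI integrable_of_real) auto
qed

text \<open>Plancherel for kk and for its pullback under t compares the volume factors of t and of its adjoint.\<close>
lemma scales_adjoint:
 fixes t :: "'a::euclidean_space => 'a"
 assumes lt: "linear t" and lu: "linear u" and inv: "\<And>x. t (u x) = x" "\<And>x. u (t x) = x"
  and adj: "\<And>x y. inner (t x) y = inner x (t' y)" and sc: "scales t \<delta>"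
 shows "scales t' \<delta>"
proof -
 define u' where "u' = adjoint u"
 have adju: "inner (u x) y = inner x (u' y)" for x y using adjoint_works[OF lu, of x y] by (simp add: u'_def inner_commute)
 have tu: "t' (u' y) = y" and ut: "u' (t' y) = y" for y
  using adj adju inv by (metis vector_eq_ldot)+
 have lt': "linear t'"
  by (intro linearI; rule vector_eq_ldot[THEN iffD1]; intro allI)
   (simp_all only: adj[symmetric] inner_add_right inner_scaleR_right)
 have lu': "linear u'" unfolding u'_def by (rule adjoint_linear[OF lu])
 obtain b where b: "scales u' b" using linear_scales[OF lu' ut tu] by blast
 have pos: "\<delta> > 0" "b > 0" using sc b by (auto simp: scales_def)
 have [measurable]: "t \<in> borel_measurable borel" "u' \<in> borel_measurable borel"
  using borel_measurable_linear lt lu' by auto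
 let ?k = "\<lambda>x::'a. cplx (kk x)"
 have ik: "integrable lborel ?k" using nice_kk[where 'a='a] by (simp only: nice_def)
 have ng: "nice (\<lambda>x. ?k (t x))" unfolding nice_def
 proof (intro conjI)
  show "continuous_on UNIV (\<lambda>x. ?k (t x))"
   using nice_kk[where 'a='a] linear_continuous_on[of t UNIV] lt unfolding nice_def
   by (intro continuous_on_compose2[of UNIV ?k UNIV t]) (auto simp: linear_conv_bounded_linear)
  show "bounded (range (\<lambda>x. ?k (t x)))"
  proof (rule bounded_subset)
   show "bounded (range ?k)" using nice_kk[where 'a='a] by (simp only: nice_def)
  qed (intro image_subsetI rangeI)
  show "integrable lborel (\<lambda>x. ?k (t x))" by (rule scales_integral(1)[OF sc lt ik])
 qed
 have FTg: "FT (\<lambda>x. ?k (t x)) \<xi> = cplx (\<delta> * KK (u' \<xi>))" for \<xi>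
 proof -
  have "FT (\<lambda>x. ?k (t x)) \<xi> = (\<integral>x. ?k (t x) * cis (- inner (t x) (u' \<xi>)) \<partial>lborel)"
   unfolding FT_def adju[symmetric] inv ..
  also have "\<dots> = \<delta> *\<^sub>R FT ?k (u' \<xi>)"
   unfolding FT_def using scales_integral(2)[OF sc lt FT_integrable[OF ik, of "u' \<xi>"]] .
  finally show ?thesis by (simp add: FT_kk scaleR_conv_of_real)
 qed
 define P where "P = (\<integral>\<^sup>+x. ennreal ((kk (x::'a))\<^sup>2) \<partial>lborel)"
 have "P < \<infinity>"
  using nice_sq_integrable[OF nice_kk[where 'a='a]] unfolding P_def by (simp add: integrable_iff_bounded)
 moreover have "P \<noteq> 0"
 proof
  assume "P = 0"
  then have "AE x in (lborel :: 'a measure). ennreal ((kk x)\<^sup>2) = 0" unfolding P_def by (subst (asm) nn_integral_0_iff_AE) auto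
  moreover have "ennreal ((kk x)\<^sup>2) \<noteq> 0" for x :: 'a using kk_pos[of x] by (simp add: not_le)
  ultimately have "AE x in (lborel :: 'a measure). False" by simp
  then show False using ae_filter_eq_bot_iff[of "lborel :: 'a measure"] trivial_limit_def[of "ae_filter (lborel :: 'a measure)"] by simp
 qed
 ultimately obtain p where p: "P = ennreal p" "p > 0" by (cases P) auto
 have KKP: "(\<integral>\<^sup>+\<xi>. ennreal ((KK (\<xi>::'a))\<^sup>2) \<partial>lborel) = ennreal (KI TYPE('a)) * P"
  using plancherel_nn[OF nice_kk[where 'a='a]] unfolding FT_kk P_def by simp
 have 1: "(\<integral>\<^sup>+\<xi>. ennreal ((\<delta> * KK (u' \<xi>))\<^sup>2) \<partial>lborel) = ennreal (KI TYPE('a)) * (\<integral>\<^sup>+x. ennreal ((kk (t x))\<^sup>2) \<partial>lborel)"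
  using plancherel_nn[OF ng] unfolding FTg norm_of_real power2_abs .
 have 2: "(\<integral>\<^sup>+x. ennreal ((kk (t x))\<^sup>2) \<partial>lborel) = ennreal \<delta> * P"
  unfolding P_def by (rule scalesD[OF sc]) measurable
 have 3: "(\<integral>\<^sup>+\<xi>. ennreal ((KK (u' \<xi>))\<^sup>2) \<partial>lborel) = ennreal b * (\<integral>\<^sup>+\<xi>. ennreal ((KK (\<xi>::'a))\<^sup>2) \<partial>lborel)"
  by (rule scalesD[OF b]) measurable
 have 4: "(\<integral>\<^sup>+\<xi>. ennreal ((\<delta> * KK (u' \<xi>))\<^sup>2) \<partial>lborel) = ennreal (\<delta>\<^sup>2) * (\<integral>\<^sup>+\<xi>. ennreal ((KK (u' \<xi>))\<^sup>2) \<partial>lborel)"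
  unfolding power_mult_distrib by (subst nn_integral_cmult[symmetric]) (auto simp: ennreal_mult)
 have "ennreal (\<delta>\<^sup>2) * (ennreal b * (ennreal (KI TYPE('a)) * ennreal p)) = ennreal (KI TYPE('a)) * (ennreal \<delta> * ennreal p)"
  using 1 unfolding 2 4 3 KKP p(1) .
 then have "ennreal (\<delta>\<^sup>2 * (b * (KI TYPE('a) * p))) = ennreal (KI TYPE('a) * (\<delta> * p))"
  using pos p KI_pos[where 'a='a] by (simp add: ennreal_mult' less_imp_le)
 then have "\<delta>\<^sup>2 * (b * (KI TYPE('a) * p)) = KI TYPE('a) * (\<delta> * p)"
  using pos p KI_pos[where 'a='a] by (subst (asm) ennreal_inj) (auto simp: less_imp_le)
 then have "\<delta> * b = 1" using pos p KI_pos[where 'a='a] by (simp add: power2_eq_square)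
 then have "1 / b = \<delta>" using pos by (simp add: field_simps)
 then show ?thesis using scales_inverse[OF b lu' lt' tu ut] by simp
qed

lemma ennreal_inverse_antimono: "a \<le> b ==> inverse b \<le> inverse a" for a b :: ennreal
proof (cases "a = 0 \<or> b = \<infinity>")
 case False
 assume le: "a \<le> b"
 obtain x where x: "a = ennreal x" "x \<ge> 0" using False le by (cases a) (auto simp: top_unique)
 obtain y where y: "b = ennreal y" "y \<ge> 0" using False by (cases b) auto
 have "x > 0" "x \<le> y" using False le x y by (auto simp: less_le)
 then show ?thesis using x y by (simp add: inverse_ennreal le_imp_inverse_le)
qed auto

lemma one_plus_powr_le_exp: "\<exists>C>0. \<forall>r\<ge>0. (1 + r) powr p \<le> C * exp r" for p :: real
proof -
 define P where "P = max 1 p"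
 have P: "P \<ge> 1" "p \<le> P" by (auto simp: P_def)
 have "(1 + r) powr p \<le> P powr P * exp r" if r: "r \<ge> 0" for r
 proof -
  have "1 + r \<le> P * (1 + r / P)" using P r by (simp add: algebra_simps)
  also have "\<dots> \<le> P * exp (r / P)" using P r by (intro mult_left_mono exp_ge_add_one_self) auto
  finally have "(1 + r) powr P \<le> (P * exp (r / P)) powr P" using P r by (intro powr_mono2) auto
  also have "\<dots> = P powr P * exp r" using P by (simp add: powr_mult exp_powr_real)
  finally show ?thesis using powr_mono[OF P(2), of "1 + r"] r by simp
 qed
 then show ?thesis using P by (intro exI[of _ "P powr P"]) auto
qed

text \<open>Half of the exponential absorbs every power of 1 + |y|, including the 2n extra ones that
  are traded for the integrable majorant \<open>KK\<close> \<ge> (1 + |y|)^{-2n}.\<close>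

lemma powr_exp_nn_integral:
 "(\<integral>\<^sup>+y. ennreal ((1 + norm (y::'a::euclidean_space)) powr p * exp (- (2 * norm y))) \<partial>lborel) < \<infinity>"
proof -
 let ?n = "DIM('a)"
 obtain C where C: "C > 0" "\<And>r. r \<ge> 0 ==> (1 + r) powr (p + 2 * real ?n) \<le> C * exp r"
  using one_plus_powr_le_exp[of "p + 2 * real ?n"] by blast
 have "(1 + norm y) powr p * exp (- (2 * norm y)) \<le> C * KK y" for y :: 'a
 proof -
  let ?r = "norm y"
  have r1: "1 + ?r > 0" using norm_ge_zero[of y] by linarith
  have "1 / (1 + ?r) powr (2 * real ?n) = (\<Prod>b\<in>(Basis::'a set). 1 / (1 + ?r)\<^sup>2)"
  proof -
   have "(1 + ?r) powr (2 * real ?n) = ((1 + ?r)\<^sup>2) ^ ?n"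
    using powr_realpow[OF r1, of "2 * ?n"] unfolding power_mult[symmetric] by simp
   then show ?thesis by (simp only: prod_constant power_one_over)
  qed
  also have "\<dots> \<le> KK y" unfolding KK_def
  proof (intro prod_mono conjI)
   fix b :: 'a assume "b \<in> Basis"
   have "(inner y b)\<^sup>2 \<le> ?r\<^sup>2" using Basis_le_norm[OF \<open>b \<in> Basis\<close>, of y] by (metis abs_ge_zero power2_abs power_mono)
   then have "1 + (inner y b)\<^sup>2 \<le> (1 + ?r)\<^sup>2" by (simp add: power2_sum add_increasing2)
   moreover have "1 + (inner y b)\<^sup>2 > 0" by (simp add: add_pos_nonneg)
   ultimately have "1 / (1 + ?r)\<^sup>2 \<le> 1 / (1 + (inner y b)\<^sup>2)" using r1 by (intro divide_left_mono mult_pos_pos) auto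
   also have "\<dots> \<le> 2 / (1 + (inner y b)\<^sup>2)" by (intro divide_right_mono) auto
   finally show "1 / (1 + ?r)\<^sup>2 \<le> 2 / (1 + (inner y b)\<^sup>2)" .
  qed simp
  finally have K: "1 / (1 + ?r) powr (2 * real ?n) \<le> KK y" .
  have "(1 + ?r) powr p * exp (- (2 * ?r)) = (1 + ?r) powr (p + 2 * real ?n) * exp (- (2 * ?r)) * (1 / (1 + ?r) powr (2 * real ?n))"
   using r1 by (simp add: powr_add)
  also have "\<dots> \<le> C * exp ?r * exp (- (2 * ?r)) * KK y"
   using C(2)[of ?r] K C(1) by (intro mult_mono) auto
  also have "C * exp ?r * exp (- (2 * ?r)) = C * exp (- ?r)" by (simp add: mult.assoc flip: exp_add)
  also have "C * exp (- ?r) * KK y \<le> C * 1 * KK y" using C(1) KK_pos[of y] by (intro mult_right_mono mult_left_mono) auto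
  finally show ?thesis by simp
 qed
 then have "(\<integral>\<^sup>+y. ennreal ((1 + norm (y::'a)) powr p * exp (- (2 * norm y))) \<partial>lborel) \<le> (\<integral>\<^sup>+y. ennreal (C * KK (y::'a)) \<partial>lborel)"
  by (intro nn_integral_mono ennreal_leI)
 also have "\<dots> = ennreal (\<integral>y. C * KK (y::'a) \<partial>lborel)"
  using C(1) by (intro nn_integral_eq_integral integrable_mult_right KK_integrable) (auto simp: less_imp_le KK_pos)
 finally show ?thesis using ennreal_less_top order_le_less_trans by (metis infinity_ennreal_def)
qed

context mu_jordan
begin

abbreviation s2 :: "nat => real" where "s2 \<equiv> \<lambda>j. 2 * s j"
abbreviation s3 :: "nat => nat => real" where "s3 n \<equiv> \<lambda>j. 2 * s j + real n / real r"

text \<open>The convolution square of 1/LL(2 .) restricted to the closed cone: the factor left over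
  by Cauchy-Schwarz when f*f is weighted by LL.\<close>

definition BB :: "'a => ennreal" where
 "BB \<xi> = (\<integral>\<^sup>+\<eta>. indicator Q \<eta> * indicator Q (\<xi> - \<eta>) * (inverse (LL (2 *\<^sub>R \<eta>)) * inverse (LL (2 *\<^sub>R (\<xi> - \<eta>)))) \<partial>lborel)"

text \<open>The Laplace transform of \<Delta>_{2s} dy at 2 \<xi>.\<close>

definition PH :: "'a => ennreal" where
 "PH \<xi> = (\<integral>\<^sup>+y. indicator \<Omega> y * ennreal (gp s2 y) * ennreal (exp (- inner y (2 *\<^sub>R \<xi>))) \<partial>lborel)"

text \<open>The \<Delta>_{2s}-mass of the order interval between 0 and \<open>y\<close>. Through
  \<open>PS_PH\<close> it converts the integrated estimate into a pointwise one with the same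
  constant.\<close>

definition PS :: "'a => ennreal" where
 "PS y = (\<integral>\<^sup>+x. indicator \<Omega> x * ennreal (gp s2 x) * indicator \<Omega> (y - x) \<partial>lborel)"

lemma tri_adjoint_Q:
 assumes t: "tri t A" and adj: "\<And>x y. inner (t x) y = inner x (t' y)"
 shows "t' x \<in> Q \<longleftrightarrow> x \<in> Q"
proof
 have inv: "t (inv t z) = z" for z using tri_bij[OF t] by (simp add: bij_is_surj surj_f_inv_f)
 show "x \<in> Q" if x: "t' x \<in> Q" unfolding Q_dual[of x]
 proof
  fix z assume "z \<in> Q"
  then have "inner (inv t z) (t' x) \<ge> 0" using tri_Q[OF tri_inv[OF t]] x Q_dual inner_commute by metis
  then show "inner x z \<ge> 0" unfolding adj[symmetric] inv by (simp only: inner_commute)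
 qed
 show "t' x \<in> Q" if x: "x \<in> Q" unfolding Q_dual[of "t' x"]
 proof
  fix z assume "z \<in> Q"
  then have "inner (t z) x \<ge> 0" using tri_Q[OF t] x Q_dual inner_commute by metis
  then show "inner (t' x) z \<ge> 0" unfolding adj by (simp only: inner_commute)
 qed
qed

text \<open>Besides inversion of \<open>LL_tri\<close>, the extended-real conventions are checked:
  1/0 is infinite, and \<open>LL\<close> infinite at \<xi> forces it to be infinite at the
  image.\<close>

lemma LL_tri_inverse:
 assumes t: "tri t A" and adj: "\<And>x y. inner (t x) y = inner x (t' y)"
 shows "inverse (LL (t' \<xi>)) \<le> ennreal (chi A s) * inverse (LL \<xi>)"
proof -
 have k: "chi A s > 0" by (rule chi_pos[OF t])
 note L = LL_tri[OF t adj, of \<xi>]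
 show ?thesis
 proof (cases "LL \<xi>")
  case (real l)
  show ?thesis
  proof (cases "l = 0")
   case True then show ?thesis using real k by (simp add: ennreal_mult_top)
  next
   case False
   then have l: "l > 0" using real by simp
   have "inverse (LL (t' \<xi>)) \<le> inverse (ennreal (1 / chi A s) * LL \<xi>)" by (rule ennreal_inverse_antimono[OF L])
   also have "ennreal (1 / chi A s) * LL \<xi> = ennreal (1 / chi A s * l)"
    by (subst ennreal_mult') (use real k in auto)
   also have "inverse (ennreal (1 / chi A s * l)) = ennreal (chi A s) * inverse (LL \<xi>)"
    using real k l by (simp add: inverse_ennreal ennreal_mult'[symmetric] divide_inverse)
   finally show ?thesis .
  qed
 next
  case top
  then have "LL (t' \<xi>) = \<infinity>" using L k by (simp add: ennreal_mult_top top_unique)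
  then show ?thesis by simp
 qed
qed

text \<open>Each factor 1/LL contributes the character of weight \<open>s\<close>, and the Jacobian
  of the adjoint, equal to that of \<open>t\<close> by \<open>scales_adjoint\<close>, contributes
  weight n/r.\<close>

lemma BB_tri:
 assumes t: "tri t A" and adj: "\<And>x y. inner (t x) y = inner x (t' y)"
 shows "BB (t' \<xi>) \<le> ennreal (chi A (s3 DIM('a))) * BB \<xi>"
proof -
 define u where "u = inv t"
 have tu: "t (u x) = x" "u (t x) = x" for x
  using tri_bij[OF t] by (simp_all add: u_def bij_is_surj surj_f_inv_f bij_is_inj)
 have lu: "linear u" unfolding u_def by (rule tri_linear[OF tri_inv[OF t]])
 have lt': "linear t'"
  by (intro linearI; rule vector_eq_ldot[THEN iffD1]; intro allI)
   (simp_all only: adj[symmetric] inner_add_right inner_scaleR_right)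
 have sc: "scales t' (A r powr (- (real DIM('a) / real r)))"
  by (rule scales_adjoint[OF tri_linear[OF t] lu tu adj tri_scales[OF t]])
 let ?\<delta> = "A r powr (- (real DIM('a) / real r))"
 have cn: "chi A (\<lambda>_. real DIM('a) / real r) = 1 / ?\<delta>" by (simp add: chi_const[OF t] powr_minus field_simps)
 have Ar: "A r > 0" using tri_pos[OF t, of r] r2 by simp
 let ?k = "chi A s"
 have k: "?k > 0" by (rule chi_pos[OF t])
 have "s3 DIM('a) = (\<lambda>j. s j + (s j + real DIM('a) / real r))" by auto
 then have c3: "chi A (s3 DIM('a)) = ?k * ?k * (1 / ?\<delta>)" using chi_add[OF t, of s "\<lambda>j. s j + real DIM('a) / real r"] chi_add[OF t, of s "\<lambda>_. real DIM('a) / real r"] cn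
  by simp
 let ?f = "\<lambda>\<xi> \<eta>. indicator Q \<eta> * indicator Q (\<xi> - \<eta>) * (inverse (LL (2 *\<^sub>R \<eta>)) * inverse (LL (2 *\<^sub>R (\<xi> - \<eta>))))"
 have le: "?f (t' \<xi>) (t' \<eta>) \<le> ennreal (?k * ?k) * ?f \<xi> \<eta>" for \<eta>
 proof -
  have 1: "t' \<xi> - t' \<eta> = t' (\<xi> - \<eta>)" "2 *\<^sub>R t' \<eta> = t' (2 *\<^sub>R \<eta>)" "2 *\<^sub>R t' (\<xi> - \<eta>) = t' (2 *\<^sub>R (\<xi> - \<eta>))"
   using lt' by (simp_all add: linear_diff linear_scale)
  have 2: "indicator Q (t' z) = (indicator Q z :: ennreal)" for z
   using tri_adjoint_Q[OF t adj, of z] by (simp add: indicator_def)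
  have "inverse (LL (t' (2 *\<^sub>R \<eta>))) * inverse (LL (t' (2 *\<^sub>R (\<xi> - \<eta>))))
    \<le> (ennreal ?k * inverse (LL (2 *\<^sub>R \<eta>))) * (ennreal ?k * inverse (LL (2 *\<^sub>R (\<xi> - \<eta>))))"
   by (intro mult_mono LL_tri_inverse[OF t adj]) auto
  also have "\<dots> = ennreal (?k * ?k) * (inverse (LL (2 *\<^sub>R \<eta>)) * inverse (LL (2 *\<^sub>R (\<xi> - \<eta>))))"
   using k by (simp add: ennreal_mult' mult_ac)
  finally show ?thesis unfolding 1 2 by (auto simp: indicator_def)
 qed
 have "ennreal ?\<delta> * BB (t' \<xi>) = (\<integral>\<^sup>+\<eta>. ?f (t' \<xi>) (t' \<eta>) \<partial>lborel)"
  unfolding BB_def by (rule scalesD[OF sc, symmetric]) measurable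
 also have "\<dots> \<le> (\<integral>\<^sup>+\<eta>. ennreal (?k * ?k) * ?f \<xi> \<eta> \<partial>lborel)" by (intro nn_integral_mono le)
 also have "\<dots> = ennreal (?k * ?k) * BB \<xi>" unfolding BB_def by (rule nn_integral_cmult) measurable
 finally have "ennreal (1 / ?\<delta>) * (ennreal ?\<delta> * BB (t' \<xi>)) \<le> ennreal (1 / ?\<delta>) * (ennreal (?k * ?k) * BB \<xi>)"
  by (rule mult_left_mono) simp
 moreover have "ennreal (1 / ?\<delta>) * ennreal ?\<delta> = 1" using Ar by (simp add: ennreal_mult'[symmetric])
 moreover have "ennreal (1 / ?\<delta>) * ennreal (?k * ?k) = ennreal (chi A (s3 DIM('a)))"
  unfolding c3 using k Ar by (simp add: ennreal_mult'[symmetric] mult.commute)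
 ultimately show ?thesis by (simp add: mult.assoc[symmetric])
qed

lemma PH_tri:
 assumes t: "tri t A" and adj: "\<And>x y. inner (t x) y = inner x (t' y)"
 shows "PH (t' \<xi>) = ennreal (1 / chi A (s3 DIM('a))) * PH \<xi>"
proof -
 have "inner (t y) (2 *\<^sub>R \<xi>) = inner y (2 *\<^sub>R t' \<xi>)" for y by (simp add: adj)
 then show ?thesis
  unfolding PH_def using tri_nn_integral[OF t, of "\<lambda>y. ennreal (exp (- inner y (2 *\<^sub>R \<xi>)))" s2] by simp
qed

text \<open>If \<eta> and e - \<eta> lie in the cone, their traces add up to r, so both have norm at
  most r. The integrand is then supported in a ball, where \<open>LL_lower\<close> bounds
  it.\<close>

lemma BB_e: "BB e < \<infinity>"
proof -
 obtain l where l: "l > 0" "\<And>\<xi>. norm \<xi> \<le> 2 * real r ==> ennreal l \<le> LL \<xi>" using LL_lower by blast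
 have "indicator Q \<eta> * indicator Q (e - \<eta>) * (inverse (LL (2 *\<^sub>R \<eta>)) * inverse (LL (2 *\<^sub>R (e - \<eta>))))
   \<le> indicator (cball 0 (real r)) \<eta> * ennreal (1 / l * (1 / l))" for \<eta>
 proof (cases "\<eta> \<in> Q \<and> e - \<eta> \<in> Q")
  case True
  have "norm \<eta> \<le> inner e \<eta>" "norm (e - \<eta>) \<le> inner e (e - \<eta>)" using Q_norm_le True by auto
  then have n: "norm \<eta> \<le> real r" "norm (e - \<eta>) \<le> real r"
   using norm_ge_zero[of "e - \<eta>"] norm_ge_zero[of \<eta>] unfolding inner_diff_right inner_ee by linarith+
  have "inverse (LL (2 *\<^sub>R z)) \<le> ennreal (1 / l)" if "norm z \<le> real r" for z
  proof -
   have "inverse (LL (2 *\<^sub>R z)) \<le> inverse (ennreal l)" using that by (intro ennreal_inverse_antimono l(2)) simp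
   then show ?thesis using l(1) by (simp add: inverse_ennreal inverse_eq_divide)
  qed
  then have "inverse (LL (2 *\<^sub>R \<eta>)) * inverse (LL (2 *\<^sub>R (e - \<eta>))) \<le> ennreal (1 / l) * ennreal (1 / l)"
   using n by (intro mult_mono) auto
  also have "\<dots> = ennreal (1 / l * (1 / l))" using l(1) by (intro ennreal_mult'[symmetric]) simp
  finally show ?thesis using True n by simp
 qed auto
 then have "BB e \<le> (\<integral>\<^sup>+\<eta>. indicator (cball (0::'a) (real r)) \<eta> * ennreal (1 / l * (1 / l)) \<partial>lborel)"
  unfolding BB_def by (intro nn_integral_mono)
 also have "\<dots> = emeasure lborel (cball (0::'a) (real r)) * ennreal (1 / l * (1 / l))"
  by (subst nn_integral_multc) (auto intro!: borel_measurable_indicator)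
 also have "\<dots> < \<infinity>" using emeasure_bounded_finite[of "cball (0::'a) (real r)"] by (simp add: ennreal_mult_less_top)
 finally show ?thesis .
qed

lemma PH_e: "PH e < \<infinity>"
proof -
 let ?p = "\<Sum>j=1..r. s2 j"
 have "indicator \<Omega> y * ennreal (gp s2 y) * ennreal (exp (- inner y (2 *\<^sub>R e))) \<le> ennreal ((1 + norm y) powr ?p * exp (- (2 * norm y)))" for y
 proof (cases "y \<in> \<Omega>")
  case True
  have "gp s2 y \<le> (1 + norm y) powr ?p" by (rule gp_bound[OF True]) (use s_nonneg in auto)
  moreover have "exp (- inner y (2 *\<^sub>R e)) \<le> exp (- (2 * norm y))"
   using Q_norm_le[of y] True \<Omega>_sub_Q by (auto simp: inner_commute)
  ultimately show ?thesis using True gp_pos[OF True, of s2] by (auto simp: ennreal_mult'[symmetric] intro!: ennreal_leI mult_mono)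
 qed simp
 then have "PH e \<le> (\<integral>\<^sup>+y. ennreal ((1 + norm (y::'a)) powr ?p * exp (- (2 * norm y))) \<partial>lborel)"
  unfolding PH_def by (intro nn_integral_mono)
 also have "\<dots> < \<infinity>" by (rule powr_exp_nn_integral)
 finally show ?thesis .
qed

lemma BB_PH_bound: "\<exists>C\<ge>0. \<forall>\<xi>\<in>\<Omega>. BB \<xi> * PH \<xi> \<le> ennreal C"
proof -
 have "BB e * PH e < \<infinity>" using BB_e PH_e by (simp add: ennreal_mult_less_top)
 then obtain C where C: "BB e * PH e = ennreal C" "C \<ge> 0" by (cases "BB e * PH e") auto
 have "BB \<xi> * PH \<xi> \<le> ennreal C" if xi: "\<xi> \<in> \<Omega>" for \<xi>
 proof -
  obtain t t' A where t: "tri t A" and adj: "\<And>x y. inner (t x) y = inner x (t' y)" and e: "t' e = \<xi>"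
   using tri_adjoint_transitive[OF xi] by metis
  have k: "chi A (s3 DIM('a)) > 0" by (rule chi_pos[OF t])
  have "BB \<xi> * PH \<xi> \<le> (ennreal (chi A (s3 DIM('a))) * BB e) * (ennreal (1 / chi A (s3 DIM('a))) * PH e)"
   using BB_tri[OF t adj, of e] PH_tri[OF t adj, of e] unfolding e by (intro mult_mono) auto
  also have "\<dots> = (ennreal (chi A (s3 DIM('a))) * ennreal (1 / chi A (s3 DIM('a)))) * (BB e * PH e)" by (simp only: mult_ac)
  also have "ennreal (chi A (s3 DIM('a))) * ennreal (1 / chi A (s3 DIM('a))) = 1" using k by (simp add: ennreal_mult'[symmetric])
  finally show ?thesis using C by simp
 qed
 then show ?thesis using C(2) by blast
qed

text \<open>Both sides transform by the same character, so the value at \<open>e\<close> decides. It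
  is positive because the open order interval below \<open>e\<close> contains e/2.\<close>

lemma PS_lower: "\<exists>b>0. \<forall>y\<in>\<Omega>. ennreal (b * gp (s3 DIM('a)) y) \<le> PS y"
proof -
 have "PS e \<noteq> 0"
 proof
  assume PS0: "PS e = 0"
  define N where "N = \<Omega> \<inter> (\<lambda>x. e - x) -` \<Omega>"
  from PS0 have "AE x in lborel. indicator \<Omega> x * ennreal (gp s2 x) * indicator \<Omega> (e - x) = 0"
   unfolding PS_def by (subst (asm) nn_integral_0_iff_AE) auto
  then have ae: "AE x in lborel. \<not> (x \<in> N)"
  proof (elim eventually_mono)
   fix x assume 0: "indicator \<Omega> x * ennreal (gp s2 x) * indicator \<Omega> (e - x) = 0"
   have "ennreal (gp s2 x) \<noteq> 0" if "x \<in> \<Omega>" using gp_pos[OF that, of s2] by (simp add: ennreal_eq_0_iff not_le)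
   then show "\<not> (x \<in> N)" using 0 by (auto simp: indicator_def N_def)
  qed
  have o: "open N" unfolding N_def by (intro open_Int open_vimage open_\<Omega> continuous_intros)
  then have "emeasure lborel N = 0" using ae AE_iff_measurable[of N lborel "\<lambda>x. \<not> (x \<in> N)"] by simp
  moreover have "(1/2) *\<^sub>R e \<in> N"
  proof -
   have "e - (1/2) *\<^sub>R e = (1/2) *\<^sub>R e" by (simp add: scaleR_left_diff_distrib[of 1 "1/2" e, simplified, symmetric])
   then show ?thesis using \<Omega>_scale[OF e_in_\<Omega>, of "1/2"] by (simp add: N_def)
  qed
  ultimately show False using open_lborel_pos[OF o] by auto
 qed
 have "\<exists>p>0. ennreal p \<le> PS e"
 proof (cases "PS e")
  case (real x)
  then show ?thesis using \<open>PS e \<noteq> 0\<close> by (intro exI[of _ x]) (auto simp: less_le)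
 next
  case top
  then show ?thesis by (intro exI[of _ 1]) simp
 qed
 then obtain p where p: "p > 0" "ennreal p \<le> PS e" by blast
 have ge: "gp (s3 DIM('a)) e > 0" by (rule gp_pos[OF e_in_\<Omega>])
 have "ennreal (p / gp (s3 DIM('a)) e * gp (s3 DIM('a)) y) \<le> PS y" if y: "y \<in> \<Omega>" for y
 proof -
  obtain t A where t: "tri t A" and te: "t e = y" using tri_transitive[OF y] by blast
  have k: "chi A (s3 DIM('a)) > 0" by (rule chi_pos[OF t])
  have "indicator \<Omega> (y - t x) = (indicator \<Omega> (e - x) :: ennreal)" for x
   using tri_in_iff[OF t, of "e - x"] by (simp add: te[symmetric] indicator_def linear_diff[OF tri_linear[OF t]])
  then have "PS e = ennreal (1 / chi A (s3 DIM('a))) * PS y"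
   unfolding PS_def using tri_nn_integral[OF t, of "\<lambda>x. indicator \<Omega> (y - x)" s2] by simp
  then have "ennreal (chi A (s3 DIM('a))) * PS e = (ennreal (chi A (s3 DIM('a))) * ennreal (1 / chi A (s3 DIM('a)))) * PS y" by (simp only: mult.assoc)
  also have "ennreal (chi A (s3 DIM('a))) * ennreal (1 / chi A (s3 DIM('a))) = 1" using k by (simp add: ennreal_mult'[symmetric])
  finally have PSy: "PS y = ennreal (chi A (s3 DIM('a))) * PS e" by simp
  have "p / gp (s3 DIM('a)) e * gp (s3 DIM('a)) y = chi A (s3 DIM('a)) * p" using gp_tri[OF t e_in_\<Omega>, of "s3 DIM('a)"] ge te by simp
  then have "ennreal (p / gp (s3 DIM('a)) e * gp (s3 DIM('a)) y) = ennreal (chi A (s3 DIM('a))) * ennreal p" using k by (simp add: ennreal_mult')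
  also have "\<dots> \<le> PS y" unfolding PSy by (intro mult_left_mono p) simp
  finally show ?thesis .
 qed
 then show ?thesis using p(1) ge by (intro exI[of _ "p / gp (s3 DIM('a)) e"]) auto
qed

text \<open>For x below y in the cone order, exp(-2(y|\<xi>)) \<le> exp(-2(x|\<xi>)); integrate over
  the order interval and enlarge it to the cone.\<close>

lemma PS_PH:
 assumes "\<xi> \<in> \<Omega>"
 shows "ennreal (exp (- inner y (2 *\<^sub>R \<xi>))) * PS y \<le> PH \<xi>"
proof -
 have "ennreal (exp (- inner y (2 *\<^sub>R \<xi>))) * PS y
   = (\<integral>\<^sup>+x. ennreal (exp (- inner y (2 *\<^sub>R \<xi>))) * (indicator \<Omega> x * ennreal (gp s2 x) * indicator \<Omega> (y - x)) \<partial>lborel)"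
  unfolding PS_def by (rule nn_integral_cmult[symmetric]) measurable
 also have "\<dots> \<le> PH \<xi>" unfolding PH_def
 proof (rule nn_integral_mono)
  fix x
  show "ennreal (exp (- inner y (2 *\<^sub>R \<xi>))) * (indicator \<Omega> x * ennreal (gp s2 x) * indicator \<Omega> (y - x))
    \<le> indicator \<Omega> x * ennreal (gp s2 x) * ennreal (exp (- inner x (2 *\<^sub>R \<xi>)))"
  proof (cases "y - x \<in> \<Omega>")
   case True
   then have "ennreal (exp (- inner y (2 *\<^sub>R \<xi>))) \<le> ennreal (exp (- inner x (2 *\<^sub>R \<xi>)))"
    using inner_\<Omega>_nonneg[OF True assms] by (intro ennreal_leI) (simp add: inner_diff_left)
   from mult_right_mono[OF this, of "indicator \<Omega> x * ennreal (gp s2 x)"]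
   show ?thesis using True by (simp add: mult_ac)
  qed simp
 qed
 finally show ?thesis .
qed

end

subsection \<open>The embedding\<close>

lemma nn_integral_lborel_reflect:
 fixes f :: "'a::euclidean_space => ennreal"
 assumes f [measurable]: "f \<in> borel_measurable borel"
 shows "(\<integral>\<^sup>+\<eta>. f (\<xi> - \<eta>) \<partial>lborel) = (\<integral>\<^sup>+\<eta>. f \<eta> \<partial>lborel)"
proof -
 have "scales (\<lambda>x::'a. - x) 1" by (rule scales_isometry[of _ "\<lambda>x. - x"]) (auto intro!: linearI)
 from scalesD[OF this, of "\<lambda>x. f (x + \<xi>)"] have "(\<integral>\<^sup>+\<eta>. f (- \<eta> + \<xi>) \<partial>lborel) = (\<integral>\<^sup>+\<eta>. f (\<eta> + \<xi>) \<partial>lborel)" by simp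
 also have "\<dots> = (\<integral>\<^sup>+\<eta>. f \<eta> \<partial>lborel)" by (rule nn_integral_lborel_translate[OF f])
 finally show ?thesis by simp
qed

lemma ennreal_enn2real_le: "ennreal (enn2real a) \<le> a"
 by (cases a) auto

lemma ennreal_inverse_enn2real_le: "ennreal (1 / enn2real a) \<le> inverse a"
proof (cases a)
 case (real x)
 then show ?thesis by (cases "x = 0") (simp_all add: inverse_ennreal inverse_eq_divide)
qed simp

lemma nice_mult:
 assumes f: "nice f" and g: "nice g"
 shows "nice (\<lambda>x. f x * g x)"
proof -
 obtain A B where A: "\<And>x. norm (f x) \<le> A" and B: "\<And>x. norm (g x) \<le> B" and "A > 0" "B > 0"
  using nice_bound[OF f] nice_bound[OF g] by metis
 have fm: "f \<in> borel_measurable borel" "g \<in> borel_measurable borel" using nice_meas f g by auto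
 have "norm (f x * g x) \<le> A * B" for x using A[of x] B[of x] \<open>A > 0\<close> by (simp add: norm_mult mult_mono)
 then have "bounded (range (\<lambda>x. f x * g x))" unfolding bounded_iff by blast
 moreover have "integrable lborel (\<lambda>x. f x * g x)"
 proof (rule Bochner_Integration.integrable_bound[of _ "\<lambda>x. A * norm (g x)"])
  show "integrable lborel (\<lambda>x. A * norm (g x))" using g by (simp add: nice_def)
  show "AE x in lborel. norm (f x * g x) \<le> norm (A * norm (g x))"
   using A \<open>A > 0\<close> by (intro always_eventually allI) (simp add: norm_mult mult_right_mono)
 qed (use fm in simp)
 ultimately show ?thesis using f g unfolding nice_def by (auto intro!: continuous_intros)
qed

lemma enn_powr_le:
 assumes "a \<le> ennreal b" "b \<ge> 0" "p \<ge> 0"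
 shows "enn_powr a p \<le> ennreal (b powr p)"
proof -
 obtain x where x: "a = ennreal x" "x \<ge> 0" using assms(1) by (cases a) (auto simp: top_unique)
 then show ?thesis using assms by (auto simp: enn_powr_def intro!: ennreal_leI powr_mono2)
qed

context framed_jordan
begin

lemma r_le_DIM: "r \<le> DIM('a)"
proof -
 have inj: "inj_on c {1..r}"
 proof (rule inj_onI)
  fix i j assume ij: "i \<in> {1..r}" "j \<in> {1..r}" "c i = c j"
  then show "i = j" using inner_cc[OF ij(1,2)] inner_cc[OF ij(1,1)] by (simp split: if_splits)
 qed
 have "pairwise orthogonal (c ` {1..r})"
  unfolding pairwise_def orthogonal_def using inner_cc by fastforce
 moreover have "0 \<notin> c ` {1..r}"
 proof
  assume "0 \<in> c ` {1..r}"
  then obtain i where "i \<in> {1..r}" "c i = 0" by auto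
  then show False using inner_cc[of i i] by simp
 qed
 ultimately have "independent (c ` {1..r})" by (rule pairwise_orthogonal_independent)
 then have "card (c ` {1..r}) \<le> DIM('a)" by (rule independent_card_le)
 then show ?thesis using card_image[OF inj] by simp
qed

text \<open>The frame is orthonormal, so r \<le> n and the structure constant d is nonnegative.
  Nonnegative s_j give \<open>gp\<close> at 2s polynomial growth and keep the Gamma quotient in
  \<open>phi0_pos\<close> positive.\<close>

lemma wallach_nonneg:
 assumes "wallach (jd DIM('a) r) r s" "j \<in> {1..r}"
 shows "s j \<ge> 0"
proof -
 obtain u :: "nat => real" where u: "\<forall>j\<in>{1..r}. u j \<ge> 0"
  "\<forall>j\<in>{1..r}. s j = u j + jd DIM('a) r / 2 * (\<Sum>i=1..<j. sgn (u i))"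
  using assms(1) unfolding wallach_def by blast
 have "0 \<le> real DIM('a) / real r - 1" using r_le_DIM r2 by (simp add: le_divide_eq)
 then have "jd DIM('a) r \<ge> 0" unfolding jd_def using r2 by (intro divide_nonneg_nonneg mult_nonneg_nonneg) linarith+
 moreover have "(\<Sum>i=1..<j. sgn (u i)) \<ge> 0" using u(1) assms(2) by (intro sum_nonneg) (auto simp: zero_le_sgn_iff)
 ultimately show ?thesis using u assms(2) by (simp add: mult_nonneg_nonneg)
qed

lemma gp_powr:
 assumes "x \<in> \<Omega>"
 shows "gp (\<lambda>j. k * \<nu> j) x = gp \<nu> x powr k"
proof -
 have "sdiff r (\<lambda>j. k * \<nu> j) j = sdiff r \<nu> j * k" for j by (simp add: sdiff_def algebra_simps)
 then have "gp (\<lambda>j. k * \<nu> j) x = (\<Prod>j=1..r. (minor m c j x powr sdiff r \<nu> j) powr k)" by (simp add: gpow_def powr_powr)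
 also have "\<dots> = gp \<nu> x powr k" unfolding gpow_def by (rule prod_powr_distrib[symmetric])
 finally show ?thesis .
qed

lemma AE_Q_\<Omega>: "AE x in lborel. x \<in> Q \<longrightarrow> x \<in> \<Omega>"
proof -
 have "negligible (frontier \<Omega>)" by (rule negligible_convex_frontier[OF convex_\<Omega>])
 then have "frontier \<Omega> \<in> null_sets lborel"
  unfolding negligible_iff_null_sets by (subst (asm) null_sets_completion_iff) auto
 then have "AE x in lborel. x \<notin> frontier \<Omega>" by (rule AE_not_in)
 then show ?thesis
  by (rule eventually_mono) (use open_\<Omega> in \<open>auto simp: frontier_def interior_open closure_\<Omega>\<close>)
qed

end

lemma EE_meas [measurable]:
 assumes "euclidean_jordan m e"
 shows "euclidean_jordan.EE m e eps \<in> borel_measurable borel"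
proof -
 interpret euclidean_jordan m e by (rule assms)
 have [measurable]: "Lf eps v \<in> borel_measurable borel" for v :: 'a
  using Thol_continuous[OF Lf_Thol[of UNIV]] by (intro borel_measurable_continuous_onI) simp
 have "(\<lambda>z. \<Prod>b\<in>Basis. inverse (Lf eps (e + eta *\<^sub>R b) z * Lf eps e z) * inverse (Lf eps (e + eta *\<^sub>R b) z * Lf eps e z)) \<in> borel_measurable borel"
  by (intro borel_measurable_prod borel_measurable_times borel_measurable_inverse) measurable
 then show ?thesis unfolding EE_def[abs_def] .
qed

context h2_fun
begin

lemma G_meas [measurable]: "G eps \<in> borel_measurable borel"
 unfolding G_def[abs_def] using EE_meas[OF euclidean_jordan_axioms] by measurable

lemma LL_pos: "LL \<xi> > 0"
 using LL_lower[of "norm \<xi>"] by (metis ennreal_less_zero_iff order_less_le_trans order_refl)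

definition aa :: "real => 'a => ennreal" where
 "aa eps \<xi> = ennreal ((cmod (ff eps \<xi>))\<^sup>2) * LL (2 *\<^sub>R \<xi>)"

definition JJ :: "real => 'a => ennreal" where
 "JJ eps \<xi> = (\<integral>\<^sup>+\<eta>. aa eps \<eta> * aa eps (\<xi> - \<eta>) \<partial>lborel)"

definition FF :: "real => 'a => ennreal" where
 "FF eps \<xi> = (\<integral>\<^sup>+\<eta>. ennreal (cmod (ff eps \<eta>) * cmod (ff eps (\<xi> - \<eta>))) \<partial>lborel)"

context
 fixes eps :: real
 assumes eps: "eps > 0"
begin

lemma ffm [measurable]: "ff eps \<in> borel_measurable borel"
 by (rule ff_meas[OF eps])

lemma aa_meas [measurable]: "aa eps \<in> borel_measurable borel"
 unfolding aa_def[abs_def] by measurable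

lemma JJ_meas [measurable]: "JJ eps \<in> borel_measurable borel"
 unfolding JJ_def[abs_def] by measurable

text \<open>Insert the square root of l(\<eta>) l(\<xi> - \<eta>), with l(\<eta>) = LL(2 \<eta>),
  and its reciprocal. The support property \<open>ff_zero\<close> allows the second factor to be
  restricted to the cone.\<close>

lemma FF_CS: "(FF eps \<xi>)\<^sup>2 \<le> JJ eps \<xi> * BB \<xi>"
proof -
 let ?l = "\<lambda>\<eta>. enn2real (LL (2 *\<^sub>R \<eta>))"
 let ?w = "\<lambda>\<eta>. ?l \<eta> * ?l (\<xi> - \<eta>)"
 let ?p = "\<lambda>\<eta>. cmod (ff eps \<eta>) * cmod (ff eps (\<xi> - \<eta>))"
 let ?g = "\<lambda>\<eta>. ennreal (?p \<eta> * sqrt (?w \<eta>))"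
 let ?h = "\<lambda>\<eta>. indicator Q \<eta> * indicator Q (\<xi> - \<eta>) * ennreal (1 / sqrt (?w \<eta>))"
 have fin: "(\<integral>\<^sup>+\<eta>. aa eps \<eta> \<partial>lborel) < \<infinity>"
  using ff_L2[OF eps] unfolding aa_def by (rule order_le_less_trans) simp
 \<comment> \<open>\<open>enn2real\<close> sends infinity to 0, which would spoil the weights.
   Almost everywhere \<open>aa\<close> is finite, so \<open>LL\<close> is finite wherever
   \<open>ff\<close> does not vanish.\<close>
 have 1: "AE \<eta> in lborel. aa eps \<eta> \<noteq> \<infinity>" by (rule nn_integral_PInf_AE) (use fin in auto)
 have 2: "AE \<eta> in lborel. aa eps (\<xi> - \<eta>) \<noteq> \<infinity>"
  by (rule nn_integral_PInf_AE) (use fin nn_integral_lborel_reflect[OF aa_meas, of \<xi>] in auto)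
 have cancel: "x * z * (1 / z) = x" if "z > 0" for x z :: real using that by simp
 have pt: "ennreal (?p \<eta>) \<le> ?g \<eta> * ?h \<eta>" if "aa eps \<eta> \<noteq> \<infinity>" "aa eps (\<xi> - \<eta>) \<noteq> \<infinity>" for \<eta>
 proof (cases "ff eps \<eta> = 0 \<or> ff eps (\<xi> - \<eta>) = 0")
  case False
  have l: "?l z > 0" if "ff eps z \<noteq> 0" "aa eps z \<noteq> \<infinity>" for z
  proof -
   have "LL (2 *\<^sub>R z) \<noteq> \<infinity>" using that by (auto simp: aa_def ennreal_mult_top)
   then show ?thesis using LL_pos[of "2 *\<^sub>R z"] by (simp add: enn2real_positive_iff less_top)
  qed
  have w: "?w \<eta> > 0" using l False that by (intro mult_pos_pos) auto
  have "\<eta> \<in> Q" "\<xi> - \<eta> \<in> Q" using False ff_zero[OF eps] by auto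
  then have "?g \<eta> * ?h \<eta> = ennreal (?p \<eta> * sqrt (?w \<eta>) * (1 / sqrt (?w \<eta>)))"
   by (simp only: indicator_simps mult_1) (rule ennreal_mult'[symmetric], simp)
  also have "?p \<eta> * sqrt (?w \<eta>) * (1 / sqrt (?w \<eta>)) = ?p \<eta>"
   by (rule cancel[OF real_sqrt_gt_zero[OF w]])
  finally show ?thesis by simp
 qed auto
 have "FF eps \<xi> \<le> (\<integral>\<^sup>+\<eta>. ?g \<eta> * ?h \<eta> \<partial>lborel)"
  unfolding FF_def by (rule nn_integral_mono_AE) (use 1 2 in eventually_elim, rule pt)
 then have "(FF eps \<xi>)\<^sup>2 \<le> (\<integral>\<^sup>+\<eta>. ?g \<eta> * ?h \<eta> \<partial>lborel)\<^sup>2" by (rule power_mono) simp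
 also have "\<dots> \<le> (\<integral>\<^sup>+\<eta>. ?g \<eta> ^ 2 \<partial>lborel) * (\<integral>\<^sup>+\<eta>. ?h \<eta> ^ 2 \<partial>lborel)"
  by (rule Cauchy_Schwarz_nn_integral) measurable
 also have "\<dots> \<le> JJ eps \<xi> * BB \<xi>"
 proof (rule mult_mono)
  show "(\<integral>\<^sup>+\<eta>. ?g \<eta> ^ 2 \<partial>lborel) \<le> JJ eps \<xi>" unfolding JJ_def
  proof (rule nn_integral_mono)
   fix \<eta>
   have "?g \<eta> ^ 2 = ennreal ((?p \<eta> * sqrt (?w \<eta>))\<^sup>2)" by (simp add: ennreal_power)
   also have "(?p \<eta> * sqrt (?w \<eta>))\<^sup>2 = ((cmod (ff eps \<eta>))\<^sup>2 * ?l \<eta>) * ((cmod (ff eps (\<xi> - \<eta>)))\<^sup>2 * ?l (\<xi> - \<eta>))"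
    unfolding power_mult_distrib by (subst real_sqrt_pow2) (auto simp: mult_ac)
   also have "ennreal \<dots> = (ennreal ((cmod (ff eps \<eta>))\<^sup>2) * ennreal (?l \<eta>)) * (ennreal ((cmod (ff eps (\<xi> - \<eta>)))\<^sup>2) * ennreal (?l (\<xi> - \<eta>)))"
    by (simp add: ennreal_mult)
   also have "\<dots> \<le> aa eps \<eta> * aa eps (\<xi> - \<eta>)" unfolding aa_def by (intro mult_mono ennreal_enn2real_le) auto
   finally show "?g \<eta> ^ 2 \<le> aa eps \<eta> * aa eps (\<xi> - \<eta>)" .
  qed
  show "(\<integral>\<^sup>+\<eta>. ?h \<eta> ^ 2 \<partial>lborel) \<le> BB \<xi>" unfolding BB_def
  proof (rule nn_integral_mono)
   fix \<eta>
   have "ennreal (1 / sqrt (?w \<eta>)) ^ 2 = ennreal (1 / ?l \<eta> * (1 / ?l (\<xi> - \<eta>)))"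
    by (simp add: ennreal_power power_divide del: real_sqrt_mult)
   also have "\<dots> = ennreal (1 / ?l \<eta>) * ennreal (1 / ?l (\<xi> - \<eta>))" by (rule ennreal_mult') simp
   also have "\<dots> \<le> inverse (LL (2 *\<^sub>R \<eta>)) * inverse (LL (2 *\<^sub>R (\<xi> - \<eta>)))" by (intro mult_mono ennreal_inverse_enn2real_le) auto
   finally have le: "ennreal (1 / sqrt (?w \<eta>)) ^ 2 \<le> inverse (LL (2 *\<^sub>R \<eta>)) * inverse (LL (2 *\<^sub>R (\<xi> - \<eta>)))" .
   show "?h \<eta> ^ 2 \<le> indicator Q \<eta> * indicator Q (\<xi> - \<eta>) * (inverse (LL (2 *\<^sub>R \<eta>)) * inverse (LL (2 *\<^sub>R (\<xi> - \<eta>))))"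
    using le by (cases "\<eta> \<in> Q"; cases "\<xi> - \<eta> \<in> Q") (simp_all del: real_sqrt_mult)
  qed
 qed auto
 finally show ?thesis .
qed

lemma FF_zero: "\<xi> \<notin> Q ==> FF eps \<xi> = 0"
proof -
 assume \<xi>: "\<xi> \<notin> Q"
 have z: "cmod (ff eps \<eta>) * cmod (ff eps (\<xi> - \<eta>)) = 0" for \<eta>
  using Q_add[of \<eta> "\<xi> - \<eta>"] \<xi> ff_zero[OF eps, of \<eta>] ff_zero[OF eps, of "\<xi> - \<eta>"] by auto
 show ?thesis unfolding FF_def z by simp
qed

text \<open>\<open>JJ\<close> is a convolution square, so its mass is the square of the mass of
  \<open>aa\<close>.\<close>

lemma JJ_integral: "(\<integral>\<^sup>+\<xi>. JJ eps \<xi> \<partial>lborel) \<le> ennreal ((KI TYPE('a) * AA)\<^sup>2)"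
proof -
 let ?I = "\<integral>\<^sup>+\<xi>. aa eps \<xi> \<partial>lborel"
 have "(\<integral>\<^sup>+\<xi>. JJ eps \<xi> \<partial>lborel) = (\<integral>\<^sup>+\<eta>. \<integral>\<^sup>+\<xi>. aa eps \<eta> * aa eps (\<xi> - \<eta>) \<partial>lborel \<partial>lborel)"
  unfolding JJ_def by (rule lborel_pair.Fubini') measurable
 also have "\<dots> = (\<integral>\<^sup>+\<eta>. aa eps \<eta> * ?I \<partial>lborel)"
 proof (rule nn_integral_cong)
  fix \<eta>
  have "(\<integral>\<^sup>+\<xi>. aa eps \<eta> * aa eps (\<xi> - \<eta>) \<partial>lborel) = aa eps \<eta> * (\<integral>\<^sup>+\<xi>. aa eps (\<xi> - \<eta>) \<partial>lborel)"
   by (rule nn_integral_cmult) measurable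
  then show "(\<integral>\<^sup>+\<xi>. aa eps \<eta> * aa eps (\<xi> - \<eta>) \<partial>lborel) = aa eps \<eta> * ?I"
   using nn_integral_lborel_translate[OF aa_meas, of "- \<eta>"] by simp
 qed
 also have "\<dots> = ?I * ?I" by (rule nn_integral_multc) measurable
 also have "\<dots> \<le> ennreal (KI TYPE('a) * AA) * ennreal (KI TYPE('a) * AA)"
  using ff_L2[OF eps] unfolding aa_def by (intro mult_mono) auto
 finally show ?thesis using KI_pos[where 'a='a] AA0 by (simp add: ennreal_mult[symmetric] power2_eq_square less_imp_le)
qed

definition "G4 y = (\<integral>\<^sup>+x. ennreal (cmod (G eps (x, y)) ^ 4) \<partial>lborel)"

lemma G4_meas [measurable]: "G4 \<in> borel_measurable borel"
 unfolding G4_def[abs_def] by measurable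

lemma BB_meas [measurable]: "BB \<in> borel_measurable borel"
 unfolding BB_def[abs_def] by measurable

text \<open>Plancherel is applied to the square of the slice. One power of \<open>KI\<close> comes
  from Plancherel, two more from squaring the convolution formula \<open>FT_square\<close>.\<close>

lemma G4_le:
 assumes y: "y \<in> \<Omega>"
 shows "ennreal (KI TYPE('a) ^ 3) * G4 y
  \<le> (\<integral>\<^sup>+\<xi>. indicator \<Omega> \<xi> * ennreal (exp (- inner y (2 *\<^sub>R \<xi>))) * (JJ eps \<xi> * BB \<xi>) \<partial>lborel)"
proof -
 let ?K = "KI TYPE('a)"
 let ?g = "\<lambda>x. G eps (x, y)"
 have K: "?K > 0" by (rule KI_pos)
 have ng: "nice ?g" by (rule G_nice[OF eps y])
 have ng2: "nice (\<lambda>x. ?g x * ?g x)" by (rule nice_mult[OF ng ng])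
 let ?T = "\<lambda>\<xi>. cmod (FT (\<lambda>x. ?g x * ?g x) \<xi>)"
 have FTb: "ennreal (?K * ?T \<xi>) \<le> ennreal (exp (- inner y \<xi>)) * FF eps \<xi>" for \<xi>
 proof -
  let ?q = "\<lambda>\<eta>. FT ?g \<eta> * FT ?g (\<xi> - \<eta>)"
  have nq: "norm (?q \<eta>) = exp (- inner y \<xi>) * (cmod (ff eps \<eta>) * cmod (ff eps (\<xi> - \<eta>)))" for \<eta>
  proof -
   have "norm (?q \<eta>) = (exp (- inner y \<eta>) * exp (- inner y (\<xi> - \<eta>))) * (cmod (ff eps \<eta>) * cmod (ff eps (\<xi> - \<eta>)))"
    unfolding FT_G[OF eps y] by (simp add: norm_mult mult_ac)
   also have "exp (- inner y \<eta>) * exp (- inner y (\<xi> - \<eta>)) = exp (- inner y \<xi>)"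
    unfolding exp_add[symmetric] by (simp add: inner_diff_right)
   finally show ?thesis .
  qed
  have "?K * ?T \<xi> = norm (cplx ?K * FT (\<lambda>x. ?g x * ?g x) \<xi>)" using K by (simp add: norm_mult)
  also have "\<dots> = norm (\<integral>\<eta>. ?q \<eta> \<partial>lborel)" unfolding FT_square[OF ng] ..
  finally have "ennreal (?K * ?T \<xi>) = ennreal (norm (\<integral>\<eta>. ?q \<eta> \<partial>lborel))" by simp
  also have "\<dots> \<le> (\<integral>\<^sup>+\<eta>. ennreal (norm (?q \<eta>)) \<partial>lborel)"
   by (cases "integrable lborel ?q") (simp_all add: integral_norm_bound_ennreal not_integrable_integral_eq)
  also have "\<dots> = ennreal (exp (- inner y \<xi>)) * FF eps \<xi>"
   unfolding nq FF_def by (subst nn_integral_cmult[symmetric]) (auto simp: ennreal_mult)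
  finally show ?thesis .
 qed
 have pt: "ennreal (?K\<^sup>2) * ennreal ((?T \<xi>)\<^sup>2) \<le> indicator Q \<xi> * ennreal (exp (- inner y (2 *\<^sub>R \<xi>))) * (JJ eps \<xi> * BB \<xi>)" for \<xi>
 proof -
  have "ennreal (?K\<^sup>2) * ennreal ((?T \<xi>)\<^sup>2) = (ennreal (?K * ?T \<xi>))\<^sup>2"
   using K by (simp add: ennreal_power power_mult_distrib ennreal_mult)
  also have "\<dots> \<le> (ennreal (exp (- inner y \<xi>)) * FF eps \<xi>)\<^sup>2" by (rule power_mono[OF FTb]) simp
  also have "\<dots> = ennreal (exp (- inner y (2 *\<^sub>R \<xi>))) * (FF eps \<xi>)\<^sup>2"
   by (simp add: power_mult_distrib ennreal_power flip: exp_double)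
  also have "\<dots> \<le> indicator Q \<xi> * ennreal (exp (- inner y (2 *\<^sub>R \<xi>))) * (JJ eps \<xi> * BB \<xi>)"
   using FF_CS[of \<xi>] FF_zero[of \<xi>] by (cases "\<xi> \<in> Q") (auto intro!: mult_left_mono)
  finally show ?thesis .
 qed
 have "cmod (?g x) ^ 4 = (cmod (?g x * ?g x))\<^sup>2" for x by (simp add: norm_mult power2_eq_square numeral_eq_Suc)
 then have "ennreal ?K * G4 y = (\<integral>\<^sup>+\<xi>. ennreal ((?T \<xi>)\<^sup>2) \<partial>lborel)"
  using plancherel_nn[OF ng2] unfolding G4_def by simp
 moreover have "ennreal (?K ^ 3) * G4 y = ennreal (?K\<^sup>2) * (ennreal ?K * G4 y)"
  using K by (simp add: mult.assoc[symmetric] ennreal_mult'[symmetric] power2_eq_square power3_eq_cube)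
 ultimately have "ennreal (?K ^ 3) * G4 y = ennreal (?K\<^sup>2) * (\<integral>\<^sup>+\<xi>. ennreal ((?T \<xi>)\<^sup>2) \<partial>lborel)" by simp
 also have "\<dots> = (\<integral>\<^sup>+\<xi>. ennreal (?K\<^sup>2) * ennreal ((?T \<xi>)\<^sup>2) \<partial>lborel)"
 proof (rule nn_integral_cmult[symmetric])
  have "FT (\<lambda>x. ?g x * ?g x) \<in> borel_measurable borel" using ng2 by (intro FT_meas) (simp add: nice_def)
  then show "(\<lambda>\<xi>. ennreal ((?T \<xi>)\<^sup>2)) \<in> borel_measurable lborel" by simp
 qed
 \<comment> \<open>The support is the closed cone, but BB PH is controlled on the open one; the
   boundary of a convex set is a null set.\<close>
 also have "\<dots> \<le> (\<integral>\<^sup>+\<xi>. indicator \<Omega> \<xi> * ennreal (exp (- inner y (2 *\<^sub>R \<xi>))) * (JJ eps \<xi> * BB \<xi>) \<partial>lborel)"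
 proof (rule nn_integral_mono_AE, use AE_Q_\<Omega> in eventually_elim)
  fix \<xi> assume "\<xi> \<in> Q \<longrightarrow> \<xi> \<in> \<Omega>"
  then have "indicator Q \<xi> * ennreal (exp (- inner y (2 *\<^sub>R \<xi>))) * (JJ eps \<xi> * BB \<xi>)
    \<le> indicator \<Omega> \<xi> * ennreal (exp (- inner y (2 *\<^sub>R \<xi>))) * (JJ eps \<xi> * BB \<xi>)"
   by (auto simp: indicator_def)
  with pt[of \<xi>] show "ennreal (?K\<^sup>2) * ennreal ((?T \<xi>)\<^sup>2)
    \<le> indicator \<Omega> \<xi> * ennreal (exp (- inner y (2 *\<^sub>R \<xi>))) * (JJ eps \<xi> * BB \<xi>)" by (rule order_trans)
 qed
 finally show ?thesis .
qed

context
 fixes C :: real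
 assumes C: "C \<ge> 0" "\<And>\<xi>. \<xi> \<in> \<Omega> ==> BB \<xi> * PH \<xi> \<le> ennreal C"
begin

lemma JJ_weighted: "(\<integral>\<^sup>+\<xi>. indicator \<Omega> \<xi> * JJ eps \<xi> * (BB \<xi> * PH \<xi>) \<partial>lborel) \<le> ennreal (C * (KI TYPE('a) * AA)\<^sup>2)"
proof -
 have "(\<integral>\<^sup>+\<xi>. indicator \<Omega> \<xi> * JJ eps \<xi> * (BB \<xi> * PH \<xi>) \<partial>lborel) \<le> (\<integral>\<^sup>+\<xi>. ennreal C * JJ eps \<xi> \<partial>lborel)"
 proof (rule nn_integral_mono)
  fix \<xi>
  show "indicator \<Omega> \<xi> * JJ eps \<xi> * (BB \<xi> * PH \<xi>) \<le> ennreal C * JJ eps \<xi>"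
   using mult_left_mono[OF C(2), of \<xi> "JJ eps \<xi>"] by (cases "\<xi> \<in> \<Omega>") (auto simp: mult.commute)
 qed
 also have "\<dots> = ennreal C * (\<integral>\<^sup>+\<xi>. JJ eps \<xi> \<partial>lborel)" by (rule nn_integral_cmult) measurable
 also have "\<dots> \<le> ennreal C * ennreal ((KI TYPE('a) * AA)\<^sup>2)" by (intro mult_left_mono JJ_integral) simp
 finally show ?thesis using C(1) by (simp add: ennreal_mult)
qed

text \<open>Multiplying by \<open>PS y\<close> replaces the exponential in \<open>G4_le\<close> by
  \<open>PH \<xi>\<close>, and BB PH is bounded by C.\<close>

lemma G4_pointwise:
 assumes y: "y \<in> \<Omega>"
 shows "ennreal (KI TYPE('a) ^ 3) * G4 y * PS y \<le> ennreal (C * (KI TYPE('a) * AA)\<^sup>2)"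
proof -
 have "ennreal (KI TYPE('a) ^ 3) * G4 y * PS y
   \<le> (\<integral>\<^sup>+\<xi>. indicator \<Omega> \<xi> * ennreal (exp (- inner y (2 *\<^sub>R \<xi>))) * (JJ eps \<xi> * BB \<xi>) \<partial>lborel) * PS y"
  by (intro mult_right_mono G4_le[OF y]) simp
 also have "\<dots> = (\<integral>\<^sup>+\<xi>. indicator \<Omega> \<xi> * ennreal (exp (- inner y (2 *\<^sub>R \<xi>))) * (JJ eps \<xi> * BB \<xi>) * PS y \<partial>lborel)"
  by (rule nn_integral_multc[symmetric]) measurable
 also have "\<dots> \<le> (\<integral>\<^sup>+\<xi>. indicator \<Omega> \<xi> * JJ eps \<xi> * (BB \<xi> * PH \<xi>) \<partial>lborel)"
 proof (rule nn_integral_mono)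
  fix \<xi>
  show "indicator \<Omega> \<xi> * ennreal (exp (- inner y (2 *\<^sub>R \<xi>))) * (JJ eps \<xi> * BB \<xi>) * PS y
    \<le> indicator \<Omega> \<xi> * JJ eps \<xi> * (BB \<xi> * PH \<xi>)"
  proof (cases "\<xi> \<in> \<Omega>")
   case True
   from mult_left_mono[OF PS_PH[OF True, of y], of "JJ eps \<xi> * BB \<xi>"] show ?thesis using True by (simp add: mult_ac)
  qed simp
 qed
 also have "\<dots> \<le> ennreal (C * (KI TYPE('a) * AA)\<^sup>2)" by (rule JJ_weighted)
 finally show ?thesis .
qed

text \<open>Integrating \<open>G4_le\<close> in y against \<Delta>_{2s}, Tonelli reproduces exactly
  \<open>PH\<close>, so the same bounded product BB PH appears.\<close>

lemma G4_integral:
 "(\<integral>\<^sup>+y. indicator \<Omega> y * ennreal (gp s2 y) * (ennreal (KI TYPE('a) ^ 3) * G4 y) \<partial>lborel) \<le> ennreal (C * (KI TYPE('a) * AA)\<^sup>2)"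
proof -
 let ?E = "\<lambda>y \<xi>. ennreal (exp (- inner y (2 *\<^sub>R \<xi>)))"
 let ?f = "\<lambda>y \<xi>. indicator \<Omega> y * ennreal (gp s2 y) * (indicator \<Omega> \<xi> * ?E y \<xi> * (JJ eps \<xi> * BB \<xi>))"
 have "(\<integral>\<^sup>+y. indicator \<Omega> y * ennreal (gp s2 y) * (ennreal (KI TYPE('a) ^ 3) * G4 y) \<partial>lborel) \<le> (\<integral>\<^sup>+y. \<integral>\<^sup>+\<xi>. ?f y \<xi> \<partial>lborel \<partial>lborel)"
 proof (rule nn_integral_mono)
  fix y
  have "(\<integral>\<^sup>+\<xi>. ?f y \<xi> \<partial>lborel) = indicator \<Omega> y * ennreal (gp s2 y) * (\<integral>\<^sup>+\<xi>. indicator \<Omega> \<xi> * ?E y \<xi> * (JJ eps \<xi> * BB \<xi>) \<partial>lborel)"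
   by (rule nn_integral_cmult) measurable
  then show "indicator \<Omega> y * ennreal (gp s2 y) * (ennreal (KI TYPE('a) ^ 3) * G4 y) \<le> (\<integral>\<^sup>+\<xi>. ?f y \<xi> \<partial>lborel)"
   using mult_left_mono[OF G4_le, of y "ennreal (gp s2 y)"] by (cases "y \<in> \<Omega>") auto
 qed
 also have "\<dots> = (\<integral>\<^sup>+\<xi>. \<integral>\<^sup>+y. ?f y \<xi> \<partial>lborel \<partial>lborel)"
  by (rule lborel_pair.Fubini'[symmetric]) (simp only: case_prod_unfold, measurable)
 also have "\<dots> = (\<integral>\<^sup>+\<xi>. indicator \<Omega> \<xi> * JJ eps \<xi> * (BB \<xi> * PH \<xi>) \<partial>lborel)"
 proof (rule nn_integral_cong)
  fix \<xi>
  have "(\<integral>\<^sup>+y. ?f y \<xi> \<partial>lborel) = (\<integral>\<^sup>+y. (indicator \<Omega> \<xi> * (JJ eps \<xi> * BB \<xi>)) * (indicator \<Omega> y * ennreal (gp s2 y) * ?E y \<xi>) \<partial>lborel)"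
   by (intro nn_integral_cong) (simp only: mult_ac)
  also have "\<dots> = (indicator \<Omega> \<xi> * (JJ eps \<xi> * BB \<xi>)) * PH \<xi>" unfolding PH_def by (rule nn_integral_cmult) measurable
  finally show "(\<integral>\<^sup>+y. ?f y \<xi> \<partial>lborel) = indicator \<Omega> \<xi> * JJ eps \<xi> * (BB \<xi> * PH \<xi>)" by (simp only: mult_ac)
 qed
 also have "\<dots> \<le> ennreal (C * (KI TYPE('a) * AA)\<^sup>2)" by (rule JJ_weighted)
 finally show ?thesis .
qed

end

end

end

context h2_fun
begin

definition F4 :: "'a => ennreal" where
 "F4 y = (\<integral>\<^sup>+x. ennreal (cmod (F (x, y)) powr 4) \<partial>lborel)"

abbreviation en :: "nat => real" where "en n \<equiv> inverse (real (Suc n))"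

lemma F4_meas [measurable]: "F4 \<in> borel_measurable borel"
 unfolding F4_def[abs_def] by measurable

text \<open>Fatou as the damping factor tends to 1. The constant is placed inside the lower limit,
  where the uniform bounds on \<open>G4\<close> with their weights can be inserted directly.\<close>

lemma F4_liminf:
 assumes k: "k \<ge> 0"
 shows "ennreal k * F4 y \<le> liminf (\<lambda>n. ennreal k * G4 (en n) y)"
proof -
 have pow: "z powr 4 = z ^ 4" if "z \<ge> 0" for z :: real using that by (cases "z = 0") auto
 have lim: "(\<lambda>n. ennreal (k * cmod (G (en n) (x, y)) ^ 4)) \<longlonglongrightarrow> ennreal (k * cmod (F (x, y)) powr 4)" for x
 proof (intro tendsto_ennrealI)
  have "(\<lambda>n. k * cmod (F (x, y) * EE (en n) (x, y)) ^ 4) \<longlonglongrightarrow> k * cmod (F (x, y) * 1) ^ 4"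
   by (intro tendsto_intros EE_limit)
  then show "(\<lambda>n. k * cmod (G (en n) (x, y)) ^ 4) \<longlonglongrightarrow> k * cmod (F (x, y)) powr 4"
   by (simp add: G_def pow)
 qed
 have "ennreal k * F4 y = (\<integral>\<^sup>+x. ennreal (k * cmod (F (x, y)) powr 4) \<partial>lborel)"
  unfolding F4_def using k by (subst nn_integral_cmult[symmetric]) (auto simp: ennreal_mult)
 also have "\<dots> = (\<integral>\<^sup>+x. liminf (\<lambda>n. ennreal (k * cmod (G (en n) (x, y)) ^ 4)) \<partial>lborel)"
  by (intro nn_integral_cong lim_imp_Liminf[symmetric] lim) simp
 also have "\<dots> \<le> liminf (\<lambda>n. \<integral>\<^sup>+x. ennreal (k * cmod (G (en n) (x, y)) ^ 4) \<partial>lborel)"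
  by (rule nn_integral_liminf) measurable
 also have "(\<lambda>n. \<integral>\<^sup>+x. ennreal (k * cmod (G (en n) (x, y)) ^ 4) \<partial>lborel) = (\<lambda>n. ennreal k * G4 (en n) y)"
 proof
  fix n
  have "G4 (en n) y = (\<integral>\<^sup>+x. ennreal (cmod (G (en n) (x, y)) ^ 4) \<partial>lborel)" by (rule G4_def) simp
  then show "(\<integral>\<^sup>+x. ennreal (k * cmod (G (en n) (x, y)) ^ 4) \<partial>lborel) = ennreal k * G4 (en n) y"
   using k by (simp only:) (subst nn_integral_cmult[symmetric], auto simp: ennreal_mult)
 qed
 finally show ?thesis .
qed

lemma liminf_le_const:
 fixes u :: "nat => ennreal"
 shows "(\<And>n. u n \<le> a) ==> liminf u \<le> a"
 by (rule Liminf_le) auto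

context
 fixes C b :: real
 assumes C: "C \<ge> 0" "\<And>\<xi>. \<xi> \<in> \<Omega> ==> BB \<xi> * PH \<xi> \<le> ennreal C"
  and b: "b > 0" "\<And>y. y \<in> \<Omega> ==> ennreal (b * gp (s3 DIM('a)) y) \<le> PS y"
begin

text \<open>One constant for both estimates: the factor 1 serves the integral bound, 1/b the
  pointwise one.\<close>

definition XX :: real where
 "XX = C * (KI TYPE('a) * AA)\<^sup>2 / KI TYPE('a) ^ 3 * max 1 (1 / b)"

lemma XX_bounds: "XX \<ge> 0" "C * (KI TYPE('a) * AA)\<^sup>2 / KI TYPE('a) ^ 3 \<le> XX"
 "C * (KI TYPE('a) * AA)\<^sup>2 / KI TYPE('a) ^ 3 / b \<le> XX"
proof -
 let ?Y = "C * (KI TYPE('a) * AA)\<^sup>2 / KI TYPE('a) ^ 3"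
 have Y: "?Y \<ge> 0" using C(1) KI_pos[where 'a='a] by (intro divide_nonneg_nonneg) (auto simp: less_imp_le)
 show "XX \<ge> 0" unfolding XX_def using Y by (intro mult_nonneg_nonneg) auto
 show "?Y \<le> XX" unfolding XX_def using mult_left_mono[OF max.cobounded1[of 1 "1 / b"] Y] by simp
 show "?Y / b \<le> XX" unfolding XX_def using mult_left_mono[OF max.cobounded2[of "1 / b" 1] Y] by simp
qed

lemma F4_pointwise:
 assumes y: "y \<in> \<Omega>"
 shows "\<exists>g\<ge>0. F4 y = ennreal g \<and> g * gp (s3 DIM('a)) y \<le> XX"
proof -
 let ?K = "KI TYPE('a)" let ?Y = "C * (?K * AA)\<^sup>2" let ?p = "gp (s3 DIM('a)) y"
 have K: "?K > 0" by (rule KI_pos)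
 have p: "?p > 0" by (rule gp_pos[OF y])
 have k: "?K ^ 3 * (b * ?p) > 0" using K p b(1) by simp
 have "ennreal (?K ^ 3 * (b * ?p)) * G4 (en n) y \<le> ennreal ?Y" for n
 proof -
  have "ennreal (?K ^ 3 * (b * ?p)) * G4 (en n) y = ennreal (?K ^ 3) * G4 (en n) y * ennreal (b * ?p)"
   using K p b(1) by (simp add: ennreal_mult' mult_ac)
  also have "\<dots> \<le> ennreal (?K ^ 3) * G4 (en n) y * PS y" by (intro mult_left_mono b(2) y) simp
  also have "\<dots> \<le> ennreal ?Y" by (rule G4_pointwise[OF _ C y]) simp
  finally show ?thesis .
 qed
 then have "ennreal (?K ^ 3 * (b * ?p)) * F4 y \<le> ennreal ?Y"
  using order_trans[OF F4_liminf liminf_le_const] k by (meson less_imp_le)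
 moreover obtain g where g: "F4 y = ennreal g" "g \<ge> 0"
  using calculation K p b(1) by (cases "F4 y") (auto simp: ennreal_mult_top top_unique)
 ultimately have "ennreal (?K ^ 3 * (b * ?p) * g) \<le> ennreal ?Y" using k by (simp add: ennreal_mult')
 then have "?K ^ 3 * (b * ?p) * g \<le> ?Y" using C(1) by (subst (asm) ennreal_le_iff) auto
 then have "g * ?p \<le> ?Y / ?K ^ 3 / b" using K b(1) by (simp add: field_simps)
 also have "\<dots> \<le> XX" by (rule XX_bounds)
 finally show ?thesis using g by blast
qed

lemma F4_integral: "(\<integral>\<^sup>+y. indicator \<Omega> y * ennreal (gp s2 y) * F4 y \<partial>lborel) \<le> ennreal XX"
proof -
 let ?K = "KI TYPE('a)" let ?Y = "C * (?K * AA)\<^sup>2"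
 let ?u = "\<lambda>n y. indicator \<Omega> y * ennreal (gp s2 y) * (ennreal (?K ^ 3) * G4 (en n) y)"
 have K: "?K > 0" by (rule KI_pos)
 have "ennreal (?K ^ 3) * (\<integral>\<^sup>+y. indicator \<Omega> y * ennreal (gp s2 y) * F4 y \<partial>lborel)
   = (\<integral>\<^sup>+y. ennreal (?K ^ 3) * (indicator \<Omega> y * ennreal (gp s2 y) * F4 y) \<partial>lborel)"
  by (rule nn_integral_cmult[symmetric]) measurable
 also have "\<dots> \<le> (\<integral>\<^sup>+y. liminf (\<lambda>n. ?u n y) \<partial>lborel)"
 proof (rule nn_integral_mono)
  fix y
  show "ennreal (?K ^ 3) * (indicator \<Omega> y * ennreal (gp s2 y) * F4 y) \<le> liminf (\<lambda>n. ?u n y)"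
  proof (cases "y \<in> \<Omega>")
   case True
   have g: "gp s2 y \<ge> 0" using gp_pos[OF True] by (simp add: less_imp_le)
   have "ennreal (gp s2 y * ?K ^ 3) * F4 y \<le> liminf (\<lambda>n. ennreal (gp s2 y * ?K ^ 3) * G4 (en n) y)"
    using g K by (intro F4_liminf) simp
   moreover have "ennreal (gp s2 y * ?K ^ 3) = ennreal (gp s2 y) * ennreal (?K ^ 3)" using g by (rule ennreal_mult')
   ultimately show ?thesis using True by (simp add: mult_ac)
  qed simp
 qed
 also have "\<dots> \<le> liminf (\<lambda>n. \<integral>\<^sup>+y. ?u n y \<partial>lborel)"
 proof (rule nn_integral_liminf)
  fix n
  have [measurable]: "G4 (en n) \<in> borel_measurable borel" by (rule G4_meas) simp
  show "?u n \<in> borel_measurable lborel" by measurable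
 qed
 also have "\<dots> \<le> ennreal ?Y" by (rule liminf_le_const, rule G4_integral[OF _ C]) simp
 finally have "ennreal (1 / ?K ^ 3) * (ennreal (?K ^ 3) * (\<integral>\<^sup>+y. indicator \<Omega> y * ennreal (gp s2 y) * F4 y \<partial>lborel))
   \<le> ennreal (1 / ?K ^ 3) * ennreal ?Y" by (rule mult_left_mono) simp
 also have "\<dots> = ennreal (?Y / ?K ^ 3)" using K by (subst ennreal_mult'[symmetric]) auto
 also have "\<dots> \<le> ennreal XX" by (rule ennreal_leI) (rule XX_bounds)
 finally show ?thesis using K by (simp add: mult.assoc[symmetric] ennreal_mult'[symmetric])
qed

text \<open>For q > 4 the surplus power is absorbed by the pointwise bound on F4.\<close>
lemma F4_mixed:
 assumes q: "q \<ge> 4"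
 shows "(\<integral>\<^sup>+y. indicator \<Omega> y * enn_powr (F4 y) (q / 4)
   * ennreal (gp (\<lambda>j. q / 4 * s3 DIM('a) j) y * jdet_in m e y powr (- real DIM('a) / real r)) \<partial>lborel) \<le> ennreal (XX powr (q / 4))"
proof -
 have pt: "indicator \<Omega> y * enn_powr (F4 y) (q / 4)
   * ennreal (gp (\<lambda>j. q / 4 * s3 DIM('a) j) y * jdet_in m e y powr (- real DIM('a) / real r))
  \<le> ennreal (XX powr (q / 4 - 1)) * (indicator \<Omega> y * ennreal (gp s2 y) * F4 y)" for y
 proof (cases "y \<in> \<Omega>")
  case True
  obtain g where g: "g \<ge> 0" "F4 y = ennreal g" "g * gp (s3 DIM('a)) y \<le> XX" using F4_pointwise[OF True] by blast
  let ?p = "gp (s3 DIM('a)) y" let ?j = "jdet_in m e y powr (- real DIM('a) / real r)"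
  have p: "?p > 0" by (rule gp_pos[OF True])
  have pj: "?p * ?j = gp s2 y" using gp_jdet[OF True, of "s3 DIM('a)" "- real DIM('a) / real r"] by simp
  have "(g * ?p) powr (q / 4) \<le> XX powr (q / 4 - 1) * (g * ?p)"
  proof (cases "g = 0")
   case False
   then have gp: "g * ?p > 0" using g p by simp
   then have "(g * ?p) powr (q / 4) = (g * ?p) powr (q / 4 - 1) * (g * ?p)" by (simp add: powr_diff)
   also have "\<dots> \<le> XX powr (q / 4 - 1) * (g * ?p)" using gp g(3) q by (intro mult_right_mono powr_mono2) auto
   finally show ?thesis .
  qed simp
  then have "(g * ?p) powr (q / 4) * ?j \<le> XX powr (q / 4 - 1) * (g * ?p) * ?j" by (intro mult_right_mono) auto
  then have le: "g powr (q / 4) * (?p powr (q / 4) * ?j) \<le> XX powr (q / 4 - 1) * (gp s2 y * g)"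
   using g(1) p unfolding pj[symmetric] by (simp add: powr_mult mult_ac)
  have "enn_powr (F4 y) (q / 4) * ennreal (gp (\<lambda>j. q / 4 * s3 DIM('a) j) y * ?j) = ennreal (g powr (q / 4) * (?p powr (q / 4) * ?j))"
   unfolding gp_powr[OF True] by (simp add: g(1,2) enn_powr_def ennreal_mult')
  also have "\<dots> \<le> ennreal (XX powr (q / 4 - 1) * (gp s2 y * g))" by (rule ennreal_leI[OF le])
  also have "\<dots> = ennreal (XX powr (q / 4 - 1)) * (ennreal (gp s2 y) * F4 y)"
   using gp_pos[OF True, of s2] by (simp add: g(2) ennreal_mult' less_imp_le)
  finally show ?thesis using True by simp
 qed simp
 have "(\<integral>\<^sup>+y. indicator \<Omega> y * enn_powr (F4 y) (q / 4)
   * ennreal (gp (\<lambda>j. q / 4 * s3 DIM('a) j) y * jdet_in m e y powr (- real DIM('a) / real r)) \<partial>lborel)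
  \<le> (\<integral>\<^sup>+y. ennreal (XX powr (q / 4 - 1)) * (indicator \<Omega> y * ennreal (gp s2 y) * F4 y) \<partial>lborel)"
  by (rule nn_integral_mono) (rule pt)
 also have "\<dots> = ennreal (XX powr (q / 4 - 1)) * (\<integral>\<^sup>+y. indicator \<Omega> y * ennreal (gp s2 y) * F4 y \<partial>lborel)"
  by (rule nn_integral_cmult) measurable
 also have "\<dots> \<le> ennreal (XX powr (q / 4 - 1)) * ennreal XX" by (intro mult_left_mono F4_integral) simp
 also have "\<dots> = ennreal (XX powr (q / 4 - 1) * XX)" by (rule ennreal_mult'[symmetric]) simp
 also have "XX powr (q / 4 - 1) * XX = XX powr (q / 4)" using XX_bounds(1) by (cases "XX = 0") (auto simp: powr_diff)
 finally show ?thesis .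
qed

text \<open>\<open>XX\<close> is quadratic in \<open>AA\<close>, the square of the Hardy norm. The
  exponents q/4 and 1/q combine to 1/4, which leaves the Hardy norm to the first power.\<close>

lemma apq_bound:
 assumes q: "q \<ge> 4"
 shows "apq_norm m e c r 4 q (\<lambda>j. q / 4 * (2 * s j + real DIM('a) / real r)) F
  \<le> ennreal ((C / KI TYPE('a) * max 1 (1 / b)) powr (1/4)) * ennreal (AA powr (1/2))"
proof -
 let ?D = "C / KI TYPE('a) * max 1 (1 / b)"
 have "apq_norm m e c r 4 q (\<lambda>j. q / 4 * (2 * s j + real DIM('a) / real r)) F \<le> ennreal ((XX powr (q / 4)) powr (1 / q))"
  unfolding apq_norm_def F4_def[symmetric] using q by (intro enn_powr_le F4_mixed) auto
 also have "(XX powr (q / 4)) powr (1 / q) = XX powr (1/4)" using q by (simp add: powr_powr)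
 also have "XX = ?D * AA\<^sup>2" unfolding XX_def using KI_pos[where 'a='a] by (simp add: field_simps power2_eq_square power3_eq_cube)
 also have "(?D * AA\<^sup>2) powr (1/4) = ?D powr (1/4) * (AA\<^sup>2) powr (1/4)" by (rule powr_mult)
 also have "(AA\<^sup>2) powr (1/4) = AA powr (1/2)"
  using AA0 by (cases "AA = 0") (simp_all add: powr_powr flip: powr_numeral)
 finally show ?thesis by (simp add: ennreal_mult')
qed

end

end

theorem theorem12:
 fixes m :: "'a::euclidean_space \<Rightarrow> 'a \<Rightarrow> 'a" and e :: 'a
  and c :: "nat \<Rightarrow> 'a" and r :: nat and s :: "nat \<Rightarrow> real"
  and M :: "'a measure" and q :: real
 assumes "eja m e" and "simple_ja m"
  and "jordan_frame m e c r" and "r \<ge> 2"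
  and "wallach (jd DIM('a) r) r s"
  and "is_mu m e c r s M"
  and "4 \<le> q"
 shows "\<exists>C::real. \<forall>F. tube_holo m F \<and> h2norm m M F < \<infinity> \<longrightarrow>
  apq_norm m e c r 4 q (\<lambda>j. q / 4 * (2 * s j + real DIM('a) / real r)) F
   \<le> ennreal C * h2norm m M F"
proof -
 interpret framed_jordan m e c r by unfold_locales (use assms in auto)
 interpret mu_jordan m e c r s M by unfold_locales (use assms wallach_nonneg in auto)
 obtain C where C: "C \<ge> 0" "\<And>\<xi>. \<xi> \<in> \<Omega> \<Longrightarrow> BB \<xi> * PH \<xi> \<le> ennreal C" using BB_PH_bound by blast
 obtain b where b: "b > 0" "\<And>y. y \<in> \<Omega> \<Longrightarrow> ennreal (b * gp (s3 DIM('a)) y) \<le> PS y" using PS_lower by blast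
 show ?thesis
 proof (intro exI allI impI)
  fix F assume F: "tube_holo m F \<and> h2norm m M F < \<infinity>"
  \<comment> \<open>Outside the tube nothing is known about F, not even measurability. Extension by
    zero gives a Borel function with the same slices over the cone, hence with the same
    norms.\<close>
  define F' where "F' z = (if snd z \<in> \<Omega> then F z else 0)" for z
  have TF: "Thol \<Omega> F" using F unfolding tube_holo_def Thol_def by blast
  have TF': "Thol \<Omega> F'" unfolding Thol_def
  proof (intro allI impI)
   fix x y assume y: "y \<in> \<Omega>"
   then obtain D where D: "(F has_derivative D) (at (x, y))" "\<forall>u v. D (- v, u) = \<i> * D (u, v)"
    using TF unfolding Thol_def by blast
   have "(F' has_derivative D) (at (x, y))"
    by (rule has_derivative_transform_within_open[OF D(1), of "UNIV \<times> \<Omega>"])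
     (use y in \<open>auto simp: F'_def open_Times open_\<Omega>\<close>)
   then show "\<exists>D. (F' has_derivative D) (at (x, y)) \<and> (\<forall>u v. D (- v, u) = \<i> * D (u, v))" using D(2) by blast
  qed
  have "F' = (\<lambda>p. indicator (UNIV \<times> \<Omega>) p *\<^sub>R F p)"
   by (intro ext) (auto simp: F'_def indicator_def mem_Times_iff)
  then have mF': "F' \<in> borel_measurable borel" using Thol_meas[OF open_\<Omega> TF] by (simp only:)
  let ?I = "\<lambda>t. \<integral>\<^sup>+ y. indicator (closure \<Omega>) y * (\<integral>\<^sup>+ x. ennreal ((cmod (F (x, y + t)))\<^sup>2) \<partial>lborel) \<partial>M"
  define S where "S = (SUP t\<in>\<Omega>. ?I t)"
  have h: "h2norm m M F = enn_powr S (1/2)" by (simp only: h2norm_def S_def)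
  then have "S \<noteq> \<infinity>" using F by (auto simp: enn_powr_def)
  then obtain AA where AA: "S = ennreal AA" "AA \<ge> 0" by (cases S) auto
  have bound: "(\<integral>\<^sup>+y. indicator Q y * (\<integral>\<^sup>+x. ennreal ((cmod (F' (x, y + t)))\<^sup>2) \<partial>lborel) \<partial>M) \<le> ennreal AA" if t: "t \<in> \<Omega>" for t
  proof -
   have "(\<integral>\<^sup>+y. indicator Q y * (\<integral>\<^sup>+x. ennreal ((cmod (F' (x, y + t)))\<^sup>2) \<partial>lborel) \<partial>M) = ?I t"
   proof (rule nn_integral_cong)
    fix y
    have "y + t \<in> \<Omega>" if "y \<in> Q" using \<Omega>_add_Q[OF t that] by (simp add: add.commute[of y t])
    then show "indicator Q y * (\<integral>\<^sup>+x. ennreal ((cmod (F' (x, y + t)))\<^sup>2) \<partial>lborel)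
      = indicator (closure \<Omega>) y * (\<integral>\<^sup>+x. ennreal ((cmod (F (x, y + t)))\<^sup>2) \<partial>lborel)"
     unfolding closure_\<Omega> by (cases "y \<in> Q") (simp_all add: F'_def)
   qed
   also have "\<dots> \<le> S" unfolding S_def using t by (rule SUP_upper)
   finally show ?thesis using AA by simp
  qed
  interpret h2_fun m e c r s M F' AA
   by unfold_locales (use TF' mF' AA bound in auto)
  let ?\<nu> = "\<lambda>j. q / 4 * (2 * s j + real DIM('a) / real r)"
  have "apq_norm m e c r 4 q ?\<nu> F = apq_norm m e c r 4 q ?\<nu> F'"
   unfolding apq_norm_def by (intro arg_cong2[where f = enn_powr] nn_integral_cong refl) (auto simp: indicator_def F'_def)
  also have "\<dots> \<le> ennreal ((C / KI TYPE('a) * max 1 (1 / b)) powr (1/4)) * ennreal (AA powr (1/2))"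
   by (rule apq_bound[OF C b assms(7)])
  also have "ennreal (AA powr (1/2)) = h2norm m M F" unfolding h using AA by (simp add: enn_powr_def)
  finally show "apq_norm m e c r 4 q ?\<nu> F \<le> ennreal ((C / KI TYPE('a) * max 1 (1 / b)) powr (1/4)) * h2norm m M F" .
 qed
qed

end
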